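(* Let $[a,b]\subset\mathbb{R}$ be a compact interval, $m,r\in\mathbb{N}$ (positive integers), $n\in\mathbb{N}\cup\{0\}$, $1\le p\le\infty$, let $I\subset\mathbb{R}$ be a closed interval and $\mu_0\in I$. For every $\mu\in I$ let $A_{0}(\cdot,\mu),\dots,A_{r-1}(\cdot,\mu)\in (W_p^n)^{m\times m}$ be matrix-valued functions and let $B(\mu)\colon (W_p^{n+r})^m\to\mathbb{C}^{rm}$ be a continuous linear operator (no regularity in $\mu$ is assumed). Put $$L(\mu)y:=y^{(r)}+\sum_{j=1}^{r}A_{r-j}(\cdot,\mu)\,y^{(r-j)},\qquad y\in (W_p^{n+r})^m,$$ and consider the boundary-value problem $$L(\mu)y(t,\mu)=f(t,\mu),\quad t\in(a,b),\qquad B(\mu)y(\cdot,\mu)=c(\mu),$$ with $f(\cdot,\mu)\in(W_p^n)^m$, $c(\mu)\in\mathbb{C}^{rm}$ and unknown $y(\cdot,\mu)\in(W_p^{n+r})^m$. Then the solution to this boundary-value problem depends continuously on the parameter $\mu$ at $\mu_0$ (in the sense defined in the context) if and only if all of the following three conditions hold: (0) the homogeneous problem $L(\mu_0)y=0$ on $(a,b)$, $B(\mu_0)y=0$ has only the trivial solution $y=0$ in $(W_p^{n+r})^m$; (I) $A_{r-j}(\cdot,\mu)\to A_{r-j}(\cdot,\mu_0)$ in $(W_p^n)^{m\times m}$ as $\mu\to\mu_0$ ($\mu\in I$), for each $j\in\{1,\dots,r\}$; (II) $B(\mu)y\to B(\mu_0)y$ in $\mathbb{C}^{rm}$ as $\mu\to\mu_0$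 ($\mu\in I$), for every $y\in(W_p^{n+r})^m$.
   Context: $W_p^n:=W_p^n([a,b];\mathbb{C})$ is the complex Sobolev space on $(a,b)$ (with $W_p^0=L_p$); $(W_p^n)^m$ and $(W_p^n)^{m\times m}$ are the spaces of $\mathbb{C}^m$-valued and $\mathbb{C}^{m\times m}$-valued functions with all entries in $W_p^n$, with norm $\|\cdot\|_{n,p}$ equal to the sum of the $W_p^n$-norms of the entries. A solution of the boundary-value problem for a given $\mu$ is a function $y(\cdot,\mu)\in(W_p^{n+r})^m$ satisfying the differential equation on $(a,b)$ (everywhere if $n\ge1$, almost everywhere if $n=0$) and the boundary condition. Definition. The solution to the boundary-value problem depends continuously on the parameter $\mu$ at $\mu_0\in I$ if the following two conditions are satisfied: $(\ast)$ there exists $\varepsilon>0$ such that for every $\mu\in I\cap(\mu_0-\varepsilon,\mu_0+\varepsilon)$ and arbitrary right-hand sides $f(\cdot,\mu)\in(W_p^n)^m$ and $c(\mu)\in\mathbb{C}^{rm}$ the problem has a unique solution $y(\cdot,\mu)\in(W_p^{n+r})^m$; $(\ast\ast)$ for all families of right-hand sides, the convergences $f(\cdot,\mu)\to f(\cdot,\mu_0)$ in $(W_p^n)^m$ and $c(\mu)\to c(\mu_0)$ in $\mathbb{C}^{rm}$ as $\mu\to\mu_0$ imply the convergence of the corresponding solutions $y(\cdot,\mu)\to y(\cdot,\mu_0)$ in $(W_p^{n+r})^m$ as $\mu\to\mu_0$. *)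

theory Defs
  imports "HOL-Analysis.Analysis" "HOL-Probability.Essential_Supremum"
begin

section \<open>Lebesgue spaces\<close>

text \<open>Elements of \<open>L\<^sub>p\<close> are represented by functions; the equivalence relation is equality
  almost everywhere.\<close>

definition in_Lp :: "ennreal \<Rightarrow> 'a measure \<Rightarrow> ('a \<Rightarrow> complex) \<Rightarrow> bool" where
  "in_Lp p M f \<longleftrightarrow>
     f \<in> borel_measurable M \<and>
     (if p = \<infinity> then esssup M (\<lambda>x. ereal (norm (f x))) < \<infinity>
      else integrable M (\<lambda>x. norm (f x) powr enn2real p))"

definition Lp_norm :: "ennreal \<Rightarrow> 'a measure \<Rightarrow> ('a \<Rightarrow> complex) \<Rightarrow> real" where
  "Lp_norm p M f =
     (if p = \<infinity> then real_of_ereal (esssup M (\<lambda>x. ereal (norm (f x))))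
      else (LINT x|M. norm (f x) powr enn2real p) powr (1 / enn2real p))"

section \<open>Sobolev spaces on a compact interval\<close>

definition abs_continuous_on :: "real \<Rightarrow> real \<Rightarrow> (real \<Rightarrow> complex) \<Rightarrow> bool" where
  "abs_continuous_on a b f \<longleftrightarrow>
     (\<forall>\<epsilon>>0. \<exists>\<delta>>0. \<forall>(N::nat) u v.
        (\<forall>i<N. a \<le> u i \<and> u i \<le> v i \<and> v i \<le> b) \<and>
        disjoint_family_on (\<lambda>i. {u i<..<v i}) {..<N} \<and>
        (\<Sum>i<N. v i - u i) < \<delta>
        \<longrightarrow> (\<Sum>i<N. norm (f (v i) - f (u i))) < \<epsilon>)"

text \<open>Derivatives are taken within \<open>[a, b]\<close>, hence one-sided at the end points, so that they depend
  on the values on \<open>[a, b]\<close> only. At points of non-differentiability the value is arbitrary.\<close>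

definition nth_deriv ::
    "real \<Rightarrow> real \<Rightarrow> nat \<Rightarrow> (real \<Rightarrow> 'v::real_normed_vector) \<Rightarrow> real \<Rightarrow> 'v" where
  "nth_deriv a b k = ((\<lambda>f t. vector_derivative f (at t within {a..b})) ^^ k)"

text \<open>\<open>W\<^sub>p\<^sup>0 = L\<^sub>p\<close>, and for \<open>n \<ge> 1\<close> the space \<open>W\<^sub>p\<^sup>n\<close> consists of the \<open>f \<in> C\<^sup>n\<^sup>-\<^sup>1[a, b]\<close> with
  \<open>f\<^sup>(\<^sup>n\<^sup>-\<^sup>1\<^sup>)\<close> absolutely continuous and with the almost everywhere existing \<open>f\<^sup>(\<^sup>n\<^sup>)\<close> in \<open>L\<^sub>p\<close>. For
  \<open>n \<ge> 1\<close> an element is thus given by its continuous representative.\<close>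

definition sobolev :: "nat \<Rightarrow> ennreal \<Rightarrow> real \<Rightarrow> real \<Rightarrow> (real \<Rightarrow> complex) set" where
  "sobolev n p a b =
     {f. (\<forall>k. Suc k < n \<longrightarrow> nth_deriv a b k f differentiable_on {a..b}) \<and>
         (\<forall>k<n. continuous_on {a..b} (nth_deriv a b k f)) \<and>
         (0 < n \<longrightarrow> abs_continuous_on a b (nth_deriv a b (n - 1) f)) \<and>
         in_Lp p (lebesgue_on {a..b}) (nth_deriv a b n f)}"

definition sobolev_norm :: "nat \<Rightarrow> ennreal \<Rightarrow> real \<Rightarrow> real \<Rightarrow> (real \<Rightarrow> complex) \<Rightarrow> real" where
  "sobolev_norm n p a b f = (\<Sum>k\<le>n. Lp_norm p (lebesgue_on {a..b}) (nth_deriv a b k f))"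

definition sobolev_vec :: "nat \<Rightarrow> ennreal \<Rightarrow> real \<Rightarrow> real \<Rightarrow> (real \<Rightarrow> complex^'m) set" where
  "sobolev_vec n p a b = {f. \<forall>i. (\<lambda>t. f t $ i) \<in> sobolev n p a b}"

definition sobolev_vec_norm ::
    "nat \<Rightarrow> ennreal \<Rightarrow> real \<Rightarrow> real \<Rightarrow> (real \<Rightarrow> complex^'m) \<Rightarrow> real" where
  "sobolev_vec_norm n p a b f = (\<Sum>i\<in>UNIV. sobolev_norm n p a b (\<lambda>t. f t $ i))"

definition sobolev_mat :: "nat \<Rightarrow> ennreal \<Rightarrow> real \<Rightarrow> real \<Rightarrow> (real \<Rightarrow> complex^'m^'m) set" where
  "sobolev_mat n p a b = {F. \<forall>i j. (\<lambda>t. F t $ i $ j) \<in> sobolev n p a b}"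

definition sobolev_mat_norm ::
    "nat \<Rightarrow> ennreal \<Rightarrow> real \<Rightarrow> real \<Rightarrow> (real \<Rightarrow> complex^'m^'m) \<Rightarrow> real" where
  "sobolev_mat_norm n p a b F =
     (\<Sum>i\<in>UNIV. \<Sum>j\<in>UNIV. sobolev_norm n p a b (\<lambda>t. F t $ i $ j))"

text \<open>Continuous complex-linear operators \<open>(W\<^sub>p\<^sup>k)\<^sup>m \<rightarrow> \<complex>\<^sup>d\<close>. Boundedness together with linearity
  forces \<open>T y = T z\<close> whenever \<open>y = z\<close> on \<open>[a, b]\<close> (almost everywhere if \<open>k = 0\<close>), so \<open>T\<close> is well
  defined on the elements of the space.\<close>

definition continuous_linear_operator ::
    "nat \<Rightarrow> ennreal \<Rightarrow> real \<Rightarrow> real \<Rightarrow> ((real \<Rightarrow> complex^'m) \<Rightarrow> complex^'d) \<Rightarrow> bool" where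
  "continuous_linear_operator k p a b T \<longleftrightarrow>
     (\<forall>y\<in>sobolev_vec k p a b. \<forall>z\<in>sobolev_vec k p a b. T (\<lambda>t. y t + z t) = T y + T z) \<and>
     (\<forall>\<alpha>. \<forall>y\<in>sobolev_vec k p a b. T (\<lambda>t. \<alpha> *s y t) = \<alpha> *s T y) \<and>
     (\<exists>C. \<forall>y\<in>sobolev_vec k p a b. norm (T y) \<le> C * sobolev_vec_norm k p a b y)"

section \<open>The boundary-value problem\<close>

definition diff_expr ::
    "real \<Rightarrow> real \<Rightarrow> nat \<Rightarrow> (nat \<Rightarrow> real \<Rightarrow> complex^'m^'m) \<Rightarrow> (real \<Rightarrow> complex^'m) \<Rightarrow> real \<Rightarrow> complex^'m"
  where
  "diff_expr a b r A y t =
     nth_deriv a b r y t + (\<Sum>j=1..r. A (r - j) t *v nth_deriv a b (r - j) y t)"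

definition bvp_solution ::
    "nat \<Rightarrow> ennreal \<Rightarrow> real \<Rightarrow> real \<Rightarrow> nat \<Rightarrow> (nat \<Rightarrow> real \<Rightarrow> complex^'m^'m) \<Rightarrow>
     ((real \<Rightarrow> complex^'m) \<Rightarrow> complex^'d) \<Rightarrow> (real \<Rightarrow> complex^'m) \<Rightarrow> complex^'d \<Rightarrow>
     (real \<Rightarrow> complex^'m) \<Rightarrow> bool" where
  "bvp_solution n p a b r A B f c y \<longleftrightarrow>
     y \<in> sobolev_vec (n + r) p a b \<and>
     (if n = 0 then AE t in lebesgue_on {a<..<b}. diff_expr a b r A y t = f t
      else \<forall>t\<in>{a<..<b}. diff_expr a b r A y t = f t) \<and>
     B y = c"

definition bvp_uniquely_solvable ::
    "nat \<Rightarrow> ennreal \<Rightarrow> real \<Rightarrow> real \<Rightarrow> nat \<Rightarrow> (nat \<Rightarrow> real \<Rightarrow> complex^'m^'m) \<Rightarrow>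
     ((real \<Rightarrow> complex^'m) \<Rightarrow> complex^'d) \<Rightarrow> (real \<Rightarrow> complex^'m) \<Rightarrow> complex^'d \<Rightarrow> bool" where
  "bvp_uniquely_solvable n p a b r A B f c \<longleftrightarrow>
     (\<exists>y. bvp_solution n p a b r A B f c y \<and>
          (\<forall>z. bvp_solution n p a b r A B f c z \<longrightarrow> (\<forall>t\<in>{a..b}. z t = y t)))"

text \<open>The argument order is \<open>A j \<mu> t\<close> for \<open>A\<^sub>j(t, \<mu>)\<close>. As solutions are only guaranteed to exist for
  \<open>\<mu>\<close> near \<open>\<mu>\<^sub>0\<close>, both conditions refer to the same \<open>\<epsilon>\<close>.\<close>

definition depends_continuously_at ::
    "nat \<Rightarrow> ennreal \<Rightarrow> real \<Rightarrow> real \<Rightarrow> nat \<Rightarrow> real set \<Rightarrow> real \<Rightarrow>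
     (nat \<Rightarrow> real \<Rightarrow> real \<Rightarrow> complex^'m^'m) \<Rightarrow>
     (real \<Rightarrow> (real \<Rightarrow> complex^'m) \<Rightarrow> complex^'d) \<Rightarrow> bool" where
  "depends_continuously_at n p a b r I \<mu>\<^sub>0 A B \<longleftrightarrow>
     (\<exists>\<epsilon>>0.
        (\<forall>\<mu>\<in>I \<inter> {\<mu>\<^sub>0 - \<epsilon><..<\<mu>\<^sub>0 + \<epsilon>}. \<forall>f\<in>sobolev_vec n p a b. \<forall>c.
           bvp_uniquely_solvable n p a b r (\<lambda>j. A j \<mu>) (B \<mu>) f c) \<and>
        (\<forall>f c y.
           (\<forall>\<mu>\<in>I. f \<mu> \<in> sobolev_vec n p a b) \<and>
           (\<forall>\<mu>\<in>I \<inter> {\<mu>\<^sub>0 - \<epsilon><..<\<mu>\<^sub>0 + \<epsilon>}.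
              bvp_solution n p a b r (\<lambda>j. A j \<mu>) (B \<mu>) (f \<mu>) (c \<mu>) (y \<mu>)) \<and>
           ((\<lambda>\<mu>. sobolev_vec_norm n p a b (\<lambda>t. f \<mu> t - f \<mu>\<^sub>0 t)) \<longlongrightarrow> 0) (at \<mu>\<^sub>0 within I) \<and>
           (c \<longlongrightarrow> c \<mu>\<^sub>0) (at \<mu>\<^sub>0 within I)
           \<longrightarrow> ((\<lambda>\<mu>. sobolev_vec_norm (n + r) p a b (\<lambda>t. y \<mu> t - y \<mu>\<^sub>0 t)) \<longlongrightarrow> 0) (at \<mu>\<^sub>0 within I)))"

end

theory Submission
  imports Defs
begin

text \<open>
  The equation is rewritten as a first-order system \<open>X' = M X + G\<close> for the jet
  \<open>X = (y, y', \<dots>, y\<^sup>(\<^sup>r\<^sup>-\<^sup>1\<^sup>))\<close>. For such a system with Sobolev coefficients the initial value problem at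
  \<open>a\<close> is uniquely solvable, with an estimate of the solution by the initial value and the residual.
  Hence solutions of initial value problems depend continuously on the coefficients.

  If (0), (I), (II) hold, then by the principle of uniform boundedness the \<open>B(\<mu>)\<close> are uniformly
  bounded near \<open>\<mu>\<^sub>0\<close>, so the matrix of \<open>B(\<mu>)\<close> on a fundamental system converges. By (0) its limit
  is invertible, and the boundary-value problem is reduced to a convergent linear system for the
  initial jet.

  Conversely, let \<open>Y(\<mu>)\<close> be the solutions of the homogeneous equation with \<open>B(\<mu>) Y(\<mu>) = 1\<close>, and
  let \<open>J(\<mu>)\<close> be the Wronskian matrix of \<open>Y(\<mu>)\<close>. The row \<open>\<alpha>(\<mu>)\<close> of coefficients satisfies
  \<open>\<alpha>(\<mu>) J(\<mu>) = - Y\<^sup>(\<^sup>r\<^sup>)(\<mu>)\<close>, where \<open>J(\<mu>) \<rightarrow> J(\<mu>\<^sub>0)\<close>, \<open>J(\<mu>\<^sub>0)\<close> is invertible and its inverse, built from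
  solutions of the adjoint system, is a Sobolev function; this yields (I). For (II), take the
  solution \<open>z(\<mu>)\<close> with \<open>L(\<mu>) z(\<mu>) = L(\<mu>) y\<close> and \<open>B(\<mu>) z(\<mu>) = B(\<mu>\<^sub>0) y\<close>. By (I), \<open>z(\<mu>) \<rightarrow> y\<close>, while
  \<open>y - z(\<mu>) = Y(\<mu>) q(\<mu>)\<close> with \<open>q(\<mu>) = B(\<mu>) y - B(\<mu>\<^sub>0) y\<close>, so \<open>q(\<mu>) \<rightarrow> 0\<close>.
\<close>

section \<open>Absolutely continuous functions\<close>

text \<open>Two obstacles shape the proof. First, \<open>nth_deriv\<close> is arbitrary where the
  derivative fails to exist, and membership in W^n is expressed through absolute continuity.
  Everything is therefore reduced to one description: W^(n+1) consists of the primitives of W^n.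
  This requires that absolutely continuous functions are the indefinite integrals of their
  derivatives; norms, products, completeness and regularity then follow by induction on n. Second,
  for n = 0 the coefficients lie only in L_p, where two factors cannot be multiplied. In every
  product the other factor is therefore one derivative better: jets of solutions and the inverse
  Wronskian lie in W^(n+1). This is why the coefficients can be recovered in the norm of W^n itself.

  Differences of solutions are estimated with the operator at \<open>\<mu>\<^sub>0\<close>, so that
  its a priori estimate need not be uniform in the parameter. The price is an inequality s \<le> r +
  d s with r and d tending to 0, in which the term d s is absorbed.\<close>

lemma borel_measurable_lebesgue_on_AE_cong:
  assumes f: "f \<in> borel_measurable (lebesgue_on S)" and S: "S \<in> sets lebesgue"
    and ae: "AE x in lebesgue_on S. g x = f x"
  shows "g \<in> borel_measurable (lebesgue_on S)"
proof (rule measurableI)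
  obtain N where N: "{x \<in> space (lebesgue_on S). g x \<noteq> f x} \<subseteq> N" "N \<in> null_sets (lebesgue_on S)"
    using ae unfolding eventually_ae_filter by blast
  have N0: "N \<in> null_sets lebesgue" "N \<subseteq> S"
    using N(2) S by (auto simp: null_sets_restrict_space)
  fix B :: "'b set" assume B: "B \<in> sets borel"
  have "g -` B \<inter> S = ((f -` B \<inter> S) - N) \<union> (g -` B \<inter> N)"
    using N(1) N0(2) by (auto simp: space_restrict_space)
  moreover have "f -` B \<inter> S \<in> sets lebesgue"
    using measurable_sets[OF f B] S by (auto simp: sets_restrict_space_iff)
  \<comment> \<open>Here g is unknown. Since \<open>lebesgue\<close> is complete, every subset of a
    null set is measurable; derivatives known only almost everywhere become measurable this
    way.\<close>
  moreover have "g -` B \<inter> N \<in> null_sets lebesgue"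
    by (rule null_sets_completion_subset[OF _ N0(1)]) auto
  ultimately have "g -` B \<inter> S \<in> sets lebesgue"
    using N0(1) by (metis sets.Un sets.Diff null_setsD2)
  then show "g -` B \<inter> space (lebesgue_on S) \<in> sets (lebesgue_on S)"
    using S by (auto simp: sets_restrict_space_iff)
qed simp

lemma integrable_lebesgue_on_AE_cong:
  fixes f g :: "'a::euclidean_space \<Rightarrow> 'b::{banach, second_countable_topology}"
  assumes f: "integrable (lebesgue_on S) f" and S: "S \<in> sets lebesgue"
    and ae: "AE x in lebesgue_on S. g x = f x"
  shows "integrable (lebesgue_on S) g"
proof -
  have "g \<in> borel_measurable (lebesgue_on S)"
    by (rule borel_measurable_lebesgue_on_AE_cong[OF _ S ae]) (use f in auto)
  then show ?thesis using f ae by (subst integrable_cong_AE[of g _ f]) auto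
qed

text \<open>Lebesgue's differentiation theorem, one-sided at the end points. Averages over
  [x, x + k] control the increments to the right of x; those to the left are increments of the
  reflected function at -x.\<close>

lemma integral_has_vector_derivative_AE:
  fixes g :: "real \<Rightarrow> 'b::euclidean_space"
  assumes g: "integrable (lebesgue_on {a..b}) g"
  shows "AE t in lebesgue_on {a..b}.
           ((\<lambda>u. integral {a..u} g) has_vector_derivative g t) (at t within {a..b})"
proof -
  \<comment> \<open>Extension by 0, so that the averages may leave [a, b].\<close>
  define h where "h x = (if x \<in> {a..b} then g x else 0)" for x
  have gi: "g integrable_on {a..b}"
    using g by (simp add: integrable_on_lebesgue_on)
  have hU: "h integrable_on UNIV"
    using gi unfolding h_def integrable_restrict_UNIV .
  have hI: "h integrable_on cbox c d" for c d
    by (rule integrable_on_subcbox[OF hU]) auto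
  then have hI': "h integrable_on {c..d}" for c d by simp
  have hR: "(\<lambda>x. h (- x)) integrable_on cbox c d" for c d
    using hI'[of "-d" "-c"] Henstock_Kurzweil_Integration.integrable_reflect_real[where f=h and a="-d" and b="-c"] by simp
  obtain N where N: "negligible N"
    "\<And>x e. \<lbrakk>x \<notin> N; 0 < e\<rbrakk> \<Longrightarrow> \<exists>d>0. \<forall>k. 0 < k \<and> k < d \<longrightarrow>
        norm (integral (cbox x (x + k *\<^sub>R One)) h /\<^sub>R k ^ DIM(real) - h x) < e"
    using integrable_ccontinuous_explicit[OF hI] by metis
  obtain N' where N': "negligible N'"
    "\<And>x e. \<lbrakk>x \<notin> N'; 0 < e\<rbrakk> \<Longrightarrow> \<exists>d>0. \<forall>k. 0 < k \<and> k < d \<longrightarrow>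
        norm (integral (cbox x (x + k *\<^sub>R One)) (\<lambda>x. h (- x)) /\<^sub>R k ^ DIM(real) - h (- x)) < e"
    using integrable_ccontinuous_explicit[OF hR] by metis
  define Z where "Z = N \<union> uminus ` N'"
  have "negligible (uminus ` N')"
    by (rule negligible_differentiable_image_negligible)
       (auto simp: N' intro!: derivative_intros)
  then have Z: "negligible Z" using N by (simp add: Z_def)
  have F: "integral {a..v} g - integral {a..u} g = integral {u..v} h" if "a \<le> u" "u \<le> v" "v \<le> b" for u v
  proof -
    have "integral {a..w} g = integral {a..w} h" if "w \<le> b" for w
      using that by (intro integral_cong) (auto simp: h_def)
    then show ?thesis using Henstock_Kurzweil_Integration.integral_combine[of a u v h] that hI'
      by (simp add: algebra_simps)
  qed
  have main: "((\<lambda>u. integral {a..u} g) has_vector_derivative g x) (at x within {a..b})"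
    if x: "x \<in> {a..b}" "x \<notin> Z" for x
    unfolding has_vector_derivative_def has_derivative_within_alt
  proof (intro conjI allI impI)
    show "bounded_linear (\<lambda>k. k *\<^sub>R g x)" by (rule bounded_linear_scaleR_left)
    fix e :: real assume e: "e > 0"
    have "x \<notin> N" using x by (simp add: Z_def)
    then obtain d where d: "d > 0" "\<And>k. 0 < k \<Longrightarrow> k < d \<Longrightarrow>
        norm (integral {x..x + k} h /\<^sub>R k - h x) < e"
      using N(2)[OF _ e, of x] by auto
    have "- x \<notin> N'" using x by (force simp: Z_def)
    then obtain d' where d': "d' > 0" "\<And>k. 0 < k \<Longrightarrow> k < d' \<Longrightarrow>
        norm (integral {-x..-x + k} (\<lambda>x. h (-x)) /\<^sub>R k - h x) < e"
      using N'(2)[OF _ e, of "-x"] by auto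
    have hx: "h x = g x" using x by (simp add: h_def)
    have cvt: "norm (I - k *\<^sub>R g x) \<le> e * k" if k: "0 < k" and n: "norm (I /\<^sub>R k - h x) < e" for I :: 'b and k :: real
    proof -
      have "I - k *\<^sub>R g x = k *\<^sub>R (I /\<^sub>R k - h x)" using k by (simp add: hx algebra_simps)
      then have "norm (I - k *\<^sub>R g x) = k * norm (I /\<^sub>R k - h x)" using k by simp
      also have "\<dots> \<le> k * e" using n k by simp
      finally show ?thesis by (simp add: mult.commute)
    qed
    show "\<exists>d>0. \<forall>y\<in>{a..b}. norm (y - x) < d \<longrightarrow>
        norm (integral {a..y} g - integral {a..x} g - (y - x) *\<^sub>R g x) \<le> e * norm (y - x)"
    proof (intro exI[of _ "min d d'"] conjI ballI impI)
      show "0 < min d d'" using d d' by simp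
      fix y assume y: "y \<in> {a..b}" "norm (y - x) < min d d'"
      consider "y = x" | "x < y" | "y < x" by linarith
      then show "norm (integral {a..y} g - integral {a..x} g - (y - x) *\<^sub>R g x) \<le> e * norm (y - x)"
      proof cases
        case 1 then show ?thesis by simp
      next
        case 2
        then have "integral {a..y} g - integral {a..x} g = integral {x..x + (y - x)} h"
          using F[of x y] x y by simp
        then show ?thesis using cvt[OF _ d(2)[of "y - x"]] 2 y by simp
      next
        case 3
        then have "integral {a..x} g - integral {a..y} g = integral {y..x} h"
          using F[of y x] x y by simp
        also have "\<dots> = integral {-x..-x + (x - y)} (\<lambda>x. h (-x))"
          using Henstock_Kurzweil_Integration.integral_reflect_real[where f=h and a=y and b=x] by simp
        finally have *: "integral {a..x} g - integral {a..y} g = \<dots>" .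
        have "norm ((integral {a..x} g - integral {a..y} g) - (x - y) *\<^sub>R g x) \<le> e * (x - y)"
          unfolding * using cvt[OF _ d'(2)[of "x - y"]] 3 y by simp
        then show ?thesis using 3 by (simp add: norm_minus_commute algebra_simps)
      qed
    qed
  qed
  have "Z \<in> null_sets lebesgue" using Z negligible_iff_null_sets by blast
  then have "AE x in lebesgue. x \<notin> Z" by (rule AE_not_in)
  then show ?thesis
    by (subst AE_restrict_space_iff) (use main in \<open>auto elim!: AE_mp\<close>)
qed

text \<open>\<open>abs_continuous_on\<close> for an arbitrary normed codomain: real and imaginary
  parts, positive variations and weights are real-valued.\<close>

definition ac_on :: "real \<Rightarrow> real \<Rightarrow> (real \<Rightarrow> 'v::real_normed_vector) \<Rightarrow> bool" where
  "ac_on a b f \<longleftrightarrow>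
     (\<forall>\<epsilon>>0. \<exists>\<delta>>0. \<forall>(N::nat) u v.
        (\<forall>i<N. a \<le> u i \<and> u i \<le> v i \<and> v i \<le> b) \<and>
        disjoint_family_on (\<lambda>i. {u i<..<v i}) {..<N} \<and>
        (\<Sum>i<N. v i - u i) < \<delta>
        \<longrightarrow> (\<Sum>i<N. norm (f (v i) - f (u i))) < \<epsilon>)"

lemma abs_continuous_on_eq: "abs_continuous_on = ac_on"
  unfolding abs_continuous_on_def[abs_def] ac_on_def[abs_def] ..

text \<open>The condition for a single pair (\<epsilon>, \<delta>), named because the \<delta>
  belonging to \<epsilon> = 1 has to be fixed for a whole argument.\<close>

definition oscillation_bound :: "real \<Rightarrow> real \<Rightarrow> (real \<Rightarrow> 'v::real_normed_vector) \<Rightarrow> real \<Rightarrow> real \<Rightarrow> bool" where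
  "oscillation_bound a b f \<epsilon> \<delta> \<longleftrightarrow>
     (\<forall>(N::nat) u v.
        (\<forall>i<N. a \<le> u i \<and> u i \<le> v i \<and> v i \<le> b) \<and>
        disjoint_family_on (\<lambda>i. {u i<..<v i}) {..<N} \<and>
        (\<Sum>i<N. v i - u i) < \<delta>
        \<longrightarrow> (\<Sum>i<N. norm (f (v i) - f (u i))) < \<epsilon>)"

lemma ac_on_iff_oscillation_bound: "ac_on a b f \<longleftrightarrow> (\<forall>\<epsilon>>0. \<exists>\<delta>>0. oscillation_bound a b f \<epsilon> \<delta>)"
  unfolding ac_on_def oscillation_bound_def ..

text \<open>Sets of intervals and dependent pairs also serve as index sets below, whereas the
  definition enumerates families by natural numbers.\<close>

lemma oscillation_bound_finite:
  assumes ob: "oscillation_bound a b f \<epsilon> \<delta>" and J: "finite J"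
    and uv: "\<And>i. i \<in> J \<Longrightarrow> a \<le> u i \<and> u i \<le> v i \<and> v i \<le> b"
    and dis: "disjoint_family_on (\<lambda>i. {u i<..<v i}) J"
    and len: "(\<Sum>i\<in>J. v i - u i) < \<delta>"
  shows "(\<Sum>i\<in>J. norm (f (v i) - f (u i))) < \<epsilon>"
proof -
  obtain h where h: "bij_betw h {..<card J} J"
    using ex_bij_betw_nat_finite[OF J] by (metis atLeast0LessThan)
  have eq: "(\<Sum>i\<in>J. F i) = (\<Sum>i<card J. F (h i))" for F :: "_ \<Rightarrow> real"
    by (rule sum.reindex_bij_betw[OF h, symmetric])
  have hJ: "h i \<in> J" if "i < card J" for i using h that by (auto simp: bij_betw_def)
  have inj: "h i = h j \<longleftrightarrow> i = j" if "i < card J" "j < card J" for i j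
    using h that by (auto simp: bij_betw_def inj_on_def)
  have "disjoint_family_on (\<lambda>i. {u (h i)<..<v (h i)}) {..<card J}"
    unfolding disjoint_family_on_def
  proof (intro ballI impI)
    fix m n assume "m \<in> {..<card J}" "n \<in> {..<card J}" "m \<noteq> n"
    then show "{u (h m)<..<v (h m)} \<inter> {u (h n)<..<v (h n)} = {}"
      using dis[unfolded disjoint_family_on_def, rule_format, of "h m" "h n"] hJ inj by auto
  qed
  then show ?thesis
    using ob[unfolded oscillation_bound_def, rule_format, of "card J" "\<lambda>i. u (h i)" "\<lambda>i. v (h i)"]
      uv hJ len unfolding eq by auto
qed

lemma sum_disjoint_lengths_le:
  fixes u v :: "'i \<Rightarrow> real"
  assumes J: "finite J" and uv: "\<And>i. i \<in> J \<Longrightarrow> c \<le> u i \<and> u i \<le> v i \<and> v i \<le> d"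
    and dis: "disjoint_family_on (\<lambda>i. {u i<..<v i}) J" and cd: "c \<le> d"
  shows "(\<Sum>i\<in>J. v i - u i) \<le> d - c"
proof -
  have "(\<Sum>i\<in>J. v i - u i) = (\<Sum>i\<in>J. measure lborel {u i<..<v i})"
    by (rule sum.cong) (use uv in auto)
  also have "\<dots> = measure lborel (\<Union>i\<in>J. {u i<..<v i})"
    using J dis by (intro measure_finite_Union[symmetric]) (auto simp: uv)
  also have "\<dots> \<le> measure lborel {c..d}"
    using uv cd J by (intro measure_mono_fmeasurable) (force, auto intro!: fmeasurableI simp: emeasure_lborel_Icc)
  finally show ?thesis using cd by simp
qed

lemma ac_on_imp_continuous_on:
  assumes "ac_on a b f"
  shows "continuous_on {a..b} f"
  unfolding continuous_on_iff
proof (intro ballI allI impI)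
  fix x e assume x: "x \<in> {a..b}" and e: "0 < (e::real)"
  obtain d where d: "d > 0" "oscillation_bound a b f e d"
    using assms e unfolding ac_on_iff_oscillation_bound by blast
  have *: "norm (f z - f y) < e" if "a \<le> y" "y \<le> z" "z \<le> b" "z - y < d" for y z
    using oscillation_bound_finite[OF d(2), of "{()}" "\<lambda>_. y" "\<lambda>_. z"] that
    by (simp add: disjoint_family_on_def)
  have "dist (f y) (f x) < e" if y: "y \<in> {a..b}" "dist y x < d" for y
  proof (cases "y \<le> x")
    case True then show ?thesis using *[of y x] x y by (simp add: dist_norm norm_minus_commute)
  next
    case False then show ?thesis using *[of x y] x y by (simp add: dist_norm)
  qed
  then show "\<exists>d>0. \<forall>x'\<in>{a..b}. dist x' x < d \<longrightarrow> dist (f x') (f x) < e"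
    using d(1) by blast
qed

text \<open>Differences, products, an exponential and real and imaginary parts are all treated by
  comparing increments in this way.\<close>

lemma ac_on_if_increments2:
  assumes f: "ac_on a b f" and g: "ac_on a b g" and C: "0 \<le> C"
    and le: "\<And>x y. a \<le> x \<Longrightarrow> x \<le> y \<Longrightarrow> y \<le> b \<Longrightarrow>
               norm (h y - h x) \<le> C * (norm (f y - f x) + norm (g y - g x))"
  shows "ac_on a b h"
  unfolding ac_on_iff_oscillation_bound
proof (intro allI impI)
  fix e :: real assume e: "e > 0"
  \<comment> \<open>C may be 0, hence the divisor C + 1.\<close>
  then have e': "e / (2 * (C + 1)) > 0" using C by simp
  obtain d where d: "d > 0" "oscillation_bound a b f (e / (2 * (C + 1))) d"
    using f e' unfolding ac_on_iff_oscillation_bound by blast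
  obtain d' where d': "d' > 0" "oscillation_bound a b g (e / (2 * (C + 1))) d'"
    using g e' unfolding ac_on_iff_oscillation_bound by blast
  have "oscillation_bound a b h e (min d d')"
    unfolding oscillation_bound_def
  proof (intro allI impI)
    fix N :: nat and u v
    assume H: "(\<forall>i<N. a \<le> u i \<and> u i \<le> v i \<and> v i \<le> b) \<and>
       disjoint_family_on (\<lambda>i. {u i<..<v i}) {..<N} \<and> (\<Sum>i<N. v i - u i) < min d d'"
    let ?F = "\<Sum>i<N. norm (f (v i) - f (u i))" and ?G = "\<Sum>i<N. norm (g (v i) - g (u i))"
    have "(\<Sum>i<N. norm (h (v i) - h (u i))) \<le> (\<Sum>i<N. C * (norm (f (v i) - f (u i)) + norm (g (v i) - g (u i))))"
      by (rule sum_mono) (use H le in auto)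
    also have "\<dots> = C * (?F + ?G)"
      by (simp add: sum.distrib flip: sum_distrib_left)
    also have "\<dots> \<le> (C + 1) * (?F + ?G)"
      by (intro mult_right_mono add_nonneg_nonneg sum_nonneg) auto
    also have "\<dots> < (C + 1) * (e / (2 * (C + 1)) + e / (2 * (C + 1)))"
      using d(2) d'(2) H C unfolding oscillation_bound_def
      by (intro mult_strict_left_mono add_strict_mono) auto
    also have "\<dots> = e"
    proof -
      have "(C + 1) * (x / (2 * (C + 1))) = x / 2" for x using C by (simp add: field_simps)
      from this[of e] show ?thesis unfolding distrib_left by linarith
    qed
    finally show "(\<Sum>i<N. norm (h (v i) - h (u i))) < e" .
  qed
  then show "\<exists>d>0. oscillation_bound a b h e d" using d d' by (meson min_less_iff_conj)
qed

lemma ac_on_if_increments: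
  assumes "ac_on a b f" "0 \<le> C"
    and "\<And>x y. a \<le> x \<Longrightarrow> x \<le> y \<Longrightarrow> y \<le> b \<Longrightarrow> norm (h y - h x) \<le> C * norm (f y - f x)"
  shows "ac_on a b h"
proof (rule ac_on_if_increments2[OF assms(1,1,2)])
  fix x y assume xy: "a \<le> x" "x \<le> y" "y \<le> b"
  have "C * norm (f y - f x) \<le> C * (norm (f y - f x) + norm (f y - f x))"
    using assms(2) by (intro mult_left_mono) auto
  then show "norm (h y - h x) \<le> C * (norm (f y - f x) + norm (f y - f x))"
    using assms(3)[OF xy] by linarith
qed

lemma ac_on_diff:
  assumes "ac_on a b f" "ac_on a b g"
  shows "ac_on a b (\<lambda>x. f x - g x)"
proof (rule ac_on_if_increments2[OF assms, of 1])
  fix x y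
  have "f y - g y - (f x - g x) = (f y - f x) - (g y - g x)" by simp
  then show "norm (f y - g y - (f x - g x)) \<le> 1 * (norm (f y - f x) + norm (g y - g x))"
    by (metis mult_1 norm_triangle_ineq4)
qed simp

lemma ac_on_subinterval:
  assumes "ac_on a b f" "a \<le> c" "d \<le> b"
  shows "ac_on c d f"
  using assms unfolding ac_on_def by (meson order_trans)

text \<open>Constant continuation, which extends F to the whole line, where
  \<open>interval_measure\<close> lives. Clamping keeps disjoint intervals disjoint and does not
  lengthen them.\<close>

lemma ac_on_clamp:
  assumes F: "ac_on s t F" and st: "s \<le> t"
  shows "ac_on c d (\<lambda>x. F (max s (min t x)))"
  unfolding ac_on_iff_oscillation_bound
proof (intro allI impI)
  fix e :: real assume e: "e > 0"
  obtain k where k: "k > 0" "oscillation_bound s t F e k"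
    using F e unfolding ac_on_iff_oscillation_bound by blast
  have "oscillation_bound c d (\<lambda>x. F (max s (min t x))) e k"
    unfolding oscillation_bound_def
  proof (intro allI impI)
    fix N :: nat and u v
    assume H: "(\<forall>i<N. c \<le> u i \<and> u i \<le> v i \<and> v i \<le> d) \<and>
       disjoint_family_on (\<lambda>i. {u i<..<v i}) {..<N} \<and> (\<Sum>i<N. v i - u i) < k"
    show "(\<Sum>i<N. norm (F (max s (min t (v i))) - F (max s (min t (u i))))) < e"
    proof (rule oscillation_bound_finite[OF k(2)])
      show "disjoint_family_on (\<lambda>i. {max s (min t (u i))<..<max s (min t (v i))}) {..<N}"
      proof -
        have "{max s (min t (u i))<..<max s (min t (v i))} \<subseteq> {u i<..<v i}" for i
          using st by (auto simp: less_max_iff_disj max_less_iff_conj min_less_iff_disj)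
        then show ?thesis using H unfolding disjoint_family_on_def by blast
      qed
      have "(\<Sum>i<N. max s (min t (v i)) - max s (min t (u i))) \<le> (\<Sum>i<N. v i - u i)"
        by (rule sum_mono) (use H in \<open>force split: split_max split_min\<close>)
      then show "(\<Sum>i<N. max s (min t (v i)) - max s (min t (u i))) < k" using H by simp
    qed (use H st in \<open>auto simp: le_max_iff_disj min_le_iff_disj\<close>)
  qed
  then show "\<exists>k>0. oscillation_bound c d (\<lambda>x. F (max s (min t x))) e k" using k by blast
qed

text \<open>A bounded null set is enclosed in an open set U of measure below \<delta> and covered by
  nonoverlapping intervals inside U. The \<epsilon>-\<delta> condition bounds the total increase of
  F over finitely many of them, and the bound passes to the union.\<close>

lemma interval_measure_absolutely_continuous:
  fixes F :: "real \<Rightarrow> real"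
  assumes mono: "\<And>x y. x \<le> y \<Longrightarrow> F x \<le> F y" and ac: "\<And>c d. ac_on c d F"
  shows "absolutely_continuous lborel (interval_measure F)"
  unfolding absolutely_continuous_def
proof
  have contF: "continuous_on UNIV F"
  proof (rule continuous_at_imp_continuous_on, rule ballI)
    fix x
    have "continuous_on {x-1<..<x+1} F"
      by (rule continuous_on_subset[OF ac_on_imp_continuous_on[OF ac[of "x-1" "x+1"]]]) auto
    then show "isCont F x"
      by (rule continuous_on_interior) simp
  qed
  let ?M = "interval_measure F"
  have Icc: "emeasure ?M {c..d} = F d - F c" if "c \<le> d" for c d
    using emeasure_interval_measure_Icc[OF that mono contF] by simp
  fix N :: "real set" assume N: "N \<in> null_sets lborel"
  then have Nb: "N \<in> sets borel" by auto
  have zero: "emeasure ?M (N \<inter> {- real k - 1..real k + 1}) = 0" for k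
  proof -
    let ?S = "N \<inter> {- real k - 1..real k + 1}"
    have "emeasure ?M ?S \<le> ennreal e" if e: "e > 0" for e :: real
    proof -
      obtain d where d: "d > 0" "oscillation_bound (-real k - 1) (real k + 1) F e d"
        using ac[of "-real k - 1" "real k + 1"] e unfolding ac_on_iff_oscillation_bound by blast
      obtain U where U: "open U" "N \<subseteq> U" "emeasure lborel (U - N) < d"
        using outer_regular_lborel[OF Nb, of d] d(1) by auto
      have "emeasure lborel U \<le> emeasure lborel ((U - N) \<union> N)"
        using U Nb by (intro emeasure_mono) auto
      also have "\<dots> \<le> emeasure lborel (U - N) + emeasure lborel N"
        using U Nb by (intro emeasure_subadditive) auto
      also have "\<dots> < d" using U(3) N by auto
      finally have mU: "emeasure lborel U < d" .
      \<comment> \<open>With this gauge \<open>covering_lemma\<close> yields intervals inside U: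
        each is contained in \<open>g x\<close> for some x of the null set, hence of U.\<close>
      define g where "g x = (if x \<in> U then U else UNIV)" for x
      have g: "gauge g" using U(1) by (auto simp: gauge_def g_def)
      obtain D where D: "countable D" "\<Union>D \<subseteq> cbox (-real k - 1) (real k + 1)"
        "\<And>K. K \<in> D \<Longrightarrow> interior K \<noteq> {} \<and> (\<exists>c d. K = cbox c d)"
        "pairwise (\<lambda>A B. interior A \<inter> interior B = {}) D"
        "\<And>K. K \<in> D \<Longrightarrow> \<exists>x \<in> ?S \<inter> K. K \<subseteq> g x" "?S \<subseteq> \<Union>D"
        by (rule covering_lemma[of ?S "-real k - 1" "real k + 1" g]) (use g in auto)
      have DU: "K \<subseteq> U" if "K \<in> D" for K
        using D(5)[OF that] U(2) by (auto simp: g_def split: if_splits)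
      \<comment> \<open>\<open>oscillation_bound\<close> speaks of finite families only; the
        countable family D is exhausted afterwards by the increasing unions
        \<open>A n\<close>.\<close>
      have fin: "emeasure ?M (\<Union>E) \<le> e" if E: "finite E" "E \<subseteq> D" for E
      proof -
        have K: "K = {Inf K..Sup K} \<and> Inf K < Sup K \<and> interior K = {Inf K<..<Sup K} \<and> K \<subseteq> U \<and>
             -real k - 1 \<le> Inf K \<and> Sup K \<le> real k + 1"
          if "K \<in> E" for K
        proof -
          have KD: "K \<in> D" using that E by auto
          then obtain c d where cd: "K = {c..d}" "interior K \<noteq> {}" using D(3)[of K] by auto
          then have "c < d" by (auto simp: interior_atLeastAtMost_real)
          moreover have "K \<subseteq> {-real k - 1..real k + 1}" using D(2) KD by auto
          ultimately show ?thesis using cd DU[OF KD] by (auto simp: interior_atLeastAtMost_real)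
        qed
        have K': "Inf K < Sup K \<and> -real k - 1 \<le> Inf K \<and> Sup K \<le> real k + 1" if "K \<in> E" for K
          using K[OF that] by blast
        have dis: "disjoint_family_on (\<lambda>K. {Inf K<..<Sup K}) E"
          unfolding disjoint_family_on_def
        proof (intro ballI impI)
          fix A B assume "A \<in> E" "B \<in> E" "A \<noteq> B"
          then show "{Inf A<..<Sup A} \<inter> {Inf B<..<Sup B} = {}"
            using D(4) E(2) K[of A] K[of B] unfolding pairwise_def by (metis subsetD)
        qed
        have "ennreal (\<Sum>K\<in>E. Sup K - Inf K) = (\<Sum>K\<in>E. emeasure lborel {Inf K<..<Sup K})"
        proof -
          have "(\<Sum>K\<in>E. emeasure lborel {Inf K<..<Sup K}) = (\<Sum>K\<in>E. ennreal (Sup K - Inf K))"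
            by (rule sum.cong) (use K' in \<open>auto simp: less_imp_le\<close>)
          also have "\<dots> = ennreal (\<Sum>K\<in>E. Sup K - Inf K)"
            by (rule sum_ennreal) (use K' in \<open>auto simp: less_imp_le\<close>)
          finally show ?thesis by simp
        qed
        also have "\<dots> = emeasure lborel (\<Union>K\<in>E. {Inf K<..<Sup K})"
          using dis E by (intro sum_emeasure) auto
        also have "\<dots> \<le> emeasure lborel U"
        proof (intro emeasure_mono UN_least)
          fix K assume "K \<in> E"
          then have "interior K = {Inf K<..<Sup K}" "K \<subseteq> U" using K by blast+
          then show "{Inf K<..<Sup K} \<subseteq> U" using interior_subset[of K] by (metis subset_trans)
        qed (use U in auto)
        also note mU
        finally have len: "(\<Sum>K\<in>E. Sup K - Inf K) < d"
          by (metis ennreal_leI not_le)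
        have "(\<Sum>K\<in>E. norm (F (Sup K) - F (Inf K))) < e"
          by (rule oscillation_bound_finite[OF d(2) E(1) _ dis len]) (use K' in \<open>auto simp: less_imp_le\<close>)
        moreover have "(\<Sum>K\<in>E. norm (F (Sup K) - F (Inf K))) = (\<Sum>K\<in>E. F (Sup K) - F (Inf K))"
          by (rule sum.cong) (use K' mono in \<open>auto simp: less_imp_le\<close>)
        moreover have "emeasure ?M (\<Union>E) \<le> (\<Sum>K\<in>E. emeasure ?M K)"
        proof -
          have "K \<in> sets borel" if "K \<in> E" for K
            using K[OF that] by (metis atLeastAtMost_borel)
          then show ?thesis
            using emeasure_subadditive_finite[OF E(1), of "\<lambda>K. K" ?M] by auto
        qed
        moreover have "(\<Sum>K\<in>E. emeasure ?M K) = (\<Sum>K\<in>E. ennreal (F (Sup K) - F (Inf K)))"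
          by (rule sum.cong) (rule refl, metis K Icc less_imp_le)
        moreover have "\<dots> = ennreal (\<Sum>K\<in>E. F (Sup K) - F (Inf K))"
          by (rule sum_ennreal) (use K' mono in \<open>auto simp: less_imp_le\<close>)
        ultimately show ?thesis
          by (metis ennreal_leI less_imp_le order_trans)
      qed
      have Db: "K \<in> sets borel" if "K \<in> D" for K using D(3)[OF that] by auto
      define A where "A n = \<Union>(from_nat_into D ` {..<n})" for n :: nat
      have "emeasure ?M (\<Union>D) \<le> e"
      proof (cases "D = {}")
        case False
        then have ran: "from_nat_into D n \<in> D" for n by (rule from_nat_into)
        have "\<Union>D = (\<Union>n. A n)"
        proof -
          have "\<Union>D = (\<Union>n. from_nat_into D n)"
            using range_from_nat_into[OF False D(1)] by (metis)
          also have "\<dots> = (\<Union>n. A n)" unfolding A_def by auto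
          finally show ?thesis .
        qed
        moreover have "emeasure ?M (\<Union>n. A n) = (SUP n. emeasure ?M (A n))"
        proof (rule SUP_emeasure_incseq[symmetric])
          show "range A \<subseteq> sets ?M" unfolding A_def using Db ran by (auto intro!: sets.finite_UN)
          show "incseq A" unfolding A_def incseq_def by (intro allI impI Union_mono image_mono) simp
        qed
        moreover have "(SUP n. emeasure ?M (A n)) \<le> e"
          unfolding A_def by (intro SUP_least fin) (use ran in auto)
        ultimately show ?thesis by simp
      qed simp
      moreover have "emeasure ?M ?S \<le> emeasure ?M (\<Union>D)"
        using D(1,6) Db by (intro emeasure_mono) (auto intro!: sets.countable_Union)
      ultimately show ?thesis by simp
    qed
    then have "emeasure ?M ?S \<le> 0 + ennreal e" if "e > 0" for e
      using that by simp
    then have "emeasure ?M ?S \<le> 0"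
      by (rule ennreal_le_epsilon)
    then show ?thesis by simp
  qed
  have "N = (\<Union>k. N \<inter> {- real k - 1..real k + 1})"
  proof -
    have "\<exists>k. x \<in> {- real k - 1..real k + 1}" for x :: real
    proof -
      obtain k :: nat where "\<bar>x\<bar> < real k" using reals_Archimedean2 by blast
      then show ?thesis by (intro exI[of _ k]) auto
    qed
    then show ?thesis by auto
  qed
  moreover have "(\<Union>k. N \<inter> {- real k - 1..real k + 1}) \<in> null_sets ?M"
    using zero Nb by (intro null_sets_UN) (auto simp: null_sets_def)
  ultimately show "N \<in> null_sets ?M" by simp
qed

text \<open>The density is the Radon-Nikodym derivative of the Stieltjes measure of the constant
  continuation F of G.\<close>

lemma mono_ac_density:
  fixes G :: "real \<Rightarrow> real"
  assumes ac: "ac_on s t G" and mono: "\<And>x y. s \<le> x \<Longrightarrow> x \<le> y \<Longrightarrow> y \<le> t \<Longrightarrow> G x \<le> G y" and st: "s \<le> t"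
  shows "\<exists>h. integrable (lebesgue_on {s..t}) h \<and> (\<forall>x\<in>{s..t}. G x = G s + integral {s..x} h)"
proof -
  define F where "F x = G (max s (min t x))" for x
  have monoF: "F x \<le> F y" if "x \<le> y" for x y
    unfolding F_def by (rule mono) (use that st in \<open>auto split: split_max split_min\<close>)
  have acF: "ac_on c d F" for c d
    unfolding F_def by (rule ac_on_clamp[OF ac st])
  let ?M = "interval_measure F"
  have rc: "continuous (at_right x) F" for x
  proof -
    have "continuous_on {x-1<..<x+1} F"
      by (rule continuous_on_subset[OF ac_on_imp_continuous_on[OF acF[of "x-1" "x+1"]]]) auto
    then have "isCont F x" by (rule continuous_on_interior) simp
    then show ?thesis by (rule continuous_at_imp_continuous_within)
  qed
  have abs: "absolutely_continuous lborel ?M"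
    by (rule interval_measure_absolutely_continuous[OF monoF acF])
  define h where "h = RN_deriv lborel ?M"
  have hm[measurable]: "h \<in> borel_measurable borel" unfolding h_def by simp
  have dens: "density lborel h = ?M"
    unfolding h_def by (rule sigma_finite_measure.density_RN_deriv[OF sigma_finite_lborel abs]) simp
  have fin: "AE x in lborel. h x \<noteq> \<infinity>"
    unfolding h_def
    by (rule sigma_finite_measure.RN_deriv_finite[OF sigma_finite_lborel sigma_finite_interval_measure[OF monoF rc] abs]) auto
  \<comment> \<open>The derivative has values in \<open>ennreal\<close>. The Stieltjes measure is
    sigma-finite, so the derivative is finite almost everywhere and \<open>enn2real\<close> loses
    nothing.\<close>
  define g where "g x = enn2real (h x)" for x
  have gm[measurable]: "g \<in> borel_measurable borel" unfolding g_def by simp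
  have nn: "(\<integral>\<^sup>+ y. ennreal (indicator {s..x} y *\<^sub>R g y) \<partial>lborel) = ennreal (G x - G s)" if x: "x \<in> {s..t}" for x
  proof -
    \<comment> \<open>F x - F s is the measure of the half-open interval (s, x], while the integral
      runs over [s, x].\<close>
    have "AE y in lborel. y \<noteq> s" by (rule AE_lborel_singleton)
    with fin have "AE y in lborel. ennreal (indicator {s..x} y *\<^sub>R g y) = h y * indicator {s<..x} y"
      by eventually_elim (auto simp: g_def indicator_def less_top)
    then have "(\<integral>\<^sup>+ y. ennreal (indicator {s..x} y *\<^sub>R g y) \<partial>lborel) = (\<integral>\<^sup>+ y. h y * indicator {s<..x} y \<partial>lborel)"
      by (rule nn_integral_cong_AE)
    also have "\<dots> = emeasure (density lborel h) {s<..x}"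
      by (rule emeasure_density[symmetric]) auto
    also have "\<dots> = ennreal (F x - F s)"
      unfolding dens using emeasure_interval_measure_Ioc[OF _ monoF rc, of s x] x by simp
    finally show ?thesis using x st by (simp add: F_def)
  qed
  have int: "set_integrable lborel {s..x} g" and val: "(LINT y:{s..x}|lborel. g y) = G x - G s"
    if x: "x \<in> {s..t}" for x
  proof -
    have nonneg: "AE y in lborel. 0 \<le> indicator {s..x} y *\<^sub>R g y"
      by (auto simp: g_def indicator_def)
    show "set_integrable lborel {s..x} g"
      unfolding set_integrable_def using nn[OF x] by (intro integrableI_nonneg[OF _ nonneg]) auto
    show "(LINT y:{s..x}|lborel. g y) = G x - G s"
      unfolding set_lebesgue_integral_def
      using nn[OF x] mono[of s x] x
      by (subst integral_eq_nn_integral[OF _ nonneg]) auto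
  qed
  have "set_integrable lebesgue {s..t} g"
    using int[of t] st unfolding set_integrable_def by (auto simp: integrable_completion)
  then have "integrable (lebesgue_on {s..t}) g"
    by (intro absolutely_integrable_imp_integrable) auto
  moreover have "G x = G s + integral {s..x} g" if "x \<in> {s..t}" for x
    using set_borel_integral_eq_integral(2)[OF int[OF that]] val[OF that] by simp
  ultimately show ?thesis by blast
qed


text \<open>On an interval shorter than \<open>\<delta>\<close> the positive variation \<open>P\<close> of \<open>f\<close> is at most \<open>1\<close>, and both \<open>P\<close>
  and \<open>P - f\<close> are nondecreasing. Splitting the intervals of a family at a point shows that \<open>P\<close> is
  absolutely continuous, so the Radon--Nikodym theorem applies to both Stieltjes measures.\<close>

definition interval_family :: "real \<Rightarrow> real \<Rightarrow> nat \<Rightarrow> (nat \<Rightarrow> real) \<Rightarrow> (nat \<Rightarrow> real) \<Rightarrow> bool" where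
  "interval_family s x N u v \<longleftrightarrow>
     (\<forall>i<N. s \<le> u i \<and> u i \<le> v i \<and> v i \<le> x) \<and> disjoint_family_on (\<lambda>i. {u i<..<v i}) {..<N}"

definition positive_variation :: "(real \<Rightarrow> real) \<Rightarrow> real \<Rightarrow> real \<Rightarrow> real" where
  "positive_variation f s x = Sup {\<Sum>i<N. f (v i) - f (u i) |N u v. interval_family s x N u v}"

context
  fixes f :: "real \<Rightarrow> real" and s t \<delta> :: real
  assumes ac: "ac_on s t f" and ob: "oscillation_bound s t f 1 \<delta>" and st: "s \<le> t" "t - s < \<delta>"
begin

lemma bdd_above_variation_sums:
  assumes "x \<le> t" "s \<le> x"
  shows "bdd_above {\<Sum>i<N. f (v i) - f (u i) |N u v. interval_family s x N u v}"
proof (rule bdd_aboveI[of _ 1])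
  fix z assume "z \<in> {\<Sum>i<N. f (v i) - f (u i) |N u v. interval_family s x N u v}"
  then obtain N u v where z: "z = (\<Sum>i<N. f (v i) - f (u i))" "interval_family s x N u v" by blast
  have "z \<le> (\<Sum>i<N. norm (f (v i) - f (u i)))" unfolding z by (rule sum_mono) simp
  also have "\<dots> < 1"
  proof (rule oscillation_bound_finite[OF ob])
    have "(\<Sum>i<N. v i - u i) \<le> x - s"
      by (rule sum_disjoint_lengths_le) (use z assms in \<open>auto simp: interval_family_def\<close>)
    then show "(\<Sum>i<N. v i - u i) < \<delta>" using st assms by simp
  qed (use z assms in \<open>auto simp: interval_family_def\<close>)
  finally show "z \<le> 1" by simp
qed

lemma le_positive_variation:
  assumes "x \<le> t" "s \<le> x" "interval_family s x N u v"
  shows "(\<Sum>i<N. f (v i) - f (u i)) \<le> positive_variation f s x"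
  unfolding positive_variation_def
  by (rule cSup_upper[OF _ bdd_above_variation_sums[OF assms(1,2)]]) (use assms in blast)

lemma positive_variation_approx:
  assumes "x \<le> t" "s \<le> x" "\<eta> > 0"
  obtains N u v where "interval_family s x N u v"
    "positive_variation f s x - \<eta> < (\<Sum>i<N. f (v i) - f (u i))"
proof -
  have "interval_family s x 0 u v" for u v by (simp add: interval_family_def disjoint_family_on_def)
  then have "{\<Sum>i<N. f (v i) - f (u i) |N u v. interval_family s x N u v} \<noteq> {}" by blast
  from less_cSupD[OF this, of "positive_variation f s x - \<eta>"] show thesis
    using that assms(3) unfolding positive_variation_def by force
qed

text \<open>Adjoining [x, y] to a family in [s, x] gains f y - f x, and keeping the family gains 0.
  The maximum says at once that both the positive variation and its difference to f are
  nondecreasing.\<close>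

lemma positive_variation_increment:
  assumes "s \<le> x" "x \<le> y" "y \<le> t"
  shows "positive_variation f s x + max 0 (f y - f x) \<le> positive_variation f s y"
proof (rule field_le_epsilon)
  fix e :: real assume e: "e > 0"
  obtain N u v where N: "interval_family s x N u v"
    "positive_variation f s x - e < (\<Sum>i<N. f (v i) - f (u i))"
    using positive_variation_approx[of x e] assms e by auto
  have "interval_family s y N u v" using N(1) assms by (force simp: interval_family_def)
  then have 1: "(\<Sum>i<N. f (v i) - f (u i)) \<le> positive_variation f s y"
    using le_positive_variation assms by simp
  have "interval_family s y (Suc N) (u(N := x)) (v(N := y))"
    unfolding interval_family_def
  proof
    show "\<forall>i<Suc N. s \<le> (u(N := x)) i \<and> (u(N := x)) i \<le> (v(N := y)) i \<and> (v(N := y)) i \<le> y"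
      using N(1) assms by (force simp: interval_family_def less_Suc_eq)
    have *: "{u i<..<v i} \<inter> {x<..<y} = {}" if "i < N" for i
      using N(1) that by (force simp: interval_family_def)
    then show "disjoint_family_on (\<lambda>i. {(u(N := x)) i<..<(v(N := y)) i}) {..<Suc N}"
      using N(1) by (auto simp: interval_family_def disjoint_family_on_def lessThan_Suc)
  qed
  then have 2: "(\<Sum>i<Suc N. f ((v(N := y)) i) - f ((u(N := x)) i)) \<le> positive_variation f s y"
    using le_positive_variation assms by (meson order_trans)
  have "(\<Sum>i<N. f ((v(N := y)) i) - f ((u(N := x)) i)) = (\<Sum>i<N. f (v i) - f (u i))"
    by (rule sum.cong) auto
  then show "positive_variation f s x + max 0 (f y - f x) \<le> positive_variation f s y + e"
    using 1 2 N(2) by (simp add: max_def)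
qed

lemma ac_on_positive_variation: "ac_on s t (positive_variation f s)"
  unfolding ac_on_iff_oscillation_bound
proof (intro allI impI)
  let ?P = "positive_variation f s"
  fix e :: real assume e: "e > 0"
  obtain d where d: "d > 0" "oscillation_bound s t f (e / 2) d"
    using ac e unfolding ac_on_iff_oscillation_bound by (meson half_gt_zero)
  have "oscillation_bound s t ?P e d"
    unfolding oscillation_bound_def
  proof (intro allI impI)
    fix N :: nat and u v
    assume H: "(\<forall>i<N. s \<le> u i \<and> u i \<le> v i \<and> v i \<le> t) \<and>
       disjoint_family_on (\<lambda>i. {u i<..<v i}) {..<N} \<and> (\<Sum>i<N. v i - u i) < d"
    \<comment> \<open>N approximation errors cost at most e / 2 together; the summand 1 covers N =
      0.\<close>
    define \<eta> where "\<eta> = e / (2 * (N + 1))"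
    have \<eta>: "\<eta> > 0" using e by (simp add: \<eta>_def)
    have "\<exists>M p q. interval_family s (v i) M p q \<and> ?P (v i) - \<eta> < (\<Sum>j<M. f (q j) - f (p j))" if "i < N" for i
      using positive_variation_approx[of "v i" \<eta>] H that \<eta> by (metis order_trans)
    then obtain M p q where fam: "\<And>i. i < N \<Longrightarrow> interval_family s (v i) (M i) (p i) (q i)"
      and apx: "\<And>i. i < N \<Longrightarrow> ?P (v i) - \<eta> < (\<Sum>j<M i. f (q i j) - f (p i j))"
      by metis
    \<comment> \<open>The part of the i-th near-optimal family to the right of \<open>u i\<close>.
      The part to the left is a family in [s, u i], so \<open>?P (u i)\<close> bounds its sum, and
      the right part alone accounts for the increment of \<open>?P\<close>.\<close>
    define p' where "p' i j = max (p i j) (u i)" for i j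
    define q' where "q' i j = max (q i j) (u i)" for i j
    have uv: "s \<le> u i" "u i \<le> v i" "v i \<le> t" if "i < N" for i using H that by auto
    have pq: "s \<le> p i j" "p i j \<le> q i j" "q i j \<le> v i" if "i < N" "j < M i" for i j
      using fam[OF that(1)] that by (auto simp: interval_family_def)
    have piece: "?P (v i) - ?P (u i) \<le> (\<Sum>j<M i. norm (f (q' i j) - f (p' i j))) + \<eta>" if i: "i < N" for i
    proof -
      have split: "f (q i j) - f (p i j) = (f (min (q i j) (u i)) - f (min (p i j) (u i))) + (f (q' i j) - f (p' i j))" for j
        by (auto simp: p'_def q'_def max_def min_def)
      have "interval_family s (u i) (M i) (\<lambda>j. min (p i j) (u i)) (\<lambda>j. min (q i j) (u i))"
        unfolding interval_family_def
      proof
        show "\<forall>j<M i. s \<le> min (p i j) (u i) \<and> min (p i j) (u i) \<le> min (q i j) (u i) \<and> min (q i j) (u i) \<le> u i"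
          using pq[OF i] uv[OF i] by (auto simp: min_le_iff_disj)
        have "{min (p i j) (u i)<..<min (q i j) (u i)} \<subseteq> {p i j<..<q i j}" for j by auto
        then show "disjoint_family_on (\<lambda>j. {min (p i j) (u i)<..<min (q i j) (u i)}) {..<M i}"
          using fam[OF i] unfolding interval_family_def disjoint_family_on_def by blast
      qed
      then have "(\<Sum>j<M i. f (min (q i j) (u i)) - f (min (p i j) (u i))) \<le> ?P (u i)"
        using le_positive_variation uv[OF i] by simp
      moreover have "(\<Sum>j<M i. f (q i j) - f (p i j)) =
         (\<Sum>j<M i. f (min (q i j) (u i)) - f (min (p i j) (u i))) + (\<Sum>j<M i. f (q' i j) - f (p' i j))"
        unfolding sum.distrib[symmetric] by (rule sum.cong) (use split in auto)
      moreover have "(\<Sum>j<M i. f (q' i j) - f (p' i j)) \<le> (\<Sum>j<M i. norm (f (q' i j) - f (p' i j)))"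
        by (rule sum_mono) simp
      ultimately show ?thesis using apx[OF i] by simp
    qed
    have sub: "{p' i j<..<q' i j} \<subseteq> {p i j<..<q i j}" "{p' i j<..<q' i j} \<subseteq> {u i<..<v i}"
      if "i < N" "j < M i" for i j
      using pq[OF that] by (auto simp: p'_def q'_def)
    have bounds: "u i \<le> p' i j \<and> p' i j \<le> q' i j \<and> q' i j \<le> v i" if "i < N" "j < M i" for i j
      using pq[OF that] uv[OF that(1)] by (auto simp: p'_def q'_def)
    have inner: "disjoint_family_on (\<lambda>j. {p' i j<..<q' i j}) {..<M i}" if "i < N" for i
      unfolding disjoint_family_on_def
    proof (intro ballI impI)
      fix j k assume "j \<in> {..<M i}" "k \<in> {..<M i}" "j \<noteq> k"
      then show "{p' i j<..<q' i j} \<inter> {p' i k<..<q' i k} = {}"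
        using fam[OF that] sub(1)[OF that, of j] sub(1)[OF that, of k]
        unfolding interval_family_def disjoint_family_on_def by blast
    qed
    \<comment> \<open>The right-hand parts for all i together form one disjoint family of total
      length below d, to which the bound for f applies.\<close>
    let ?J = "Sigma {..<N} (\<lambda>i. {..<M i})"
    have "(\<Sum>i<N. \<Sum>j<M i. norm (f (q' i j) - f (p' i j))) = (\<Sum>(i,j)\<in>?J. norm (f (q' i j) - f (p' i j)))"
      by (rule sum.Sigma) auto
    also have "\<dots> = (\<Sum>z\<in>?J. norm (f (q' (fst z) (snd z)) - f (p' (fst z) (snd z))))"
      by (simp add: case_prod_unfold)
    also have "\<dots> < e / 2"
    proof (rule oscillation_bound_finite[OF d(2)])
      show "finite ?J" by auto
      show "s \<le> p' (fst z) (snd z) \<and> p' (fst z) (snd z) \<le> q' (fst z) (snd z) \<and> q' (fst z) (snd z) \<le> t"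
        if "z \<in> ?J" for z
        using that bounds uv by (cases z) (auto, (meson order_trans)+)
      show "disjoint_family_on (\<lambda>z. {p' (fst z) (snd z)<..<q' (fst z) (snd z)}) ?J"
        unfolding disjoint_family_on_def
      proof (intro ballI impI)
        fix y z assume yz: "y \<in> ?J" "z \<in> ?J" "y \<noteq> z"
        obtain i j k l where y: "y = (i, j)" and z: "z = (k, l)" by (metis surj_pair)
        have ij: "i < N" "j < M i" "k < N" "l < M k" using yz y z by auto
        show "{p' (fst y) (snd y)<..<q' (fst y) (snd y)} \<inter> {p' (fst z) (snd z)<..<q' (fst z) (snd z)} = {}"
        proof (cases "i = k")
          case True
          then show ?thesis using inner[OF ij(1)] ij yz y z unfolding disjoint_family_on_def by auto
        next
          case False
          then have "{u i<..<v i} \<inter> {u k<..<v k} = {}"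
            using H ij unfolding disjoint_family_on_def by auto
          then show ?thesis using sub(2)[OF ij(1,2)] sub(2)[OF ij(3,4)] unfolding y z fst_conv snd_conv by blast
        qed
      qed
      have "(\<Sum>z\<in>?J. q' (fst z) (snd z) - p' (fst z) (snd z)) = (\<Sum>i<N. \<Sum>j<M i. q' i j - p' i j)"
        by (subst sum.Sigma) (auto simp: case_prod_unfold)
      also have "\<dots> \<le> (\<Sum>i<N. v i - u i)"
        by (intro sum_mono sum_disjoint_lengths_le inner) (use bounds uv in auto)
      also have "\<dots> < d" using H by simp
      finally show "(\<Sum>z\<in>?J. q' (fst z) (snd z) - p' (fst z) (snd z)) < d" .
    qed
    finally have tot: "(\<Sum>i<N. \<Sum>j<M i. norm (f (q' i j) - f (p' i j))) < e / 2" .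
    have "(\<Sum>i<N. norm (?P (v i) - ?P (u i))) \<le> (\<Sum>i<N. (\<Sum>j<M i. norm (f (q' i j) - f (p' i j))) + \<eta>)"
    proof (rule sum_mono)
      fix i assume "i \<in> {..<N}"
      then have i: "i < N" by simp
      have "?P (u i) \<le> ?P (v i)"
        using positive_variation_increment[of "u i" "v i"] uv[OF i] by (simp add: max_def split: if_splits)
      then show "norm (?P (v i) - ?P (u i)) \<le> (\<Sum>j<M i. norm (f (q' i j) - f (p' i j))) + \<eta>"
        using piece[OF i] by simp
    qed
    also have "\<dots> = (\<Sum>i<N. \<Sum>j<M i. norm (f (q' i j) - f (p' i j))) + N * \<eta>"
      by (simp add: sum.distrib)
    also have "N * \<eta> \<le> e / 2" using e by (simp add: \<eta>_def field_simps)
    finally show "(\<Sum>i<N. norm (?P (v i) - ?P (u i))) < e" using tot by simp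
  qed
  then show "\<exists>d>0. oscillation_bound s t ?P e d" using d by blast
qed

lemma ac_density_short:
  "\<exists>h. integrable (lebesgue_on {s..t}) h \<and> (\<forall>x\<in>{s..t}. f x = f s + integral {s..x} h)"
proof -
  let ?P = "positive_variation f s"
  have inc: "?P x \<le> ?P y" "?P x - f x \<le> ?P y - f y" if "s \<le> x" "x \<le> y" "y \<le> t" for x y
    using positive_variation_increment[OF that] by auto
  obtain g where g: "integrable (lebesgue_on {s..t}) g" "\<And>x. x \<in> {s..t} \<Longrightarrow> ?P x = ?P s + integral {s..x} g"
    using mono_ac_density[OF ac_on_positive_variation inc(1) st(1)] by blast
  obtain h where h: "integrable (lebesgue_on {s..t}) h"
    "\<And>x. x \<in> {s..t} \<Longrightarrow> ?P x - f x = ?P s - f s + integral {s..x} h"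
    using mono_ac_density[OF ac_on_diff[OF ac_on_positive_variation ac] inc(2) st(1)] by blast
  have "f x = f s + integral {s..x} (\<lambda>y. g y - h y)" if x: "x \<in> {s..t}" for x
  proof -
    have "g integrable_on {s..x}" "h integrable_on {s..x}"
      using integrable_subinterval[OF g(1), of s x] integrable_subinterval[OF h(1), of s x] x
      by (auto simp: integrable_on_lebesgue_on)
    then show ?thesis using g(2)[OF x] h(2)[OF x] by (simp add: Henstock_Kurzweil_Integration.integral_diff)
  qed
  moreover have "integrable (lebesgue_on {s..t}) (\<lambda>y. g y - h y)"
    using g(1) h(1) by (rule Bochner_Integration.integrable_diff)
  ultimately show ?thesis by blast
qed

end

text \<open>The positive variation is under control only on intervals shorter than \<delta>. Longer
  intervals are covered by steps of length \<delta> / 2 and the densities are glued, the common end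
  points being negligible.\<close>

lemma ac_density_real:
  fixes f :: "real \<Rightarrow> real"
  assumes ac: "ac_on a b f" and ab: "a \<le> b"
  shows "\<exists>h. integrable (lebesgue_on {a..b}) h \<and> (\<forall>x\<in>{a..b}. f x = f a + integral {a..x} h)"
proof -
  obtain \<delta> where \<delta>: "\<delta> > 0" "oscillation_bound a b f 1 \<delta>"
    using ac unfolding ac_on_iff_oscillation_bound by (meson zero_less_one)
  have step: "\<exists>h. integrable (lebesgue_on {a..c}) h \<and> (\<forall>x\<in>{a..c}. f x = f a + integral {a..x} h)"
    if "a \<le> c" "c \<le> b" "c \<le> a + real k * (\<delta> / 2)" for k c
    using that
  proof (induction k arbitrary: c)
    case 0
    then have "c = a" by simp
    then show ?case by (intro exI[of _ "\<lambda>_. 0"]) auto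
  next
    case (Suc k)
    define m where "m = max a (c - \<delta> / 2)"
    have m: "a \<le> m" "m \<le> c" "m \<le> a + real k * (\<delta> / 2)" "c - m < \<delta>"
    proof -
      show "a \<le> m" "m \<le> c" "c - m < \<delta>" using Suc.prems \<delta>(1) by (auto simp: m_def)
      have "c - \<delta> / 2 \<le> a + real k * (\<delta> / 2)" using Suc.prems(3) by (simp add: algebra_simps add_divide_distrib)
      then show "m \<le> a + real k * (\<delta> / 2)" using \<delta>(1) by (simp add: m_def)
    qed
    have "m \<le> b" using m(2) Suc.prems(2) by simp
    then obtain h where h: "integrable (lebesgue_on {a..m}) h" "\<And>x. x \<in> {a..m} \<Longrightarrow> f x = f a + integral {a..x} h"
      using Suc.IH[OF m(1) _ m(3)] by blast
    have acm: "ac_on m c f" by (rule ac_on_subinterval[OF ac]) (use m Suc.prems in auto)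
    have obm: "oscillation_bound m c f 1 \<delta>"
      unfolding oscillation_bound_def
    proof (intro allI impI)
      fix N :: nat and u v
      assume H: "(\<forall>i<N. m \<le> u i \<and> u i \<le> v i \<and> v i \<le> c) \<and>
        disjoint_family_on (\<lambda>i. {u i<..<v i}) {..<N} \<and> (\<Sum>i<N. v i - u i) < \<delta>"
      show "(\<Sum>i<N. norm (f (v i) - f (u i))) < 1"
        by (rule oscillation_bound_finite[OF \<delta>(2)]) (use H m Suc.prems in \<open>force+\<close>)
    qed
    obtain g where g: "integrable (lebesgue_on {m..c}) g" "\<And>x. x \<in> {m..c} \<Longrightarrow> f x = f m + integral {m..x} g"
      using ac_density_short[OF acm obm m(2,4)] by blast
    define k where "k x = (if x \<le> m then h x else g x)" for x
    have k1: "integrable (lebesgue_on {a..m}) k"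
      using h(1) by (subst Bochner_Integration.integrable_cong[where g=h and N="lebesgue_on {a..m}"]) (auto simp: k_def)
    have "AE x in lebesgue_on {m..c}. k x = g x"
    proof -
      have "AE x in lebesgue. x \<noteq> m"
        by (metis AE_lborel_singleton AE_completion)
      then show ?thesis by (subst AE_restrict_space_iff) (auto simp: k_def elim!: AE_mp)
    qed
    then have k2: "integrable (lebesgue_on {m..c}) k"
      by (intro integrable_lebesgue_on_AE_cong[OF g(1)]) auto
    have kk: "integrable (lebesgue_on {a..c}) k" by (rule integrable_combine[OF k1 k2 m(1,2)])
    have "f x = f a + integral {a..x} k" if x: "x \<in> {a..c}" for x
    proof (cases "x \<le> m")
      case True
      have "integral {a..x} k = integral {a..x} h"
        by (rule integral_cong) (use True in \<open>auto simp: k_def\<close>)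
      then show ?thesis using h(2)[of x] True x by simp
    next
      case False
      have "k integrable_on {a..x}"
        using integrable_subinterval[OF kk, of a x] x by (auto simp: integrable_on_lebesgue_on)
      then have "integral {a..x} k = integral {a..m} k + integral {m..x} k"
        using Henstock_Kurzweil_Integration.integral_combine[of a m x k] m False by simp
      moreover have "integral {a..m} k = integral {a..m} h"
        by (rule integral_cong) (auto simp: k_def)
      moreover have "integral {m..x} k = integral {m..x} g"
        by (rule integral_spike[of "{m}"]) (auto simp: k_def)
      ultimately show ?thesis using h(2)[of m] g(2)[of x] False x m by simp
    qed
    then show ?case using kk by blast
  qed
  obtain k :: nat where "(b - a) / (\<delta> / 2) < real k" using reals_Archimedean2 by blast
  then show ?thesis using step[of b k] ab \<delta>(1) by (simp add: field_simps)
qed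


lemma ac_density:
  fixes f :: "real \<Rightarrow> complex"
  assumes ac: "ac_on a b f" and ab: "a \<le> b"
  obtains h where "integrable (lebesgue_on {a..b}) h" "\<And>x. x \<in> {a..b} \<Longrightarrow> f x = f a + integral {a..x} h"
proof -
  have "ac_on a b (\<lambda>x. Re (f x))" "ac_on a b (\<lambda>x. Im (f x))"
    by (rule ac_on_if_increments[OF ac, of 1];
        simp flip: minus_complex.simps add: abs_Re_le_cmod abs_Im_le_cmod)+
  then obtain g h where
    g: "integrable (lebesgue_on {a..b}) g" "\<And>x. x \<in> {a..b} \<Longrightarrow> Re (f x) = Re (f a) + integral {a..x} g" and
    h: "integrable (lebesgue_on {a..b}) h" "\<And>x. x \<in> {a..b} \<Longrightarrow> Im (f x) = Im (f a) + integral {a..x} h"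
    using ac_density_real ab by metis
  define k where "k x = of_real (g x) + \<i> * of_real (h x)" for x
  have k: "integrable (lebesgue_on {a..b}) k"
    unfolding k_def using g(1) h(1) by auto
  have "f x = f a + integral {a..x} k" if x: "x \<in> {a..b}" for x
  proof -
    have sub: "{a..x} \<subseteq> {a..b}" using x by auto
    have gi: "(g has_integral integral {a..x} g) {a..x}"
      using integrable_subinterval[OF g(1) sub] by (simp add: integrable_on_lebesgue_on integrable_integral)
    have hi: "(h has_integral integral {a..x} h) {a..x}"
      using integrable_subinterval[OF h(1) sub] by (simp add: integrable_on_lebesgue_on integrable_integral)
    have "(k has_integral (of_real (integral {a..x} g) + \<i> * of_real (integral {a..x} h))) {a..x}"
      unfolding k_def using has_integral_of_real[OF gi] has_integral_of_real[OF hi]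
      by (intro has_integral_add has_integral_mult_right) auto
    then have "integral {a..x} k = of_real (integral {a..x} g) + \<i> * of_real (integral {a..x} h)"
      by (rule integral_unique)
    then show ?thesis using g(2)[OF x] h(2)[OF x] by (simp add: complex_eq_iff)
  qed
  with k show thesis by (rule that)
qed

lemma ac_density_derivative_AE:
  fixes h :: "real \<Rightarrow> 'b::euclidean_space"
  assumes h: "integrable (lebesgue_on {a..b}) h" and f: "\<And>x. x \<in> {a..b} \<Longrightarrow> f x = c + integral {a..x} h"
  shows "AE t in lebesgue_on {a..b}. (f has_vector_derivative h t) (at t within {a..b})"
  using integral_has_vector_derivative_AE[OF h] AE_space
proof eventually_elim
  fix t assume d: "((\<lambda>u. integral {a..u} h) has_vector_derivative h t) (at t within {a..b})"
    and t: "t \<in> space (lebesgue_on {a..b})"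
  have "((\<lambda>u. c + integral {a..u} h) has_vector_derivative 0 + h t) (at t within {a..b})"
    by (intro has_vector_derivative_add has_vector_derivative_const d)
  then have d': "((\<lambda>u. c + integral {a..u} h) has_vector_derivative h t) (at t within {a..b})" by simp
  show "(f has_vector_derivative h t) (at t within {a..b})"
    by (rule has_vector_derivative_transform[OF _ _ d']) (use f t in auto)
qed

section \<open>Indefinite integrals and the fundamental theorem of calculus\<close>

lemma integral_AE_cong:
  fixes g h :: "real \<Rightarrow> 'b::real_normed_vector"
  assumes "AE t in lebesgue_on {a..b}. g t = h t" "t \<in> {a..b}"
  shows "integral {a..t} g = integral {a..t} h"
proof -
  obtain N where N: "N \<in> null_sets (lebesgue_on {a..b})" "{x \<in> space (lebesgue_on {a..b}). g x \<noteq> h x} \<subseteq> N"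
    using assms(1) unfolding eventually_ae_filter by blast
  have "N \<in> null_sets lebesgue"
    using N(1) null_sets_restrict_space[of "{a..b}" lebesgue N] by simp
  then have "negligible N"
    by (simp add: negligible_iff_null_sets)
  then show ?thesis
    by (rule integral_spike) (use N(2) assms(2) in auto)
qed

text \<open>A nondecreasing K sends disjoint intervals (u, v) to disjoint, possibly empty intervals
  (K u, K v), so the bound on total length applies to the images.\<close>

lemma sum_disjoint_mono_increments_le:
  fixes K :: "real \<Rightarrow> real"
  assumes J: "finite J" and uv: "\<And>i. i \<in> J \<Longrightarrow> c \<le> u i \<and> u i \<le> v i \<and> v i \<le> d"
    and dis: "disjoint_family_on (\<lambda>i. {u i<..<v i}) J" and cd: "c \<le> d"
    and K: "\<And>x y. c \<le> x \<Longrightarrow> x \<le> y \<Longrightarrow> y \<le> d \<Longrightarrow> K x \<le> K y"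
  shows "(\<Sum>i\<in>J. K (v i) - K (u i)) \<le> K d - K c"
proof (rule sum_disjoint_lengths_le[OF J])
  show "K c \<le> K (u i) \<and> K (u i) \<le> K (v i) \<and> K (v i) \<le> K d" if "i \<in> J" for i
    using uv[OF that] by (intro conjI K) auto
  show "disjoint_family_on (\<lambda>i. {K (u i)<..<K (v i)}) J"
    unfolding disjoint_family_on_def
  proof (intro ballI impI equals0I)
    fix i j y assume ij: "i \<in> J" "j \<in> J" "i \<noteq> j" and y: "y \<in> {K (u i)<..<K (v i)} \<inter> {K (u j)<..<K (v j)}"
    have "u k < v l" if "k \<in> J" "l \<in> J" "y \<in> {K (u k)<..<K (v k)}" "y \<in> {K (u l)<..<K (v l)}" for k l
      using K[of "v l" "u k"] uv[OF that(1)] uv[OF that(2)] that(3,4) by force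
    then have *: "max (u i) (u j) < min (v i) (v j)" using ij y by auto
    then obtain z where "max (u i) (u j) < z" "z < min (v i) (v j)" using dense by blast
    then have "z \<in> {u i<..<v i} \<inter> {u j<..<v j}" by auto
    then show False using dis ij unfolding disjoint_family_on_def by blast
  qed
  show "K c \<le> K d" using K cd by simp
qed

text \<open>Truncation of the norm of g at height n: the excess over n has integral below e / 2 for
  large n, and what remains contributes at most n times the total length.\<close>

lemma ac_on_integral:
  fixes g :: "real \<Rightarrow> 'b::euclidean_space"
  assumes g: "integrable (lebesgue_on {a..b}) g"
  shows "ac_on a b (\<lambda>t. integral {a..t} g)"
  unfolding ac_on_iff_oscillation_bound
proof (intro allI impI)
  fix e :: real assume e: "e > 0"
  let ?L = "lebesgue_on {a..b}"
  define h where "h x = norm (g x)" for x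
  define k where "k n x = h x - min (h x) (real n)" for n x
  have h: "integrable ?L h" unfolding h_def using g by simp
  have [measurable]: "h \<in> borel_measurable ?L" using h by auto
  have "(\<lambda>n. LINT x|?L. k n x) \<longlonglongrightarrow> (LINT x|?L. 0)"
  proof (rule integral_dominated_convergence[OF _ _ h])
    show "AE x in ?L. (\<lambda>n. k n x) \<longlonglongrightarrow> 0"
    proof (rule AE_I2)
      fix x
      obtain m :: nat where "h x < real m" using reals_Archimedean2 by blast
      then have "eventually (\<lambda>n. k n x = 0) sequentially"
        unfolding eventually_sequentially k_def by (intro exI[of _ m]) auto
      then show "(\<lambda>n. k n x) \<longlonglongrightarrow> 0" by (rule tendsto_eventually)
    qed
    show "AE x in ?L. norm (k n x) \<le> h x" for n
      by (rule AE_I2) (auto simp: k_def h_def)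
  qed (auto simp: k_def)
  then have "eventually (\<lambda>n. (LINT x|?L. k n x) < e / 2) sequentially"
    using e by (intro order_tendstoD) auto
  then obtain n where n: "(LINT x|?L. k n x) < e / 2"
    by (meson eventually_happens trivial_limit_sequentially)
  have ki: "integrable ?L (k n)"
  proof (rule Bochner_Integration.integrable_bound[OF h])
    show "k n \<in> borel_measurable ?L" unfolding k_def[abs_def] by measurable
  qed (auto simp: k_def h_def)
  define K where "K t = integral {a..t} (k n)" for t
  \<comment> \<open>Makes n d at most e / 2; n + 1 keeps the divisor positive.\<close>
  define d where "d = e / (2 * (real n + 1))"
  have d: "d > 0" using e by (simp add: d_def)
  have on: "F integrable_on {x..y}" if "integrable ?L F" "a \<le> x" "y \<le> b" for F :: "real \<Rightarrow> 'c::euclidean_space" and x y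
    using integrable_subinterval[OF that(1), of x y] that by (cases "x \<le> y") (auto simp: integrable_on_lebesgue_on)
  have comb: "integral {a..y} F - integral {a..x} F = integral {x..y} F"
    if "integrable ?L F" "a \<le> x" "x \<le> y" "y \<le> b" for F :: "real \<Rightarrow> 'c::euclidean_space" and x y
    using Henstock_Kurzweil_Integration.integral_combine[of a x y F] on[OF that(1), of a y] that by (simp add: algebra_simps)
  have monoK: "K x \<le> K y" if "a \<le> x" "x \<le> y" "y \<le> b" for x y
    using comb[OF ki that] Henstock_Kurzweil_Integration.integral_nonneg[OF on[OF ki that(1,3)]]
    by (auto simp: K_def k_def)
  have piece: "norm (integral {a..y} g - integral {a..x} g) \<le> K y - K x + real n * (y - x)"
    if xy: "a \<le> x" "x \<le> y" "y \<le> b" for x y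
  proof -
    have "norm (integral {x..y} g) \<le> integral {x..y} (\<lambda>z. k n z + real n)"
    proof (rule integral_norm_bound_integral)
      show "(\<lambda>z. k n z + real n) integrable_on {x..y}"
        by (intro Henstock_Kurzweil_Integration.integrable_add on[OF ki]) (use xy in auto)
    qed (use on[OF g] xy in \<open>auto simp: k_def h_def\<close>)
    also have "\<dots> = integral {x..y} (k n) + integral {x..y} (\<lambda>z. real n)"
      by (rule Henstock_Kurzweil_Integration.integral_add) (use on[OF ki] xy in auto)
    finally show ?thesis using comb[OF g xy] comb[OF ki xy] xy by (simp add: K_def mult.commute)
  qed
  have "oscillation_bound a b (\<lambda>t. integral {a..t} g) e d"
    unfolding oscillation_bound_def
  proof (intro allI impI)
    fix N :: nat and u v
    assume H: "(\<forall>i<N. a \<le> u i \<and> u i \<le> v i \<and> v i \<le> b) \<and>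
       disjoint_family_on (\<lambda>i. {u i<..<v i}) {..<N} \<and> (\<Sum>i<N. v i - u i) < d"
    show "(\<Sum>i<N. norm (integral {a..v i} g - integral {a..u i} g)) < e"
    proof (cases "a \<le> b")
      case True
      have "(\<Sum>i<N. norm (integral {a..v i} g - integral {a..u i} g)) \<le> (\<Sum>i<N. K (v i) - K (u i) + real n * (v i - u i))"
        by (rule sum_mono, rule piece) (use H in auto)
      also have "\<dots> = (\<Sum>i<N. K (v i) - K (u i)) + n * (\<Sum>i<N. v i - u i)"
        by (simp add: sum.distrib sum_distrib_left)
      also have "\<dots> \<le> (K b - K a) + n * d"
        by (intro add_mono mult_left_mono sum_disjoint_mono_increments_le) (use H True monoK in auto)
      also have "K b - K a = (LINT x|?L. k n x)"
        unfolding K_def using lebesgue_integral_eq_integral[OF ki] by simp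
      also have "(LINT x|?L. k n x) + n * d < e / 2 + e / 2"
        using n e by (intro add_less_le_mono) (auto simp: d_def field_simps)
      finally show ?thesis by simp
    next
      case False
      then have "N = 0" using H by (metis order_trans not_gr0)
      then show ?thesis using e by simp
    qed
  qed
  then show "\<exists>d>0. oscillation_bound a b (\<lambda>t. integral {a..t} g) e d" using d by blast
qed


text \<open>Serves derivatives computed pointwise, as for products and exponentials: g agrees almost
  everywhere with the density of f, and its integrability is a conclusion.\<close>

lemma ac_on_derivative_AE:
  fixes f :: "real \<Rightarrow> complex"
  assumes ac: "ac_on a b f" and ab: "a < b"
    and der: "AE t in lebesgue_on {a..b}. (f has_vector_derivative g t) (at t within {a..b})"
  shows "integrable (lebesgue_on {a..b}) g" "\<And>t. t \<in> {a..b} \<Longrightarrow> f t = f a + integral {a..t} g"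
proof -
  obtain h where h: "integrable (lebesgue_on {a..b}) h" "\<And>x. x \<in> {a..b} \<Longrightarrow> f x = f a + integral {a..x} h"
    using ac_density[OF ac] ab by auto
  have hd: "AE t in lebesgue_on {a..b}. (f has_vector_derivative h t) (at t within {a..b})"
    using ac_density_derivative_AE[OF h] by simp
  have eq: "AE t in lebesgue_on {a..b}. g t = h t"
    using der hd AE_space
  proof eventually_elim
    fix t assume "(f has_vector_derivative g t) (at t within {a..b})"
      "(f has_vector_derivative h t) (at t within {a..b})" "t \<in> space (lebesgue_on {a..b})"
    then show "g t = h t"
      using vector_derivative_unique_within_closed_interval[OF ab, of t f "g t" "h t"] by simp
  qed
  show g: "integrable (lebesgue_on {a..b}) g"
    by (rule integrable_lebesgue_on_AE_cong[OF h(1) _ eq]) simp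
  show "f t = f a + integral {a..t} g" if t: "t \<in> {a..b}" for t
    using h(2)[OF t] integral_AE_cong[OF eq t] by simp
qed

section \<open>Lebesgue spaces\<close>

text \<open>\<open>powr_convex\<close> treats positive arguments. If one argument is 0, the claim
  reduces to (c z)^p \<le> c z^p for 0 < c < 1.\<close>

lemma powr_convex_nonneg:
  assumes p: "1 \<le> p"
  shows "convex_on {0..} (\<lambda>x::real. x powr p)"
proof (rule convex_onI)
  fix t x y :: real
  assume t: "0 < t" "t < 1" and xy: "x \<in> {0..}" "y \<in> {0..}"
  have shrink: "(c * z) powr p \<le> c * z powr p" if "0 < c" "c < 1" "0 \<le> z" for c z
  proof -
    have "c powr p \<le> c powr 1" using that p by (intro powr_mono') auto
    then have "c powr p * z powr p \<le> c * z powr p" using that by (intro mult_right_mono) auto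
    then show ?thesis using that by (simp add: powr_mult)
  qed
  show "((1 - t) *\<^sub>R x + t *\<^sub>R y) powr p \<le> (1 - t) * x powr p + t * y powr p"
  proof (cases "x = 0 \<or> y = 0")
    case True
    then show ?thesis using shrink[of t y] shrink[of "1 - t" x] t xy by auto
  next
    case False
    then show ?thesis using convex_onD[OF powr_convex[OF p], of t x y] t xy by auto
  qed
qed auto

text \<open>Positive total mass makes the essential supremum of a constant equal to that constant,
  and hence that of a norm nonnegative.\<close>

locale Lp_on = finite_measure M for M :: "'a measure" +
  fixes p :: ennreal
  assumes p_ge_1: "1 \<le> p" and nontrivial: "emeasure M (space M) \<noteq> 0"
begin

abbreviation "exponent \<equiv> enn2real p"

lemma exponent_ge_1: "p \<noteq> \<infinity> \<Longrightarrow> 1 \<le> exponent"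
  using p_ge_1 enn2real_mono[of 1 p] by (simp add: less_top)

text \<open>This and its finite counterpart replace norm bounds by a pointwise or an integral
  inequality. Estimates thereby avoid extended reals and p-th roots, and yield membership together
  with the bound.\<close>

lemma Lp_norm_le_iff_infinite:
  assumes p: "p = \<infinity>" and c: "0 \<le> c"
  shows "in_Lp p M f \<and> Lp_norm p M f \<le> c \<longleftrightarrow> f \<in> borel_measurable M \<and> (AE x in M. norm (f x) \<le> c)"
proof (cases "f \<in> borel_measurable M")
  case True
  let ?e = "esssup M (\<lambda>x. ereal (norm (f x)))"
  have [measurable]: "(\<lambda>x. ereal (norm (f x))) \<in> borel_measurable M" using True by simp
  have nonneg: "0 \<le> ?e"
  proof -
    have "esssup M (\<lambda>x. 0 :: ereal) \<le> ?e" by (rule esssup_mono) auto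
    then show ?thesis by (simp add: esssup_const[OF nontrivial])
  qed
  have le_iff: "?e \<le> ereal c \<longleftrightarrow> (AE x in M. norm (f x) \<le> c)"
  proof
    assume le: "?e \<le> ereal c"
    have "AE x in M. ereal (norm (f x)) \<le> ?e" by (rule esssup_AE)
    then show "AE x in M. norm (f x) \<le> c"
      by eventually_elim (use le in \<open>metis ereal_less_eq(3) order_trans\<close>)
  next
    assume "AE x in M. norm (f x) \<le> c"
    then show "?e \<le> ereal c" by (intro esssup_I) auto
  qed
  have "in_Lp p M f \<and> Lp_norm p M f \<le> c \<longleftrightarrow> ?e \<le> ereal c"
    using nonneg True unfolding in_Lp_def Lp_norm_def p by (cases ?e) auto
  then show ?thesis using le_iff True by simp
next
  case False then show ?thesis by (simp add: in_Lp_def)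
qed

lemma Lp_norm_le_iff_finite:
  assumes p: "p \<noteq> \<infinity>" and c: "0 \<le> c"
  shows "in_Lp p M f \<and> Lp_norm p M f \<le> c \<longleftrightarrow>
    f \<in> borel_measurable M \<and> integrable M (\<lambda>x. norm (f x) powr exponent) \<and>
      (LINT x|M. norm (f x) powr exponent) \<le> c powr exponent"
proof -
  let ?I = "LINT x|M. norm (f x) powr exponent"
  have I: "0 \<le> ?I" by (rule integral_nonneg_AE) auto
  have e: "1 \<le> exponent" using exponent_ge_1[OF p] .
  have "?I powr (1 / exponent) \<le> c \<longleftrightarrow> ?I \<le> c powr exponent"
  proof
    assume "?I powr (1 / exponent) \<le> c"
    then have "(?I powr (1 / exponent)) powr exponent \<le> c powr exponent"
      using e by (intro powr_mono2) auto
    then show "?I \<le> c powr exponent" using e I by (simp add: powr_powr)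
  next
    assume "?I \<le> c powr exponent"
    then have "?I powr (1 / exponent) \<le> (c powr exponent) powr (1 / exponent)"
      using e I by (intro powr_mono2) auto
    then show "?I powr (1 / exponent) \<le> c" using e c by (simp add: powr_powr)
  qed
  then show ?thesis using p by (auto simp: in_Lp_def Lp_norm_def)
qed

section \<open>Comparison, Minkowski's inequality and completeness in L_p\<close>

lemma in_Lp_measurable: "in_Lp p M f \<Longrightarrow> f \<in> borel_measurable M"
  by (simp add: in_Lp_def)

lemma Lp_norm_nonneg: "in_Lp p M f \<Longrightarrow> 0 \<le> Lp_norm p M f"
proof (cases "p = \<infinity>")
  case True
  assume f: "in_Lp p M f"
  have "0 \<le> esssup M (\<lambda>x. ereal (norm (f x)))"
  proof -
    have "esssup M (\<lambda>x. 0 :: ereal) \<le> esssup M (\<lambda>x. ereal (norm (f x)))" by (rule esssup_mono) auto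
    then show ?thesis by (simp add: esssup_const[OF nontrivial])
  qed
  then show ?thesis using True by (simp add: Lp_norm_def real_of_ereal_pos)
qed (simp add: Lp_norm_def)

lemma Lp_mono:
  assumes g: "in_Lp p M g" and f: "f \<in> borel_measurable M" and c: "0 \<le> c"
    and le: "AE x in M. norm (f x) \<le> c * norm (g x)"
  shows "in_Lp p M f" "Lp_norm p M f \<le> c * Lp_norm p M g"
proof -
  let ?n = "Lp_norm p M g"
  have n: "0 \<le> ?n" using Lp_norm_nonneg[OF g] .
  have "in_Lp p M f \<and> Lp_norm p M f \<le> c * ?n"
  proof (cases "p = \<infinity>")
    case True
    have "AE x in M. norm (g x) \<le> ?n" using Lp_norm_le_iff_infinite[OF True n, of g] g by simp
    with le have "AE x in M. norm (f x) \<le> c * ?n"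
      by eventually_elim (use c in \<open>meson mult_left_mono order_trans\<close>)
    then show ?thesis using f c n by (subst Lp_norm_le_iff_infinite[OF True]) auto
  next
    case False
    have e: "1 \<le> exponent" using exponent_ge_1[OF False] .
    have gi: "integrable M (\<lambda>x. norm (g x) powr exponent)"
      and gl: "(LINT x|M. norm (g x) powr exponent) \<le> ?n powr exponent"
      using Lp_norm_le_iff_finite[OF False n, of g] g by auto
    have *: "AE x in M. norm (f x) powr exponent \<le> c powr exponent * norm (g x) powr exponent"
      using le
    proof eventually_elim
      fix x assume "norm (f x) \<le> c * norm (g x)"
      then have "norm (f x) powr exponent \<le> (c * norm (g x)) powr exponent"
        using e by (intro powr_mono2) auto
      then show "norm (f x) powr exponent \<le> c powr exponent * norm (g x) powr exponent"
        using c by (simp add: powr_mult)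
    qed
    have gi': "integrable M (\<lambda>x. c powr exponent * norm (g x) powr exponent)" using gi by simp
    have fi: "integrable M (\<lambda>x. norm (f x) powr exponent)"
      by (rule Bochner_Integration.integrable_bound[OF gi'])
         (use f * in \<open>auto simp: abs_mult\<close>)
    have "(LINT x|M. norm (f x) powr exponent) \<le> (LINT x|M. c powr exponent * norm (g x) powr exponent)"
      by (rule integral_mono_AE[OF fi gi' *])
    also have "\<dots> \<le> c powr exponent * ?n powr exponent" using gl by (simp add: mult_left_mono)
    also have "\<dots> = (c * ?n) powr exponent" using c n by (simp add: powr_mult)
    finally show ?thesis using f c n fi by (subst Lp_norm_le_iff_finite[OF False]) auto
  qed
  then show "in_Lp p M f" "Lp_norm p M f \<le> c * ?n" by auto
qed

lemma Lp_cong: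
  assumes f: "in_Lp p M f" and g: "g \<in> borel_measurable M" and eq: "AE x in M. g x = f x"
  shows "in_Lp p M g" "Lp_norm p M g = Lp_norm p M f"
proof -
  show g': "in_Lp p M g" by (rule Lp_mono(1)[OF f g, of 1]) (use eq in auto)
  show "Lp_norm p M g = Lp_norm p M f"
  proof (rule antisym)
    have "AE x in M. norm (g x) \<le> 1 * norm (f x)" using eq by eventually_elim simp
    then show "Lp_norm p M g \<le> Lp_norm p M f" using Lp_mono(2)[OF f g, of 1] by auto
    have "AE x in M. norm (f x) \<le> 1 * norm (g x)" using eq by eventually_elim simp
    then show "Lp_norm p M f \<le> Lp_norm p M g"
      using Lp_mono(2)[OF g' in_Lp_measurable[OF f], of 1] by auto
  qed
qed

text \<open>Convexity of t^p is applied to |f| / A and |g| / B with weights A / (A + B) and B / (A +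
  B). The bounds A and B are strictly positive, so that vanishing norms need no separate
  case.\<close>

lemma Lp_minkowski_pos:
  assumes f: "in_Lp p M f" and g: "in_Lp p M g"
    and A: "Lp_norm p M f \<le> A" "0 < A" and B: "Lp_norm p M g \<le> B" "0 < B"
  shows "in_Lp p M (\<lambda>x. f x + g x) \<and> Lp_norm p M (\<lambda>x. f x + g x) \<le> A + B"
proof (cases "p = \<infinity>")
  case True
  have "AE x in M. norm (f x) \<le> A" "AE x in M. norm (g x) \<le> B"
    using Lp_norm_le_iff_infinite[OF True, of A f] Lp_norm_le_iff_infinite[OF True, of B g] assms by auto
  then have "AE x in M. norm (f x + g x) \<le> A + B"
    by eventually_elim (meson add_mono norm_triangle_le)
  then show ?thesis
    using in_Lp_measurable[OF f] in_Lp_measurable[OF g] A B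
    by (subst Lp_norm_le_iff_infinite[OF True]) auto
next
  case False
  have e: "1 \<le> exponent" using exponent_ge_1[OF False] .
  have [measurable]: "f \<in> borel_measurable M" "g \<in> borel_measurable M"
    using f g by (auto simp: in_Lp_def)
  have fi: "integrable M (\<lambda>x. norm (f x) powr exponent)"
    and fl: "(LINT x|M. norm (f x) powr exponent) \<le> A powr exponent"
    using Lp_norm_le_iff_finite[OF False, of A f] f A by auto
  have gi: "integrable M (\<lambda>x. norm (g x) powr exponent)"
    and gl: "(LINT x|M. norm (g x) powr exponent) \<le> B powr exponent"
    using Lp_norm_le_iff_finite[OF False, of B g] g B by auto
  \<comment> \<open>The weights are scaled so that \<alpha> A^p + \<beta> B^p = 1; the integral of
    the pointwise bound is then at most C.\<close>
  define C where "C = (A + B) powr exponent"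
  define \<alpha> where "\<alpha> = A / (A + B) / A powr exponent"
  define \<beta> where "\<beta> = B / (A + B) / B powr exponent"
  have pos: "0 \<le> \<alpha>" "0 \<le> \<beta>" "0 \<le> C" using A B by (auto simp: \<alpha>_def \<beta>_def C_def)
  have conv: "convex_on {0..} (\<lambda>x. x powr exponent)"
    using e by (rule powr_convex_nonneg)
  have pt: "norm (f x + g x) powr exponent \<le> C * (\<alpha> * norm (f x) powr exponent + \<beta> * norm (g x) powr exponent)" for x
  proof -
    define l where "l = B / (A + B)"
    have l: "0 \<le> l" "l \<le> 1" "1 - l = A / (A + B)" using A B by (auto simp: l_def field_simps)
    have "norm (f x + g x) powr exponent \<le> (norm (f x) + norm (g x)) powr exponent"
      using e by (intro powr_mono2) (auto simp: norm_triangle_ineq)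
    also have "norm (f x) + norm (g x) = (A + B) * ((1 - l) * (norm (f x) / A) + l * (norm (g x) / B))"
      using A B unfolding l(3) by (simp add: l_def flip: add_divide_distrib)
    also have "\<dots> powr exponent = C * ((1 - l) * (norm (f x) / A) + l * (norm (g x) / B)) powr exponent"
      using A B l unfolding C_def by (simp add: powr_mult)
    also have "((1 - l) * (norm (f x) / A) + l * (norm (g x) / B)) powr exponent
        \<le> (1 - l) * (norm (f x) / A) powr exponent + l * (norm (g x) / B) powr exponent"
      using convex_onD[OF conv, of l "norm (f x) / A" "norm (g x) / B"] l A B by auto
    also have "\<dots> = \<alpha> * norm (f x) powr exponent + \<beta> * norm (g x) powr exponent"
      using A B unfolding l(3) by (simp add: l_def \<alpha>_def \<beta>_def powr_divide)
    finally show ?thesis using pos by (simp add: mult_left_mono)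
  qed
  have bi: "integrable M (\<lambda>x. C * (\<alpha> * norm (f x) powr exponent + \<beta> * norm (g x) powr exponent))"
    using fi gi by auto
  have si: "integrable M (\<lambda>x. norm (f x + g x) powr exponent)"
    by (rule Bochner_Integration.integrable_bound[OF bi]) (use pt pos in \<open>auto intro!: AE_I2 simp: abs_of_nonneg\<close>)
  have "(LINT x|M. norm (f x + g x) powr exponent)
      \<le> (LINT x|M. C * (\<alpha> * norm (f x) powr exponent + \<beta> * norm (g x) powr exponent))"
    by (rule integral_mono[OF si bi]) (rule pt)
  also have "\<dots> = C * (\<alpha> * (LINT x|M. norm (f x) powr exponent) + \<beta> * (LINT x|M. norm (g x) powr exponent))"
    using fi gi by simp
  also have "\<dots> \<le> C * (\<alpha> * A powr exponent + \<beta> * B powr exponent)"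
    using fl gl pos by (intro mult_left_mono add_mono) auto
  also have "\<alpha> * A powr exponent + \<beta> * B powr exponent = 1"
    using A B by (simp add: \<alpha>_def \<beta>_def flip: add_divide_distrib)
  finally show ?thesis
    using A B si by (subst Lp_norm_le_iff_finite[OF False]) (auto simp: C_def)
qed

lemma Lp_add:
  assumes f: "in_Lp p M f" and g: "in_Lp p M g"
  shows "in_Lp p M (\<lambda>x. f x + g x)" "Lp_norm p M (\<lambda>x. f x + g x) \<le> Lp_norm p M f + Lp_norm p M g"
proof -
  have *: "in_Lp p M (\<lambda>x. f x + g x) \<and> Lp_norm p M (\<lambda>x. f x + g x) \<le> (Lp_norm p M f + e) + (Lp_norm p M g + e)"
    if "e > 0" for e
    using Lp_norm_nonneg[OF f] Lp_norm_nonneg[OF g] that by (intro Lp_minkowski_pos[OF f g]) auto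
  show "in_Lp p M (\<lambda>x. f x + g x)" using *[of 1] by simp
  show "Lp_norm p M (\<lambda>x. f x + g x) \<le> Lp_norm p M f + Lp_norm p M g"
  proof (rule field_le_epsilon)
    fix e :: real assume "e > 0"
    then show "Lp_norm p M (\<lambda>x. f x + g x) \<le> Lp_norm p M f + Lp_norm p M g + e"
      using *[of "e/2"] by simp
  qed
qed

lemma in_Lp_const: "in_Lp p M (\<lambda>x. c)"
  unfolding in_Lp_def by (auto simp: esssup_const[OF nontrivial])

lemma Lp_bounded:
  assumes f: "f \<in> borel_measurable M" and c: "0 \<le> c" and le: "AE x in M. norm (f x) \<le> c"
  shows "in_Lp p M f" "Lp_norm p M f \<le> c * Lp_norm p M (\<lambda>x. 1)"
  using Lp_mono[OF in_Lp_const f c, of 1] le by auto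

lemma Lp_norm_zero: "Lp_norm p M (\<lambda>x. 0) = 0"
  using Lp_bounded(2)[of "\<lambda>x. 0" 0] Lp_norm_nonneg[OF in_Lp_const[of 0]] by simp

lemma Lp_cmult:
  assumes f: "in_Lp p M f"
  shows "in_Lp p M (\<lambda>x. c * f x)" "Lp_norm p M (\<lambda>x. c * f x) \<le> norm c * Lp_norm p M f"
  using Lp_mono[OF f, of "\<lambda>x. c * f x" "norm c"] in_Lp_measurable[OF f] by (auto simp: norm_mult)

lemma Lp_sum:
  assumes "\<And>i. i \<in> J \<Longrightarrow> in_Lp p M (f i)"
  shows "in_Lp p M (\<lambda>x. \<Sum>i\<in>J. f i x)" "Lp_norm p M (\<lambda>x. \<Sum>i\<in>J. f i x) \<le> (\<Sum>i\<in>J. Lp_norm p M (f i))"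
proof -
  have "in_Lp p M (\<lambda>x. \<Sum>i\<in>J. f i x) \<and> Lp_norm p M (\<lambda>x. \<Sum>i\<in>J. f i x) \<le> (\<Sum>i\<in>J. Lp_norm p M (f i))"
    using assms
  proof (induction J rule: infinite_finite_induct)
    case (insert i J)
    then show ?case using Lp_add[of "f i" "\<lambda>x. \<Sum>i\<in>J. f i x"] by auto
  qed (auto simp: in_Lp_const Lp_norm_zero)
  then show "in_Lp p M (\<lambda>x. \<Sum>i\<in>J. f i x)" "Lp_norm p M (\<lambda>x. \<Sum>i\<in>J. f i x) \<le> (\<Sum>i\<in>J. Lp_norm p M (f i))"
    by auto
qed

text \<open>One constant for all p: the total mass suffices for p = infinity, and for finite p the
  inequality t \<le> 1 + t^p is integrated with t = |f| / A.\<close>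

definition "L1_const = 1 + measure M (space M)"

lemma L1_const_pos: "0 < L1_const"
  unfolding L1_const_def by (simp add: add_pos_nonneg)

lemma Lp_imp_L1:
  assumes f: "in_Lp p M f"
  shows "integrable M f" "(LINT x|M. norm (f x)) \<le> L1_const * Lp_norm p M f"
proof -
  have [measurable]: "f \<in> borel_measurable M" using f by (simp add: in_Lp_def)
  have *: "integrable M (\<lambda>x. norm (f x)) \<and> (LINT x|M. norm (f x)) \<le> L1_const * A"
    if A: "Lp_norm p M f \<le> A" "0 < A" for A
  proof (cases "p = \<infinity>")
    case True
    have le: "AE x in M. norm (f x) \<le> A"
      using Lp_norm_le_iff_infinite[OF True, of A f] f A by auto
    have i: "integrable M (\<lambda>x. norm (f x))"
      by (rule integrable_const_bound[of _ A]) (use le in auto)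
    have "(LINT x|M. norm (f x)) \<le> (LINT x|M. A)"
      by (rule integral_mono_AE[OF i _ le]) auto
    also have "\<dots> \<le> L1_const * A" using A by (simp add: L1_const_def algebra_simps)
    finally show ?thesis using i by simp
  next
    case False
    have e: "1 \<le> exponent" using exponent_ge_1[OF False] .
    have fi: "integrable M (\<lambda>x. norm (f x) powr exponent)"
      and fl: "(LINT x|M. norm (f x) powr exponent) \<le> A powr exponent"
      using Lp_norm_le_iff_finite[OF False, of A f] f A by auto
    have pt: "norm (f x) \<le> A * (1 + norm (f x) powr exponent / A powr exponent)" for x
    proof -
      define t where "t = norm (f x) / A"
      have t: "0 \<le> t" using A by (simp add: t_def)
      have "t \<le> 1 + t powr exponent"
      proof (cases "t \<le> 1")
        case True then show ?thesis by (simp add: add_increasing2)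
      next
        case False
        then have "t powr 1 \<le> t powr exponent" using e by (intro powr_mono) auto
        then show ?thesis using False by simp
      qed
      then have "A * t \<le> A * (1 + t powr exponent)" using A by simp
      then show ?thesis using A by (simp add: t_def powr_divide)
    qed
    have bi: "integrable M (\<lambda>x. A * (1 + norm (f x) powr exponent / A powr exponent))"
      using fi by auto
    have i: "integrable M (\<lambda>x. norm (f x))"
      by (rule Bochner_Integration.integrable_bound[OF bi]) (use pt A in \<open>auto intro!: AE_I2 simp: abs_of_nonneg\<close>)
    have "(LINT x|M. norm (f x)) \<le> (LINT x|M. A * (1 + norm (f x) powr exponent / A powr exponent))"
      by (rule integral_mono[OF i bi]) (rule pt)
    also have "\<dots> = A * (measure M (space M) + (LINT x|M. norm (f x) powr exponent) / A powr exponent)"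
      using fi by simp
    also have "\<dots> \<le> A * (measure M (space M) + 1)"
      using fl A by (intro mult_left_mono add_mono) auto
    finally show ?thesis using i by (simp add: L1_const_def algebra_simps)
  qed
  have "integrable M (\<lambda>x. norm (f x))"
    using *[of "Lp_norm p M f + 1"] Lp_norm_nonneg[OF f] by auto
  then show "integrable M f" by (simp add: integrable_norm_iff)
  show "(LINT x|M. norm (f x)) \<le> L1_const * Lp_norm p M f"
  proof (rule field_le_epsilon)
    fix e :: real assume e: "e > 0"
    have "(LINT x|M. norm (f x)) \<le> L1_const * (Lp_norm p M f + e / L1_const)"
      using * Lp_norm_nonneg[OF f] L1_const_pos e by (meson add_nonneg_pos divide_pos_pos less_add_same_cancel1 less_imp_le)
    also have "\<dots> = L1_const * Lp_norm p M f + e" using L1_const_pos by (simp add: field_simps)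
    finally show "(LINT x|M. norm (f x)) \<le> L1_const * Lp_norm p M f + e" .
  qed
qed

text \<open>Riesz-Fischer with an explicit rate. The embedding in L_1 gives absolute convergence
  almost everywhere; the bounds on partial sums pass to the limit pointwise for p = infinity and by
  Fatou's lemma otherwise.\<close>

lemma Lp_series:
  assumes g: "\<And>k. in_Lp p M (g k)" and le: "\<And>k. Lp_norm p M (g k) \<le> \<epsilon> k" and sm: "summable \<epsilon>"
  obtains G where "in_Lp p M G" "\<And>n. Lp_norm p M (\<lambda>x. G x - (\<Sum>k<n. g k x)) \<le> (\<Sum>k. \<epsilon> (k + n))"
proof -
  have [measurable]: "g k \<in> borel_measurable M" for k using g by (simp add: in_Lp_def)
  have eps0: "0 \<le> \<epsilon> k" for k using Lp_norm_nonneg[OF g] le order_trans by blast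
  have AEs: "AE x in M. summable (\<lambda>k. norm (g k x))"
  proof -
    have "(\<integral>\<^sup>+x. (\<Sum>k. ennreal (norm (g k x))) \<partial>M) = (\<Sum>k. \<integral>\<^sup>+x. ennreal (norm (g k x)) \<partial>M)"
      by (rule nn_integral_suminf) auto
    also have "\<dots> \<le> (\<Sum>k. ennreal (L1_const * \<epsilon> k))"
    proof (rule suminf_le)
      fix k
      have "(\<integral>\<^sup>+x. ennreal (norm (g k x)) \<partial>M) = ennreal (LINT x|M. norm (g k x))"
        using Lp_imp_L1(1)[OF g] by (intro nn_integral_eq_integral) auto
      also have "\<dots> \<le> ennreal (L1_const * \<epsilon> k)"
        using Lp_imp_L1(2)[OF g, of k] le[of k] L1_const_pos
        by (intro ennreal_leI) (meson less_imp_le mult_left_mono order_trans)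
      finally show "(\<integral>\<^sup>+x. ennreal (norm (g k x)) \<partial>M) \<le> ennreal (L1_const * \<epsilon> k)" .
    qed auto
    also have "\<dots> = ennreal (\<Sum>k. L1_const * \<epsilon> k)"
      using sm eps0 L1_const_pos by (intro suminf_ennreal_eq summable_sums summable_mult) (auto simp: less_imp_le)
    also have "\<dots> < \<infinity>" by simp
    finally have "(\<integral>\<^sup>+x. (\<Sum>k. ennreal (norm (g k x))) \<partial>M) \<noteq> \<infinity>" by simp
    then have "AE x in M. (\<Sum>k. ennreal (norm (g k x))) \<noteq> \<infinity>"
      by (intro nn_integral_PInf_AE) auto
    then show ?thesis
      by eventually_elim (rule summable_suminf_not_top, auto)
  qed
  define G where "G x = (\<Sum>k. g k x)" for x
  have [measurable]: "G \<in> borel_measurable M" unfolding G_def by measurable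
  define s where "s n x = (\<Sum>k<n. g k x)" for n x
  have [measurable]: "s n \<in> borel_measurable M" for n unfolding s_def[abs_def] by measurable
  have lim: "AE x in M. (\<lambda>m. s m x) \<longlonglongrightarrow> G x"
    using AEs unfolding s_def G_def
    by eventually_elim (rule summable_LIMSEQ, rule summable_norm_cancel)
  have tail: "in_Lp p M (\<lambda>x. s m x - s n x) \<and> Lp_norm p M (\<lambda>x. s m x - s n x) \<le> (\<Sum>k. \<epsilon> (k + n))" if "n \<le> m" for m n
  proof -
    have eq: "s m x - s n x = (\<Sum>k\<in>{n..<m}. g k x)" for x
      unfolding s_def using that by (simp add: lessThan_atLeast0 sum_diff_nat_ivl)
    have "(\<Sum>k\<in>{n..<m}. Lp_norm p M (g k)) \<le> (\<Sum>k\<in>{n..<m}. \<epsilon> k)" by (rule sum_mono) (rule le)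
    also have "\<dots> = (\<Sum>k<m-n. \<epsilon> (k + n))"
      using that sum.shift_bounds_nat_ivl[of \<epsilon> 0 n "m - n"] by (simp add: lessThan_atLeast0)
    also have "\<dots> \<le> (\<Sum>k. \<epsilon> (k + n))"
      by (rule sum_le_suminf) (use sm eps0 in \<open>auto simp: summable_iff_shift\<close>)
    finally show ?thesis unfolding eq using Lp_sum[of "{n..<m}" g, OF g] by auto
  qed
  have main: "in_Lp p M (\<lambda>x. G x - s n x) \<and> Lp_norm p M (\<lambda>x. G x - s n x) \<le> (\<Sum>k. \<epsilon> (k + n))" for n
  proof -
    let ?T = "\<Sum>k. \<epsilon> (k + n)"
    have T: "0 \<le> ?T" using sm eps0 by (intro suminf_nonneg) (auto simp: summable_iff_shift)
    show ?thesis
    proof (cases "p = \<infinity>")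
      case True
      have "AE x in M. norm (s m x - s n x) \<le> ?T" if "n \<le> m" for m
        using Lp_norm_le_iff_infinite[OF True T, of "\<lambda>x. s m x - s n x"] tail[OF that] by auto
      then have "AE x in M. \<forall>m. n \<le> m \<longrightarrow> norm (s m x - s n x) \<le> ?T"
        by (simp add: AE_all_countable)
      with lim have "AE x in M. norm (G x - s n x) \<le> ?T"
      proof eventually_elim
        fix x assume 1: "(\<lambda>m. s m x) \<longlonglongrightarrow> G x" and 2: "\<forall>m. n \<le> m \<longrightarrow> norm (s m x - s n x) \<le> ?T"
        have "(\<lambda>m. norm (s m x - s n x)) \<longlonglongrightarrow> norm (G x - s n x)"
          by (intro tendsto_intros 1)
        then show "norm (G x - s n x) \<le> ?T"
          by (rule LIMSEQ_le_const2) (use 2 in blast)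
      qed
      then show ?thesis by (subst Lp_norm_le_iff_infinite[OF True T]) auto
    next
      case False
      have e: "1 \<le> exponent" using exponent_ge_1[OF False] .
      have int: "(\<integral>\<^sup>+x. ennreal (norm (s m x - s n x) powr exponent) \<partial>M) \<le> ennreal (?T powr exponent)" if "n \<le> m" for m
      proof -
        have *: "integrable M (\<lambda>x. norm (s m x - s n x) powr exponent)"
          "(LINT x|M. norm (s m x - s n x) powr exponent) \<le> ?T powr exponent"
          using Lp_norm_le_iff_finite[OF False T, of "\<lambda>x. s m x - s n x"] tail[OF that] by auto
        then show ?thesis by (subst nn_integral_eq_integral) (auto intro: ennreal_leI)
      qed
      have "(\<integral>\<^sup>+x. ennreal (norm (G x - s n x) powr exponent) \<partial>M)
          = (\<integral>\<^sup>+x. liminf (\<lambda>m. ennreal (norm (s m x - s n x) powr exponent)) \<partial>M)"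
      proof (rule nn_integral_cong_AE, use lim in eventually_elim)
        fix x assume l: "(\<lambda>m. s m x) \<longlonglongrightarrow> G x"
        have "(\<lambda>m. ennreal (norm (s m x - s n x) powr exponent)) \<longlonglongrightarrow> ennreal (norm (G x - s n x) powr exponent)"
          using e by (intro tendsto_ennrealI tendsto_powr' tendsto_intros l) auto
        then show "ennreal (norm (G x - s n x) powr exponent) = liminf (\<lambda>m. ennreal (norm (s m x - s n x) powr exponent))"
          by (rule lim_imp_Liminf[symmetric, OF trivial_limit_sequentially])
      qed
      also have "\<dots> \<le> liminf (\<lambda>m. \<integral>\<^sup>+x. ennreal (norm (s m x - s n x) powr exponent) \<partial>M)"
        by (rule nn_integral_liminf) auto
      also have "\<dots> \<le> ennreal (?T powr exponent)"
      proof (rule Liminf_le)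
        show "eventually (\<lambda>m. (\<integral>\<^sup>+x. ennreal (norm (s m x - s n x) powr exponent) \<partial>M) \<le> ennreal (?T powr exponent)) sequentially"
          using int eventually_sequentially by blast
      qed auto
      finally have nn: "(\<integral>\<^sup>+x. ennreal (norm (G x - s n x) powr exponent) \<partial>M) \<le> ennreal (?T powr exponent)" .
      have i: "integrable M (\<lambda>x. norm (G x - s n x) powr exponent)"
        by (rule integrableI_nonneg) (use nn in \<open>auto intro: le_less_trans\<close>)
      have "(LINT x|M. norm (G x - s n x) powr exponent) \<le> ?T powr exponent"
        using nn by (subst (asm) nn_integral_eq_integral[OF i]) auto
      then show ?thesis using i by (subst Lp_norm_le_iff_finite[OF False T]) auto
    qed
  qed
  have "in_Lp p M (\<lambda>x. G x - s 0 x)" using main by blast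
  then have "in_Lp p M G" by (simp add: s_def)
  then show thesis by (rule that) (use main in \<open>auto simp: s_def\<close>)
qed

end

section \<open>Sobolev spaces\<close>

lemma nth_deriv_0 [simp]: "nth_deriv a b 0 f = f"
  by (simp add: nth_deriv_def)

lemma nth_deriv_Suc: "nth_deriv a b (Suc k) f t = vector_derivative (nth_deriv a b k f) (at t within {a..b})"
  by (simp add: nth_deriv_def)

text \<open>Peels off the innermost derivative, so that inductions on the order pass from f to its
  first derivative.\<close>

lemma nth_deriv_Suc_shift: "nth_deriv a b (Suc k) f = nth_deriv a b k (nth_deriv a b 1 f)"
  by (simp only: nth_deriv_def One_nat_def funpow_Suc_right o_apply funpow_0)

lemma vector_derivative_within_cong:
  assumes "\<And>x. x \<in> S \<Longrightarrow> f x = g x" "t \<in> S"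
  shows "vector_derivative f (at t within S) = vector_derivative g (at t within S)"
proof -
  have "(f has_vector_derivative d) (at t within S) \<longleftrightarrow> (g has_vector_derivative d) (at t within S)" for d
    using has_vector_derivative_transform[of t S f g d] has_vector_derivative_transform[of t S g f d] assms by metis
  then show ?thesis by (simp add: vector_derivative_def)
qed

lemma nth_deriv_cong:
  assumes "\<And>x. x \<in> {a..b} \<Longrightarrow> f x = g x" "t \<in> {a..b}"
  shows "nth_deriv a b k f t = nth_deriv a b k g t"
  using assms(2)
proof (induction k arbitrary: t)
  case (Suc k)
  then show ?case unfolding nth_deriv_Suc by (intro vector_derivative_within_cong) auto
qed (use assms in auto)

lemma differentiable_on_cong:
  assumes "\<And>x. x \<in> S \<Longrightarrow> f x = g x"
  shows "f differentiable_on S \<longleftrightarrow> g differentiable_on S"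
  unfolding differentiable_on_def differentiable_def
  using has_derivative_transform[of _ S g f] has_derivative_transform[of _ S f g] assms by metis

locale sobolev_interval =
  fixes a b :: real and p :: ennreal
  assumes ab: "a < b" and p: "1 \<le> p"
begin

abbreviation "L \<equiv> lebesgue_on {a..b}"
abbreviation "W n \<equiv> sobolev n p a b"
abbreviation "nrm n \<equiv> sobolev_norm n p a b"
definition "D f = nth_deriv a b 1 f"

lemma nth_deriv_Suc_D: "nth_deriv a b (Suc k) f = nth_deriv a b k (D f)"
  unfolding D_def by (rule nth_deriv_Suc_shift)

sublocale Lp_on L p
proof -
  interpret finite_measure L by (rule finite_measure_lebesgue_on) simp
  show "Lp_on L p"
  proof
    show "emeasure L (space L) \<noteq> 0"
      using ab by (simp add: space_restrict_space emeasure_restrict_space)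
  qed (rule p)
qed

text \<open>Equality of elements of \<open>W\<^sub>p\<^sup>n\<close>.\<close>

definition weq :: "nat \<Rightarrow> (real \<Rightarrow> complex) \<Rightarrow> (real \<Rightarrow> complex) \<Rightarrow> bool" where
  "weq n f g \<longleftrightarrow> (if n = 0 then AE t in L. f t = g t else \<forall>t\<in>{a..b}. f t = g t)"

lemma weqI: "(\<And>t. t \<in> {a..b} \<Longrightarrow> f t = g t) \<Longrightarrow> weq n f g"
  by (auto simp: weq_def intro: AE_I2)

lemma weq_imp_AE: "weq n f g \<Longrightarrow> AE t in L. f t = g t"
  by (cases n) (auto simp: weq_def intro: AE_I2)

lemma weq_sym: "weq n f g \<Longrightarrow> weq n g f"
  by (cases "n = 0") (auto simp: weq_def elim: eventually_mono)

lemma weq_trans: "weq n f g \<Longrightarrow> weq n g h \<Longrightarrow> weq n f h"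
  unfolding weq_def by (cases n) (auto elim: eventually_elim2)

lemma sobolev_0: "f \<in> W 0 \<longleftrightarrow> in_Lp p L f"
  by (simp add: sobolev_def)

lemma nrm_0: "nrm 0 f = Lp_norm p L f"
  by (simp add: sobolev_norm_def)

lemma nrm_Suc: "nrm (Suc n) f = Lp_norm p L f + nrm n (D f)"
  unfolding sobolev_norm_def by (subst sum.atMost_Suc_shift) (simp add: nth_deriv_Suc_D)

lemma in_Lp_cong:
  assumes "weq n f g" shows "in_Lp p L f \<longleftrightarrow> in_Lp p L g" "in_Lp p L f \<Longrightarrow> Lp_norm p L f = Lp_norm p L g"
proof -
  have *: "in_Lp p L g \<and> Lp_norm p L g = Lp_norm p L f" if "in_Lp p L f" "AE t in L. g t = f t" for f g
    using Lp_cong[OF that(1) borel_measurable_lebesgue_on_AE_cong[OF in_Lp_measurable[OF that(1)] _ that(2)]] that(2) by auto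
  show "in_Lp p L f \<longleftrightarrow> in_Lp p L g" "in_Lp p L f \<Longrightarrow> Lp_norm p L f = Lp_norm p L g"
    using *[of f g] *[of g f] weq_imp_AE[OF assms] weq_imp_AE[OF weq_sym[OF assms]] by auto
qed

text \<open>Almost everywhere equality says nothing about derivatives, which excludes n = 0 with k >
  0. For n > 0 the functions agree on all of [a, b], so the truncated subtraction n - k does no
  harm.\<close>

lemma nth_deriv_weq:
  assumes "weq n f g" "0 < n \<or> k = 0" shows "weq (n - k) (nth_deriv a b k f) (nth_deriv a b k g)"
proof (cases "n = 0")
  case False
  then show ?thesis using assms(1) by (intro weqI nth_deriv_cong) (auto simp: weq_def)
qed (use assms in auto)

lemma sobolev_weq:
  assumes "weq n f g" shows "f \<in> W n \<longleftrightarrow> g \<in> W n"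
proof (cases n)
  case 0
  then show ?thesis using in_Lp_cong[OF assms] by (simp add: sobolev_0)
next
  case (Suc m)
  then have eq: "t \<in> {a..b} \<Longrightarrow> f t = g t" for t using assms by (auto simp: weq_def)
  have *: "t \<in> {a..b} \<Longrightarrow> nth_deriv a b k f t = nth_deriv a b k g t" for k t
    by (rule nth_deriv_cong[OF eq])
  have 1: "nth_deriv a b k f differentiable_on {a..b} \<longleftrightarrow> nth_deriv a b k g differentiable_on {a..b}" for k
    using differentiable_on_cong[of "{a..b}" "nth_deriv a b k f" "nth_deriv a b k g"] * by blast
  have 2: "continuous_on {a..b} (nth_deriv a b k f) \<longleftrightarrow> continuous_on {a..b} (nth_deriv a b k g)" for k
    by (rule continuous_on_cong) (auto simp: *)
  have "ac_on a b (nth_deriv a b k f) \<longleftrightarrow> ac_on a b (nth_deriv a b k g)" for k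
    using ac_on_if_increments[of a b "nth_deriv a b k f" 1 "nth_deriv a b k g"]
      ac_on_if_increments[of a b "nth_deriv a b k g" 1 "nth_deriv a b k f"] * by force
  then have 3: "abs_continuous_on a b (nth_deriv a b k f) \<longleftrightarrow> abs_continuous_on a b (nth_deriv a b k g)" for k
    by (simp add: abs_continuous_on_eq)
  have 4: "in_Lp p L (nth_deriv a b k f) \<longleftrightarrow> in_Lp p L (nth_deriv a b k g)" for k
    by (rule in_Lp_cong(1)[of 0], rule weqI, rule *)
  show ?thesis unfolding sobolev_def by (simp add: 1 2 3 4)
qed

lemma nrm_weq:
  assumes "weq n f g" "f \<in> W n" shows "nrm n f = nrm n g"
proof (cases n)
  case 0
  then show ?thesis using in_Lp_cong(2)[OF assms(1)] assms by (simp add: sobolev_0 nrm_0)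
next
  case (Suc m)
  then have eq: "t \<in> {a..b} \<Longrightarrow> f t = g t" for t using assms by (auto simp: weq_def)
  have "Lp_norm p L (nth_deriv a b k f) = Lp_norm p L (nth_deriv a b k g)" for k
  proof -
    have *: "t \<in> {a..b} \<Longrightarrow> nth_deriv a b k f t = nth_deriv a b k g t" for t
      by (rule nth_deriv_cong[OF eq])
    have "esssup L (\<lambda>x. ereal (norm (nth_deriv a b k f x))) = esssup L (\<lambda>x. ereal (norm (nth_deriv a b k g x)))"
    proof -
      have "(\<lambda>x. ereal (norm (nth_deriv a b k f x))) \<in> borel_measurable L \<longleftrightarrow>
            (\<lambda>x. ereal (norm (nth_deriv a b k g x))) \<in> borel_measurable L"
        by (rule measurable_cong) (simp add: *)
      then show ?thesis unfolding esssup_def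
        by (auto intro!: Limsup_eq AE_I2 simp: *)
    qed
    moreover have "(LINT x|L. norm (nth_deriv a b k f x) powr enn2real p) = (LINT x|L. norm (nth_deriv a b k g x) powr enn2real p)"
      by (rule Bochner_Integration.integral_cong) (simp_all add: *)
    ultimately show ?thesis unfolding Lp_norm_def by simp
  qed
  then show ?thesis by (simp add: sobolev_norm_def)
qed

lemma continuous_imp_in_Lp:
  assumes "continuous_on {a..b} f"
  shows "in_Lp p L f"
proof -
  have "bounded (f ` {a..b})"
    using assms by (intro compact_imp_bounded compact_continuous_image) auto
  then obtain c where c: "c > 0" "\<And>t. t \<in> {a..b} \<Longrightarrow> norm (f t) \<le> c"
    by (auto simp: bounded_pos)
  show ?thesis
    by (rule Lp_bounded(1)[of _ c])
       (use c assms in \<open>auto intro!: AE_I2 continuous_imp_measurable_on_sets_lebesgue\<close>)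
qed

lemma sobolev_Suc_Suc:
  "f \<in> W (Suc (Suc n)) \<longleftrightarrow> f differentiable_on {a..b} \<and> D f \<in> W (Suc n)"
proof -
  have 1: "(\<forall>k. Suc k < Suc (Suc n) \<longrightarrow> nth_deriv a b k f differentiable_on {a..b}) \<longleftrightarrow>
     f differentiable_on {a..b} \<and> (\<forall>k. Suc k < Suc n \<longrightarrow> nth_deriv a b k (D f) differentiable_on {a..b})"
    using All_less_Suc2[of n "\<lambda>k. nth_deriv a b k f differentiable_on {a..b}"]
    by (simp add: nth_deriv_Suc_D)
  have 2: "(\<forall>k<Suc (Suc n). continuous_on {a..b} (nth_deriv a b k f)) \<longleftrightarrow>
     continuous_on {a..b} f \<and> (\<forall>k<Suc n. continuous_on {a..b} (nth_deriv a b k (D f)))"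
    using All_less_Suc2[of "Suc n" "\<lambda>k. continuous_on {a..b} (nth_deriv a b k f)"]
    by (simp add: nth_deriv_Suc_D)
  show ?thesis
    unfolding sobolev_def mem_Collect_eq 1 2
    using differentiable_imp_continuous_on[of f "{a..b}"]
    by (auto simp: nth_deriv_Suc_D)
qed

lemma sobolev_1:
  "f \<in> W 1 \<longleftrightarrow> continuous_on {a..b} f \<and> ac_on a b f \<and> in_Lp p L (D f)"
  by (auto simp: sobolev_def abs_continuous_on_eq nth_deriv_Suc_D)

lemma sobolev_Suc_continuous: "f \<in> W (Suc n) \<Longrightarrow> continuous_on {a..b} f"
  unfolding sobolev_def by force

lemma sobolev_imp_in_Lp: "f \<in> W n \<Longrightarrow> in_Lp p L f"
  by (cases n) (auto simp: sobolev_0 intro: continuous_imp_in_Lp sobolev_Suc_continuous)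

lemma sobolev_imp_integrable: "f \<in> W n \<Longrightarrow> integrable L f"
  using sobolev_imp_in_Lp Lp_imp_L1 by blast

lemma has_D:
  fixes f :: "real \<Rightarrow> 'v::euclidean_space"
  assumes "(f has_vector_derivative d) (at t within {a..b})" "t \<in> {a..b}"
  shows "D f t = d"
  unfolding D_def One_nat_def nth_deriv_Suc nth_deriv_0
  by (rule vector_derivative_within_closed_interval[OF ab assms(2,1)])

text \<open>Together with \<open>sobolev_SucD\<close> this identifies W^(n+1) with the primitives of
  W^n, the form in which the inductions on n run. For n = 0 it rests on Lebesgue differentiation;
  for n \<ge> 1 the integrand is continuous and calculus suffices.\<close>

lemma sobolev_SucI:
  assumes g: "g \<in> W n" and f: "\<And>t. t \<in> {a..b} \<Longrightarrow> f t = c + integral {a..t} g"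
  shows "f \<in> W (Suc n)" "weq n (D f) g" "nrm (Suc n) f = Lp_norm p L f + nrm n g"
proof -
  have gi: "integrable L g" by (rule sobolev_imp_integrable[OF g])
  have "f \<in> W (Suc n) \<and> weq n (D f) g"
  proof (cases n)
    case 0
    have eq: "AE t in L. D f t = g t"
    proof -
      have "AE t in L. (f has_vector_derivative g t) (at t within {a..b})"
        by (rule ac_density_derivative_AE[OF gi]) (rule f)
      then show ?thesis using AE_space by eventually_elim (auto intro: has_D)
    qed
    have "ac_on a b f"
      by (rule ac_on_if_increments[OF ac_on_integral[OF gi], of 1]) (simp_all add: f)
    moreover have "in_Lp p L (D f)"
      using in_Lp_cong(1)[of 0 "D f" g] eq g 0 by (simp add: weq_def sobolev_0)
    ultimately show ?thesis
      using eq ac_on_imp_continuous_on 0 by (auto simp: sobolev_1[unfolded One_nat_def] weq_def)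
  next
    case (Suc m)
    then have cont: "continuous_on {a..b} g" using g sobolev_Suc_continuous by blast
    have der: "(f has_vector_derivative g t) (at t within {a..b})" if t: "t \<in> {a..b}" for t
    proof -
      have "((\<lambda>u. c + integral {a..u} g) has_vector_derivative 0 + g t) (at t within {a..b})"
        by (intro has_vector_derivative_add has_vector_derivative_const integral_has_vector_derivative[OF cont t])
      then have d': "((\<lambda>u. c + integral {a..u} g) has_vector_derivative g t) (at t within {a..b})" by simp
      show ?thesis by (rule has_vector_derivative_transform[OF t _ d']) (use f in auto)
    qed
    then have eq: "weq n (D f) g" by (intro weqI has_D)
    then have "D f \<in> W n" using g sobolev_weq by blast
    moreover have "f differentiable_on {a..b}"
      using der unfolding differentiable_on_def by (meson differentiableI_vector)
    ultimately show ?thesis using eq Suc by (simp add: sobolev_Suc_Suc)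
  qed
  then show "f \<in> W (Suc n)" "weq n (D f) g" by auto
  then show "nrm (Suc n) f = Lp_norm p L f + nrm n g"
    using nrm_weq[OF weq_sym[of n "D f" g] g] by (simp add: nrm_Suc)
qed

lemma sobolev_SucD:
  assumes "f \<in> W (Suc n)"
  shows "D f \<in> W n" "\<And>t. t \<in> {a..b} \<Longrightarrow> f t = f a + integral {a..t} (D f)"
proof -
  have "D f \<in> W n \<and> (\<forall>t\<in>{a..b}. f t = f a + integral {a..t} (D f))"
  proof (cases n)
    case 0
    then have f: "continuous_on {a..b} f" "ac_on a b f" "in_Lp p L (D f)"
      using assms sobolev_1[of f] by auto
    obtain h where h: "integrable L h" "\<And>x. x \<in> {a..b} \<Longrightarrow> f x = f a + integral {a..x} h"
      using ac_density[OF f(2)] ab by auto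
    have eq: "AE t in L. D f t = h t"
    proof -
      have "AE t in L. (f has_vector_derivative h t) (at t within {a..b})"
        by (rule ac_density_derivative_AE[OF h(1)]) (rule h(2))
      then show ?thesis using AE_space by eventually_elim (auto intro: has_D)
    qed
    have "f t = f a + integral {a..t} (D f)" if "t \<in> {a..b}" for t
      by (subst integral_AE_cong[OF eq that]) (rule h(2)[OF that])
    then show ?thesis using f(3) by (simp only: 0 sobolev_0) blast
  next
    case (Suc m)
    then have f: "f differentiable_on {a..b}" "D f \<in> W n" using assms sobolev_Suc_Suc by auto
    have der: "(f has_vector_derivative D f t) (at t within {a..b})" if "t \<in> {a..b}" for t
    proof -
      have "f differentiable at t within {a..b}" using f(1) that by (auto simp: differentiable_on_def)
      then show ?thesis
        unfolding D_def One_nat_def nth_deriv_Suc nth_deriv_0 by (simp add: vector_derivative_works)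
    qed
    have "(D f has_integral (f t - f a)) {a..t}" if t: "t \<in> {a..b}" for t
    proof (rule fundamental_theorem_of_calculus)
      show "a \<le> t" using t by simp
      fix x assume "x \<in> {a..t}"
      then have "x \<in> {a..b}" "{a..t} \<subseteq> {a..b}" using t by auto
      then show "(f has_vector_derivative D f x) (at x within {a..t})"
        using der has_vector_derivative_within_subset by blast
    qed
    then have "integral {a..t} (D f) = f t - f a" if "t \<in> {a..b}" for t
      using integral_unique that by blast
    then show ?thesis using f(2) by simp
  qed
  then show "D f \<in> W n" "\<And>t. t \<in> {a..b} \<Longrightarrow> f t = f a + integral {a..t} (D f)" by blast+
qed

section \<open>Inclusions and linear operations in W^n\<close>

lemma sobolev_mono_Suc:
  assumes "f \<in> W (Suc n)" shows "f \<in> W n"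
  using assms
proof (induction n arbitrary: f)
  case 0
  then show ?case using sobolev_imp_in_Lp sobolev_0 by blast
next
  case (Suc n)
  show ?case
    by (rule sobolev_SucI(1)[OF Suc.IH[OF sobolev_SucD(1)[OF Suc.prems]] sobolev_SucD(2)[OF Suc.prems]])
qed

lemma sobolev_mono: "f \<in> W n \<Longrightarrow> m \<le> n \<Longrightarrow> f \<in> W m"
  by (rotate_tac, induction rule: inc_induct) (auto intro: sobolev_mono_Suc)

lemma nrm_nonneg: "f \<in> W n \<Longrightarrow> 0 \<le> nrm n f"
proof (induction n arbitrary: f)
  case 0 then show ?case by (simp add: nrm_0 sobolev_0 Lp_norm_nonneg)
next
  case (Suc n)
  then show ?case
    using sobolev_SucD(1)[OF Suc.prems] Lp_norm_nonneg[OF sobolev_imp_in_Lp[OF Suc.prems]] by (simp add: nrm_Suc)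
qed

lemma nrm_mono_Suc: "f \<in> W (Suc n) \<Longrightarrow> nrm n f \<le> nrm (Suc n) f"
proof (induction n arbitrary: f)
  case 0
  then show ?case using nrm_nonneg[OF sobolev_SucD(1)[OF 0]] by (simp add: nrm_Suc nrm_0)
next
  case (Suc n)
  then show ?case using sobolev_SucD(1)[OF Suc.prems] by (simp add: nrm_Suc)
qed

lemma nrm_mono: "f \<in> W n \<Longrightarrow> m \<le> n \<Longrightarrow> nrm m f \<le> nrm n f"
proof (rotate_tac, induction rule: inc_induct)
  case (step k)
  then show ?case using nrm_mono_Suc[of f k] sobolev_mono[of f n "Suc k"] by simp
qed simp

lemma Lp_norm_le_nrm: "f \<in> W n \<Longrightarrow> Lp_norm p L f \<le> nrm n f"
  using nrm_mono[of f n 0] by (simp add: nrm_0)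

lemma sobolev_integrable_on: "f \<in> W n \<Longrightarrow> t \<in> {a..b} \<Longrightarrow> f integrable_on {a..t}"
  using integrable_subinterval[OF sobolev_imp_integrable, of f n a t] by (auto simp: integrable_on_lebesgue_on)

lemma sobolev_add:
  assumes "f \<in> W n" "g \<in> W n"
  shows "(\<lambda>t. f t + g t) \<in> W n" "nrm n (\<lambda>t. f t + g t) \<le> nrm n f + nrm n g"
proof -
  have "(\<lambda>t. f t + g t) \<in> W n \<and> nrm n (\<lambda>t. f t + g t) \<le> nrm n f + nrm n g"
    using assms
  proof (induction n arbitrary: f g)
    case 0 then show ?case by (simp add: sobolev_0 nrm_0 Lp_add)
  next
    case (Suc n)
    note fD = sobolev_SucD[OF Suc.prems(1)] and gD = sobolev_SucD[OF Suc.prems(2)]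
    have "f t + g t = (f a + g a) + integral {a..t} (\<lambda>s. D f s + D g s)" if t: "t \<in> {a..b}" for t
      using fD(2)[OF t] gD(2)[OF t]
      by (simp add: Henstock_Kurzweil_Integration.integral_add sobolev_integrable_on[OF fD(1) t] sobolev_integrable_on[OF gD(1) t])
    note I = sobolev_SucI[OF conjunct1[OF Suc.IH[OF fD(1) gD(1)]], of "\<lambda>t. f t + g t", OF this]
    have "Lp_norm p L (\<lambda>t. f t + g t) \<le> Lp_norm p L f + Lp_norm p L g"
      using Suc.prems by (intro Lp_add sobolev_imp_in_Lp)
    then show ?case using I Suc.IH[OF fD(1) gD(1)] by (simp add: nrm_Suc)
  qed
  then show "(\<lambda>t. f t + g t) \<in> W n" "nrm n (\<lambda>t. f t + g t) \<le> nrm n f + nrm n g" by auto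
qed

lemma sobolev_cmult:
  assumes "f \<in> W n"
  shows "(\<lambda>t. c * f t) \<in> W n" "nrm n (\<lambda>t. c * f t) \<le> norm c * nrm n f"
proof -
  have "(\<lambda>t. c * f t) \<in> W n \<and> nrm n (\<lambda>t. c * f t) \<le> norm c * nrm n f"
    using assms
  proof (induction n arbitrary: f)
    case 0 then show ?case by (simp add: sobolev_0 nrm_0 Lp_cmult)
  next
    case (Suc n)
    note fD = sobolev_SucD[OF Suc.prems]
    have "c * f t = c * f a + integral {a..t} (\<lambda>s. c * D f s)" if t: "t \<in> {a..b}" for t
      using fD(2)[OF t] by (simp add: algebra_simps)
    note I = sobolev_SucI[OF conjunct1[OF Suc.IH[OF fD(1)]], of "\<lambda>t. c * f t", OF this]
    have "Lp_norm p L (\<lambda>t. c * f t) \<le> norm c * Lp_norm p L f"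
      using Suc.prems by (intro Lp_cmult sobolev_imp_in_Lp)
    then show ?case using I Suc.IH[OF fD(1)] by (simp add: nrm_Suc algebra_simps)
  qed
  then show "(\<lambda>t. c * f t) \<in> W n" "nrm n (\<lambda>t. c * f t) \<le> norm c * nrm n f" by auto
qed

lemma sobolev_uminus:
  assumes "f \<in> W n" shows "(\<lambda>t. - f t) \<in> W n" "nrm n (\<lambda>t. - f t) = nrm n f"
proof -
  show m: "(\<lambda>t. - f t) \<in> W n" using sobolev_cmult(1)[OF assms, of "-1"] by simp
  show "nrm n (\<lambda>t. - f t) = nrm n f"
    using sobolev_cmult(2)[OF assms, of "-1"] sobolev_cmult(2)[OF m, of "-1"] by simp
qed

lemma sobolev_diff:
  assumes "f \<in> W n" "g \<in> W n"
  shows "(\<lambda>t. f t - g t) \<in> W n" "nrm n (\<lambda>t. f t - g t) \<le> nrm n f + nrm n g"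
  using sobolev_add[OF assms(1) sobolev_uminus(1)[OF assms(2)]] sobolev_uminus(2)[OF assms(2)] by auto

lemma sobolev_const: "(\<lambda>t. c) \<in> W n"
proof (induction n arbitrary: c)
  case 0 then show ?case by (simp add: sobolev_0 in_Lp_const)
next
  case (Suc n)
  show ?case by (rule sobolev_SucI(1)[OF Suc[of 0], of _ c]) auto
qed

lemma nrm_zero: "nrm n (\<lambda>t. 0) = 0"
  using sobolev_cmult(2)[OF sobolev_const[of 0 n], of 0] nrm_nonneg[OF sobolev_const[of 0 n]] by simp

lemma sobolev_sum:
  assumes "\<And>i. i \<in> J \<Longrightarrow> f i \<in> W n"
  shows "(\<lambda>t. \<Sum>i\<in>J. f i t) \<in> W n" "nrm n (\<lambda>t. \<Sum>i\<in>J. f i t) \<le> (\<Sum>i\<in>J. nrm n (f i))"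
proof -
  have "(\<lambda>t. \<Sum>i\<in>J. f i t) \<in> W n \<and> nrm n (\<lambda>t. \<Sum>i\<in>J. f i t) \<le> (\<Sum>i\<in>J. nrm n (f i))"
    using assms
  proof (induction J rule: infinite_finite_induct)
    case (insert i J)
    then show ?case using sobolev_add[of "f i" n "\<lambda>t. \<Sum>i\<in>J. f i t"] by force
  qed (auto simp: sobolev_const nrm_zero)
  then show "(\<lambda>t. \<Sum>i\<in>J. f i t) \<in> W n" "nrm n (\<lambda>t. \<Sum>i\<in>J. f i t) \<le> (\<Sum>i\<in>J. nrm n (f i))" by auto
qed

section \<open>Bounds for the supremum and by the initial value\<close>

lemma integral_norm_le_nrm:
  assumes "f \<in> W n" "t \<in> {a..b}"
  shows "norm (integral {a..t} f) \<le> L1_const * nrm n f"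
proof -
  have f: "f integrable_on {a..t}" by (rule sobolev_integrable_on[OF assms])
  have fi: "integrable L (\<lambda>s. norm (f s))" using sobolev_imp_integrable[OF assms(1)] by simp
  have ni: "(\<lambda>s. norm (f s)) integrable_on {a..b}" by (rule integrable_on_lebesgue_on[OF fi]) simp
  have nt: "(\<lambda>s. norm (f s)) integrable_on {a..t}"
    by (rule integrable_on_subinterval[OF ni]) (use assms in auto)
  have "norm (integral {a..t} f) \<le> integral {a..t} (\<lambda>s. norm (f s))"
    by (rule integral_norm_bound_integral[OF f nt]) simp
  also have "\<dots> \<le> integral {a..b} (\<lambda>s. norm (f s))"
    by (rule integral_subset_le[OF _ nt ni]) (use assms in auto)
  also have "\<dots> = (LINT s|L. norm (f s))"
    by (rule lebesgue_integral_eq_integral[OF fi, symmetric]) simp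
  also have "\<dots> \<le> L1_const * Lp_norm p L f" by (rule Lp_imp_L1(2)[OF sobolev_imp_in_Lp[OF assms(1)]])
  also have "\<dots> \<le> L1_const * nrm n f"
    using Lp_norm_le_nrm[OF assms(1)] L1_const_pos by simp
  finally show ?thesis .
qed

definition "sup_const = L1_const * (2 + 1 / (b - a))"

lemma sup_const_pos: "0 < sup_const"
  unfolding sup_const_def using L1_const_pos ab by (intro mult_pos_pos add_pos_pos) auto

text \<open>The inequality |f t| \<le> |f s| + 2 \<open>L1_const\<close> ||f'|| is averaged over s
  in [a, b]. This turns |f s| into an L_1 norm and accounts for the term 1 / (b - a) in
  \<open>sup_const\<close>.\<close>

lemma sobolev_sup_bound:
  assumes f: "f \<in> W (Suc n)" and t: "t \<in> {a..b}"
  shows "norm (f t) \<le> sup_const * nrm (Suc n) f"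
proof -
  note fD = sobolev_SucD[OF f]
  let ?d = "L1_const * nrm n (D f)"
  have osc: "norm (f t) \<le> norm (f s) + 2 * ?d" if s: "s \<in> {a..b}" for s
  proof -
    have "f t = f s + (integral {a..t} (D f) - integral {a..s} (D f))"
      using fD(2)[OF t] fD(2)[OF s] by simp
    then have "norm (f t) \<le> norm (f s) + norm (integral {a..t} (D f) - integral {a..s} (D f))"
      by (metis norm_triangle_ineq)
    also have "norm (integral {a..t} (D f) - integral {a..s} (D f)) \<le> ?d + ?d"
      by (rule order_trans[OF norm_triangle_ineq4]) (intro add_mono integral_norm_le_nrm fD(1) s t)
    finally show ?thesis by simp
  qed
  have i: "integrable L (\<lambda>s. norm (f s))" using sobolev_imp_integrable[OF f] by simp
  have "(LINT s|L. norm (f t)) \<le> (LINT s|L. norm (f s) + 2 * ?d)"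
    by (rule integral_mono) (use i osc in \<open>auto\<close>)
  also have "\<dots> = (LINT s|L. norm (f s)) + (b - a) * (2 * ?d)"
    using i ab by (simp add: measure_restrict_space space_restrict_space)
  also have "(LINT s|L. norm (f s)) \<le> L1_const * Lp_norm p L f"
    by (rule Lp_imp_L1(2)[OF sobolev_imp_in_Lp[OF f]])
  finally have "(b - a) * norm (f t) \<le> L1_const * Lp_norm p L f + (b - a) * (2 * ?d)"
    using ab by (simp add: measure_restrict_space space_restrict_space)
  then have "norm (f t) \<le> L1_const * Lp_norm p L f / (b - a) + 2 * ?d"
    using ab by (simp add: field_simps)
  also have "\<dots> \<le> L1_const * nrm (Suc n) f / (b - a) + 2 * (L1_const * nrm (Suc n) f)"
    using nrm_nonneg[OF fD(1)] Lp_norm_nonneg[OF sobolev_imp_in_Lp[OF f]] L1_const_pos ab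
    by (intro add_mono divide_right_mono mult_left_mono) (auto simp: nrm_Suc)
  also have "\<dots> = sup_const * nrm (Suc n) f" by (simp add: sup_const_def algebra_simps)
  finally show ?thesis .
qed

definition "one_const = Lp_norm p L (\<lambda>_. 1)"

lemma one_const_nonneg: "0 \<le> one_const"
  unfolding one_const_def by (rule Lp_norm_nonneg[OF in_Lp_const])

definition "init_const = one_const + one_const * L1_const + 1"

lemma init_const_ge_1: "1 \<le> init_const"
  unfolding init_const_def using one_const_nonneg L1_const_pos by simp

text \<open>On [a, b] the function is bounded by |f a| + \<open>L1_const\<close> ||f'||, and
  \<open>one_const\<close>, the norm of 1, converts this bound into an L_p norm.\<close>

lemma nrm_Suc_le_initial:
  assumes f: "f \<in> W (Suc n)"
  shows "nrm (Suc n) f \<le> init_const * (norm (f a) + nrm n (D f))"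
proof -
  note fD = sobolev_SucD[OF f]
  let ?c = "norm (f a) + L1_const * nrm n (D f)"
  have c: "0 \<le> ?c" using nrm_nonneg[OF fD(1)] L1_const_pos by simp
  have "norm (f t) \<le> ?c" if t: "t \<in> {a..b}" for t
    using fD(2)[OF t] integral_norm_le_nrm[OF fD(1) t] norm_triangle_ineq[of "f a" "integral {a..t} (D f)"] by simp
  then have "Lp_norm p L f \<le> ?c * one_const"
    unfolding one_const_def
    by (intro Lp_bounded(2) c) (use in_Lp_measurable[OF sobolev_imp_in_Lp[OF f]] in \<open>auto intro!: AE_I2\<close>)
  then have "nrm (Suc n) f \<le> ?c * one_const + nrm n (D f)" by (simp add: nrm_Suc)
  also have "\<dots> \<le> init_const * (norm (f a) + nrm n (D f))"
    using nrm_nonneg[OF fD(1)] one_const_nonneg L1_const_pos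
    by (simp add: init_const_def algebra_simps mult_nonneg_nonneg)
  finally show ?thesis .
qed

end

section \<open>Products and convergent series in W^n\<close>

context sobolev_interval
begin

lemma sobolev_Suc_ac:
  assumes "f \<in> W (Suc n)"
  shows "ac_on a b f"
  using sobolev_mono[OF assms, of 1] sobolev_1 by auto

lemma sobolev_Suc_derivative_AE:
  assumes f: "f \<in> W (Suc n)"
  shows "AE t in L. (f has_vector_derivative D f t) (at t within {a..b})"
  by (rule ac_density_derivative_AE[OF sobolev_imp_integrable[OF sobolev_SucD(1)[OF f]]])
     (rule sobolev_SucD(2)[OF f])

lemma Lp_norm_mult_le:
  assumes f: "in_Lp p L f" and g: "g \<in> W (Suc n)"
  shows "in_Lp p L (\<lambda>t. f t * g t)"
    "Lp_norm p L (\<lambda>t. f t * g t) \<le> sup_const * nrm (Suc n) g * Lp_norm p L f"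
proof -
  let ?c = "sup_const * nrm (Suc n) g"
  have c: "0 \<le> ?c" using sup_const_pos nrm_nonneg[OF g] by simp
  have m: "(\<lambda>t. f t * g t) \<in> borel_measurable L"
    using in_Lp_measurable[OF f] in_Lp_measurable[OF sobolev_imp_in_Lp[OF g]] by simp
  have le: "AE t in L. norm (f t * g t) \<le> ?c * norm (f t)"
  proof (rule AE_I2)
    fix t assume "t \<in> space L"
    then have "norm (g t) \<le> ?c" using sobolev_sup_bound[OF g] by simp
    then show "norm (f t * g t) \<le> ?c * norm (f t)"
      by (simp add: norm_mult mult.commute[of "norm (f t)"] mult_right_mono)
  qed
  show "in_Lp p L (\<lambda>t. f t * g t)" "Lp_norm p L (\<lambda>t. f t * g t) \<le> ?c * Lp_norm p L f"
    by (rule Lp_mono[OF f m c le])+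
qed

text \<open>Leibniz's rule in integrated form. In each summand the differentiated factor comes
  first, so that one estimate serves both.\<close>

lemma sobolev_mult_derivative:
  assumes f: "f \<in> W (Suc n)" and g: "g \<in> W (Suc n)" and t: "t \<in> {a..b}"
  shows "f t * g t = f a * g a + integral {a..t} (\<lambda>s. D f s * g s + D g s * f s)"
proof -
  have ac: "ac_on a b (\<lambda>t. f t * g t)"
  proof (rule ac_on_if_increments2[OF sobolev_Suc_ac[OF f] sobolev_Suc_ac[OF g]])
    let ?F = "sup_const * nrm (Suc n) f" and ?G = "sup_const * nrm (Suc n) g"
    have nn: "0 \<le> ?F" "0 \<le> ?G" using sup_const_pos nrm_nonneg f g by (auto intro!: mult_nonneg_nonneg simp: less_imp_le)
    then show "0 \<le> ?F + ?G" by simp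
    fix x y assume xy: "a \<le> x" "x \<le> y" "y \<le> b"
    have "f y * g y - f x * g x = (f y - f x) * g y + f x * (g y - g x)" by (simp add: algebra_simps)
    then have "norm (f y * g y - f x * g x) \<le> norm (f y - f x) * norm (g y) + norm (f x) * norm (g y - g x)"
      by (metis norm_mult norm_triangle_ineq)
    also have "\<dots> \<le> norm (f y - f x) * (?F + ?G) + (?F + ?G) * norm (g y - g x)"
      using sobolev_sup_bound[OF f, of x] sobolev_sup_bound[OF g, of y] xy nn
      by (intro add_mono mult_left_mono mult_right_mono) auto
    finally show "norm (f y * g y - f x * g x) \<le> (?F + ?G) * (norm (f y - f x) + norm (g y - g x))"
      by (simp add: algebra_simps)
  qed
  have "AE t in L. ((\<lambda>t. f t * g t) has_vector_derivative D f t * g t + D g t * f t) (at t within {a..b})"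
    using sobolev_Suc_derivative_AE[OF f] sobolev_Suc_derivative_AE[OF g]
  proof eventually_elim
    fix t assume "(f has_vector_derivative D f t) (at t within {a..b})"
      "(g has_vector_derivative D g t) (at t within {a..b})"
    from has_vector_derivative_mult[OF this]
    show "((\<lambda>t. f t * g t) has_vector_derivative D f t * g t + D g t * f t) (at t within {a..b})"
      by (simp add: algebra_simps)
  qed
  from ac_on_derivative_AE(2)[OF ac ab this t] show ?thesis .
qed

text \<open>Since \<open>W\<^sub>p\<^sup>0 = L\<^sub>p\<close> is not an algebra, one factor is taken from \<open>W\<^sub>p\<^sup>1\<close> when \<open>n = 0\<close>.\<close>

definition mult_bound :: "nat \<Rightarrow> real \<Rightarrow> bool" where
  "mult_bound n K \<longleftrightarrow> 0 \<le> K \<and> (\<forall>f\<in>W n. \<forall>g\<in>W (max n 1).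
      (\<lambda>t. f t * g t) \<in> W n \<and> nrm n (\<lambda>t. f t * g t) \<le> K * nrm n f * nrm (max n 1) g)"

text \<open>In (f g)' = f' g + g' f the differentiated factor lies in W^n and the other one in
  W^(n+1), hence in W^(max n 1), which is what the induction hypothesis asks for.\<close>

lemma mult_bound_ex: "\<exists>K. mult_bound n K"
proof (induction n)
  case 0
  have "mult_bound 0 sup_const"
    unfolding mult_bound_def
  proof (intro conjI ballI)
    fix f g assume fg: "f \<in> W 0" "g \<in> W (max 0 1)"
    then have g: "g \<in> W (Suc 0)" by simp
    have f: "in_Lp p L f" using fg(1) by (simp add: sobolev_0)
    show "(\<lambda>t. f t * g t) \<in> W 0" using Lp_norm_mult_le(1)[OF f g] by (simp add: sobolev_0)
    show "nrm 0 (\<lambda>t. f t * g t) \<le> sup_const * nrm 0 f * nrm (max 0 1) g"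
      using Lp_norm_mult_le(2)[OF f g] by (simp add: nrm_0 mult_ac)
  qed (use sup_const_pos in simp)
  then show ?case by blast
next
  case (Suc n)
  then obtain K where K: "mult_bound n K" by blast
  have K0: "0 \<le> K" using K by (simp add: mult_bound_def)
  have "mult_bound (Suc n) (sup_const + 2 * K)"
    unfolding mult_bound_def
  proof (intro conjI ballI)
    fix f g assume f: "f \<in> W (Suc n)" and "g \<in> W (max (Suc n) 1)"
    then have g: "g \<in> W (Suc n)" by simp
    have half: "(\<lambda>t. D f t * g t) \<in> W n \<and> nrm n (\<lambda>t. D f t * g t) \<le> K * (nrm (Suc n) f * nrm (Suc n) g)"
      if f: "f \<in> W (Suc n)" and g: "g \<in> W (Suc n)" for f g
    proof -
      have fD: "D f \<in> W n" by (rule sobolev_SucD(1)[OF f])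
      have g': "g \<in> W (max n 1)" by (rule sobolev_mono[OF g]) simp
      have "nrm n (\<lambda>t. D f t * g t) \<le> K * nrm n (D f) * nrm (max n 1) g" "(\<lambda>t. D f t * g t) \<in> W n"
        using K fD g' unfolding mult_bound_def by auto
      moreover have "K * (nrm n (D f) * nrm (max n 1) g) \<le> K * (nrm (Suc n) f * nrm (Suc n) g)"
        using nrm_mono[OF g, of "max n 1"] nrm_nonneg[OF fD] nrm_nonneg[OF g'] Lp_norm_nonneg[OF sobolev_imp_in_Lp[OF f]]
        by (intro mult_left_mono[OF _ K0] mult_mono) (auto simp: nrm_Suc[of n f])
      ultimately show ?thesis by (simp add: mult.assoc)
    qed
    have P: "(\<lambda>s. D f s * g s + D g s * f s) \<in> W n"
      using sobolev_add(1) half[OF f g] half[OF g f] by blast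
    note I = sobolev_SucI[OF P, of "\<lambda>t. f t * g t", OF sobolev_mult_derivative[OF f g]]
    show "(\<lambda>t. f t * g t) \<in> W (Suc n)" by (rule I(1))
    have I3: "nrm (Suc n) (\<lambda>t. f t * g t) = Lp_norm p L (\<lambda>t. f t * g t) + nrm n (\<lambda>s. D f s * g s + D g s * f s)"
      by (rule I(3))
    have "nrm (Suc n) (\<lambda>t. f t * g t) \<le> sup_const * nrm (Suc n) g * Lp_norm p L f +
       (K * (nrm (Suc n) f * nrm (Suc n) g) + K * (nrm (Suc n) g * nrm (Suc n) f))"
      unfolding I3
      using Lp_norm_mult_le(2)[OF sobolev_imp_in_Lp[OF f] g]
        sobolev_add(2)[OF half[OF f g, THEN conjunct1] half[OF g f, THEN conjunct1]]
        half[OF f g, THEN conjunct2] half[OF g f, THEN conjunct2]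
      by linarith
    also have "sup_const * nrm (Suc n) g * Lp_norm p L f \<le> sup_const * nrm (Suc n) g * nrm (Suc n) f"
      using Lp_norm_le_nrm[OF f] sup_const_pos nrm_nonneg[OF g] by (intro mult_left_mono) auto
    finally show "nrm (Suc n) (\<lambda>t. f t * g t) \<le> (sup_const + 2 * K) * nrm (Suc n) f * nrm (max (Suc n) 1) g"
      by (simp add: algebra_simps)
  qed (use sup_const_pos K0 in simp)
  then show ?case by blast
qed

definition "mult_const n = (SOME K. mult_bound n K)"

lemma mult_bound_const: "mult_bound n (mult_const n)"
  unfolding mult_const_def by (rule someI_ex[OF mult_bound_ex])

lemma mult_const_nonneg: "0 \<le> mult_const n"
  using mult_bound_const[of n] by (simp add: mult_bound_def)

lemma sobolev_mult:
  assumes "f \<in> W n" "g \<in> W (max n 1)"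
  shows "(\<lambda>t. f t * g t) \<in> W n" "nrm n (\<lambda>t. f t * g t) \<le> mult_const n * nrm n f * nrm (max n 1) g"
  using mult_bound_const[of n] assms by (auto simp: mult_bound_def)

text \<open>Completeness of W^n with tail bounds. The initial values and, by induction, the
  derivatives are summed separately; the limit is the primitive of the summed derivatives with the
  summed initial value.\<close>

lemma sobolev_series:
  "\<exists>K\<ge>0. \<forall>g \<epsilon>. (\<forall>k. g k \<in> W n \<and> nrm n (g k) \<le> \<epsilon> k) \<longrightarrow> summable \<epsilon> \<longrightarrow>
     (\<exists>G\<in>W n. \<forall>N. nrm n (\<lambda>t. G t - (\<Sum>k<N. g k t)) \<le> K * (\<Sum>k. \<epsilon> (k + N)))"
proof (induction n)
  case 0
  show ?case
  proof (intro exI[of _ 1] conjI allI impI)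
    fix g \<epsilon> assume g: "\<forall>k. g k \<in> W 0 \<and> nrm 0 (g k) \<le> \<epsilon> k" and s: "summable (\<epsilon> :: nat \<Rightarrow> real)"
    have gLp: "in_Lp p L (g k)" and gle: "Lp_norm p L (g k) \<le> \<epsilon> k" for k
      using g[rule_format, of k] by (auto simp: sobolev_0 nrm_0)
    obtain G where "in_Lp p L G" "\<And>N. Lp_norm p L (\<lambda>x. G x - (\<Sum>k<N. g k x)) \<le> (\<Sum>k. \<epsilon> (k + N))"
      using Lp_series[OF gLp gle s] by metis
    then show "\<exists>G\<in>W 0. \<forall>N. nrm 0 (\<lambda>t. G t - (\<Sum>k<N. g k t)) \<le> 1 * (\<Sum>k. \<epsilon> (k + N))"
      by (intro bexI[of _ G]) (simp_all add: sobolev_0 nrm_0)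
  qed simp
next
  case (Suc n)
  then obtain K where K: "K \<ge> 0" "\<And>g \<epsilon>. (\<And>k. g k \<in> W n \<and> nrm n (g k) \<le> \<epsilon> k) \<Longrightarrow> summable \<epsilon> \<Longrightarrow>
     \<exists>G\<in>W n. \<forall>N. nrm n (\<lambda>t. G t - (\<Sum>k<N. g k t)) \<le> K * (\<Sum>k. \<epsilon> (k + N))" by blast
  show ?case
  proof (intro exI[of _ "init_const * (sup_const + K)"] conjI allI impI)
    show "0 \<le> init_const * (sup_const + K)"
      using init_const_ge_1 sup_const_pos K(1) by simp
    fix g \<epsilon> assume g: "\<forall>k. g k \<in> W (Suc n) \<and> nrm (Suc n) (g k) \<le> \<epsilon> k" and s: "summable (\<epsilon> :: nat \<Rightarrow> real)"
    have gW: "g k \<in> W (Suc n)" and gle: "nrm (Suc n) (g k) \<le> \<epsilon> k" for k using g by auto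
    note gD = sobolev_SucD[OF gW]
    have eps0: "0 \<le> \<epsilon> k" for k using nrm_nonneg[OF gW] gle order_trans by blast
    have "D (g k) \<in> W n \<and> nrm n (D (g k)) \<le> \<epsilon> k" for k
      using gD(1)[of k] gle[of k] Lp_norm_nonneg[OF sobolev_imp_in_Lp[OF gW[of k]]] by (simp add: nrm_Suc)
    from K(2)[OF this s]
    obtain G where G: "G \<in> W n" "\<And>N. nrm n (\<lambda>t. G t - (\<Sum>k<N. D (g k) t)) \<le> K * (\<Sum>k. \<epsilon> (k + N))" by blast
    have ga: "norm (g k a) \<le> sup_const * \<epsilon> k" for k
      using sobolev_sup_bound[OF gW, of a k] ab gle[of k] sup_const_pos
      by (meson atLeastAtMost_iff less_imp_le mult_left_mono order_refl order_trans)
    have sm: "summable (\<lambda>k. sup_const * \<epsilon> k)" using s by (rule summable_mult)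
    have sn: "summable (\<lambda>k. norm (g k a))"
      by (rule summable_comparison_test'[OF sm]) (use ga in auto)
    define c where "c = (\<Sum>k. g k a)"
    define F where "F t = c + integral {a..t} G" for t
    have FW: "F \<in> W (Suc n)" by (rule sobolev_SucI(1)[OF G(1)]) (simp add: F_def)
    moreover have "nrm (Suc n) (\<lambda>t. F t - (\<Sum>k<N. g k t)) \<le> init_const * (sup_const + K) * (\<Sum>k. \<epsilon> (k + N))" for N
    proof -
      let ?H = "\<lambda>t. G t - (\<Sum>k<N. D (g k) t)" and ?F = "\<lambda>t. F t - (\<Sum>k<N. g k t)"
      have HW: "?H \<in> W n" by (intro sobolev_diff(1) sobolev_sum(1) G(1) gD(1))
      have eq: "?F t = (c - (\<Sum>k<N. g k a)) + integral {a..t} ?H" if t: "t \<in> {a..b}" for t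
      proof -
        have "integral {a..t} ?H = integral {a..t} G - (\<Sum>k<N. integral {a..t} (D (g k)))"
          using sobolev_integrable_on[OF G(1) t] sobolev_integrable_on[OF gD(1) t]
          by (subst Henstock_Kurzweil_Integration.integral_diff)
             (auto intro!: integrable_sum simp: Henstock_Kurzweil_Integration.integral_sum)
        moreover have "(\<Sum>k<N. g k t) = (\<Sum>k<N. g k a + integral {a..t} (D (g k)))"
          by (rule sum.cong[OF refl]) (rule gD(2)[OF t])
        ultimately show ?thesis by (simp add: F_def sum.distrib)
      qed
      note I = sobolev_SucI[OF HW eq]
      have Dn: "nrm n (D ?F) = nrm n ?H"
        using nrm_weq[OF weq_sym[OF I(2)] HW] by simp
      have "norm (?F a) \<le> sup_const * (\<Sum>k. \<epsilon> (k + N))"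
      proof -
        have "c = (\<Sum>k. g (k + N) a) + (\<Sum>k<N. g k a)"
          unfolding c_def by (rule suminf_split_initial_segment[OF summable_norm_cancel[OF sn]])
        then have "?F a = (\<Sum>k. g (k + N) a)" by (simp add: F_def)
        also have "norm \<dots> \<le> (\<Sum>k. norm (g (k + N) a))"
          by (rule summable_norm) (use sn in \<open>simp add: summable_iff_shift[of "\<lambda>k. norm (g k a)"]\<close>)
        also have "\<dots> \<le> (\<Sum>k. sup_const * \<epsilon> (k + N))"
          by (rule suminf_le) (use sn sm ga in \<open>auto simp: summable_iff_shift[of "\<lambda>k. norm (g k a)"] summable_iff_shift[of "\<lambda>k. sup_const * \<epsilon> k"]\<close>)
        also have "\<dots> = sup_const * (\<Sum>k. \<epsilon> (k + N))"
          by (rule suminf_mult) (use s in \<open>simp add: summable_iff_shift\<close>)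
        finally show ?thesis .
      qed
      then have "norm (?F a) + nrm n (D ?F) \<le> sup_const * (\<Sum>k. \<epsilon> (k + N)) + K * (\<Sum>k. \<epsilon> (k + N))"
        using G(2)[of N] Dn by simp
      then have "init_const * (norm (?F a) + nrm n (D ?F)) \<le> init_const * ((sup_const + K) * (\<Sum>k. \<epsilon> (k + N)))"
        using init_const_ge_1 by (intro mult_left_mono) (auto simp: algebra_simps)
      then show ?thesis using nrm_Suc_le_initial[OF I(1)] by (simp add: mult.assoc)
    qed
    ultimately show "\<exists>F\<in>W (Suc n). \<forall>N. nrm (Suc n) (\<lambda>t. F t - (\<Sum>k<N. g k t)) \<le> init_const * (sup_const + K) * (\<Sum>k. \<epsilon> (k + N))"
      by blast
  qed
qed

end

section \<open>Linear first-order systems\<close>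

lemma norm_vec_le_sum: "norm (x :: 'b::real_normed_vector ^ 'k) \<le> (\<Sum>i\<in>UNIV. norm (x $ i))"
  unfolding norm_vec_def by (rule L2_set_le_sum) simp

context sobolev_interval
begin

lemma integrable_on_Icc:
  fixes m :: "real \<Rightarrow> 'b::euclidean_space"
  assumes "integrable L m" "x \<in> {a..b}" "y \<in> {a..b}"
  shows "m integrable_on {x..y}"
  using integrable_subinterval[OF assms(1), of x y] assms by (auto simp: integrable_on_lebesgue_on)

lemma integrable_mult_continuous:
  fixes m x :: "real \<Rightarrow> real"
  assumes m: "integrable L m" and x: "continuous_on {a..b} x"
  shows "integrable L (\<lambda>t. m t * x t)"
proof -
  have "bounded (x ` {a..b})"
    using x by (intro compact_imp_bounded compact_continuous_image) auto
  then obtain c where c: "c > 0" "\<And>t. t \<in> {a..b} \<Longrightarrow> norm (x t) \<le> c"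
    by (auto simp: bounded_pos)
  have xm: "x \<in> borel_measurable L" using x by (intro continuous_imp_measurable_on_sets_lebesgue) auto
  have ci: "integrable L (\<lambda>t. c * m t)" using m by simp
  show ?thesis
  proof (rule Bochner_Integration.integrable_bound[OF ci])
    show "(\<lambda>t. m t * x t) \<in> borel_measurable L" using m xm by auto
    show "AE t in L. norm (m t * x t) \<le> norm (c * m t)"
      using c by (intro AE_I2) (simp add: abs_mult mult.commute[of "\<bar>m _\<bar>"] mult_right_mono)
  qed
qed

text \<open>In the norm \<open>sup\<^sub>t exp (- 2 \<Lambda>(t)) |x(t)|\<close> the Volterra operator with kernel bounded by \<open>m\<close> is
  a contraction with constant \<open>1/2\<close>; this gives both the Gronwall estimate and existence.\<close>

context
  fixes m :: "real \<Rightarrow> real" and \<Lambda> :: "real \<Rightarrow> real"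
  assumes m: "integrable L m" and m0: "\<And>t. 0 \<le> m t"
  defines "\<Lambda> \<equiv> \<lambda>t. integral {a..t} m"
begin

lemma weight_mono: "\<Lambda> x \<le> \<Lambda> y" if "a \<le> x" "x \<le> y" "y \<le> b"
  unfolding \<Lambda>_def using integrable_on_Icc[OF m, of a x] integrable_on_Icc[OF m, of a y] that m0
  by (intro integral_subset_le) auto

lemma weight_nonneg: "0 \<le> \<Lambda> t" if "t \<in> {a..b}"
  using weight_mono[of a t] that by (simp add: \<Lambda>_def)

lemma weight_continuous: "continuous_on {a..b} \<Lambda>"
  unfolding \<Lambda>_def by (rule ac_on_imp_continuous_on[OF ac_on_integral[OF m]])

lemma integrable_exp_weight: "integrable L (\<lambda>s. m s * exp (2 * \<Lambda> s))"
  by (intro integrable_mult_continuous m continuous_intros weight_continuous)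

text \<open>m is merely integrable, so \<Lambda> has derivative m only almost everywhere. Absolute
  continuity of exp (2 \<Lambda>) is what allows its derivative 2 m exp (2 \<Lambda>) to be
  integrated back.\<close>

lemma integral_exp_weight:
  assumes t: "t \<in> {a..b}"
  shows "integral {a..t} (\<lambda>s. m s * exp (2 * \<Lambda> s)) = (exp (2 * \<Lambda> t) - 1) / 2"
proof -
  \<comment> \<open>Complex-valued because \<open>ac_on_derivative_AE\<close> is stated for such
    functions.\<close>
  let ?f = "\<lambda>t. complex_of_real (exp (2 * \<Lambda> t))"
  let ?g = "\<lambda>t. complex_of_real (2 * (m t * exp (2 * \<Lambda> t)))"
  have acm: "ac_on a b \<Lambda>" unfolding \<Lambda>_def by (rule ac_on_integral[OF m])
  have ac: "ac_on a b ?f"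
  proof (rule ac_on_if_increments[OF acm, of "2 * exp (2 * \<Lambda> b)"])
    fix x y assume xy: "a \<le> x" "x \<le> y" "y \<le> b"
    have le: "\<Lambda> x \<le> \<Lambda> y" "\<Lambda> y \<le> \<Lambda> b" using weight_mono xy ab by auto
    have "norm (?f y - ?f x) = exp (2 * \<Lambda> y) - exp (2 * \<Lambda> x)"
      using le by (simp flip: of_real_diff)
    also have "\<dots> = exp (2 * \<Lambda> y) * (1 - exp (- (2 * (\<Lambda> y - \<Lambda> x))))"
      by (simp add: algebra_simps flip: exp_add)
    also have "\<dots> \<le> exp (2 * \<Lambda> b) * (2 * (\<Lambda> y - \<Lambda> x))"
    proof (intro mult_mono)
      show "1 - exp (- (2 * (\<Lambda> y - \<Lambda> x))) \<le> 2 * (\<Lambda> y - \<Lambda> x)"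
        using exp_ge_add_one_self[of "- (2 * (\<Lambda> y - \<Lambda> x))"] by linarith
    qed (use le in auto)
    finally show "norm (?f y - ?f x) \<le> 2 * exp (2 * \<Lambda> b) * norm (\<Lambda> y - \<Lambda> x)"
      using le by (simp add: algebra_simps)
  qed simp
  have der: "AE t in L. (?f has_vector_derivative ?g t) (at t within {a..b})"
    using integral_has_vector_derivative_AE[OF m]
  proof eventually_elim
    fix t assume "((\<lambda>u. integral {a..u} m) has_vector_derivative m t) (at t within {a..b})"
    then have d: "(\<Lambda> has_real_derivative m t) (at t within {a..b})"
      by (simp add: \<Lambda>_def has_real_derivative_iff_has_vector_derivative)
    have "((\<lambda>t. exp (2 * \<Lambda> t)) has_real_derivative 2 * (m t * exp (2 * \<Lambda> t))) (at t within {a..b})"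
      by (rule derivative_eq_intros d refl | simp)+
    then show "(?f has_vector_derivative ?g t) (at t within {a..b})"
      by (intro has_vector_derivative_of_real) (simp add: has_real_derivative_iff_has_vector_derivative)
  qed
  have gi: "?g integrable_on {a..t}"
    using integrable_on_Icc[OF ac_on_derivative_AE(1)[OF ac ab der], of a t] t by auto
  have "?f t = ?f a + integral {a..t} ?g"
    by (rule ac_on_derivative_AE(2)[OF ac ab der t])
  then have "exp (2 * \<Lambda> t) = 1 + Re (integral {a..t} ?g)"
    by (simp add: complex_eq_iff \<Lambda>_def)
  also have "Re (integral {a..t} ?g) = integral {a..t} (\<lambda>s. Re (?g s))"
    using integral_linear[OF gi bounded_linear_Re] by (simp add: o_def)
  finally show ?thesis by simp
qed

lemma gronwall:
  assumes x: "continuous_on {a..b} x" and x0: "\<And>t. t \<in> {a..b} \<Longrightarrow> 0 \<le> x t" and c: "0 \<le> c"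
    and le: "\<And>t. t \<in> {a..b} \<Longrightarrow> x t \<le> c + integral {a..t} (\<lambda>s. m s * x s)"
    and t: "t \<in> {a..b}"
  shows "x t \<le> 2 * exp (2 * \<Lambda> b) * c"
proof -
  have "continuous_on {a..b} (\<lambda>t. exp (- 2 * \<Lambda> t) * x t)"
    by (intro continuous_intros weight_continuous x)
  then obtain s where s: "s \<in> {a..b}" "\<And>t. t \<in> {a..b} \<Longrightarrow> exp (- 2 * \<Lambda> t) * x t \<le> exp (- 2 * \<Lambda> s) * x s"
    using continuous_attains_sup[of "{a..b}"] ab by force
  \<comment> \<open>The weighted supremum of x, attained at s. Inserting the bound by S into the
    integral inequality at s gives S \<le> c + S / 2.\<close>
  define S where "S = exp (- 2 * \<Lambda> s) * x s"
  have S: "0 \<le> S" using x0[OF s(1)] by (simp add: S_def)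
  have bd: "x t \<le> S * exp (2 * \<Lambda> t)" if "t \<in> {a..b}" for t
  proof -
    have "x t = (exp (- 2 * \<Lambda> t) * x t) * exp (2 * \<Lambda> t)" by (simp add: exp_minus)
    also have "\<dots> \<le> S * exp (2 * \<Lambda> t)" using s(2)[OF that] by (simp add: S_def)
    finally show ?thesis .
  qed
  have "x s \<le> c + integral {a..s} (\<lambda>s. m s * x s)" by (rule le[OF s(1)])
  also have "integral {a..s} (\<lambda>s. m s * x s) \<le> integral {a..s} (\<lambda>t. S * (m t * exp (2 * \<Lambda> t)))"
  proof (rule integral_le)
    show "(\<lambda>s. m s * x s) integrable_on {a..s}"
      using integrable_on_Icc[OF integrable_mult_continuous[OF m x]] s ab by auto
    show "(\<lambda>t. S * (m t * exp (2 * \<Lambda> t))) integrable_on {a..s}"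
      using integrable_on_Icc[OF integrable_exp_weight, of a s] s ab by (intro integrable_on_mult_right) auto
    fix u assume "u \<in> {a..s}"
    then have "m u * x u \<le> m u * (S * exp (2 * \<Lambda> u))"
      using bd[of u] s m0[of u] by (intro mult_left_mono) auto
    then show "m u * x u \<le> S * (m u * exp (2 * \<Lambda> u))" by (simp add: algebra_simps)
  qed
  also have "\<dots> = S * ((exp (2 * \<Lambda> s) - 1) / 2)"
    using integral_exp_weight[OF s(1)] by simp
  finally have "x s \<le> c + S * (exp (2 * \<Lambda> s) / 2)" using S by (simp add: right_diff_distrib diff_divide_distrib)
  then have "exp (- 2 * \<Lambda> s) * x s \<le> exp (- 2 * \<Lambda> s) * (c + S * (exp (2 * \<Lambda> s) / 2))"
    by simp
  also have "\<dots> = exp (- 2 * \<Lambda> s) * c + S / 2"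
    by (simp add: algebra_simps exp_minus)
  also have "\<dots> \<le> c + S / 2"
    using weight_nonneg[OF s(1)] c by (simp add: mult_left_le_one_le)
  finally have "S \<le> 2 * c" by (simp add: S_def)
  then have "x t \<le> 2 * c * exp (2 * \<Lambda> t)" using bd[OF t] by (meson exp_ge_zero mult_right_mono order_trans)
  also have "\<dots> \<le> 2 * c * exp (2 * \<Lambda> b)" using weight_mono[of t b] t c by (intro mult_left_mono) auto
  finally show ?thesis by (simp add: mult_ac)
qed

end

definition mat_size :: "(real \<Rightarrow> complex^'k^'k) \<Rightarrow> real \<Rightarrow> real" where
  "mat_size M t = (\<Sum>i\<in>UNIV. \<Sum>j\<in>UNIV. norm (M t $ i $ j))"

lemma mat_size_nonneg: "0 \<le> mat_size M t"
  unfolding mat_size_def by (intro sum_nonneg) auto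

lemma sum_norm_matrix_vector_le:
  "(\<Sum>i\<in>UNIV. norm ((M t *v x) $ i)) \<le> mat_size M t * norm x"
proof -
  have "norm ((M t *v x) $ i) \<le> (\<Sum>j\<in>UNIV. norm (M t $ i $ j)) * norm x" for i
  proof -
    have "norm ((M t *v x) $ i) \<le> (\<Sum>j\<in>UNIV. norm (M t $ i $ j * x $ j))"
      unfolding matrix_vector_mult_def by (simp add: norm_sum)
    also have "\<dots> \<le> (\<Sum>j\<in>UNIV. norm (M t $ i $ j) * norm x)"
      by (rule sum_mono) (simp add: norm_mult mult_left_mono Finite_Cartesian_Product.norm_nth_le)
    finally show ?thesis by (simp add: sum_distrib_right)
  qed
  then show ?thesis unfolding mat_size_def sum_distrib_right by (intro sum_mono)
qed

lemma integrable_mat_size: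
  assumes "M \<in> sobolev_mat n p a b"
  shows "integrable L (mat_size M)"
  unfolding mat_size_def[abs_def]
  using assms sobolev_imp_integrable unfolding sobolev_mat_def
  by (intro Bochner_Integration.integrable_sum integrable_norm) blast

lemma Lp_mult_continuous:
  fixes f x :: "real \<Rightarrow> complex"
  assumes f: "in_Lp p L f" and x: "continuous_on {a..b} x" and c: "\<And>t. t \<in> {a..b} \<Longrightarrow> norm (x t) \<le> c"
  shows "in_Lp p L (\<lambda>t. f t * x t)" "Lp_norm p L (\<lambda>t. f t * x t) \<le> c * Lp_norm p L f"
proof -
  have "norm (x a) \<le> c" using c ab by simp
  then have c0: "0 \<le> c" using norm_ge_zero order_trans by blast
  have xm: "x \<in> borel_measurable L" using x by (intro continuous_imp_measurable_on_sets_lebesgue) auto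
  have m: "(\<lambda>t. f t * x t) \<in> borel_measurable L" using in_Lp_measurable[OF f] xm by simp
  have le: "AE t in L. norm (f t * x t) \<le> c * norm (f t)"
    using c by (intro AE_I2) (simp add: norm_mult mult.commute[of "norm (f _)"] mult_right_mono)
  show "in_Lp p L (\<lambda>t. f t * x t)" "Lp_norm p L (\<lambda>t. f t * x t) \<le> c * Lp_norm p L f"
    by (rule Lp_mono[OF f m c0 le])+
qed

text \<open>\<open>X' = M X + G\<close> in integral form, which makes sense for merely integrable \<open>M\<close> and \<open>G\<close>.\<close>

definition solves_system ::
    "(real \<Rightarrow> complex^'k^'k) \<Rightarrow> (real \<Rightarrow> complex^'k) \<Rightarrow> (real \<Rightarrow> complex^'k) \<Rightarrow> bool" where
  "solves_system M G X \<longleftrightarrow> continuous_on {a..b} X \<and>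
     (\<forall>i. \<forall>t\<in>{a..b}. X t $ i = X a $ i + integral {a..t} (\<lambda>s. (M s *v X s) $ i + G s $ i))"

text \<open>Within the fixed point argument and at the start of the regularity proof nothing beyond
  continuity of x is known.\<close>

lemma matrix_vector_continuous_in_Lp:
  assumes M: "M \<in> sobolev_mat n p a b" and x: "continuous_on {a..b} x"
  shows "in_Lp p L (\<lambda>s. (M s *v x s) $ i)"
proof -
  have "bounded (x ` {a..b})"
    using x by (intro compact_imp_bounded compact_continuous_image) auto
  then obtain c where c: "\<And>t. t \<in> {a..b} \<Longrightarrow> norm (x t) \<le> c"
    by (metis bounded_iff imageI)
  have "in_Lp p L (\<lambda>s. M s $ i $ j * x s $ j)" for j
    using c Finite_Cartesian_Product.norm_nth_le[of "x _" j] M unfolding sobolev_mat_def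
    by (intro Lp_mult_continuous(1)[of _ _ c] sobolev_imp_in_Lp[of _ n] continuous_on_component x)
       (auto intro: order_trans)
  then show ?thesis unfolding matrix_vector_mult_def by (simp add: Lp_sum(1))
qed

lemma system_existence:
  fixes M :: "real \<Rightarrow> complex^'k^'k"
  assumes M: "M \<in> sobolev_mat n p a b" and G: "G \<in> sobolev_vec n p a b"
  obtains X where "solves_system M G X" "X a = q"
proof -
  let ?m = "mat_size M"
  define \<Lambda> where "\<Lambda> t = integral {a..t} ?m" for t
  note mi = integrable_mat_size[OF M]
  note weight = weight_continuous[OF mi mat_size_nonneg, folded \<Lambda>_def]
  \<comment> \<open>\<open>bcontfun\<close> consists of functions on the whole line; composition
    with the projection \<open>cl\<close> to [a, b] turns the Picard iterates into such
    functions.\<close>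
  define cl where "cl t = max a (min b t)" for t
  have cl: "cl t \<in> {a..b}" for t using ab by (auto simp: cl_def)
  have cl_id: "t \<in> {a..b} \<Longrightarrow> cl t = t" for t by (auto simp: cl_def)
  have clc: "continuous_on UNIV cl" unfolding cl_def by (intro continuous_intros)
  \<comment> \<open>z stands for exp (- 2 \<Lambda>) X, so that the plain supremum distance of z is
    the weighted one of X = \<open>U z\<close>.\<close>
  define U where "U z s = exp (2 * \<Lambda> s) *\<^sub>R apply_bcontfun z s" for z :: "real \<Rightarrow>\<^sub>C (complex^'k)" and s
  have Uc: "continuous_on {a..b} (U z)" for z
    unfolding U_def by (intro continuous_on_scaleR continuous_intros weight continuous_on_apply_bcontfun)
  define H where "H z i s = (M s *v U z s) $ i + G s $ i" for z i s
  have HI: "integrable L (H z i)" for z i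
    unfolding H_def[abs_def]
    using matrix_vector_continuous_in_Lp[OF M Uc] G sobolev_imp_integrable Lp_imp_L1(1)
    unfolding sobolev_vec_def by (intro Bochner_Integration.integrable_add) blast+
  define V where "V z t = q + (\<chi> i. integral {a..t} (H z i))" for z t
  have Vc: "continuous_on {a..b} (V z)" for z
    unfolding V_def
    by (intro continuous_intros continuous_on_vec_lambda ac_on_imp_continuous_on[OF ac_on_integral[OF HI]])
  define P where "P z t = exp (- 2 * \<Lambda> (cl t)) *\<^sub>R V z (cl t)" for z t
  have Pb: "P z \<in> bcontfun" for z
  proof -
    have c: "continuous_on {a..b} (\<lambda>t. exp (- 2 * \<Lambda> t) *\<^sub>R V z t)"
      by (intro continuous_intros weight Vc)
    have "bounded ((\<lambda>t. exp (- 2 * \<Lambda> t) *\<^sub>R V z t) ` {a..b})"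
      using c by (intro compact_imp_bounded compact_continuous_image) auto
    then obtain C where C: "\<forall>x\<in>(\<lambda>t. exp (- 2 * \<Lambda> t) *\<^sub>R V z t) ` {a..b}. norm x \<le> C"
      unfolding bounded_iff by blast
    show ?thesis
    proof (rule bcontfun_normI)
      show "continuous_on UNIV (P z)"
        unfolding P_def by (rule continuous_on_compose2[OF c clc]) (use cl in auto)
      show "norm (P z t) \<le> C" for t unfolding P_def using cl C by blast
    qed
  qed
  have contr: "dist (Bcontfun (P y)) (Bcontfun (P z)) \<le> 1 / 2 * dist y z" for y z
  proof (rule dist_bound)
    fix t
    let ?t = "cl t" and ?d = "dist y z"
    have t: "?t \<in> {a..b}" by (rule cl)
    have Hd: "norm (\<Sum>i\<in>UNIV. norm (H y i s - H z i s)) \<le> ?d * (?m s * exp (2 * \<Lambda> s))" for s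
    proof -
      have "H y i s - H z i s = (M s *v (U y s - U z s)) $ i" for i
        by (simp add: H_def matrix_vector_mult_diff_distrib)
      then have "(\<Sum>i\<in>UNIV. norm (H y i s - H z i s)) \<le> ?m s * norm (U y s - U z s)"
        using sum_norm_matrix_vector_le by simp
      also have "norm (U y s - U z s) = exp (2 * \<Lambda> s) * dist (apply_bcontfun y s) (apply_bcontfun z s)"
        unfolding U_def by (simp add: dist_norm flip: scaleR_diff_right)
      also have "?m s * \<dots> \<le> ?m s * (exp (2 * \<Lambda> s) * ?d)"
        by (intro mult_left_mono dist_bounded mat_size_nonneg) auto
      finally show ?thesis by (simp add: mult_ac sum_nonneg)
    qed
    have Hi: "H z i integrable_on {a..?t}" for z i
      using integrable_on_Icc[OF HI] t ab by auto
    have ni: "(\<lambda>s. norm (H y i s - H z i s)) integrable_on {a..?t}" for i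
    proof -
      have "integrable L (\<lambda>s. norm (H y i s - H z i s))" using HI by auto
      from integrable_on_Icc[OF this] show ?thesis using t ab by auto
    qed
    have "norm (V y ?t - V z ?t) \<le> (\<Sum>i\<in>UNIV. norm (integral {a..?t} (H y i) - integral {a..?t} (H z i)))"
      by (rule order_trans[OF norm_vec_le_sum]) (simp add: V_def)
    also have "\<dots> \<le> (\<Sum>i\<in>UNIV. integral {a..?t} (\<lambda>s. norm (H y i s - H z i s)))"
    proof (rule sum_mono)
      fix i
      have "integral {a..?t} (H y i) - integral {a..?t} (H z i) = integral {a..?t} (\<lambda>s. H y i s - H z i s)"
        by (rule Henstock_Kurzweil_Integration.integral_diff[symmetric]) (rule Hi)+
      then show "norm (integral {a..?t} (H y i) - integral {a..?t} (H z i)) \<le> integral {a..?t} (\<lambda>s. norm (H y i s - H z i s))"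
        using integral_norm_bound_integral[of "\<lambda>s. H y i s - H z i s" "{a..?t}" "\<lambda>s. norm (H y i s - H z i s)"]
          Hi[of y i] Hi[of z i] ni[of i]
        by (simp add: Henstock_Kurzweil_Integration.integrable_diff)
    qed
    also have "\<dots> = integral {a..?t} (\<lambda>s. \<Sum>i\<in>UNIV. norm (H y i s - H z i s))"
      by (rule Henstock_Kurzweil_Integration.integral_sum[symmetric]) (use ni in auto)
    also have "\<dots> \<le> integral {a..?t} (\<lambda>s. ?d * (?m s * exp (2 * \<Lambda> s)))"
    proof (rule integral_le)
      show "(\<lambda>s. \<Sum>i\<in>UNIV. norm (H y i s - H z i s)) integrable_on {a..?t}"
        by (rule Henstock_Kurzweil_Integration.integrable_sum) (use ni in auto)
      show "(\<lambda>s. ?d * (?m s * exp (2 * \<Lambda> s))) integrable_on {a..?t}"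
        using integrable_on_Icc[OF integrable_exp_weight[OF mi mat_size_nonneg, folded \<Lambda>_def], of a ?t] t ab
        by (intro integrable_on_mult_right) auto
      show "(\<Sum>i\<in>UNIV. norm (H y i s - H z i s)) \<le> ?d * (?m s * exp (2 * \<Lambda> s))" for s
        using Hd[of s] by simp
    qed
    also have "\<dots> = ?d * ((exp (2 * \<Lambda> ?t) - 1) / 2)"
      using integral_exp_weight[OF mi mat_size_nonneg t, folded \<Lambda>_def] by simp
    \<comment> \<open>The remaining exponential is cancelled by the weight in P, which leaves the
      contraction constant 1/2.\<close>
    also have "\<dots> \<le> ?d * (exp (2 * \<Lambda> ?t) / 2)" by (intro mult_left_mono) auto
    finally have main: "norm (V y ?t - V z ?t) \<le> ?d * (exp (2 * \<Lambda> ?t) / 2)" .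
    have "dist (P y t) (P z t) = exp (- 2 * \<Lambda> ?t) * norm (V y ?t - V z ?t)"
      by (simp add: P_def dist_norm flip: scaleR_diff_right)
    also have "\<dots> \<le> exp (- 2 * \<Lambda> ?t) * (?d * (exp (2 * \<Lambda> ?t) / 2))" by (intro mult_left_mono main) simp
    also have "\<dots> = 1 / 2 * ?d" by (simp add: exp_minus)
    finally show "dist (apply_bcontfun (Bcontfun (P y)) t) (apply_bcontfun (Bcontfun (P z)) t) \<le> 1 / 2 * dist y z"
      by (simp add: Bcontfun_inverse[OF Pb])
  qed
  obtain z where z: "Bcontfun (P z) = z"
    using banach_fix_type[of "1/2" "\<lambda>z. Bcontfun (P z)"] contr by auto
  then have zP: "apply_bcontfun z t = P z t" for t
    by (metis Bcontfun_inverse Pb)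
  have UV: "U z t = V z t" if t: "t \<in> {a..b}" for t
    unfolding U_def zP P_def cl_id[OF t] by (simp add: exp_minus)
  have "solves_system M G (U z)"
    unfolding solves_system_def
  proof (intro conjI allI ballI Uc)
    fix i t assume t: "t \<in> {a..b}"
    have "U z t $ i = q $ i + integral {a..t} (H z i)" "U z a $ i = q $ i"
      using UV[OF t] UV[of a] ab by (simp_all add: V_def)
    then show "U z t $ i = U z a $ i + integral {a..t} (\<lambda>s. (M s *v U z s) $ i + G s $ i)"
      by (simp add: H_def[abs_def])
  qed
  moreover have "U z a = q" using UV[of a] ab by (simp add: V_def vec_eq_iff)
  ultimately show thesis by (rule that)
qed


section \<open>Vector-valued and matrix-valued Sobolev functions\<close>

abbreviation "Wv n \<equiv> sobolev_vec n p a b"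
abbreviation "nv n \<equiv> sobolev_vec_norm n p a b"
abbreviation "nm n \<equiv> sobolev_mat_norm n p a b"

lemma sobolev_vec_component: "f \<in> Wv n \<Longrightarrow> (\<lambda>t. f t $ i) \<in> W n"
  by (simp add: sobolev_vec_def)

lemma sobolev_mat_component: "F \<in> sobolev_mat n p a b \<Longrightarrow> (\<lambda>t. F t $ i $ j) \<in> W n"
  by (simp add: sobolev_mat_def)

lemma nv_nonneg: "f \<in> Wv n \<Longrightarrow> 0 \<le> nv n f"
  unfolding sobolev_vec_norm_def by (intro sum_nonneg nrm_nonneg sobolev_vec_component)

lemma nm_nonneg: "F \<in> sobolev_mat n p a b \<Longrightarrow> 0 \<le> nm n F"
  unfolding sobolev_mat_norm_def by (intro sum_nonneg nrm_nonneg sobolev_mat_component)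

lemma nrm_component_le: "f \<in> Wv n \<Longrightarrow> nrm n (\<lambda>t. f t $ i) \<le> nv n f"
  unfolding sobolev_vec_norm_def
  by (rule member_le_sum[of i UNIV "\<lambda>i. nrm n (\<lambda>t. f t $ i)"]) (auto intro: nrm_nonneg sobolev_vec_component)

lemma nrm_mat_component_le: "F \<in> sobolev_mat n p a b \<Longrightarrow> nrm n (\<lambda>t. F t $ i $ j) \<le> nm n F"
proof -
  assume F: "F \<in> sobolev_mat n p a b"
  have "nrm n (\<lambda>t. F t $ i $ j) \<le> (\<Sum>j\<in>UNIV. nrm n (\<lambda>t. F t $ i $ j))"
    by (rule member_le_sum[of j UNIV "\<lambda>j. nrm n (\<lambda>t. F t $ i $ j)"]) (auto intro: nrm_nonneg sobolev_mat_component[OF F])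
  also have "\<dots> \<le> nm n F"
    unfolding sobolev_mat_norm_def
    by (rule member_le_sum[of i UNIV "\<lambda>i. \<Sum>j\<in>UNIV. nrm n (\<lambda>t. F t $ i $ j)"])
       (auto intro!: sum_nonneg nrm_nonneg sobolev_mat_component[OF F])
  finally show ?thesis .
qed

lemma nv_add: "f \<in> Wv n \<Longrightarrow> g \<in> Wv n \<Longrightarrow> nv n (\<lambda>t. f t + g t) \<le> nv n f + nv n g"
  unfolding sobolev_vec_norm_def sum.distrib[symmetric]
  by (intro sum_mono) (simp add: sobolev_add(2) sobolev_vec_component)

lemma sobolev_vec_add: "f \<in> Wv n \<Longrightarrow> g \<in> Wv n \<Longrightarrow> (\<lambda>t. f t + g t) \<in> Wv n"
  unfolding sobolev_vec_def by (simp add: sobolev_add(1))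

lemma sobolev_vec_diff: "f \<in> Wv n \<Longrightarrow> g \<in> Wv n \<Longrightarrow> (\<lambda>t. f t - g t) \<in> Wv n"
  unfolding sobolev_vec_def by (simp add: sobolev_diff(1))

lemma nv_diff: "f \<in> Wv n \<Longrightarrow> g \<in> Wv n \<Longrightarrow> nv n (\<lambda>t. f t - g t) \<le> nv n f + nv n g"
  unfolding sobolev_vec_norm_def sum.distrib[symmetric]
  by (intro sum_mono) (simp add: sobolev_diff(2) sobolev_vec_component)

lemma sobolev_vec_scale: "f \<in> Wv n \<Longrightarrow> (\<lambda>t. c *s f t) \<in> Wv n"
  unfolding sobolev_vec_def by (simp add: sobolev_cmult(1))

lemma nv_scale: "f \<in> Wv n \<Longrightarrow> nv n (\<lambda>t. c *s f t) \<le> norm c * nv n f"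
  unfolding sobolev_vec_norm_def sum_distrib_left
  by (intro sum_mono) (simp add: sobolev_cmult(2) sobolev_vec_component)

lemma sobolev_vec_zero: "(\<lambda>t. 0) \<in> Wv n"
  by (simp add: sobolev_vec_def sobolev_const)

lemma nv_zero: "nv n (\<lambda>t. 0) = 0"
  by (simp add: sobolev_vec_norm_def nrm_zero)

lemma sobolev_vec_sum:
  assumes "\<And>i. i \<in> J \<Longrightarrow> f i \<in> Wv n"
  shows "(\<lambda>t. \<Sum>i\<in>J. f i t) \<in> Wv n"
  using assms unfolding sobolev_vec_def by (auto intro!: sobolev_sum(1))

lemma nv_sum:
  assumes "\<And>i. i \<in> J \<Longrightarrow> f i \<in> Wv n"
  shows "nv n (\<lambda>t. \<Sum>i\<in>J. f i t) \<le> (\<Sum>i\<in>J. nv n (f i))"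
  using assms
proof (induction J rule: infinite_finite_induct)
  case (insert i J)
  have "nv n (\<lambda>t. f i t + (\<Sum>i\<in>J. f i t)) \<le> nv n (f i) + nv n (\<lambda>t. \<Sum>i\<in>J. f i t)"
    using insert by (intro nv_add sobolev_vec_sum) auto
  then show ?case using insert by simp
qed (auto simp: nv_zero)

lemma nv_mono: "f \<in> Wv n \<Longrightarrow> m \<le> n \<Longrightarrow> nv m f \<le> nv n f"
  unfolding sobolev_vec_norm_def by (intro sum_mono nrm_mono sobolev_vec_component)

lemma sobolev_vec_mono: "f \<in> Wv n \<Longrightarrow> m \<le> n \<Longrightarrow> f \<in> Wv m"
  unfolding sobolev_vec_def by (auto intro: sobolev_mono)

lemma sobolev_mat_mono: "F \<in> sobolev_mat n p a b \<Longrightarrow> m \<le> n \<Longrightarrow> F \<in> sobolev_mat m p a b"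
  unfolding sobolev_mat_def by (auto intro: sobolev_mono)

lemma nv_sup_bound:
  assumes f: "f \<in> Wv (Suc n)" and t: "t \<in> {a..b}"
  shows "norm (f t) \<le> sup_const * nv (Suc n) f"
proof -
  have "norm (f t) \<le> (\<Sum>i\<in>UNIV. norm (f t $ i))" by (rule norm_vec_le_sum)
  also have "\<dots> \<le> (\<Sum>i\<in>UNIV. sup_const * nrm (Suc n) (\<lambda>t. f t $ i))"
    by (intro sum_mono sobolev_sup_bound sobolev_vec_component f t)
  finally show ?thesis by (simp add: sobolev_vec_norm_def sum_distrib_left)
qed

lemma sobolev_vec_Suc_continuous:
  assumes "f \<in> Wv (Suc n)"
  shows "continuous_on {a..b} f"
proof -
  have "continuous_on {a..b} (\<lambda>t. f t $ i)" for i
    by (rule sobolev_Suc_continuous[OF sobolev_vec_component[OF assms]])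
  from continuous_on_vec_lambda[of "{a..b}" "\<lambda>i t. f t $ i", OF this] show ?thesis by simp
qed

lemma nrm_matrix_vector_le:
  assumes F: "F \<in> sobolev_mat n p a b" and x: "x \<in> Wv (max n 1)"
  shows "(\<lambda>t. (F t *v x t) $ i) \<in> W n"
    "nrm n (\<lambda>t. (F t *v x t) $ i) \<le> mult_const n * (\<Sum>j\<in>UNIV. nrm n (\<lambda>t. F t $ i $ j)) * nv (max n 1) x"
proof -
  have W: "(\<lambda>t. F t $ i $ j * x t $ j) \<in> W n" for j
    by (intro sobolev_mult(1) sobolev_mat_component[OF F] sobolev_vec_component[OF x])
  show "(\<lambda>t. (F t *v x t) $ i) \<in> W n"
    unfolding matrix_vector_mult_def by (simp add: sobolev_sum(1) W)
  have "nrm n (\<lambda>t. (F t *v x t) $ i) \<le> (\<Sum>j\<in>UNIV. nrm n (\<lambda>t. F t $ i $ j * x t $ j))"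
    unfolding matrix_vector_mult_def using sobolev_sum(2)[of UNIV "\<lambda>j t. F t $ i $ j * x t $ j"] W by simp
  also have "\<dots> \<le> (\<Sum>j\<in>UNIV. mult_const n * nrm n (\<lambda>t. F t $ i $ j) * nv (max n 1) x)"
  proof (rule sum_mono)
    fix j
    have "nrm n (\<lambda>t. F t $ i $ j * x t $ j) \<le> mult_const n * nrm n (\<lambda>t. F t $ i $ j) * nrm (max n 1) (\<lambda>t. x t $ j)"
      by (intro sobolev_mult(2) sobolev_mat_component[OF F] sobolev_vec_component[OF x])
    also have "\<dots> \<le> mult_const n * nrm n (\<lambda>t. F t $ i $ j) * nv (max n 1) x"
      using nrm_component_le[OF x] mult_const_nonneg nrm_nonneg[OF sobolev_mat_component[OF F]]
      by (intro mult_left_mono) auto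
    finally show "nrm n (\<lambda>t. F t $ i $ j * x t $ j) \<le> mult_const n * nrm n (\<lambda>t. F t $ i $ j) * nv (max n 1) x" .
  qed
  finally show "nrm n (\<lambda>t. (F t *v x t) $ i) \<le> mult_const n * (\<Sum>j\<in>UNIV. nrm n (\<lambda>t. F t $ i $ j)) * nv (max n 1) x"
    by (simp add: sum_distrib_left sum_distrib_right)
qed

lemma sobolev_matrix_vector:
  assumes F: "F \<in> sobolev_mat n p a b" and x: "x \<in> Wv (max n 1)"
  shows "(\<lambda>t. F t *v x t) \<in> Wv n" "nv n (\<lambda>t. F t *v x t) \<le> mult_const n * nm n F * nv (max n 1) x"
proof -
  show "(\<lambda>t. F t *v x t) \<in> Wv n" unfolding sobolev_vec_def using nrm_matrix_vector_le(1)[OF F x] by simp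
  have "nv n (\<lambda>t. F t *v x t) \<le> (\<Sum>i\<in>UNIV. mult_const n * (\<Sum>j\<in>UNIV. nrm n (\<lambda>t. F t $ i $ j)) * nv (max n 1) x)"
    unfolding sobolev_vec_norm_def[of n p a b "\<lambda>t. F t *v x t"] by (intro sum_mono nrm_matrix_vector_le(2) F x)
  then show "nv n (\<lambda>t. F t *v x t) \<le> mult_const n * nm n F * nv (max n 1) x"
    unfolding sobolev_mat_norm_def by (simp add: sum_distrib_left sum_distrib_right)
qed

text \<open>Bootstrapping: if M X lies in W^k with k \<le> n, integration puts X into W^(k+1), and
  then M X lies in W^(k+1) as long as k < n. Continuity of X starts the chain.\<close>

lemma system_regularity:
  assumes M: "M \<in> sobolev_mat n p a b" and G: "G \<in> Wv n" and X: "solves_system M G X"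
  shows "X \<in> Wv (Suc n)" "weq n (D (\<lambda>t. X t $ i)) (\<lambda>s. (M s *v X s) $ i + G s $ i)"
proof -
  have eq: "X t $ i = X a $ i + integral {a..t} (\<lambda>s. (M s *v X s) $ i + G s $ i)" if "t \<in> {a..b}" for i t
    using X that unfolding solves_system_def by blast
  have step: "(\<lambda>t. X t $ i) \<in> W (Suc k)" if "(\<lambda>s. (M s *v X s) $ i) \<in> W k" "k \<le> n" for k i
    by (rule sobolev_SucI(1)[OF _ eq])
       (intro sobolev_add(1) that sobolev_mono[OF sobolev_vec_component[OF G]])
  have R: "(\<lambda>s. (M s *v X s) $ i) \<in> W k" if "k \<le> n" for k i
    using that
  proof (induction k arbitrary: i)
    case 0
    show ?case
      using matrix_vector_continuous_in_Lp[OF M] X by (simp add: sobolev_0 solves_system_def)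
  next
    case (Suc k)
    then have "X \<in> Wv (Suc k)" using step[OF Suc.IH] by (simp add: sobolev_vec_def)
    then show ?case
      using nrm_matrix_vector_le(1)[OF sobolev_mat_mono[OF M Suc.prems], of X] by simp
  qed
  show "X \<in> Wv (Suc n)" using step[OF R] by (simp add: sobolev_vec_def)
  show "weq n (D (\<lambda>t. X t $ i)) (\<lambda>s. (M s *v X s) $ i + G s $ i)"
    by (rule sobolev_SucI(2)[OF _ eq]) (intro sobolev_add(1) R sobolev_vec_component[OF G] order_refl)
qed

section \<open>A priori estimates for systems\<close>

definition system_residual :: "(real \<Rightarrow> complex^'k^'k) \<Rightarrow> (real \<Rightarrow> complex^'k) \<Rightarrow> real \<Rightarrow> complex^'k" where
  "system_residual M X t = (\<chi> i. D (\<lambda>t. X t $ i) t - (M t *v X t) $ i)"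

lemma system_residual_sobolev:
  assumes M: "M \<in> sobolev_mat n p a b" and X: "X \<in> Wv (Suc n)"
  shows "system_residual M X \<in> Wv n"
proof -
  have X': "X \<in> Wv (max n 1)" by (rule sobolev_vec_mono[OF X]) simp
  have "(\<lambda>t. D (\<lambda>t. X t $ i) t - (M t *v X t) $ i) \<in> W n" for i
    by (intro sobolev_diff(1) sobolev_SucD(1) sobolev_vec_component[OF X] nrm_matrix_vector_le(1)[OF M X'])
  then show ?thesis
    unfolding sobolev_vec_def system_residual_def by simp
qed

text \<open>Gronwall's inequality for |X|, with the initial value and the integrated residual as
  constant term.\<close>

lemma system_sup_estimate:
  fixes M :: "real \<Rightarrow> complex^'k^'k"
  assumes M: "M \<in> sobolev_mat n p a b"
  shows "\<exists>K\<ge>0. \<forall>X\<in>Wv (Suc n). \<forall>t\<in>{a..b}. norm (X t) \<le> K * (norm (X a) + nv n (system_residual M X))"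
proof -
  let ?m = "mat_size M"
  define K where "K = 2 * exp (2 * integral {a..b} ?m)"
  note mi = integrable_mat_size[OF M]
  show ?thesis
  proof (intro exI[of _ "K * (1 + L1_const)"] conjI ballI)
    show "0 \<le> K * (1 + L1_const)" using L1_const_pos by (simp add: K_def)
    fix X :: "real \<Rightarrow> complex^'k" and t assume X: "X \<in> Wv (Suc n)" and t: "t \<in> {a..b}"
    let ?R = "system_residual M X"
    have RW: "?R \<in> Wv n" by (rule system_residual_sobolev[OF M X])
    have Xc: "continuous_on {a..b} X" by (rule sobolev_vec_Suc_continuous[OF X])
    let ?c = "norm (X a) + L1_const * nv n ?R"
    have c: "0 \<le> ?c" using L1_const_pos nv_nonneg[OF RW] by simp
    have "norm (X t) \<le> K * ?c"
      unfolding K_def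
    proof (rule gronwall[OF mi mat_size_nonneg _ _ c _ t])
      show "continuous_on {a..b} (\<lambda>t. norm (X t))" by (intro continuous_intros Xc)
      fix t assume t: "t \<in> {a..b}"
      show "norm (X t) \<le> ?c + integral {a..t} (\<lambda>s. ?m s * norm (X s))"
      proof -
        have MXi: "integrable L (\<lambda>s. (M s *v X s) $ i)" for i
          by (rule Lp_imp_L1(1)[OF matrix_vector_continuous_in_Lp[OF M Xc]])
        have MX: "(\<lambda>s. (M s *v X s) $ i) integrable_on {a..t}" for i
          using integrable_on_Icc[OF MXi] t ab by auto
        have nMX: "(\<lambda>s. norm ((M s *v X s) $ i)) integrable_on {a..t}" for i
          using integrable_on_Icc[OF integrable_norm[OF MXi]] t ab by auto
        have Ri: "(\<lambda>s. ?R s $ i) integrable_on {a..t}" for i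
          by (rule sobolev_integrable_on[OF sobolev_vec_component[OF RW] t])
        have "X t $ i = X a $ i + (integral {a..t} (\<lambda>s. (M s *v X s) $ i) + integral {a..t} (\<lambda>s. ?R s $ i))" for i
        proof -
          have "D (\<lambda>t. X t $ i) = (\<lambda>s. (M s *v X s) $ i + ?R s $ i)"
            by (simp add: system_residual_def)
          then show ?thesis
            using sobolev_SucD(2)[OF sobolev_vec_component[OF X] t, of i]
              Henstock_Kurzweil_Integration.integral_add[OF MX[of i] Ri[of i]] by metis
        qed
        then have Xt: "X t - X a = (\<chi> i. integral {a..t} (\<lambda>s. (M s *v X s) $ i) + integral {a..t} (\<lambda>s. ?R s $ i))"
          by (simp add: vec_eq_iff)
        have "norm (X t) \<le> norm (X a) + norm (X t - X a)"
          by (metis add.commute diff_add_cancel norm_triangle_ineq)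
        also have "norm (X t - X a) \<le> (\<Sum>i\<in>UNIV. norm (integral {a..t} (\<lambda>s. (M s *v X s) $ i)) + norm (integral {a..t} (\<lambda>s. ?R s $ i)))"
          unfolding Xt by (rule order_trans[OF norm_vec_le_sum]) (simp add: sum_mono norm_triangle_ineq)
        also have "\<dots> \<le> (\<Sum>i\<in>UNIV. integral {a..t} (\<lambda>s. norm ((M s *v X s) $ i)) + L1_const * nrm n (\<lambda>s. ?R s $ i))"
          by (intro sum_mono add_mono integral_norm_le_nrm sobolev_vec_component[OF RW] t integral_norm_bound_integral MX nMX) auto
        also have "\<dots> = integral {a..t} (\<lambda>s. \<Sum>i\<in>UNIV. norm ((M s *v X s) $ i)) + L1_const * nv n ?R"
          using nMX by (simp add: sum.distrib sobolev_vec_norm_def sum_distrib_left Henstock_Kurzweil_Integration.integral_sum)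
        also have "integral {a..t} (\<lambda>s. \<Sum>i\<in>UNIV. norm ((M s *v X s) $ i)) \<le> integral {a..t} (\<lambda>s. ?m s * norm (X s))"
        proof (rule integral_le)
          show "(\<lambda>s. ?m s * norm (X s)) integrable_on {a..t}"
            using integrable_on_Icc[OF integrable_mult_continuous[OF mi continuous_on_norm[OF Xc]]] t ab by auto
          show "(\<lambda>s. \<Sum>i\<in>UNIV. norm ((M s *v X s) $ i)) integrable_on {a..t}"
            using nMX by (intro Henstock_Kurzweil_Integration.integrable_sum) auto
        qed (rule sum_norm_matrix_vector_le)
        finally show ?thesis by simp
      qed
    qed simp
    also have "\<dots> \<le> K * ((1 + L1_const) * (norm (X a) + nv n ?R))"
      using L1_const_pos nv_nonneg[OF RW] by (intro mult_left_mono) (auto simp: K_def algebra_simps)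
    finally show "norm (X t) \<le> K * (1 + L1_const) * (norm (X a) + nv n ?R)" by (simp add: mult.assoc)
  qed
qed

lemma nv_Suc_le:
  fixes X :: "real \<Rightarrow> complex^'k"
  assumes M: "M \<in> sobolev_mat n p a b" and X: "X \<in> Wv (Suc n)"
    and MX: "\<And>i. nrm n (\<lambda>t. (M t *v X t) $ i) \<le> c"
  shows "nv (Suc n) X \<le> init_const * real CARD('k) * (norm (X a) + nv n (system_residual M X) + c)"
proof -
  let ?R = "system_residual M X"
  have RW: "?R \<in> Wv n" by (rule system_residual_sobolev[OF M X])
  have X': "X \<in> Wv (max n 1)" by (rule sobolev_vec_mono[OF X]) simp
  have "nrm (Suc n) (\<lambda>t. X t $ i) \<le> init_const * (norm (X a) + nv n ?R + c)" for i
  proof -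
    have "D (\<lambda>t. X t $ i) = (\<lambda>s. (M s *v X s) $ i + ?R s $ i)"
      by (simp add: system_residual_def)
    then have "nrm n (D (\<lambda>t. X t $ i)) \<le> c + nv n ?R"
      using sobolev_add(2)[OF nrm_matrix_vector_le(1)[OF M X', of i] sobolev_vec_component[OF RW, of i]]
        MX[of i] nrm_component_le[OF RW, of i] by simp
    moreover have "norm (X a $ i) \<le> norm (X a)" by (rule Finite_Cartesian_Product.norm_nth_le)
    ultimately have "init_const * (norm (X a $ i) + nrm n (D (\<lambda>t. X t $ i))) \<le> init_const * (norm (X a) + nv n ?R + c)"
      using init_const_ge_1 by (intro mult_left_mono) auto
    then show ?thesis using nrm_Suc_le_initial[OF sobolev_vec_component[OF X, of i]] by simp
  qed
  then have "nv (Suc n) X \<le> (\<Sum>i\<in>(UNIV :: 'k set). init_const * (norm (X a) + nv n ?R + c))"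
    unfolding sobolev_vec_norm_def by (intro sum_mono)
  then show ?thesis by (simp add: mult_ac)
qed

lemma system_residual_mono:
  assumes M: "M \<in> sobolev_mat n p a b" and X: "X \<in> Wv (Suc n)" and k: "k \<le> n"
  shows "nv k (system_residual M X) \<le> nv n (system_residual M X)"
  by (rule nv_mono[OF system_residual_sobolev[OF M X] k])

text \<open>Each step gains a derivative: a bound for X in W^(n+1) bounds M X in the same norm,
  hence X' and so X in W^(n+2). For n = 0 the factor X in M X is measured by its supremum
  instead.\<close>

lemma system_estimate:
  fixes M :: "real \<Rightarrow> complex^'k^'k"
  assumes M: "M \<in> sobolev_mat n p a b"
  shows "\<exists>K\<ge>0. \<forall>X\<in>Wv (Suc n). nv (Suc n) X \<le> K * (norm (X a) + nv n (system_residual M X))"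
  using M
proof (induction n)
  case 0
  obtain S where S: "S \<ge> 0" "\<And>X t. X \<in> Wv (Suc 0) \<Longrightarrow> t \<in> {a..b} \<Longrightarrow>
      norm (X t) \<le> S * (norm (X a) + nv 0 (system_residual M X))"
    using system_sup_estimate[OF 0] by blast
  let ?N = "init_const * real CARD('k)"
  have N: "0 \<le> ?N" using init_const_ge_1 by simp
  show ?case
  proof (intro exI[of _ "?N * (1 + S * nm 0 M)"] conjI ballI)
    show "0 \<le> ?N * (1 + S * nm 0 M)" using S(1) nm_nonneg[OF 0] by (intro mult_nonneg_nonneg[OF N]) simp
    fix X :: "real \<Rightarrow> complex^'k" assume X: "X \<in> Wv (Suc 0)"
    let ?q = "norm (X a) + nv 0 (system_residual M X)"
    have q: "0 \<le> ?q" using nv_nonneg[OF system_residual_sobolev[OF 0 X]] by simp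
    have Xc: "continuous_on {a..b} X" by (rule sobolev_vec_Suc_continuous[OF X])
    have "nrm 0 (\<lambda>t. (M t *v X t) $ i) \<le> S * ?q * nm 0 M" for i
    proof -
      have MW: "in_Lp p L (\<lambda>t. M t $ i $ j)" for j
        using sobolev_mat_component[OF 0] by (simp add: sobolev_0)
      have b: "norm (X t $ j) \<le> S * ?q" if "t \<in> {a..b}" for t j
        using S(2)[OF X that] Finite_Cartesian_Product.norm_nth_le order_trans by blast
      note J = Lp_mult_continuous[OF MW continuous_on_component[OF Xc] b]
      have "nrm 0 (\<lambda>t. (M t *v X t) $ i) \<le> (\<Sum>j\<in>UNIV. Lp_norm p L (\<lambda>t. M t $ i $ j * X t $ j))"
        unfolding matrix_vector_mult_def nrm_0 using Lp_sum(2)[of UNIV "\<lambda>j t. M t $ i $ j * X t $ j"] J(1) by simp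
      also have "\<dots> \<le> (\<Sum>j\<in>UNIV. S * ?q * nrm 0 (\<lambda>t. M t $ i $ j))"
        unfolding nrm_0 by (rule sum_mono) (rule J(2))
      also have "\<dots> = S * ?q * (\<Sum>j\<in>UNIV. nrm 0 (\<lambda>t. M t $ i $ j))" by (simp add: sum_distrib_left)
      also have "(\<Sum>j\<in>UNIV. nrm 0 (\<lambda>t. M t $ i $ j)) \<le> nm 0 M"
        unfolding sobolev_mat_norm_def
        by (rule member_le_sum[of i UNIV "\<lambda>i. \<Sum>j\<in>UNIV. nrm 0 (\<lambda>t. M t $ i $ j)"])
           (auto intro!: sum_nonneg nrm_nonneg sobolev_mat_component[OF 0])
      finally show ?thesis using S(1) q by (simp add: mult_left_mono)
    qed
    from nv_Suc_le[OF 0 X this] show "nv (Suc 0) X \<le> ?N * (1 + S * nm 0 M) * ?q"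
      by (simp add: algebra_simps)
  qed
next
  case (Suc n)
  have M': "M \<in> sobolev_mat n p a b" by (rule sobolev_mat_mono[OF Suc.prems]) simp
  obtain K where K: "K \<ge> 0" "\<And>X. X \<in> Wv (Suc n) \<Longrightarrow> nv (Suc n) X \<le> K * (norm (X a) + nv n (system_residual M X))"
    using Suc.IH[OF M'] by blast
  let ?N = "init_const * real CARD('k)" and ?C = "mult_const (Suc n) * nm (Suc n) M"
  have N: "0 \<le> ?N" using init_const_ge_1 by simp
  have C: "0 \<le> ?C" using mult_const_nonneg nm_nonneg[OF Suc.prems] by simp
  show ?case
  proof (intro exI[of _ "?N * (1 + ?C * K)"] conjI ballI)
    show "0 \<le> ?N * (1 + ?C * K)" using mult_nonneg_nonneg[OF C K(1)] by (intro mult_nonneg_nonneg[OF N]) linarith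
    fix X :: "real \<Rightarrow> complex^'k" assume X: "X \<in> Wv (Suc (Suc n))"
    let ?q = "norm (X a) + nv (Suc n) (system_residual M X)"
    have X': "X \<in> Wv (Suc n)" by (rule sobolev_vec_mono[OF X]) simp
    have "nv (Suc n) X \<le> K * (norm (X a) + nv n (system_residual M X))" by (rule K(2)[OF X'])
    also have "\<dots> \<le> K * ?q" using system_residual_mono[OF Suc.prems X, of n] K(1) by (intro mult_left_mono) auto
    finally have nX: "nv (Suc n) X \<le> K * ?q" .
    have "nrm (Suc n) (\<lambda>t. (M t *v X t) $ i) \<le> ?C * (K * ?q)" for i
    proof -
      have MX: "(\<lambda>t. M t *v X t) \<in> Wv (Suc n)" "nv (Suc n) (\<lambda>t. M t *v X t) \<le> ?C * nv (Suc n) X"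
        using sobolev_matrix_vector[OF Suc.prems, of X] X' by auto
      have "?C * nv (Suc n) X \<le> ?C * (K * ?q)" by (rule mult_left_mono[OF nX C])
      then show ?thesis using MX(2) nrm_component_le[OF MX(1), of i] by linarith
    qed
    from nv_Suc_le[OF Suc.prems X this] show "nv (Suc (Suc n)) X \<le> ?N * (1 + ?C * K) * ?q"
      by (simp add: algebra_simps)
  qed
qed

end

section \<open>Reduction to a first-order system\<close>

lemma has_vector_derivative_vecI:
  fixes f :: "real \<Rightarrow> 'b::real_normed_vector ^ 'k"
  assumes "\<And>i. ((\<lambda>s. f s $ i) has_vector_derivative d $ i) (at t within S)"
  shows "(f has_vector_derivative d) (at t within S)"
  unfolding has_vector_derivative_def has_derivative_within
proof (intro conjI vec_tendstoI)
  show "bounded_linear (\<lambda>x. x *\<^sub>R d)" by (rule bounded_linear_scaleR_left)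
  fix i
  have "((\<lambda>y. (1 / norm (y - t)) *\<^sub>R (f y $ i - (f t $ i + (y - t) *\<^sub>R d $ i))) \<longlongrightarrow> 0) (at t within S)"
    using assms[of i] unfolding has_vector_derivative_def has_derivative_within by simp
  then show "((\<lambda>y. ((1 / norm (y - t)) *\<^sub>R (f y - (f t + (y - t) *\<^sub>R d))) $ i) \<longlongrightarrow> 0 $ i) (at t within S)"
    by simp
qed

context sobolev_interval
begin

lemma nth_deriv_Suc_outer: "nth_deriv a b (Suc k) f = D (nth_deriv a b k f)"
  by (simp add: fun_eq_iff D_def nth_deriv_Suc)

lemma sobolev_nth_deriv:
  assumes "f \<in> W (m + k)"
  shows "nth_deriv a b k f \<in> W m" "nrm m (nth_deriv a b k f) \<le> nrm (m + k) f"
proof -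
  have "nth_deriv a b k f \<in> W m \<and> nrm m (nth_deriv a b k f) \<le> nrm (m + k) f"
    using assms
  proof (induction k arbitrary: f)
    case (Suc k)
    then have f: "f \<in> W (Suc (m + k))" by simp
    have "nrm (m + k) (D f) \<le> nrm (Suc (m + k)) f"
      using Lp_norm_nonneg[OF sobolev_imp_in_Lp[OF f]] by (simp add: nrm_Suc)
    then show ?case using Suc.IH[OF sobolev_SucD(1)[OF f]] by (simp add: nth_deriv_Suc_D)
  qed simp
  then show "nth_deriv a b k f \<in> W m" "nrm m (nth_deriv a b k f) \<le> nrm (m + k) f" by auto
qed

lemma nrm_le_sum_nth_deriv:
  assumes "f \<in> W (n + r)" "1 \<le> r"
  shows "nrm (n + r) f \<le> (\<Sum>k<r. nrm (Suc n) (nth_deriv a b k f))"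
  using assms(2,1)
proof (induction r arbitrary: f rule: dec_induct)
  case base then show ?case by simp
next
  case (step r)
  then have f: "f \<in> W (Suc (n + r))" by simp
  have "f \<in> W (Suc n)" by (rule sobolev_mono[OF f]) simp
  then have "Lp_norm p L f \<le> nrm (Suc n) f" by (rule Lp_norm_le_nrm)
  then have "nrm (n + Suc r) f \<le> nrm (Suc n) f + (\<Sum>k<r. nrm (Suc n) (nth_deriv a b k (D f)))"
    using step.IH[OF sobolev_SucD(1)[OF f]] by (simp add: nrm_Suc)
  then show ?case by (subst sum.lessThan_Suc_shift) (simp add: nth_deriv_Suc_D)
qed

text \<open>Reads the components of a system solution as y and its derivatives up to order r - 1:
  each \<open>g k\<close> is a primitive of the next one, and the last lies in W^(n+1).\<close>

lemma sobolev_chain: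
  assumes "1 \<le> r" "g (r - 1) \<in> W (Suc n)"
    and "\<And>k t. Suc k < r \<Longrightarrow> t \<in> {a..b} \<Longrightarrow> g k t = g k a + integral {a..t} (g (Suc k))"
  shows "g 0 \<in> W (n + r) \<and> (\<forall>k<r. \<forall>t\<in>{a..b}. nth_deriv a b k (g 0) t = g k t)"
  using assms
proof (induction r arbitrary: g rule: dec_induct)
  case base then show ?case by simp
next
  case (step r)
  have IH: "g (Suc 0) \<in> W (n + r) \<and> (\<forall>k<r. \<forall>t\<in>{a..b}. nth_deriv a b k (g (Suc 0)) t = g (Suc k) t)"
  proof (rule step.IH[of "\<lambda>k. g (Suc k)"])
    show "g (Suc (r - 1)) \<in> W (Suc n)" using step.prems(1) step.hyps by simp
    show "g (Suc k) t = g (Suc k) a + integral {a..t} (g (Suc (Suc k)))" if "Suc k < r" "t \<in> {a..b}" for k t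
      by (rule step.prems(2)) (use that in auto)
  qed
  have eq: "g 0 t = g 0 a + integral {a..t} (g (Suc 0))" if "t \<in> {a..b}" for t
    using step.prems(2)[of 0 t] step.hyps that by simp
  note I = sobolev_SucI[OF conjunct1[OF IH] eq]
  have weq: "weq (n + r) (D (g 0)) (g (Suc 0))" by (rule I(2))
  have D: "D (g 0) t = g (Suc 0) t" if "t \<in> {a..b}" for t
    using weq step.hyps that by (auto simp: weq_def)
  have "nth_deriv a b k (g 0) t = g k t" if "k < Suc r" "t \<in> {a..b}" for k t
  proof (cases k)
    case (Suc l)
    have "nth_deriv a b l (D (g 0)) t = nth_deriv a b l (g (Suc 0)) t"
      by (rule nth_deriv_cong[OF D that(2)])
    then show ?thesis using IH that Suc by (simp add: nth_deriv_Suc_D)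
  qed simp
  moreover have "g 0 \<in> W (Suc (n + r))" by (rule I(1))
  ultimately show ?case by simp
qed

lemma weq_add_right: "weq n f g \<Longrightarrow> weq n (\<lambda>t. f t + h t) (\<lambda>t. g t + h t)"
  unfolding weq_def by (cases "n = 0") (auto elim: eventually_mono)

lemma weq_continuous_interior:
  assumes f: "f \<in> W (Suc n)" and g: "g \<in> W (Suc n)" and eq: "\<And>t. t \<in> {a<..<b} \<Longrightarrow> f t = g t"
  shows "weq (Suc n) f g"
proof (rule weqI)
  fix t assume t: "t \<in> {a..b}"
  have cl: "closure {a<..<b} = {a..b}" using ab by (simp add: closure_greaterThanLessThan)
  have "f t - g t = 0"
  proof (rule continuous_constant_on_closure[of "{a<..<b}" "\<lambda>t. f t - g t" 0])
    show "continuous_on (closure {a<..<b}) (\<lambda>t. f t - g t)"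
      unfolding cl by (intro continuous_on_diff sobolev_Suc_continuous[OF f] sobolev_Suc_continuous[OF g])
  qed (use eq t cl in auto)
  then show "f t = g t" by simp
qed

text \<open>The derivative of a vector function is given by its components only where all of them
  are differentiable, which is almost everywhere for n = 0 and everywhere for n \<ge> 1.\<close>

lemma vector_derivative_component_weq:
  fixes g :: "real \<Rightarrow> complex^'k"
  assumes h: "\<And>i. h i \<in> W (Suc n)" and g: "\<And>i t. t \<in> {a..b} \<Longrightarrow> g t $ i = h i t"
  shows "weq n (\<lambda>t. D g t $ i) (D (h i))"
proof -
  have comp: "D g t $ i = D (h i) t"
    if t: "t \<in> {a..b}" and d: "\<And>i. (h i has_vector_derivative D (h i) t) (at t within {a..b})" for t
  proof -
    have "(g has_vector_derivative (\<chi> i. D (h i) t)) (at t within {a..b})"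
    proof (rule has_vector_derivative_vecI)
      fix j
      have "((\<lambda>s. g s $ j) has_vector_derivative D (h j) t) (at t within {a..b})"
        by (rule has_vector_derivative_transform[OF t _ d]) (rule g)
      then show "((\<lambda>s. g s $ j) has_vector_derivative (\<chi> i. D (h i) t) $ j) (at t within {a..b})" by simp
    qed
    then show ?thesis using has_D[OF _ t] by fastforce
  qed
  show ?thesis
  proof (cases n)
    case 0
    have "AE t in L. \<forall>i. (h i has_vector_derivative D (h i) t) (at t within {a..b})"
      using sobolev_Suc_derivative_AE[OF h] by (intro eventually_all_finite)
    then have "AE t in L. D g t $ i = D (h i) t"
      using AE_space by eventually_elim (use comp in auto)
    then show ?thesis by (simp add: weq_def 0)
  next
    case (Suc m)
    show ?thesis
    proof (rule weqI, rule comp)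
      fix t j assume t: "t \<in> {a..b}"
      have "h j differentiable at t within {a..b}"
        using h[of j] t by (simp add: Suc sobolev_Suc_Suc differentiable_on_def)
      then show "(h j has_vector_derivative D (h j) t) (at t within {a..b})"
        unfolding D_def One_nat_def nth_deriv_Suc nth_deriv_0 by (simp add: vector_derivative_works)
    qed
  qed
qed

lemma nth_deriv_component_weq:
  fixes y :: "real \<Rightarrow> complex^'k"
  assumes y: "y \<in> Wv (n + k)"
  shows "weq n (\<lambda>t. nth_deriv a b k y t $ i) (nth_deriv a b k (\<lambda>t. y t $ i))"
  using y
proof (induction k arbitrary: n i)
  case 0 then show ?case by (simp add: weqI)
next
  case (Suc k)
  have eq: "nth_deriv a b k y t $ i = nth_deriv a b k (\<lambda>t. y t $ i) t" if "t \<in> {a..b}" for t i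
    using Suc.IH[of "Suc n" i] Suc.prems that by (simp add: weq_def)
  show ?case
    unfolding nth_deriv_Suc_outer
  proof (rule vector_derivative_component_weq[OF _ eq])
    fix j
    have "(\<lambda>t. y t $ j) \<in> W (Suc n + k)" using sobolev_vec_component[OF Suc.prems, of j] by simp
    then show "nth_deriv a b k (\<lambda>t. y t $ j) \<in> W (Suc n)" by (rule sobolev_nth_deriv(1))
  qed
qed

section \<open>Equality of vector-valued Sobolev functions\<close>

definition wveq :: "nat \<Rightarrow> (real \<Rightarrow> complex^'k) \<Rightarrow> (real \<Rightarrow> complex^'k) \<Rightarrow> bool" where
  "wveq n f g \<longleftrightarrow> (\<forall>i. weq n (\<lambda>t. f t $ i) (\<lambda>t. g t $ i))"

lemma wveq_sym: "wveq n f g \<Longrightarrow> wveq n g f"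
  unfolding wveq_def using weq_sym by blast

lemma wveq_trans: "wveq n f g \<Longrightarrow> wveq n g h \<Longrightarrow> wveq n f h"
  unfolding wveq_def using weq_trans by blast

lemma wveqI: "(\<And>t. t \<in> {a..b} \<Longrightarrow> f t = g t) \<Longrightarrow> wveq n f g"
  unfolding wveq_def by (auto intro: weqI)

lemma wveq_sobolev: "wveq n f g \<Longrightarrow> f \<in> Wv n \<longleftrightarrow> g \<in> Wv n"
  unfolding wveq_def sobolev_vec_def using sobolev_weq by blast

lemma wveq_nv: "wveq n f g \<Longrightarrow> f \<in> Wv n \<Longrightarrow> nv n f = nv n g"
  unfolding wveq_def sobolev_vec_norm_def
  by (intro sum.cong refl nrm_weq) (auto simp: sobolev_vec_def)

text \<open>Bridge to \<open>bvp_solution\<close>, which demands the equation on the open interval: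
  the end points form a null set if n = 0, and continuity extends the equality to them if n \<ge>
  1.\<close>

lemma wveq_iff_interior:
  fixes f g :: "real \<Rightarrow> complex^'k"
  assumes f: "f \<in> Wv n" and g: "g \<in> Wv n"
  shows "wveq n f g \<longleftrightarrow>
     (if n = 0 then AE t in lebesgue_on {a<..<b}. f t = g t else \<forall>t\<in>{a<..<b}. f t = g t)"
proof (cases n)
  case 0
  have ends: "AE t in lebesgue. t \<noteq> a \<and> t \<noteq> b"
    using AE_completion[OF AE_lborel_singleton[of a]] AE_completion[OF AE_lborel_singleton[of b]]
    by (rule AE_conjI)
  have "wveq n f g \<longleftrightarrow> (AE t in L. f t = g t)"
    using eventually_ball_finite_distrib[of UNIV "\<lambda>t i. f t $ i = g t $ i" "ae_filter L"]
    by (simp add: wveq_def weq_def 0 vec_eq_iff)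
  also have "\<dots> \<longleftrightarrow> (AE t in lebesgue. t \<in> {a..b} \<longrightarrow> f t = g t)"
    by (subst AE_restrict_space_iff) auto
  also have "\<dots> \<longleftrightarrow> (AE t in lebesgue. t \<in> {a<..<b} \<longrightarrow> f t = g t)"
  proof
    assume "AE t in lebesgue. t \<in> {a<..<b} \<longrightarrow> f t = g t"
    with ends show "AE t in lebesgue. t \<in> {a..b} \<longrightarrow> f t = g t" by eventually_elim auto
  qed (auto elim: eventually_mono)
  also have "\<dots> \<longleftrightarrow> (AE t in lebesgue_on {a<..<b}. f t = g t)"
    by (subst AE_restrict_space_iff) auto
  finally show ?thesis using 0 by simp
next
  case (Suc m)
  have "wveq n f g" if "\<forall>t\<in>{a<..<b}. f t = g t"
    unfolding wveq_def Suc
    by (intro allI weq_continuous_interior) (use f g that in \<open>auto simp: sobolev_vec_def Suc\<close>)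
  then show ?thesis using Suc by (auto simp: wveq_def weq_def vec_eq_iff)
qed

end

text \<open>\<open>e\<close> enumerates the pairs (order of derivative, component), so that \<open>\<complex>\<^sup>r\<^sup>m\<close> carries
  \<open>(y, y', \<dots>, y\<^sup>(\<^sup>r\<^sup>-\<^sup>1\<^sup>))\<close>.\<close>

locale companion = sobolev_interval a b p for a b :: real and p :: ennreal +
  fixes r :: nat and e :: "'d::finite \<Rightarrow> nat \<times> 'm::finite"
  assumes r: "1 \<le> r" and e: "bij_betw e UNIV ({..<r} \<times> UNIV)"
begin

definition "e' = inv_into UNIV e"

lemma fst_e: "fst (e d) < r"
  using bij_betw_apply[OF e, of d] by (simp add: mem_Times_iff)

lemma e_e': "k < r \<Longrightarrow> e (e' (k, i)) = (k, i)"
  unfolding e'_def using e by (intro f_inv_into_f) (auto simp: bij_betw_def)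

lemma e'_e: "e' (e d) = d"
  unfolding e'_def using e by (intro inv_into_f_f) (auto simp: bij_betw_def)

lemma sum_e: "(\<Sum>d\<in>UNIV. F (e d)) = (\<Sum>k<r. \<Sum>i\<in>UNIV. F (k, i))"
  using sum.reindex_bij_betw[OF e, of F] by (simp add: sum.cartesian_product)

text \<open>The companion matrix: the last block row carries the coefficients, the others shift the
  derivatives.\<close>

definition comp :: "(nat \<Rightarrow> real \<Rightarrow> complex^'m^'m) \<Rightarrow> real \<Rightarrow> complex^'d^'d" where
  "comp A t = (\<chi> d d'. if Suc (fst (e d)) < r
     then (if e d' = (Suc (fst (e d)), snd (e d)) then 1 else 0)
     else - (A (fst (e d')) t $ snd (e d) $ snd (e d')))"

definition jet :: "(real \<Rightarrow> complex^'m) \<Rightarrow> real \<Rightarrow> complex^'d" where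
  "jet y t = (\<chi> d. nth_deriv a b (fst (e d)) (\<lambda>s. y s $ snd (e d)) t)"

definition rhs :: "(real \<Rightarrow> complex^'m) \<Rightarrow> real \<Rightarrow> complex^'d" where
  "rhs f t = (\<chi> d. if Suc (fst (e d)) < r then 0 else f t $ snd (e d))"

text \<open>\<open>diff_expr\<close> with componentwise derivatives, to which the scalar estimates
  apply. For n = 0 the two may differ on a null set, where some component has no derivative.\<close>

definition residual :: "(nat \<Rightarrow> real \<Rightarrow> complex^'m^'m) \<Rightarrow> (real \<Rightarrow> complex^'m) \<Rightarrow> real \<Rightarrow> complex^'m" where
  "residual A y t = (\<chi> i. nth_deriv a b r (\<lambda>s. y s $ i) t +
     (\<Sum>l<r. \<Sum>j\<in>UNIV. A l t $ i $ j * nth_deriv a b l (\<lambda>s. y s $ j) t))"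

abbreviation coeffs :: "nat \<Rightarrow> (nat \<Rightarrow> real \<Rightarrow> complex^'m^'m) \<Rightarrow> bool" where
  "coeffs n A \<equiv> \<forall>l<r. A l \<in> sobolev_mat n p a b"

lemma comp_sobolev:
  assumes A: "coeffs n A"
  shows "comp A \<in> sobolev_mat n p a b"
  unfolding sobolev_mat_def[of n p a b]
proof (intro CollectI allI)
  fix d d'
  show "(\<lambda>t. comp A t $ d $ d') \<in> W n"
  proof (cases "Suc (fst (e d)) < r")
    case True then show ?thesis by (simp add: comp_def sobolev_const)
  next
    case False
    then show ?thesis
      using sobolev_uminus(1)[OF sobolev_mat_component[of "A (fst (e d'))" n]] A fst_e[of d'] by (simp add: comp_def)
  qed
qed

lemma comp_vector:
  "(comp A t *v x) $ d = (if Suc (fst (e d)) < r then x $ e' (Suc (fst (e d)), snd (e d))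
     else - (\<Sum>l<r. \<Sum>j\<in>UNIV. A l t $ snd (e d) $ j * x $ e' (l, j)))"
proof (cases "Suc (fst (e d)) < r")
  case True
  let ?z = "(Suc (fst (e d)), snd (e d))"
  have "e d' = ?z \<longleftrightarrow> d' = e' ?z" for d' using True e_e' e'_e by metis
  then show ?thesis using True
    by (simp add: matrix_vector_mult_def comp_def if_distrib[of "\<lambda>c. c * _"] cong: if_cong)
next
  case False
  have "(comp A t *v x) $ d = (\<Sum>d'\<in>UNIV. (\<lambda>z. - (A (fst z) t $ snd (e d) $ snd z * x $ e' z)) (e d'))"
    using False by (simp add: matrix_vector_mult_def comp_def e'_e)
  also have "\<dots> = (\<Sum>l<r. \<Sum>j\<in>UNIV. - (A l t $ snd (e d) $ j * x $ e' (l, j)))"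
    using sum_e[of "\<lambda>z. - (A (fst z) t $ snd (e d) $ snd z * x $ e' z)"] by simp
  finally show ?thesis using False by (simp add: sum_negf)
qed

lemma jet_e': "k < r \<Longrightarrow> jet y t $ e' (k, i) = nth_deriv a b k (\<lambda>s. y s $ i) t"
  by (simp add: jet_def e_e')

lemma jet_sobolev:
  assumes y: "y \<in> Wv (n + r)"
  shows "jet y \<in> Wv (Suc n)"
  unfolding sobolev_vec_def[of "Suc n"]
proof (intro CollectI allI)
  fix d
  have "(\<lambda>t. y t $ snd (e d)) \<in> W (Suc n + fst (e d))"
    by (rule sobolev_mono[OF sobolev_vec_component[OF y]]) (use fst_e[of d] in simp)
  from sobolev_nth_deriv(1)[OF this] show "(\<lambda>t. jet y t $ d) \<in> W (Suc n)" by (simp add: jet_def)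
qed

text \<open>The shift rows cancel identically, because \<open>D\<close> of a jet component is the
  next one. What remains is the residual of the equation of order r, so the estimates for systems
  transfer to it.\<close>

lemma system_residual_jet: "system_residual (comp A) (jet y) = rhs (residual A y)"
proof
  fix t
  have "system_residual (comp A) (jet y) t $ d = rhs (residual A y) t $ d" for d
  proof -
    have D: "D (\<lambda>t. jet y t $ d) = nth_deriv a b (Suc (fst (e d))) (\<lambda>s. y s $ snd (e d))"
      by (simp add: jet_def nth_deriv_Suc_outer)
    show ?thesis
    proof (cases "Suc (fst (e d)) < r")
      case True
      then show ?thesis by (simp add: system_residual_def D comp_vector rhs_def jet_e')
    next
      case False
      then have "Suc (fst (e d)) = r" using fst_e[of d] by simp
      then show ?thesis by (simp add: system_residual_def D comp_vector rhs_def jet_e' residual_def)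
    qed
  qed
  then show "system_residual (comp A) (jet y) t = rhs (residual A y) t" by (simp add: vec_eq_iff)
qed

lemma nv_jet: "nv (Suc n) (jet y) = (\<Sum>i\<in>UNIV. \<Sum>k<r. nrm (Suc n) (nth_deriv a b k (\<lambda>s. y s $ i)))"
proof -
  have "nv (Suc n) (jet y) = (\<Sum>d\<in>UNIV. (\<lambda>z. nrm (Suc n) (nth_deriv a b (fst z) (\<lambda>s. y s $ snd z))) (e d))"
    by (simp add: sobolev_vec_norm_def jet_def)
  also have "\<dots> = (\<Sum>k<r. \<Sum>i\<in>UNIV. nrm (Suc n) (nth_deriv a b k (\<lambda>s. y s $ i)))"
    using sum_e[of "\<lambda>z. nrm (Suc n) (nth_deriv a b (fst z) (\<lambda>s. y s $ snd z))"] by simp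
  finally show ?thesis by (subst sum.swap) simp
qed

lemma nv_le_jet:
  assumes y: "y \<in> Wv (n + r)"
  shows "nv (n + r) y \<le> nv (Suc n) (jet y)"
  unfolding nv_jet sobolev_vec_norm_def[of "n + r"]
  by (intro sum_mono nrm_le_sum_nth_deriv sobolev_vec_component[OF y] r)

lemma jet_le_nv:
  assumes y: "y \<in> Wv (n + r)"
  shows "nv (Suc n) (jet y) \<le> real r * nv (n + r) y"
proof -
  have "nrm (Suc n) (nth_deriv a b k (\<lambda>s. y s $ i)) \<le> nrm (n + r) (\<lambda>s. y s $ i)" if "k < r" for k i
  proof -
    have yi: "(\<lambda>s. y s $ i) \<in> W (n + r)" by (rule sobolev_vec_component[OF y])
    have "(\<lambda>s. y s $ i) \<in> W (Suc n + k)" by (rule sobolev_mono[OF yi]) (use that in simp)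
    from sobolev_nth_deriv(2)[OF this] nrm_mono[OF yi, of "Suc n + k"] that show ?thesis by simp
  qed
  then have "nv (Suc n) (jet y) \<le> (\<Sum>i\<in>UNIV. \<Sum>k<r. nrm (n + r) (\<lambda>s. y s $ i))"
    unfolding nv_jet by (intro sum_mono) simp
  then show ?thesis by (simp add: sobolev_vec_norm_def sum_distrib_left)
qed

lemma rhs_sobolev:
  assumes f: "f \<in> Wv n"
  shows "rhs f \<in> Wv n"
  unfolding sobolev_vec_def
proof (intro CollectI allI)
  show "(\<lambda>t. rhs f t $ d) \<in> W n" for d
    by (cases "Suc (fst (e d)) < r") (simp_all add: rhs_def sobolev_const sobolev_vec_component[OF f])
qed

lemma nv_rhs: "nv n (rhs f) = nv n f"
proof -
  have "nv n (rhs f) = (\<Sum>d\<in>UNIV. (\<lambda>z. if Suc (fst z) < r then 0 else nrm n (\<lambda>s. f s $ snd z)) (e d))"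
    unfolding sobolev_vec_norm_def by (rule sum.cong) (auto simp: rhs_def nrm_zero)
  also have "\<dots> = (\<Sum>k<r. \<Sum>i\<in>UNIV. if Suc k < r then 0 else nrm n (\<lambda>s. f s $ i))"
    using sum_e[of "\<lambda>z. if Suc (fst z) < r then 0 else nrm n (\<lambda>s. f s $ snd z)"]
    by (simp cong: if_cong)
  also have "\<dots> = (\<Sum>k<r. if k = r - 1 then nv n f else 0)"
  proof (rule sum.cong[OF refl])
    fix k assume "k \<in> {..<r}"
    then have "Suc k < r \<longleftrightarrow> k \<noteq> r - 1" using r by auto
    then show "(\<Sum>i\<in>UNIV. if Suc k < r then 0 else nrm n (\<lambda>s. f s $ i)) = (if k = r - 1 then nv n f else 0)"
      by (simp add: sobolev_vec_norm_def)
  qed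
  also have "\<dots> = nv n f" using r by simp
  finally show ?thesis .
qed

lemma residual_sobolev:
  assumes A: "coeffs n A" and y: "y \<in> Wv (n + r)"
  shows "residual A y \<in> Wv n"
  unfolding sobolev_vec_def[of n]
proof (intro CollectI allI)
  fix i
  have "(\<lambda>t. nth_deriv a b l (\<lambda>s. y s $ j) t) \<in> W (max n 1)" if "l < r" for l j
  proof -
    have "(\<lambda>s. y s $ j) \<in> W (Suc n + l)"
      by (rule sobolev_mono[OF sobolev_vec_component[OF y]]) (use that in simp)
    from sobolev_mono[OF sobolev_nth_deriv(1)[OF this], of "max n 1"] show ?thesis by simp
  qed
  then have "(\<lambda>t. A l t $ i $ j * nth_deriv a b l (\<lambda>s. y s $ j) t) \<in> W n" if "l < r" for l j
    using A that by (intro sobolev_mult(1) sobolev_mat_component) auto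
  then show "(\<lambda>t. residual A y t $ i) \<in> W n"
    unfolding residual_def vec_lambda_beta
    by (intro sobolev_add(1) sobolev_sum(1) sobolev_nth_deriv(1)[OF sobolev_vec_component[OF y]]) auto
qed

lemma ivp_estimate:
  assumes A: "coeffs n A"
  shows "\<exists>K\<ge>0. \<forall>y\<in>Wv (n + r). nv (n + r) y \<le> K * (norm (jet y a) + nv n (residual A y))"
proof -
  obtain K where K: "K \<ge> 0" "\<And>X. X \<in> Wv (Suc n) \<Longrightarrow> nv (Suc n) X \<le> K * (norm (X a) + nv n (system_residual (comp A) X))"
    using system_estimate[OF comp_sobolev[OF A]] by blast
  have "nv (n + r) y \<le> K * (norm (jet y a) + nv n (residual A y))" if y: "y \<in> Wv (n + r)" for y
    using nv_le_jet[OF y] K(2)[OF jet_sobolev[OF y]] by (simp add: system_residual_jet nv_rhs)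
  then show ?thesis using K(1) by blast
qed

lemma ivp_existence:
  assumes A: "coeffs n A" and f: "f \<in> Wv n"
  obtains y where "y \<in> Wv (n + r)" "wveq n (residual A y) f" "jet y a = q"
proof -
  note M = comp_sobolev[OF A] and G = rhs_sobolev[OF f]
  obtain X where X: "solves_system (comp A) (rhs f) X" "X a = q"
    using system_existence[OF M G] by blast
  note reg = system_regularity[OF M G X(1)]
  have chain: "(\<lambda>t. X t $ e' (0, i)) \<in> W (n + r) \<and>
      (\<forall>k<r. \<forall>t\<in>{a..b}. nth_deriv a b k (\<lambda>t. X t $ e' (0, i)) t = X t $ e' (k, i))" for i
  proof (rule sobolev_chain[of r "\<lambda>k t. X t $ e' (k, i)", OF r])
    show "(\<lambda>t. X t $ e' (r - 1, i)) \<in> W (Suc n)" by (rule sobolev_vec_component[OF reg(1)])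
    fix k t assume k: "Suc k < r" and t: "t \<in> {a..b}"
    have "X t $ e' (k, i) = X a $ e' (k, i) + integral {a..t} (\<lambda>s. (comp A s *v X s) $ e' (k, i) + rhs f s $ e' (k, i))"
      using X(1) t unfolding solves_system_def by blast
    also have "(\<lambda>s. (comp A s *v X s) $ e' (k, i) + rhs f s $ e' (k, i)) = (\<lambda>s. X s $ e' (Suc k, i))"
      using k by (simp add: comp_vector rhs_def e_e')
    finally show "X t $ e' (k, i) = X a $ e' (k, i) + integral {a..t} (\<lambda>s. X s $ e' (Suc k, i))" .
  qed
  define y where "y t = (\<chi> i. X t $ e' (0, i))" for t
  have yW: "y \<in> Wv (n + r)" using chain by (simp add: sobolev_vec_def y_def)
  have nd: "nth_deriv a b k (\<lambda>s. y s $ i) t = X t $ e' (k, i)" if "k < r" "t \<in> {a..b}" for k i t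
    using chain that by (simp add: y_def)
  have jet: "jet y t = X t" if "t \<in> {a..b}" for t
    using nd[OF fst_e that] by (simp add: vec_eq_iff jet_def e'_e)
  have "wveq n (residual A y) f"
    unfolding wveq_def
  proof
    fix i
    let ?S = "\<lambda>t. \<Sum>l<r. \<Sum>j\<in>UNIV. A l t $ i $ j * X t $ e' (l, j)"
    have Sr: "Suc (r - 1) = r" using r by simp
    have "residual A y t $ i = D (\<lambda>t. X t $ e' (r - 1, i)) t + ?S t" if t: "t \<in> {a..b}" for t
    proof -
      have "nth_deriv a b r (\<lambda>s. y s $ i) t = D (nth_deriv a b (r - 1) (\<lambda>s. y s $ i)) t"
        by (metis Sr nth_deriv_Suc_outer)
      also have "\<dots> = D (\<lambda>t. X t $ e' (r - 1, i)) t"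
        unfolding D_def by (rule nth_deriv_cong[OF nd t]) (use r in auto)
      finally show ?thesis using nd t by (simp add: residual_def)
    qed
    then have 1: "weq n (\<lambda>t. residual A y t $ i) (\<lambda>t. D (\<lambda>t. X t $ e' (r - 1, i)) t + ?S t)"
      by (rule weqI)
    \<comment> \<open>The lower derivatives agree with components of X on all of [a, b]; the top one
      is determined only up to \<open>weq n\<close>.\<close>
    have "weq n (\<lambda>t. D (\<lambda>t. X t $ e' (r - 1, i)) t + ?S t)
       (\<lambda>t. ((comp A t *v X t) $ e' (r - 1, i) + rhs f t $ e' (r - 1, i)) + ?S t)"
      by (rule weq_add_right) (rule reg(2))
    moreover have "((comp A t *v X t) $ e' (r - 1, i) + rhs f t $ e' (r - 1, i)) + ?S t = f t $ i" for t
      using r by (simp add: comp_vector rhs_def e_e')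
    ultimately show "weq n (\<lambda>t. residual A y t $ i) (\<lambda>t. f t $ i)" using weq_trans[OF 1] by simp
  qed
  moreover have "jet y a = q" using jet[of a] ab X(2) by simp
  ultimately show thesis using that yW by blast
qed

lemma diff_expr_residual:
  assumes y: "y \<in> Wv (n + r)"
  shows "wveq n (diff_expr a b r A y) (residual A y)"
  unfolding wveq_def
proof
  fix i
  have low: "nth_deriv a b l y t $ j = nth_deriv a b l (\<lambda>s. y s $ j) t" if l: "l < r" and t: "t \<in> {a..b}" for l j t
  proof -
    have "y \<in> Wv (Suc n + l)" by (rule sobolev_vec_mono[OF y]) (use l in simp)
    from nth_deriv_component_weq[OF this, of j] t show ?thesis by (simp add: weq_def)
  qed
  let ?S = "\<lambda>t. \<Sum>l<r. \<Sum>j\<in>UNIV. A l t $ i $ j * nth_deriv a b l (\<lambda>s. y s $ j) t"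
  have "diff_expr a b r A y t $ i = nth_deriv a b r y t $ i + ?S t" if t: "t \<in> {a..b}" for t
  proof -
    have "(\<Sum>j=1..r. A (r - j) t *v nth_deriv a b (r - j) y t) = (\<Sum>l<r. A l t *v nth_deriv a b l y t)"
      by (rule sum.reindex_bij_witness[of _ "\<lambda>l. r - l" "\<lambda>j. r - j"]) auto
    then show ?thesis using low t by (simp add: diff_expr_def matrix_vector_mult_def)
  qed
  then have 1: "weq n (\<lambda>t. diff_expr a b r A y t $ i) (\<lambda>t. nth_deriv a b r y t $ i + ?S t)" by (rule weqI)
  have "weq n (\<lambda>t. nth_deriv a b r y t $ i + ?S t) (\<lambda>t. nth_deriv a b r (\<lambda>s. y s $ i) t + ?S t)"
    by (rule weq_add_right[OF nth_deriv_component_weq[OF y]])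
  from weq_trans[OF 1 this] show "weq n (\<lambda>t. diff_expr a b r A y t $ i) (\<lambda>t. residual A y t $ i)"
    by (simp add: residual_def)
qed

lemma bvp_solution_iff:
  assumes A: "coeffs n A" and f: "f \<in> Wv n"
  shows "bvp_solution n p a b r A B f c y \<longleftrightarrow> y \<in> Wv (n + r) \<and> wveq n (residual A y) f \<and> B y = c"
proof (cases "y \<in> Wv (n + r)")
  case True
  note dr = diff_expr_residual[OF True, of A]
  have dW: "diff_expr a b r A y \<in> Wv n" using wveq_sobolev[OF dr] residual_sobolev[OF A True] by simp
  have "wveq n (residual A y) f \<longleftrightarrow> wveq n (diff_expr a b r A y) f"
    using wveq_trans[OF dr] wveq_trans[OF wveq_sym[OF dr]] by blast
  then show ?thesis using True wveq_iff_interior[OF dW f] by (simp add: bvp_solution_def)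
qed (simp add: bvp_solution_def)

end

section \<open>Linearity and uniform boundedness\<close>

lemma of_real_smult: "complex_of_real c *s x = c *\<^sub>R x"
  unfolding vec_eq_iff vector_smult_component vector_scaleR_component by (simp add: scaleR_conv_of_real)

context sobolev_interval
begin

text \<open>Lets pointwise algebra be carried out on finitely many equalities in W^n without
  distinguishing equality everywhere from equality almost everywhere.\<close>

lemma weq_finite:
  fixes f g :: "'k::finite \<Rightarrow> real \<Rightarrow> complex"
  assumes fg: "\<And>c. weq n (f c) (g c)"
    and imp: "\<And>t. t \<in> {a..b} \<Longrightarrow> (\<And>c. f c t = g c t) \<Longrightarrow> F t = G t"
  shows "weq n F G"
proof (cases n)
  case 0
  have "AE t in L. \<forall>c. f c t = g c t"
    by (intro eventually_all_finite weq_imp_AE[OF fg])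
  then have "AE t in L. F t = G t"
    using AE_space by eventually_elim (use imp in auto)
  then show ?thesis by (simp add: weq_def 0)
next
  case (Suc m)
  then show ?thesis using fg by (intro weqI imp) (auto simp: weq_def)
qed

lemma nth_deriv_linear:
  assumes f: "f \<in> W (m + k)" and g: "g \<in> W (m + k)"
  shows "weq m (nth_deriv a b k (\<lambda>t. c * f t + g t)) (\<lambda>t. c * nth_deriv a b k f t + nth_deriv a b k g t)"
  using f g
proof (induction k arbitrary: f g)
  case 0 then show ?case by (simp add: weqI)
next
  case (Suc k)
  then have f: "f \<in> W (Suc (m + k))" and g: "g \<in> W (Suc (m + k))" by auto
  note fD = sobolev_SucD[OF f] and gD = sobolev_SucD[OF g]
  have P: "(\<lambda>s. c * D f s + D g s) \<in> W (m + k)"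
    by (intro sobolev_add(1) sobolev_cmult(1) fD(1) gD(1))
  have eq: "c * f t + g t = (c * f a + g a) + integral {a..t} (\<lambda>s. c * D f s + D g s)" if t: "t \<in> {a..b}" for t
  proof -
    have "integral {a..t} (\<lambda>s. c * D f s + D g s) = c * integral {a..t} (D f) + integral {a..t} (D g)"
      using sobolev_integrable_on[OF sobolev_cmult(1)[OF fD(1)] t, of c] sobolev_integrable_on[OF gD(1) t]
      by (subst Henstock_Kurzweil_Integration.integral_add) auto
    then show ?thesis using fD(2)[OF t] gD(2)[OF t] by (simp add: algebra_simps)
  qed
  have w: "weq (m + k) (D (\<lambda>t. c * f t + g t)) (\<lambda>s. c * D f s + D g s)"
    by (rule sobolev_SucI(2)[OF P eq])
  have "weq m (nth_deriv a b k (D (\<lambda>t. c * f t + g t))) (nth_deriv a b k (\<lambda>s. c * D f s + D g s))"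
    using nth_deriv_weq[OF w, of k] by (cases "m + k = 0") auto
  then show ?case
    unfolding nth_deriv_Suc_D using Suc.IH[OF fD(1) gD(1)] weq_trans by blast
qed

lemma sobolev_vec_series:
  "\<exists>K\<ge>0. \<forall>(g :: nat \<Rightarrow> real \<Rightarrow> complex^'k) \<epsilon>. (\<forall>k. g k \<in> Wv n \<and> nv n (g k) \<le> \<epsilon> k) \<longrightarrow> summable \<epsilon> \<longrightarrow>
     (\<exists>G\<in>Wv n. \<forall>N. nv n (\<lambda>t. G t - (\<Sum>k<N. g k t)) \<le> K * (\<Sum>k. \<epsilon> (k + N)))"
proof -
  obtain K where K: "K \<ge> 0" "\<And>g \<epsilon>. (\<And>k. g k \<in> W n \<and> nrm n (g k) \<le> \<epsilon> k) \<Longrightarrow> summable \<epsilon> \<Longrightarrow>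
     \<exists>G\<in>W n. \<forall>N. nrm n (\<lambda>t. G t - (\<Sum>k<N. g k t)) \<le> K * (\<Sum>k. \<epsilon> (k + N))"
    using sobolev_series[of n] by blast
  show ?thesis
  proof (intro exI[of _ "real CARD('k) * K"] conjI allI impI)
    fix g :: "nat \<Rightarrow> real \<Rightarrow> complex^'k" and \<epsilon>
    assume g: "\<forall>k. g k \<in> Wv n \<and> nv n (g k) \<le> \<epsilon> k" and s: "summable (\<epsilon> :: nat \<Rightarrow> real)"
    have "\<exists>G\<in>W n. \<forall>N. nrm n (\<lambda>t. G t - (\<Sum>k<N. g k t $ i)) \<le> K * (\<Sum>k. \<epsilon> (k + N))" for i
    proof (rule K(2)[OF _ s])
      fix k
      have "g k \<in> Wv n" "nv n (g k) \<le> \<epsilon> k" using g by blast+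
      then show "(\<lambda>t. g k t $ i) \<in> W n \<and> nrm n (\<lambda>t. g k t $ i) \<le> \<epsilon> k"
        using nrm_component_le[of "g k" n i] sobolev_vec_component[of "g k" n i] by simp
    qed
    then have "\<forall>i. \<exists>G. G \<in> W n \<and> (\<forall>N. nrm n (\<lambda>t. G t - (\<Sum>k<N. g k t $ i)) \<le> K * (\<Sum>k. \<epsilon> (k + N)))"
      by blast
    from choice[OF this] obtain G where G: "\<And>i. G i \<in> W n"
      "\<And>i N. nrm n (\<lambda>t. G i t - (\<Sum>k<N. g k t $ i)) \<le> K * (\<Sum>k. \<epsilon> (k + N))" by blast
    have "nv n (\<lambda>t. (\<chi> i. G i t) - (\<Sum>k<N. g k t)) \<le> real CARD('k) * K * (\<Sum>k. \<epsilon> (k + N))" for N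
    proof -
      have "nv n (\<lambda>t. (\<chi> i. G i t) - (\<Sum>k<N. g k t)) = (\<Sum>i\<in>UNIV. nrm n (\<lambda>t. G i t - (\<Sum>k<N. g k t $ i)))"
        by (simp add: sobolev_vec_norm_def)
      also have "\<dots> \<le> (\<Sum>i\<in>(UNIV :: 'k set). K * (\<Sum>k. \<epsilon> (k + N)))" by (intro sum_mono G(2))
      finally show ?thesis by (simp add: mult.assoc)
    qed
    then show "\<exists>G\<in>Wv n. \<forall>N. nv n (\<lambda>t. G t - (\<Sum>k<N. g k t)) \<le> real CARD('k) * K * (\<Sum>k. \<epsilon> (k + N))"
      using G(1) by (intro bexI[of _ "\<lambda>t. \<chi> i. G i t"]) (auto simp: sobolev_vec_def)
  qed (use K(1) in simp)
qed

section \<open>Boundary operators\<close>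

lemma operator_linear:
  assumes B: "continuous_linear_operator k p a b B" and "y \<in> Wv k" "z \<in> Wv k"
  shows "B (\<lambda>t. c *s y t + z t) = c *s B y + B z"
  using assms sobolev_vec_scale[of y k c] unfolding continuous_linear_operator_def by auto

lemma operator_bounded:
  assumes "continuous_linear_operator k p a b B"
  obtains C where "C \<ge> 0" "\<And>y. y \<in> Wv k \<Longrightarrow> norm (B y) \<le> C * nv k y"
proof -
  obtain C where C: "\<And>y. y \<in> Wv k \<Longrightarrow> norm (B y) \<le> C * nv k y"
    using assms unfolding continuous_linear_operator_def by blast
  have "norm (B y) \<le> max 0 C * nv k y" if "y \<in> Wv k" for y
    using C[OF that] mult_right_mono[of C "max 0 C" "nv k y"] nv_nonneg[OF that] by linarith
  then show thesis using that[of "max 0 C"] by auto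
qed

text \<open>Such a y may be nonzero outside [a, b], or on a null set if k = 0; boundedness still
  forces the value 0.\<close>

lemma operator_zero:
  assumes B: "continuous_linear_operator k p a b B" and "y \<in> Wv k" "nv k y = 0"
  shows "B y = 0"
proof -
  obtain C where "\<And>y. y \<in> Wv k \<Longrightarrow> norm (B y) \<le> C * nv k y" using operator_bounded[OF B] by blast
  from this[OF assms(2)] show ?thesis using assms(3) by simp
qed

lemma operator_sum:
  assumes B: "continuous_linear_operator k p a b B" and y: "\<And>i. i \<in> J \<Longrightarrow> y i \<in> Wv k"
  shows "B (\<lambda>t. \<Sum>i\<in>J. q i *s y i t) = (\<Sum>i\<in>J. q i *s B (y i))"
  using y
proof (induction J rule: infinite_finite_induct)
  case (insert i J)
  have "B (\<lambda>t. q i *s y i t + (\<Sum>i\<in>J. q i *s y i t)) = q i *s B (y i) + B (\<lambda>t. \<Sum>i\<in>J. q i *s y i t)"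
    by (rule operator_linear[OF B]) (use insert in \<open>auto intro!: sobolev_vec_sum sobolev_vec_scale\<close>)
  then show ?case using insert by simp
qed (use operator_zero[OF B sobolev_vec_zero nv_zero] in auto)

lemma operator_diff:
  assumes B: "continuous_linear_operator k p a b B" and y: "y \<in> Wv k" and z: "z \<in> Wv k"
  shows "B (\<lambda>t. y t - z t) = B y - B z"
  using operator_linear[OF B z y, of "-1"] by (simp add: vec_eq_iff)

text \<open>Gliding hump (Sokal's proof of the uniform boundedness principle).\<close>

lemma uniform_boundedness:
  fixes T :: "nat \<Rightarrow> (real \<Rightarrow> complex^'m) \<Rightarrow> complex^'d"
  assumes T: "\<And>k. continuous_linear_operator N p a b (T k)"
    and large: "\<And>C. \<exists>l. \<exists>y\<in>Wv N. norm (T l y) > C * nv N y"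
  shows "\<exists>x\<in>Wv N. \<forall>C. \<exists>l. norm (T l x) > C"
proof -
  \<comment> \<open>The operator norm of \<open>T l\<close>.\<close>
  define S where "S l = Sup {norm (T l y) |y. y \<in> Wv N \<and> nv N y \<le> 1}" for l
  have bdd: "bdd_above {norm (T l y) |y. y \<in> Wv N \<and> nv N y \<le> 1}" for l
  proof -
    obtain C where "C \<ge> 0" "\<And>y. y \<in> Wv N \<Longrightarrow> norm (T l y) \<le> C * nv N y" using operator_bounded[OF T] by blast
    then show ?thesis by (intro bdd_aboveI[of _ C]) (auto intro: order_trans mult_left_le)
  qed
  have S_ge: "norm (T l y) \<le> S l" if "y \<in> Wv N" "nv N y \<le> 1" for l y
    unfolding S_def by (rule cSup_upper[OF _ bdd]) (use that in blast)
  have S0: "0 \<le> S l" for l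
    using S_ge[OF sobolev_vec_zero, of l] by (simp add: nv_zero) (meson norm_ge_zero order_trans)
  have bound: "norm (T l y) \<le> S l * nv N y" if y: "y \<in> Wv N" for l y
  proof (cases "nv N y = 0")
    case True
    then show ?thesis using operator_zero[OF T y] by simp
  next
    case False
    then have pos: "nv N y > 0" using nv_nonneg[OF y] by simp
    let ?c = "complex_of_real (1 / nv N y)"
    have "nv N (\<lambda>t. ?c *s y t) \<le> norm ?c * nv N y" by (rule nv_scale[OF y])
    then have "norm (T l (\<lambda>t. ?c *s y t)) \<le> S l"
      using pos by (intro S_ge sobolev_vec_scale y) (simp add: norm_divide)
    moreover have "T l (\<lambda>t. ?c *s y t) = ?c *s T l y"
      using T[of l] y unfolding continuous_linear_operator_def by blast
    moreover have "norm (?c *s T l y) = norm (T l y) / nv N y"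
      unfolding of_real_smult using pos by simp
    ultimately have "norm (T l y) / nv N y \<le> S l" by (simp only:)
    then show ?thesis using pos by (simp add: divide_le_eq)
  qed
  have Slarge: "\<exists>l. S l > C" for C
  proof -
    obtain l y where y: "y \<in> Wv N" "norm (T l y) > C * nv N y" using large[of C] by blast
    have "C * nv N y < S l * nv N y" using bound[OF y(1), of l] y(2) by simp
    then show ?thesis using nv_nonneg[OF y(1)] by (metis mult_less_cancel_right not_le)
  qed
  obtain K where K: "K \<ge> 0" "\<And>g \<epsilon>. (\<And>k. g k \<in> Wv N \<and> nv N (g k) \<le> \<epsilon> k) \<Longrightarrow> summable \<epsilon> \<Longrightarrow>
     \<exists>G\<in>Wv N. \<forall>M. nv N (\<lambda>t. G t - (\<Sum>k<M. g k t :: complex^'m)) \<le> K * (\<Sum>k. \<epsilon> (k + M))"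
    using sobolev_vec_series[of N] by blast
  \<comment> \<open>A ratio for which K times the geometric tail from k + 1 on is at most \<rho>^k /
    4, where K is the constant of the completeness estimate.\<close>
  define \<rho> where "\<rho> = 1 / (4 * K + 5)"
  have \<rho>: "0 < \<rho>" "\<rho> < 1" "4 * K * \<rho> \<le> 1 - \<rho>"
    using K(1) by (auto simp: \<rho>_def field_simps)
  have "\<exists>l. S l > (real k + 1) / \<rho> ^ k" for k by (rule Slarge)
  then obtain l where l: "\<And>k. S (l k) > (real k + 1) / \<rho> ^ k" by metis
  have Sl: "0 < S (l k)" for k
  proof -
    have "0 < (real k + 1) / \<rho> ^ k" using \<rho> by simp
    then show ?thesis using l[of k] by linarith
  qed
  \<comment> \<open>Nearly norming vectors scaled to norm at most \<rho>^k; by the choice of l this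
    scaling still leaves values that grow like k + 1.\<close>
  have "\<exists>\<xi>\<in>Wv N. nv N \<xi> \<le> \<rho> ^ k \<and> norm (T (l k) \<xi>) \<ge> 3 / 4 * \<rho> ^ k * S (l k)" for k
  proof -
    have ne: "{norm (T (l k) y) |y. y \<in> Wv N \<and> nv N y \<le> 1} \<noteq> {}"
      using sobolev_vec_zero[of N] nv_zero[of N] by (metis (mono_tags, lifting) empty_Collect_eq zero_le_one)
    have "3 / 4 * S (l k) < S (l k)" using Sl[of k] by simp
    then obtain y where y: "y \<in> Wv N" "nv N y \<le> 1" "3 / 4 * S (l k) < norm (T (l k) y)"
      using less_cSupD[OF ne, of "3 / 4 * S (l k)"] unfolding S_def by blast
    let ?\<xi> = "\<lambda>t. complex_of_real (\<rho> ^ k) *s y t"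
    have "nv N ?\<xi> \<le> norm (complex_of_real (\<rho> ^ k)) * nv N y" by (rule nv_scale[OF y(1)])
    also have "\<dots> \<le> \<rho> ^ k" using y(2) \<rho> by (simp add: norm_power mult_left_le)
    finally have 1: "nv N ?\<xi> \<le> \<rho> ^ k" .
    have "T (l k) ?\<xi> = complex_of_real (\<rho> ^ k) *s T (l k) y"
      using T[of "l k"] y unfolding continuous_linear_operator_def by blast
    also have "\<dots> = \<rho> ^ k *\<^sub>R T (l k) y" by (rule of_real_smult)
    finally have "norm (T (l k) ?\<xi>) = \<rho> ^ k * norm (T (l k) y)" using \<rho> by simp
    then have "3 / 4 * \<rho> ^ k * S (l k) \<le> norm (T (l k) ?\<xi>)"
      using mult_left_mono[of "3 / 4 * S (l k)" "norm (T (l k) y)" "\<rho> ^ k"] y(3) \<rho> by (simp add: mult_ac)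
    then show ?thesis using 1 sobolev_vec_scale[OF y(1)] by blast
  qed
  then obtain \<xi> where \<xi>: "\<And>k. \<xi> k \<in> Wv N" "\<And>k. nv N (\<xi> k) \<le> \<rho> ^ k"
    "\<And>k. norm (T (l k) (\<xi> k)) \<ge> 3 / 4 * \<rho> ^ k * S (l k)" by metis
  \<comment> \<open>The sum takes in \<open>\<xi> k\<close> only if \<open>T (l k)\<close> is small
    at s. Since \<open>\<xi> k\<close> is the difference of the two candidates, the value at one of
    them has at least half the norm of the value at \<open>\<xi> k\<close>.\<close>
  define s where "s = rec_nat (\<lambda>t. 0)
    (\<lambda>k z. if norm (T (l k) z) \<ge> 1 / 2 * norm (T (l k) (\<xi> k)) then z else (\<lambda>t. 1 *s z t + \<xi> k t))"
  have s0: "s 0 = (\<lambda>t. 0)" by (simp add: s_def)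
  have sSuc: "s (Suc k) = (if norm (T (l k) (s k)) \<ge> 1 / 2 * norm (T (l k) (\<xi> k)) then s k else (\<lambda>t. 1 *s s k t + \<xi> k t))" for k
    by (simp add: s_def)
  have sW: "s k \<in> Wv N" for k
    by (induction k) (auto simp: s0 sSuc sobolev_vec_zero intro!: sobolev_vec_add \<xi>(1))
  have hump: "norm (T (l k) (s (Suc k))) \<ge> 1 / 2 * norm (T (l k) (\<xi> k))" for k
  proof (cases "norm (T (l k) (s k)) \<ge> 1 / 2 * norm (T (l k) (\<xi> k))")
    case False
    have "T (l k) (s (Suc k)) = 1 *s T (l k) (s k) + T (l k) (\<xi> k)"
      using False operator_linear[OF T sW \<xi>(1), of "l k" 1 k k] by (simp add: sSuc)
    then have "norm (T (l k) (\<xi> k)) \<le> norm (T (l k) (s (Suc k))) + norm (T (l k) (s k))"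
      using norm_triangle_ineq4[of "T (l k) (s (Suc k))" "T (l k) (s k)"] by simp
    then show ?thesis using False by simp
  qed (simp add: sSuc)
  define g where "g k t = s (Suc k) t - s k t" for k t
  have gW: "g k \<in> Wv N \<and> nv N (g k) \<le> \<rho> ^ k" for k
  proof -
    have "g k = (\<lambda>t. 0) \<or> g k = \<xi> k" by (auto simp: g_def fun_eq_iff sSuc)
    then show ?thesis
    proof
      assume "g k = (\<lambda>t. 0)"
      then show ?thesis using \<rho> by (simp add: sobolev_vec_zero nv_zero)
    qed (simp add: \<xi>(1,2))
  qed
  have sum_g: "(\<Sum>k<M. g k t) = s M t" for M t
    unfolding g_def using sum_lessThan_telescope[of "\<lambda>k. s k t" M] by (simp add: s0)
  have "summable (\<lambda>k. \<rho> ^ k)" using \<rho> by (intro summable_geometric) auto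
  from K(2)[of g, OF gW this]
  obtain x where x: "x \<in> Wv N" "\<And>M. nv N (\<lambda>t. x t - s M t) \<le> K * (\<Sum>k. \<rho> ^ (k + M))"
    unfolding sum_g by blast
  have tail: "(\<Sum>k. \<rho> ^ (k + M)) = \<rho> ^ M / (1 - \<rho>)" for M
    using suminf_mult2[OF summable_geometric[of \<rho>], of "\<rho> ^ M"] suminf_geometric[of \<rho>] \<rho> by (simp add: power_add)
  \<comment> \<open>Half of 3/4 of \<open>\<rho> ^ k * S (l k)\<close> survives at the partial sum,
    the tail removes at most 1/4, and 1/8 is left; the product itself is at least k + 1.\<close>
  have big: "norm (T (l k) x) \<ge> (real k + 1) / 8" for k
  proof -
    let ?d = "\<lambda>t. x t - s (Suc k) t"
    have dW: "?d \<in> Wv N" by (rule sobolev_vec_diff[OF x(1) sW])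
    have "nv N ?d \<le> K * (\<rho> ^ Suc k / (1 - \<rho>))" using x(2)[of "Suc k"] by (simp only: tail)
    also have "\<dots> \<le> 1 / 4 * \<rho> ^ k"
    proof -
      have "K * \<rho> / (1 - \<rho>) \<le> 1 / 4" using \<rho> by (simp add: divide_le_eq)
      from mult_right_mono[OF this, of "\<rho> ^ k"] \<rho> show ?thesis by (simp add: mult_ac)
    qed
    finally have d: "nv N ?d \<le> 1 / 4 * \<rho> ^ k" .
    have "norm (T (l k) ?d) \<le> S (l k) * nv N ?d" by (rule bound[OF dW])
    also have "\<dots> \<le> S (l k) * (1 / 4 * \<rho> ^ k)" by (rule mult_left_mono[OF d S0])
    finally have 1: "norm (T (l k) ?d) \<le> 1 / 4 * (\<rho> ^ k * S (l k))" by (simp add: mult_ac)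
    have 2: "norm (T (l k) (s (Suc k))) \<ge> 3 / 8 * (\<rho> ^ k * S (l k))"
      using hump[of k] \<xi>(3)[of k] by linarith
    have "T (l k) (s (Suc k)) = T (l k) x - T (l k) ?d"
      using operator_diff[OF T x(1) sW, of "l k" "Suc k"] by simp
    then have "norm (T (l k) (s (Suc k))) \<le> norm (T (l k) x) + norm (T (l k) ?d)"
      by (metis norm_triangle_ineq4)
    then have "norm (T (l k) x) \<ge> 1 / 8 * (\<rho> ^ k * S (l k))" using 1 2 by linarith
    moreover have "real k + 1 \<le> \<rho> ^ k * S (l k)"
      using l[of k] \<rho> by (simp add: divide_less_eq mult.commute less_imp_le)
    ultimately have "1 / 8 * (real k + 1) \<le> norm (T (l k) x)"
      using mult_left_mono[of "real k + 1" "\<rho> ^ k * S (l k)" "1 / 8"] by simp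
    then show ?thesis by simp
  qed
  have "\<exists>l. norm (T l x) > C" for C
  proof -
    obtain k :: nat where "8 * C < real k" using reals_Archimedean2 by blast
    then have "C < (real k + 1) / 8" by simp
    then show ?thesis using big[of k] less_le_trans by blast
  qed
  then show ?thesis using x(1) by blast
qed

end

section \<open>Solutions of the differential equation\<close>

context companion
begin

definition sol :: "nat \<Rightarrow> (nat \<Rightarrow> real \<Rightarrow> complex^'m^'m) \<Rightarrow> (real \<Rightarrow> complex^'m) \<Rightarrow> (real \<Rightarrow> complex^'m) \<Rightarrow> bool" where
  "sol n A f y \<longleftrightarrow> y \<in> Wv (n + r) \<and> wveq n (residual A y) f"

lemma sol_sobolev: "sol n A f y \<Longrightarrow> y \<in> Wv (n + r)"
  by (simp add: sol_def)

lemma sol_residual: "y \<in> Wv (n + r) \<Longrightarrow> sol n A (residual A y) y"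
  unfolding sol_def by (auto intro: wveqI)

lemma jet_linear:
  assumes y: "y \<in> Wv (n + r)" and z: "z \<in> Wv (n + r)" and t: "t \<in> {a..b}"
  shows "jet (\<lambda>t. c *s y t + z t) t = c *s jet y t + jet z t"
proof -
  have "jet (\<lambda>t. c *s y t + z t) t $ d = (c *s jet y t + jet z t) $ d" for d
  proof -
    have W: "(\<lambda>t. x t $ snd (e d)) \<in> W (Suc n + fst (e d))" if "x \<in> Wv (n + r)" for x
      by (rule sobolev_mono[OF sobolev_vec_component[OF that]]) (use fst_e[of d] in simp)
    from nth_deriv_linear[OF W[OF y] W[OF z], of c] t show ?thesis by (simp add: jet_def weq_def)
  qed
  then show ?thesis by (simp add: vec_eq_iff)
qed

lemma residual_linear:
  assumes y: "y \<in> Wv (n + r)" and z: "z \<in> Wv (n + r)"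
  shows "wveq n (residual A (\<lambda>t. c *s y t + z t)) (\<lambda>t. c *s residual A y t + residual A z t)"
  unfolding wveq_def
proof
  fix i
  have top: "weq n (nth_deriv a b r (\<lambda>s. c * y s $ i + z s $ i))
     (\<lambda>t. c * nth_deriv a b r (\<lambda>s. y s $ i) t + nth_deriv a b r (\<lambda>s. z s $ i) t)"
    by (rule nth_deriv_linear[OF sobolev_vec_component[OF y] sobolev_vec_component[OF z]])
  have low: "nth_deriv a b l (\<lambda>s. c * y s $ j + z s $ j) t =
     c * nth_deriv a b l (\<lambda>s. y s $ j) t + nth_deriv a b l (\<lambda>s. z s $ j) t"
    if "l < r" "t \<in> {a..b}" for l j t
  proof -
    have "jet (\<lambda>t. c *s y t + z t) t $ e' (l, j) = (c *s jet y t + jet z t) $ e' (l, j)"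
      by (simp only: jet_linear[OF y z that(2)])
    then show ?thesis using that by (simp add: jet_e')
  qed
  show "weq n (\<lambda>t. residual A (\<lambda>t. c *s y t + z t) t $ i) (\<lambda>t. (c *s residual A y t + residual A z t) $ i)"
  \<comment> \<open>A single equality, indexed by \<open>bool\<close> only to fit the shape of
    \<open>weq_finite\<close>.\<close>
  proof (rule weq_finite[of n "\<lambda>_::bool. nth_deriv a b r (\<lambda>s. c * y s $ i + z s $ i)", OF top])
    fix t assume t: "t \<in> {a..b}" and eq: "\<And>_::bool. nth_deriv a b r (\<lambda>s. c * y s $ i + z s $ i) t =
       c * nth_deriv a b r (\<lambda>s. y s $ i) t + nth_deriv a b r (\<lambda>s. z s $ i) t"
    show "residual A (\<lambda>t. c *s y t + z t) t $ i = (c *s residual A y t + residual A z t) $ i"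
      using low t eq by (simp add: residual_def algebra_simps sum.distrib sum_distrib_left)
  qed
qed

lemma sol_linear:
  assumes y: "sol n A f y" and z: "sol n A g z"
  shows "sol n A (\<lambda>t. c *s f t + g t) (\<lambda>t. c *s y t + z t)"
proof -
  have yW: "y \<in> Wv (n + r)" and zW: "z \<in> Wv (n + r)" using y z by (auto simp: sol_def)
  have "wveq n (\<lambda>t. c *s residual A y t + residual A z t) (\<lambda>t. c *s f t + g t)"
    unfolding wveq_def
  proof
    fix i
    have w: "weq n (\<lambda>t. (if k then residual A y else residual A z) t $ i) (\<lambda>t. (if k then f else g) t $ i)" for k
      using y z by (auto simp: sol_def wveq_def)
    show "weq n (\<lambda>t. (c *s residual A y t + residual A z t) $ i) (\<lambda>t. (c *s f t + g t) $ i)"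
    proof (rule weq_finite[OF w])
      fix t assume "\<And>k. (if k then residual A y else residual A z) t $ i = (if k then f else g) t $ i"
      from this[of True] this[of False] show "(c *s residual A y t + residual A z t) $ i = (c *s f t + g t) $ i"
        by simp
    qed
  qed
  from wveq_trans[OF residual_linear[OF yW zW] this]
  show ?thesis using yW zW by (simp add: sol_def sobolev_vec_add sobolev_vec_scale)
qed

lemma sol_zero: "sol n A (\<lambda>t. 0) (\<lambda>t. 0)"
proof -
  have r0: "nth_deriv a b k (\<lambda>t. 0 :: complex) t = 0" if "t \<in> {a..b}" for k t
    using that
  proof (induction k arbitrary: t)
    case (Suc k)
    have "nth_deriv a b (Suc k) (\<lambda>t. 0 :: complex) t = D (\<lambda>t. 0 :: complex) t"
      unfolding nth_deriv_Suc_outer D_def by (rule nth_deriv_cong) (use Suc in auto)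
    also have "\<dots> = 0" by (rule has_D[OF has_vector_derivative_const Suc.prems])
    finally show ?case .
  qed simp
  show ?thesis unfolding sol_def
    by (auto intro!: wveqI sobolev_vec_zero simp: residual_def r0 vec_eq_iff)
qed

lemma sol_sum:
  assumes y: "\<And>i. i \<in> J \<Longrightarrow> sol n A (\<lambda>t. 0) (y i)"
  shows "sol n A (\<lambda>t. 0) (\<lambda>t. \<Sum>i\<in>J. q i *s y i t)"
  using y
proof (induction J rule: infinite_finite_induct)
  case (insert i J)
  then show ?case using sol_linear[of n A "\<lambda>t. 0" "y i" "\<lambda>t. 0" "\<lambda>t. \<Sum>i\<in>J. q i *s y i t" "q i"] by simp
qed (auto simp: sol_zero)

lemma jet_zero: "t \<in> {a..b} \<Longrightarrow> jet (\<lambda>t. 0) t = 0"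
  using jet_linear[OF sobolev_vec_zero sobolev_vec_zero, of t 1] by simp

lemma jet_sum:
  assumes y: "\<And>i. i \<in> J \<Longrightarrow> y i \<in> Wv (n + r)" and t: "t \<in> {a..b}"
  shows "jet (\<lambda>t. \<Sum>i\<in>J. q i *s y i t) t = (\<Sum>i\<in>J. q i *s jet (y i) t)"
  using y
proof (induction J rule: infinite_finite_induct)
  case (insert i J)
  have "jet (\<lambda>t. q i *s y i t + (\<Sum>i\<in>J. q i *s y i t)) t = q i *s jet (y i) t + jet (\<lambda>t. \<Sum>i\<in>J. q i *s y i t) t"
    by (rule jet_linear[OF _ _ t, of _ n]) (use insert in \<open>auto intro!: sobolev_vec_sum sobolev_vec_scale\<close>)
  then show ?case using insert by simp
qed (use jet_zero[OF t] in auto)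

lemma jet_diff:
  assumes y: "y \<in> Wv (n + r)" and z: "z \<in> Wv (n + r)" and t: "t \<in> {a..b}"
  shows "jet (\<lambda>t. y t - z t) t = jet y t - jet z t"
  using jet_linear[OF z y t, of "-1"] by (simp add: vec_eq_iff)

lemma sol_diff:
  assumes y: "sol n A f y" and z: "sol n A g z"
  shows "sol n A (\<lambda>t. f t - g t) (\<lambda>t. y t - z t)"
proof -
  have *: "(-1) *s x + w = w - x" for x w :: "complex^'m" by (simp add: vec_eq_iff)
  show ?thesis using sol_linear[OF z y, of "-1"] unfolding * .
qed

lemma nv_zero_imp:
  assumes y: "y \<in> Wv (n + r)" and z: "nv (n + r) y = 0" and t: "t \<in> {a..b}"
  shows "y t = 0"
proof -
  obtain m where m: "n + r = Suc m" using r by (metis add_Suc_right Suc_le_D One_nat_def)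
  have "norm (y t) \<le> sup_const * nv (n + r) y"
    using nv_sup_bound[of y m t] y t unfolding m by simp
  then show ?thesis using z by simp
qed

text \<open>Stated as a vanishing norm because this is what \<open>operator_zero\<close> consumes;
  \<open>nv_zero_imp\<close> turns it into vanishing on [a, b].\<close>

lemma sol_unique:
  assumes A: "coeffs n A" and y: "sol n A (\<lambda>t. 0) y" and j: "jet y a = 0"
  shows "nv (n + r) y = 0"
proof -
  obtain K where K: "K \<ge> 0" "\<And>y. y \<in> Wv (n + r) \<Longrightarrow> nv (n + r) y \<le> K * (norm (jet y a) + nv n (residual A y))"
    using ivp_estimate[OF A] by blast
  have yW: "y \<in> Wv (n + r)" by (rule sol_sobolev[OF y])
  have "nv n (residual A y) = nv n (\<lambda>t. 0 :: complex^'m)"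
    using y residual_sobolev[OF A yW] by (intro wveq_nv) (auto simp: sol_def)
  then have "nv (n + r) y \<le> 0" using K(2)[OF yW] j by (simp add: nv_zero)
  then show ?thesis using nv_nonneg[OF yW] by simp
qed

lemma nrm_nth_deriv_component_le:
  assumes y: "y \<in> Wv (n + r)" and k: "k \<le> r"
  shows "nrm (n + r - k) (nth_deriv a b k (\<lambda>s. y s $ i)) \<le> nv (n + r) y"
proof -
  have "(\<lambda>s. y s $ i) \<in> W ((n + r - k) + k)" using sobolev_vec_component[OF y, of i] k by simp
  from sobolev_nth_deriv(2)[OF this] nrm_component_le[OF y, of i] k show ?thesis by simp
qed

section \<open>Perturbation of the coefficients\<close>

definition coeff_dist :: "nat \<Rightarrow> (nat \<Rightarrow> real \<Rightarrow> complex^'m^'m) \<Rightarrow> (nat \<Rightarrow> real \<Rightarrow> complex^'m^'m) \<Rightarrow> real" where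
  "coeff_dist n A A' = (\<Sum>l<r. nm n (\<lambda>t. A l t - A' l t))"

lemma coeff_diff_sobolev: "coeffs n A \<Longrightarrow> coeffs n A' \<Longrightarrow> l < r \<Longrightarrow> (\<lambda>t. A l t - A' l t) \<in> sobolev_mat n p a b"
  by (simp add: sobolev_mat_def sobolev_diff(1))

lemma nm_le_coeff_dist:
  assumes "coeffs n A" "coeffs n A'" "l < r"
  shows "nm n (\<lambda>t. A l t - A' l t) \<le> coeff_dist n A A'"
  unfolding coeff_dist_def
  by (rule member_le_sum[of l "{..<r}" "\<lambda>l. nm n (\<lambda>t. A l t - A' l t)"])
     (use assms in \<open>auto intro!: nm_nonneg coeff_diff_sobolev\<close>)

lemma coeff_dist_nonneg: "coeffs n A \<Longrightarrow> coeffs n A' \<Longrightarrow> 0 \<le> coeff_dist n A A'"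
  unfolding coeff_dist_def by (intro sum_nonneg nm_nonneg coeff_diff_sobolev) auto

text \<open>The top derivatives cancel. C is independent of the coefficients, which is essential
  because they vary with the parameter.\<close>

lemma residual_perturbation:
  "\<exists>C\<ge>0. \<forall>A A' y. coeffs n A \<longrightarrow> coeffs n A' \<longrightarrow> y \<in> Wv (n + r) \<longrightarrow>
     nv n (\<lambda>t. residual A y t - residual A' y t) \<le> C * coeff_dist n A A' * nv (n + r) y"
proof (intro exI[of _ "real CARD('m) * (real r * (real CARD('m) * mult_const n))"] conjI allI impI)
  show "0 \<le> real CARD('m) * (real r * (real CARD('m) * mult_const n))" using mult_const_nonneg by simp
  fix A A' and y :: "real \<Rightarrow> complex^'m" assume A: "coeffs n A" and A': "coeffs n A'" and y: "y \<in> Wv (n + r)"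
  let ?d = "coeff_dist n A A'" and ?y = "nv (n + r) y"
  have d: "0 \<le> ?d" by (rule coeff_dist_nonneg[OF A A'])
  let ?P = "\<lambda>i l j t. (A l t - A' l t) $ i $ j * nth_deriv a b l (\<lambda>s. y s $ j) t"
  have P: "?P i l j \<in> W n \<and> nrm n (?P i l j) \<le> mult_const n * ?d * ?y" if l: "l < r" for i l j
  proof -
    have D: "(\<lambda>t. A l t - A' l t) \<in> sobolev_mat n p a b" by (rule coeff_diff_sobolev[OF A A' l])
    have yW: "(\<lambda>s. y s $ j) \<in> W ((n + r - l) + l)" using sobolev_vec_component[OF y, of j] l by simp
    have yl: "nth_deriv a b l (\<lambda>s. y s $ j) \<in> W (n + r - l)" by (rule sobolev_nth_deriv(1)[OF yW])
    \<comment> \<open>A derivative of order l < r keeps at least n + 1 derivatives, so its product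
      with an entry in W^n is controlled even for n = 0.\<close>
    have ml: "max n 1 \<le> n + r - l" using l by arith
    have yl': "nth_deriv a b l (\<lambda>s. y s $ j) \<in> W (max n 1)" by (rule sobolev_mono[OF yl ml])
    have "nrm (max n 1) (nth_deriv a b l (\<lambda>s. y s $ j)) \<le> ?y"
      using nrm_mono[OF yl ml] nrm_nth_deriv_component_le[OF y, of l j] l by simp
    moreover have "nrm n (\<lambda>t. (A l t - A' l t) $ i $ j) \<le> ?d"
      using nrm_mat_component_le[OF D, of i j] nm_le_coeff_dist[OF A A' l] by simp
    ultimately have "mult_const n * nrm n (\<lambda>t. (A l t - A' l t) $ i $ j) * nrm (max n 1) (nth_deriv a b l (\<lambda>s. y s $ j))
        \<le> mult_const n * ?d * ?y"
      using d mult_const_nonneg nrm_nonneg[OF yl'] by (intro mult_mono mult_left_mono) auto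
    then show ?thesis using sobolev_mult[OF sobolev_mat_component[OF D] yl'] by (meson order_trans)
  qed
  have "nrm n (\<lambda>t. (residual A y t - residual A' y t) $ i) \<le> real r * (real CARD('m) * (mult_const n * ?d * ?y))" for i
  proof -
    have "(\<lambda>t. (residual A y t - residual A' y t) $ i) = (\<lambda>t. \<Sum>l<r. \<Sum>j\<in>UNIV. ?P i l j t)"
      by (simp add: residual_def fun_eq_iff left_diff_distrib flip: sum_subtractf)
    then have "nrm n (\<lambda>t. (residual A y t - residual A' y t) $ i) \<le> (\<Sum>l<r. nrm n (\<lambda>t. \<Sum>j\<in>UNIV. ?P i l j t))"
      using sobolev_sum(2)[of "{..<r}" "\<lambda>l t. \<Sum>j\<in>UNIV. ?P i l j t" n] P by (simp add: sobolev_sum(1))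
    also have "\<dots> \<le> (\<Sum>l<r. \<Sum>j\<in>UNIV. nrm n (?P i l j))"
      using P by (intro sum_mono sobolev_sum(2)) auto
    also have "\<dots> \<le> (\<Sum>l<r. \<Sum>j\<in>(UNIV::'m set). mult_const n * ?d * ?y)"
      using P by (intro sum_mono) auto
    finally show ?thesis by simp
  qed
  then have "nv n (\<lambda>t. residual A y t - residual A' y t) \<le> (\<Sum>i\<in>(UNIV::'m set). real r * (real CARD('m) * (mult_const n * ?d * ?y)))"
    unfolding sobolev_vec_norm_def[of n] by (intro sum_mono)
  then show "nv n (\<lambda>t. residual A y t - residual A' y t) \<le> real CARD('m) * (real r * (real CARD('m) * mult_const n)) * ?d * ?y"
    by (simp add: mult_ac)
qed

text \<open>The rows of \<open>\<Psi>\<close> solve the adjoint system, so that \<open>\<Psi>\<close> is a constant matrix times the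
  inverse of a fundamental matrix; it inherits its regularity from the adjoint system.\<close>

lemma adjoint_matrix:
  fixes Q :: "complex^'d^'d"
  assumes A: "coeffs n A"
  obtains \<Psi> where "\<Psi> \<in> sobolev_mat (Suc n) p a b"
    "\<And>y t. sol n A (\<lambda>t. 0) y \<Longrightarrow> t \<in> {a..b} \<Longrightarrow> \<Psi> t *v jet y t = Q *v jet y a"
proof -
  \<comment> \<open>The negative transpose of the companion matrix, that is, the matrix of the
    adjoint system; its solutions with initial values \<open>Q $ i\<close> become the rows of
    \<Psi>.\<close>
  define N where "N t = (\<chi> k j. - (comp A t $ j $ k))" for t
  have N: "N \<in> sobolev_mat n p a b"
    using sobolev_mat_component[OF comp_sobolev[OF A]] unfolding sobolev_mat_def N_def by (simp add: sobolev_uminus(1))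
  have "\<exists>X. solves_system N (\<lambda>t. 0) X \<and> X a = Q $ i" for i
    using system_existence[OF N sobolev_vec_zero, of "Q $ i"] by metis
  then obtain X where X: "\<And>i. solves_system N (\<lambda>t. 0) (X i)" "\<And>i. X i a = Q $ i" by metis
  note reg = system_regularity[OF N sobolev_vec_zero X(1)]
  define \<Psi> where "\<Psi> t = (\<chi> i. X i t)" for t
  have "\<Psi> \<in> sobolev_mat (Suc n) p a b"
    using sobolev_vec_component[OF reg(1)] by (simp add: sobolev_mat_def \<Psi>_def)
  moreover have "\<Psi> t *v jet y t = Q *v jet y a" if y: "sol n A (\<lambda>t. 0) y" and t: "t \<in> {a..b}" for y t
  proof -
    have yW: "y \<in> Wv (n + r)" by (rule sol_sobolev[OF y])
    have J: "(\<lambda>t. jet y t $ k) \<in> W (Suc n)" for k by (rule sobolev_vec_component[OF jet_sobolev[OF yW]])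
    have P: "(\<lambda>t. X i t $ k) \<in> W (Suc n)" for i k by (rule sobolev_vec_component[OF reg(1)])
    have DJ: "AE t in L. D (\<lambda>t. jet y t $ k) t = (comp A t *v jet y t) $ k" for k
    proof -
      have res: "wveq n (residual A y) (\<lambda>t. 0)" using y by (simp add: sol_def)
      have "AE t in L. rhs (residual A y) t $ k = 0"
        using weq_imp_AE[OF res[unfolded wveq_def, rule_format, of "snd (e k)"]]
        by eventually_elim (simp add: rhs_def)
      then show ?thesis
        unfolding system_residual_jet[symmetric] by eventually_elim (simp add: system_residual_def)
    qed
    have DX: "AE t in L. D (\<lambda>t. X i t $ k) t = (N t *v X i t) $ k" for i k
      using weq_imp_AE[OF reg(2)[of i k]] by simp
    have "(\<Psi> t *v jet y t) $ i = (Q *v jet y a) $ i" for i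
    proof -
      \<comment> \<open>The derivative of the product of the k-th components of \<open>X i\<close>
        and \<open>jet y\<close>. Summed over k it vanishes almost everywhere, the contributions of
        N and \<open>comp A\<close> being opposite, so the pairing keeps its value at a.\<close>
      let ?F = "\<lambda>k s. D (\<lambda>t. X i t $ k) s * jet y s $ k + D (\<lambda>t. jet y t $ k) s * X i s $ k"
      have int: "?F k integrable_on {a..t}" for k
      proof (rule sobolev_integrable_on[OF _ t])
        show "?F k \<in> W n"
          by (intro sobolev_add(1) sobolev_mult(1) sobolev_SucD(1)[OF P] sobolev_SucD(1)[OF J]
              sobolev_mono[OF P] sobolev_mono[OF J]) auto
      qed
      have "AE s in L. \<forall>k. D (\<lambda>t. X i t $ k) s = (N s *v X i s) $ k" "AE s in L. \<forall>k. D (\<lambda>t. jet y t $ k) s = (comp A s *v jet y s) $ k"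
        by (intro eventually_all_finite DX DJ)+
      then have zero: "AE s in L. (\<Sum>k\<in>UNIV. ?F k s) = 0"
      proof eventually_elim
        fix s assume 1: "\<forall>k. D (\<lambda>t. X i t $ k) s = (N s *v X i s) $ k" and 2: "\<forall>k. D (\<lambda>t. jet y t $ k) s = (comp A s *v jet y s) $ k"
        have "(\<Sum>k\<in>UNIV. ?F k s) = (\<Sum>k\<in>UNIV. \<Sum>j\<in>UNIV. - (comp A s $ j $ k * X i s $ j * jet y s $ k))
            + (\<Sum>k\<in>UNIV. \<Sum>j\<in>UNIV. comp A s $ k $ j * jet y s $ j * X i s $ k)"
          by (simp add: 1 2 sum.distrib N_def matrix_vector_mult_def sum_distrib_right)
        also have "(\<Sum>k\<in>UNIV. \<Sum>j\<in>UNIV. comp A s $ k $ j * jet y s $ j * X i s $ k) =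
           (\<Sum>k\<in>UNIV. \<Sum>j\<in>UNIV. comp A s $ j $ k * X i s $ j * jet y s $ k)"
          by (subst sum.swap) (simp add: mult_ac)
        finally show "(\<Sum>k\<in>UNIV. ?F k s) = 0" by (simp add: sum_negf)
      qed
      have "(\<Psi> t *v jet y t) $ i = (\<Sum>k\<in>UNIV. X i t $ k * jet y t $ k)"
        by (simp add: \<Psi>_def matrix_vector_mult_def)
      also have "\<dots> = (\<Sum>k\<in>UNIV. X i a $ k * jet y a $ k + integral {a..t} (?F k))"
        by (rule sum.cong[OF refl]) (rule sobolev_mult_derivative[OF P J t])
      also have "\<dots> = (\<Sum>k\<in>UNIV. X i a $ k * jet y a $ k) + (\<Sum>k\<in>UNIV. integral {a..t} (?F k))"
        by (rule sum.distrib)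
      also have "(\<Sum>k\<in>UNIV. integral {a..t} (?F k)) = integral {a..t} (\<lambda>s. \<Sum>k\<in>UNIV. ?F k s)"
        by (rule Henstock_Kurzweil_Integration.integral_sum[symmetric]) (use int in auto)
      also have "integral {a..t} (\<lambda>s. \<Sum>k\<in>UNIV. ?F k s) = integral {a..t} (\<lambda>s. 0)"
        by (rule integral_AE_cong[OF zero t])
      finally show ?thesis by (simp add: X(2) matrix_vector_mult_def)
    qed
    then show ?thesis by (simp add: vec_eq_iff)
  qed
  ultimately show thesis by (rule that)
qed

end

section \<open>Recovering the coefficients from a fundamental system\<close>

text \<open>For estimates in which the quantity to be shown small reappears on the right with a
  small factor: once \<delta> < 1/2 it is absorbed by the left side.\<close>

lemma tendsto_zero_absorb:
  fixes s \<rho> \<delta> :: "'x \<Rightarrow> real"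
  assumes le: "eventually (\<lambda>x. 0 \<le> s x \<and> s x \<le> \<rho> x + \<delta> x * s x) F"
    and \<rho>: "(\<rho> \<longlongrightarrow> 0) F" and \<delta>: "(\<delta> \<longlongrightarrow> 0) F"
  shows "(s \<longlongrightarrow> 0) F"
proof (rule tendsto_sandwich[of "\<lambda>_. 0" s F "\<lambda>x. 2 * \<rho> x"])
  show "eventually (\<lambda>x. 0 \<le> s x) F" using le by (auto elim: eventually_mono)
  have "eventually (\<lambda>x. \<delta> x < 1 / 2) F" using \<delta> by (rule order_tendstoD) simp
  with le show "eventually (\<lambda>x. s x \<le> 2 * \<rho> x) F"
  proof eventually_elim
    fix x assume s: "0 \<le> s x \<and> s x \<le> \<rho> x + \<delta> x * s x" and d: "\<delta> x < 1 / 2"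
    have "\<delta> x * s x \<le> 1 / 2 * s x" using s d by (intro mult_right_mono) auto
    then show "s x \<le> 2 * \<rho> x" using s by linarith
  qed
  show "((\<lambda>x. 2 * \<rho> x) \<longlongrightarrow> 0) F" using tendsto_mult_left[OF \<rho>, of 2] by simp
qed simp

lemma sum_axis_smult: "(\<Sum>c\<in>UNIV. q $ c *s axis c (1::complex)) = q"
  by (rule basis_expansion)

context sobolev_interval
begin

text \<open>\<open>mat_size\<close> takes matrix-valued functions; a single matrix is passed as a
  constant function and evaluated at 0.\<close>

lemma norm_matrix_vector_le: "norm (M *v x) \<le> mat_size (\<lambda>_. M) 0 * norm x"
  using norm_vec_le_sum[of "M *v x"] sum_norm_matrix_vector_le[of "\<lambda>_. M" 0 x] by simp

lemma wveq_add:
  assumes f: "wveq n f f'" and g: "wveq n g g'"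
  shows "wveq n (\<lambda>t. f t + g t) (\<lambda>t. f' t + g' t)"
  unfolding wveq_def
proof
  fix i
  have w: "weq n (\<lambda>t. (if k then f else g) t $ i) (\<lambda>t. (if k then f' else g') t $ i)" for k
    using f g by (auto simp: wveq_def)
  show "weq n (\<lambda>t. (f t + g t) $ i) (\<lambda>t. (f' t + g' t) $ i)"
  proof (rule weq_finite[OF w])
    fix t assume "\<And>k. (if k then f else g) t $ i = (if k then f' else g') t $ i"
    from this[of True] this[of False] show "(f t + g t) $ i = (f' t + g' t) $ i" by simp
  qed
qed

lemma wveq_diff:
  assumes f: "wveq n f f'" and g: "wveq n g g'"
  shows "wveq n (\<lambda>t. f t - g t) (\<lambda>t. f' t - g' t)"
proof -
  have "wveq n (\<lambda>t. - g t) (\<lambda>t. - g' t)"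
    using g unfolding wveq_def weq_def by (cases "n = 0") auto
  from wveq_add[OF f this] show ?thesis by simp
qed

lemma wveq_refl: "wveq n f f"
  by (rule wveqI) simp

lemma nrm_mult_le:
  assumes f: "f \<in> W n" "nrm n f \<le> F" and g: "g \<in> W (Suc n)" "nrm (Suc n) g \<le> G"
  shows "(\<lambda>t. f t * g t) \<in> W n" "nrm n (\<lambda>t. f t * g t) \<le> mult_const n * F * G"
proof -
  have g': "g \<in> W (max n 1)" by (rule sobolev_mono[OF g(1)]) simp
  show "(\<lambda>t. f t * g t) \<in> W n" by (rule sobolev_mult(1)[OF f(1) g'])
  have F: "0 \<le> F" using nrm_nonneg[OF f(1)] f(2) by simp
  have "nrm n (\<lambda>t. f t * g t) \<le> mult_const n * nrm n f * nrm (max n 1) g"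
    by (rule sobolev_mult(2)[OF f(1) g'])
  also have "\<dots> \<le> mult_const n * F * G"
    using nrm_mono[OF g(1), of "max n 1"] g(2) f(2) F mult_const_nonneg nrm_nonneg[OF g']
    by (intro mult_mono mult_left_mono mult_nonneg_nonneg) auto
  finally show "nrm n (\<lambda>t. f t * g t) \<le> mult_const n * F * G" .
qed

text \<open>If no bound holds near \<open>\<mu>\<^sub>0\<close>, there are points
  \<open>\<mu> k\<close> tending to it at which the bound k fails. Some x then has unbounded values
  under the \<open>B (\<mu> k)\<close>, contradicting convergence at x.\<close>

lemma operators_uniformly_bounded:
  fixes B :: "real \<Rightarrow> (real \<Rightarrow> complex^'m) \<Rightarrow> complex^'d"
  assumes B: "\<And>\<mu>. \<mu> \<in> I \<Longrightarrow> continuous_linear_operator N p a b (B \<mu>)"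
    and conv: "\<And>y. y \<in> Wv N \<Longrightarrow> ((\<lambda>\<mu>. B \<mu> y) \<longlongrightarrow> B \<mu>\<^sub>0 y) (at \<mu>\<^sub>0 within I)"
  shows "\<exists>C\<ge>0. eventually (\<lambda>\<mu>. \<forall>y\<in>Wv N. norm (B \<mu> y) \<le> C * nv N y) (at \<mu>\<^sub>0 within I)"
proof (rule ccontr)
  assume neg: "\<not> ?thesis"
  have "\<exists>\<mu>\<in>I. \<mu> \<noteq> \<mu>\<^sub>0 \<and> dist \<mu> \<mu>\<^sub>0 < 1 / (real k + 1) \<and> (\<exists>y\<in>Wv N. norm (B \<mu> y) > real k * nv N y)" for k
  proof (rule ccontr)
    assume "\<not> ?thesis"
    then have "\<forall>\<mu>\<in>I. \<mu> \<noteq> \<mu>\<^sub>0 \<and> dist \<mu> \<mu>\<^sub>0 < 1 / (real k + 1) \<longrightarrow> (\<forall>y\<in>Wv N. norm (B \<mu> y) \<le> real k * nv N y)"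
      by (meson not_le)
    then have "eventually (\<lambda>\<mu>. \<forall>y\<in>Wv N. norm (B \<mu> y) \<le> real k * nv N y) (at \<mu>\<^sub>0 within I)"
      unfolding eventually_at by (intro exI[of _ "1 / (real k + 1)"]) auto
    then show False using neg by (meson of_nat_0_le_iff)
  qed
  then obtain \<mu> where \<mu>: "\<And>k. \<mu> k \<in> I" "\<And>k. \<mu> k \<noteq> \<mu>\<^sub>0" "\<And>k. dist (\<mu> k) \<mu>\<^sub>0 < 1 / (real k + 1)"
    and large: "\<And>k. \<exists>y\<in>Wv N. norm (B (\<mu> k) y) > real k * nv N y" by metis
  have "\<exists>x\<in>Wv N. \<forall>C. \<exists>l. norm (B (\<mu> l) x) > C"
  proof (rule uniform_boundedness)
    show "continuous_linear_operator N p a b (B (\<mu> k))" for k by (rule B[OF \<mu>(1)])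
    fix C :: real
    obtain k :: nat where k: "C < real k" using reals_Archimedean2 by blast
    obtain y where y: "y \<in> Wv N" "norm (B (\<mu> k) y) > real k * nv N y" using large by blast
    have "C * nv N y \<le> real k * nv N y" using k nv_nonneg[OF y(1)] by (intro mult_right_mono) auto
    then show "\<exists>l. \<exists>y\<in>Wv N. norm (B (\<mu> l) y) > C * nv N y" using y by (intro exI[of _ k] bexI[of _ y]) auto
  qed
  then obtain x where x: "x \<in> Wv N" "\<And>C. \<exists>l. norm (B (\<mu> l) x) > C" by blast
  from tendstoD[OF conv[OF x(1)], of 1]
  obtain d where d: "d > 0" "\<And>\<nu>. \<nu> \<in> I \<Longrightarrow> \<nu> \<noteq> \<mu>\<^sub>0 \<Longrightarrow> dist \<nu> \<mu>\<^sub>0 < d \<Longrightarrow> dist (B \<nu> x) (B \<mu>\<^sub>0 x) < 1"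
    unfolding eventually_at by auto
  obtain l0 :: nat where l0: "1 / d < real l0" using reals_Archimedean2 by blast
  \<comment> \<open>The sum covers the finitely many indices l < l0 for which \<open>\<mu> l\<close>
    may lie outside the d-neighbourhood where the values at x are within 1 of the limit.\<close>
  define C where "C = norm (B \<mu>\<^sub>0 x) + 1 + (\<Sum>l<l0. norm (B (\<mu> l) x))"
  obtain l where l: "norm (B (\<mu> l) x) > C" using x(2) by blast
  show False
  proof (cases "l < l0")
    case True
    then have "norm (B (\<mu> l) x) \<le> (\<Sum>l<l0. norm (B (\<mu> l) x))"
      by (intro member_le_sum[of l "{..<l0}" "\<lambda>l. norm (B (\<mu> l) x)"]) auto
    then show False using l unfolding C_def by (smt (verit) norm_ge_zero)
  next
    case False
    have "1 / (real l + 1) < d"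
    proof -
      have "1 / d < real l + 1" using l0 False by linarith
      then show ?thesis using d(1) by (simp add: field_simps)
    qed
    then have "dist (B (\<mu> l) x) (B \<mu>\<^sub>0 x) < 1"
      using d(2)[OF \<mu>(1,2), of l] \<mu>(3)[of l] by linarith
    then have "norm (B (\<mu> l) x) < norm (B \<mu>\<^sub>0 x) + 1"
      by (smt (verit) dist_norm norm_triangle_sub)
    moreover have "0 \<le> (\<Sum>l<l0. norm (B (\<mu> l) x))" by (intro sum_nonneg) auto
    ultimately show False using l unfolding C_def by linarith
  qed
qed

end

context companion
begin

lemma nrm_jet_component_le:
  assumes y: "y \<in> Wv (n + r)"
  shows "nrm (Suc n) (\<lambda>t. jet y t $ d) \<le> nv (n + r) y"
proof -
  have le: "Suc n \<le> n + r - fst (e d)" "fst (e d) \<le> r" using fst_e[of d] by arith+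
  have "(\<lambda>s. y s $ snd (e d)) \<in> W ((n + r - fst (e d)) + fst (e d))"
    using sobolev_vec_component[OF y, of "snd (e d)"] le by simp
  from nrm_mono[OF sobolev_nth_deriv(1)[OF this] le(1)] nrm_nth_deriv_component_le[OF y le(2), of "snd (e d)"]
  show ?thesis by (simp add: jet_def)
qed

text \<open>The coefficients are determined by a fundamental system: the top derivatives satisfy
  \<open>y\<^sub>c\<^sup>(\<^sup>r\<^sup>) = - \<Sum>\<^sub>d \<alpha>\<^sub>d J\<^sub>c\<^sub>d\<close>, where \<open>J\<close> is the Wronskian matrix. Multiplying by the inverse \<open>\<Psi>\<close>
  of the unperturbed Wronskian gives an identity for \<open>\<alpha>\<close> that is contractive in \<open>\<alpha>\<close>.\<close>

lemma coefficient_recovery: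
  fixes y0 :: "'d \<Rightarrow> real \<Rightarrow> complex^'m" and Q :: "complex^'d^'d"
  assumes A0: "coeffs n A0" and y0: "\<And>c. sol n A0 (\<lambda>t. 0) (y0 c)"
    and Q: "Q ** (\<chi> d c. jet (y0 c) a $ d) = mat 1"
  shows "\<exists>C\<ge>0. \<forall>A y. coeffs n A \<longrightarrow> (\<forall>c. sol n A (\<lambda>t. 0) (y c)) \<longrightarrow>
     coeff_dist n A A0 \<le> C * (\<Sum>c\<in>UNIV. nv (n + r) (\<lambda>t. y c t - y0 c t)) * (1 + coeff_dist n A A0)"
proof -
  obtain \<Psi> where \<Psi>: "\<Psi> \<in> sobolev_mat (Suc n) p a b"
    "\<And>y t. sol n A0 (\<lambda>t. 0) y \<Longrightarrow> t \<in> {a..b} \<Longrightarrow> \<Psi> t *v jet y t = Q *v jet y a"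
    using adjoint_matrix[OF A0, of Q] by blast
  \<comment> \<open>Entrywise form of W \<Psi> = 1: for the square Wronskian W the left inverse
    \<Psi> is also a right inverse.\<close>
  have inv: "(\<Sum>c\<in>UNIV. jet (y0 c) t $ d * \<Psi> t $ c $ d') = (if d = d' then 1 else 0)" if t: "t \<in> {a..b}" for t d d'
  proof -
    let ?W = "\<lambda>t. (\<chi> d c. jet (y0 c) t $ d) :: complex^'d^'d"
    have "(\<Psi> t ** ?W t) $ i $ c = (Q ** ?W a) $ i $ c" for i c
    proof -
      have "(M ** ?W t) $ i $ c = (M *v jet (y0 c) t) $ i" for M :: "complex^'d^'d" and t
        by (simp add: matrix_matrix_mult_def matrix_vector_mult_def)
      then show ?thesis using \<Psi>(2)[OF y0 t] by metis
    qed
    then have "\<Psi> t ** ?W t = mat 1" using Q by (simp add: vec_eq_iff)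
    then have "?W t ** \<Psi> t = mat 1" by (simp add: matrix_left_right_inverse)
    then have "(?W t ** \<Psi> t) $ d $ d' = (mat 1 :: complex^'d^'d) $ d $ d'" by simp
    then show ?thesis by (simp add: matrix_matrix_mult_def mat_def)
  qed
  define v where "v = nm (Suc n) \<Psi>"
  have v: "0 \<le> v" unfolding v_def by (rule nm_nonneg[OF \<Psi>(1)])
  define S0 where "S0 = (\<Sum>l<r. nm n (A0 l))"
  have S0: "0 \<le> S0" unfolding S0_def using A0 by (intro sum_nonneg nm_nonneg) auto
  define k1 where "k1 = mult_const n"
  define k2 where "k2 = mult_const (Suc n)"
  have k: "0 \<le> k1" "0 \<le> k2" by (simp_all add: k1_def k2_def mult_const_nonneg)
  define dd where "dd = real CARD('d)"
  \<comment> \<open>Collects the bounds below: a difference of top derivatives contributes k1 v,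
    each coefficient times a jet difference contributes k1 (1 + S0) k2 v, and every sum has dd
    terms.\<close>
  define c1 where "c1 = dd * (k1 * v + dd * (k1 * (1 + S0) * (k2 * v)))"
  have c1: "0 \<le> c1" unfolding c1_def dd_def using v S0 k by (intro mult_nonneg_nonneg add_nonneg_nonneg) auto
  show ?thesis
  proof (intro exI[of _ "real CARD('m) * (dd * c1)"] conjI allI impI)
    show "0 \<le> real CARD('m) * (dd * c1)" using c1 by (simp add: dd_def)
    fix A and y :: "'d \<Rightarrow> real \<Rightarrow> complex^'m"
    assume A: "coeffs n A" and "\<forall>c. sol n A (\<lambda>t. 0) (y c)"
    then have y: "sol n A (\<lambda>t. 0) (y c)" for c by blast
    let ?S = "coeff_dist n A A0" and ?\<eta> = "\<Sum>c\<in>UNIV. nv (n + r) (\<lambda>t. y c t - y0 c t)"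
    note yW = sol_sobolev[OF y] and y0W = sol_sobolev[OF y0]
    have dW: "(\<lambda>t. y c t - y0 c t) \<in> Wv (n + r)" for c by (rule sobolev_vec_diff[OF yW y0W])
    have S: "0 \<le> ?S" by (rule coeff_dist_nonneg[OF A A0])
    have eta0: "0 \<le> ?\<eta>" by (intro sum_nonneg nv_nonneg dW)
    have eta: "nv (n + r) (\<lambda>t. y c t - y0 c t) \<le> ?\<eta>" for c
      by (rule member_le_sum[of c UNIV "\<lambda>c. nv (n + r) (\<lambda>t. y c t - y0 c t)"]) (auto intro: nv_nonneg dW)
    have main: "nrm n (\<lambda>t. (A (fst (e d')) t - A0 (fst (e d')) t) $ i $ snd (e d')) \<le> c1 * ?\<eta> * (1 + ?S)" for i d'
    proof -
      define \<alpha> where "\<alpha> d t = A (fst (e d)) t $ i $ snd (e d)" for d t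
      define \<alpha>0 where "\<alpha>0 d t = A0 (fst (e d)) t $ i $ snd (e d)" for d t
      define R where "R c = nth_deriv a b r (\<lambda>s. y c s $ i)" for c
      define R0 where "R0 c = nth_deriv a b r (\<lambda>s. y0 c s $ i)" for c
      define J where "J c d t = jet (y c) t $ d - jet (y0 c) t $ d" for c d t
      define V where "V c t = \<Psi> t $ c $ d'" for c t
      \<comment> \<open>With Wronskians W and W0, the equations R = - \<alpha> W and R0 = -
        \<alpha>0 W0 give (R - R0) + \<alpha> (W - W0) = (\<alpha>0 - \<alpha>) W0. Here J is W -
        W0, and V, a column of \<Psi>, inverts W0.\<close>
      let ?G = "\<lambda>t. - (\<Sum>c\<in>UNIV. (R c t - R0 c t) * V c t + (\<Sum>d\<in>UNIV. \<alpha> d t * (J c d t * V c t)))"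
      have res: "residual A' z t $ i = nth_deriv a b r (\<lambda>s. z s $ i) t +
          (\<Sum>d\<in>UNIV. A' (fst (e d)) t $ i $ snd (e d) * jet z t $ d)" for A' z t
        using sum_e[of "\<lambda>z'. A' (fst z') t $ i $ snd z' * nth_deriv a b (fst z') (\<lambda>s. z s $ snd z') t"]
        by (simp add: residual_def jet_def)
      have eq: "weq n (\<lambda>t. \<alpha> d' t - \<alpha>0 d' t) ?G"
      \<comment> \<open>The pairs of an index c and a flag range over the equations satisfied by all
        \<open>y c\<close> and \<open>y0 c\<close>.\<close>
      proof (rule weq_finite[of n "\<lambda>z t. (if snd z then residual A (y (fst z)) else residual A0 (y0 (fst z))) t $ i" "\<lambda>_ t. 0"])
        show "weq n (\<lambda>t. (if snd z then residual A (y (fst z)) else residual A0 (y0 (fst z))) t $ i) (\<lambda>t. 0)" for z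
          using y[of "fst z"] y0[of "fst z"] unfolding sol_def wveq_def by (cases "snd z") auto
        fix t assume t: "t \<in> {a..b}"
          and zero: "\<And>z. (if snd z then residual A (y (fst z)) else residual A0 (y0 (fst z))) t $ i = 0"
        have 1: "R c t = - (\<Sum>d\<in>UNIV. \<alpha> d t * jet (y c) t $ d)" for c
          using zero[of "(c, True)"] by (simp add: res R_def \<alpha>_def eq_neg_iff_add_eq_0)
        have 2: "R0 c t = - (\<Sum>d\<in>UNIV. \<alpha>0 d t * jet (y0 c) t $ d)" for c
          using zero[of "(c, False)"] by (simp add: res R0_def \<alpha>0_def eq_neg_iff_add_eq_0)
        have 3: "(\<Sum>c\<in>UNIV. (\<Sum>d\<in>UNIV. \<beta> d * jet (y0 c) t $ d) * V c t) = \<beta> d'" for \<beta> :: "'d \<Rightarrow> complex"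
        proof -
          have "(\<Sum>c\<in>UNIV. (\<Sum>d\<in>UNIV. \<beta> d * jet (y0 c) t $ d) * V c t)
              = (\<Sum>d\<in>UNIV. \<Sum>c\<in>UNIV. \<beta> d * (jet (y0 c) t $ d * V c t))"
            by (subst sum.swap) (simp add: sum_distrib_right mult.assoc)
          also have "\<dots> = (\<Sum>d\<in>UNIV. \<beta> d * (if d = d' then 1 else 0))"
            using inv[OF t, of _ d'] by (simp add: V_def flip: sum_distrib_left)
          finally show ?thesis by (simp add: mult_delta_right)
        qed
        have "(R c t - R0 c t) * V c t + (\<Sum>d\<in>UNIV. \<alpha> d t * (J c d t * V c t))
            = (\<Sum>d\<in>UNIV. (\<alpha>0 d t) * jet (y0 c) t $ d) * V c t - (\<Sum>d\<in>UNIV. \<alpha> d t * jet (y0 c) t $ d) * V c t" for c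
        proof -
          have "(\<Sum>d\<in>UNIV. \<alpha> d t * (J c d t * V c t)) = (\<Sum>d\<in>UNIV. \<alpha> d t * J c d t) * V c t"
            by (simp add: sum_distrib_right mult.assoc)
          also have "(\<Sum>d\<in>UNIV. \<alpha> d t * J c d t) = (\<Sum>d\<in>UNIV. \<alpha> d t * jet (y c) t $ d) - (\<Sum>d\<in>UNIV. \<alpha> d t * jet (y0 c) t $ d)"
            by (simp add: J_def right_diff_distrib sum_subtractf)
          finally show ?thesis unfolding 1 2 by (simp add: algebra_simps)
        qed
        then have "?G t = - (\<alpha>0 d' t - \<alpha> d' t)"
          by (simp add: sum_subtractf 3)
        then show "\<alpha> d' t - \<alpha>0 d' t = ?G t" by simp
      qed
      have VW: "V c \<in> W (Suc n)" for c unfolding V_def by (rule sobolev_mat_component[OF \<Psi>(1)])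
      have Vv: "nrm (Suc n) (V c) \<le> v" for c unfolding V_def v_def by (rule nrm_mat_component_le[OF \<Psi>(1)])
      have RR: "(\<lambda>t. R c t - R0 c t) \<in> W n \<and> nrm n (\<lambda>t. R c t - R0 c t) \<le> ?\<eta>" for c
      proof -
        have w: "weq n (nth_deriv a b r (\<lambda>s. (y c s - y0 c s) $ i)) (\<lambda>t. R c t - R0 c t)"
          using nth_deriv_linear[OF sobolev_vec_component[OF y0W[of c], of i] sobolev_vec_component[OF yW[of c], of i], of "-1"]
          by (simp add: R_def R0_def)
        have 1: "nth_deriv a b r (\<lambda>s. (y c s - y0 c s) $ i) \<in> W n"
          by (rule sobolev_nth_deriv(1)[OF sobolev_vec_component[OF dW]])
        have "nrm n (nth_deriv a b r (\<lambda>s. (y c s - y0 c s) $ i)) \<le> ?\<eta>"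
          using nrm_nth_deriv_component_le[OF dW[of c], of r i] eta[of c] by simp
        then show ?thesis using sobolev_weq[OF w] nrm_weq[OF w 1] 1 by simp
      qed
      have JJ: "J c d \<in> W (Suc n) \<and> nrm (Suc n) (J c d) \<le> ?\<eta>" for c d
      proof -
        have w: "weq (Suc n) (\<lambda>t. jet (\<lambda>t. y c t - y0 c t) t $ d) (J c d)"
          by (rule weqI) (simp add: J_def jet_diff[OF yW y0W])
        have 1: "(\<lambda>t. jet (\<lambda>t. y c t - y0 c t) t $ d) \<in> W (Suc n)"
          by (rule sobolev_vec_component[OF jet_sobolev[OF dW]])
        show ?thesis
          using sobolev_weq[OF w] nrm_weq[OF w 1] 1 nrm_jet_component_le[OF dW[of c], of d] eta[of c] by simp
      qed
      have al: "\<alpha> d \<in> W n \<and> nrm n (\<alpha> d) \<le> S0 + ?S" for d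
      proof -
        let ?l = "fst (e d)"
        have l: "?l < r" by (rule fst_e)
        have AW: "A ?l \<in> sobolev_mat n p a b" "A0 ?l \<in> sobolev_mat n p a b" using A A0 l by auto
        have DW: "(\<lambda>t. A ?l t - A0 ?l t) \<in> sobolev_mat n p a b" by (rule coeff_diff_sobolev[OF A A0 l])
        have "\<alpha> d = (\<lambda>t. (A ?l t - A0 ?l t) $ i $ snd (e d) + A0 ?l t $ i $ snd (e d))"
          by (simp add: \<alpha>_def fun_eq_iff)
        then have "nrm n (\<alpha> d) \<le> nrm n (\<lambda>t. (A ?l t - A0 ?l t) $ i $ snd (e d)) + nrm n (\<lambda>t. A0 ?l t $ i $ snd (e d))"
          using sobolev_add(2)[OF sobolev_mat_component[OF DW, of i "snd (e d)"] sobolev_mat_component[OF AW(2), of i "snd (e d)"]]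
          by simp
        also have "\<dots> \<le> nm n (\<lambda>t. A ?l t - A0 ?l t) + nm n (A0 ?l)"
          by (intro add_mono nrm_mat_component_le DW AW)
        also have "nm n (A0 ?l) \<le> S0"
          unfolding S0_def by (rule member_le_sum) (use l A0 in \<open>auto intro: nm_nonneg\<close>)
        also have "nm n (\<lambda>t. A ?l t - A0 ?l t) \<le> ?S" by (rule nm_le_coeff_dist[OF A A0 l])
        finally show ?thesis using sobolev_mat_component[OF AW(1)] by (simp add: \<alpha>_def[abs_def])
      qed
      have T1: "(\<lambda>t. (R c t - R0 c t) * V c t) \<in> W n" "nrm n (\<lambda>t. (R c t - R0 c t) * V c t) \<le> k1 * ?\<eta> * v" for c
        unfolding k1_def using RR[of c] VW Vv by (auto intro: nrm_mult_le)
      have JV: "(\<lambda>t. J c d t * V c t) \<in> W (Suc n)" "nrm (Suc n) (\<lambda>t. J c d t * V c t) \<le> k2 * ?\<eta> * v" for c d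
      proof -
        have "nrm (Suc n) (\<lambda>t. J c d t * V c t) \<le> k2 * nrm (Suc n) (J c d) * nrm (Suc n) (V c)"
          using sobolev_mult(2)[of "J c d" "Suc n" "V c"] JJ[of c d] VW[of c] by (simp add: k2_def)
        also have "\<dots> \<le> k2 * ?\<eta> * v"
          using JJ[of c d] Vv[of c] k eta0 nrm_nonneg[OF VW] by (intro mult_mono mult_left_mono mult_nonneg_nonneg) auto
        finally show "nrm (Suc n) (\<lambda>t. J c d t * V c t) \<le> k2 * ?\<eta> * v" .
        show "(\<lambda>t. J c d t * V c t) \<in> W (Suc n)"
          using sobolev_mult(1)[of "J c d" "Suc n" "V c"] JJ[of c d] VW[of c] by simp
      qed
      have T2: "(\<lambda>t. \<alpha> d t * (J c d t * V c t)) \<in> W n" "nrm n (\<lambda>t. \<alpha> d t * (J c d t * V c t)) \<le> k1 * (S0 + ?S) * (k2 * ?\<eta> * v)" for c d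
        unfolding k1_def using al[of d] JV by (auto intro: nrm_mult_le)
      have T3: "(\<lambda>t. (R c t - R0 c t) * V c t + (\<Sum>d\<in>UNIV. \<alpha> d t * (J c d t * V c t))) \<in> W n" for c
        by (intro sobolev_add(1) sobolev_sum(1) T1 T2)
      have T3n: "nrm n (\<lambda>t. (R c t - R0 c t) * V c t + (\<Sum>d\<in>UNIV. \<alpha> d t * (J c d t * V c t)))
          \<le> k1 * ?\<eta> * v + dd * (k1 * (S0 + ?S) * (k2 * ?\<eta> * v))" for c
      proof -
        have "nrm n (\<lambda>t. \<Sum>d\<in>UNIV. \<alpha> d t * (J c d t * V c t)) \<le> (\<Sum>d\<in>(UNIV::'d set). k1 * (S0 + ?S) * (k2 * ?\<eta> * v))"
          by (rule order_trans[OF sobolev_sum(2)[OF T2(1)]]) (rule sum_mono, rule T2(2))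
        moreover have "(\<lambda>t. \<Sum>d\<in>UNIV. \<alpha> d t * (J c d t * V c t)) \<in> W n" by (rule sobolev_sum(1)[OF T2(1)])
        ultimately show ?thesis
          using sobolev_add(2)[OF T1(1)[of c], of "\<lambda>t. \<Sum>d\<in>UNIV. \<alpha> d t * (J c d t * V c t)"] T1(2)[of c]
          by (simp add: dd_def)
      qed
      have GW: "?G \<in> W n" by (intro sobolev_uminus(1) sobolev_sum(1) T3)
      have "nrm n (\<lambda>t. \<alpha> d' t - \<alpha>0 d' t) = nrm n ?G"
        using nrm_weq[OF weq_sym[OF eq] GW] by simp
      also have "\<dots> = nrm n (\<lambda>t. \<Sum>c\<in>UNIV. (R c t - R0 c t) * V c t + (\<Sum>d\<in>UNIV. \<alpha> d t * (J c d t * V c t)))"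
        by (intro sobolev_uminus(2) sobolev_sum(1) T3)
      also have "\<dots> \<le> (\<Sum>c\<in>(UNIV::'d set). k1 * ?\<eta> * v + dd * (k1 * (S0 + ?S) * (k2 * ?\<eta> * v)))"
        by (rule order_trans[OF sobolev_sum(2)[OF T3]]) (intro sum_mono T3n)
      also have "\<dots> = dd * (k1 * v + dd * (k1 * (S0 + ?S) * (k2 * v))) * ?\<eta>"
        by (simp add: dd_def algebra_simps)
      also have "\<dots> \<le> c1 * (1 + ?S) * ?\<eta>"
      proof (rule mult_right_mono[OF _ eta0])
        have "k1 * v \<le> k1 * v * (1 + ?S)" using k v S by (simp add: algebra_simps)
        \<comment> \<open>S0 + S \<le> (1 + S0) (1 + S) splits off the factor 1 + S.\<close>
        moreover have "k1 * (S0 + ?S) * (k2 * v) \<le> k1 * ((1 + S0) * (1 + ?S)) * (k2 * v)"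
          using k v S S0 by (intro mult_right_mono mult_left_mono) (auto simp: algebra_simps)
        ultimately have "dd * (k1 * v + dd * (k1 * (S0 + ?S) * (k2 * v)))
            \<le> dd * (k1 * v * (1 + ?S) + dd * (k1 * ((1 + S0) * (1 + ?S)) * (k2 * v)))"
          by (intro mult_left_mono add_mono) (auto simp: dd_def)
        also have "\<dots> = c1 * (1 + ?S)" by (simp add: c1_def algebra_simps)
        finally show "dd * (k1 * v + dd * (k1 * (S0 + ?S) * (k2 * v))) \<le> c1 * (1 + ?S)" .
      qed
      finally show ?thesis by (simp add: \<alpha>_def \<alpha>0_def mult_ac)
    qed
    have "?S = (\<Sum>i\<in>UNIV. \<Sum>d\<in>UNIV. nrm n (\<lambda>t. (A (fst (e d)) t - A0 (fst (e d)) t) $ i $ snd (e d)))"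
    proof -
      have "(\<Sum>d\<in>UNIV. nrm n (\<lambda>t. (A (fst (e d)) t - A0 (fst (e d)) t) $ i $ snd (e d))) =
          (\<Sum>l<r. \<Sum>j\<in>UNIV. nrm n (\<lambda>t. (A l t - A0 l t) $ i $ j))" for i
        using sum_e[of "\<lambda>z. nrm n (\<lambda>t. (A (fst z) t - A0 (fst z) t) $ i $ snd z)"] by simp
      then show ?thesis unfolding coeff_dist_def sobolev_mat_norm_def by (simp add: sum.swap[of _ "{..<r}" UNIV])
    qed
    also have "\<dots> \<le> (\<Sum>i\<in>(UNIV::'m set). \<Sum>d\<in>(UNIV::'d set). c1 * ?\<eta> * (1 + ?S))"
      by (intro sum_mono main)
    finally show "?S \<le> real CARD('m) * (dd * c1) * ?\<eta> * (1 + ?S)" by (simp add: dd_def mult_ac)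
  qed
qed

end

section \<open>Continuous dependence on the parameter\<close>

locale bvp_family = companion a b p r e for a b :: real and p :: ennreal and r :: nat
    and e :: "'d::finite \<Rightarrow> nat \<times> 'm::finite" +
  fixes n :: nat and I :: "real set" and \<mu>\<^sub>0 :: real
    and A :: "nat \<Rightarrow> real \<Rightarrow> real \<Rightarrow> complex^'m^'m"
    and B :: "real \<Rightarrow> (real \<Rightarrow> complex^'m) \<Rightarrow> complex^'d"
  assumes mu0: "\<mu>\<^sub>0 \<in> I"
    and A: "\<And>j \<mu>. j < r \<Longrightarrow> \<mu> \<in> I \<Longrightarrow> A j \<mu> \<in> sobolev_mat n p a b"
    and B: "\<And>\<mu>. \<mu> \<in> I \<Longrightarrow> continuous_linear_operator (n + r) p a b (B \<mu>)"
begin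

abbreviation "A' \<mu> \<equiv> \<lambda>j. A j \<mu>"
abbreviation "F \<equiv> at \<mu>\<^sub>0 within I"
abbreviation "N \<equiv> n + r"

lemma coeffs: "\<mu> \<in> I \<Longrightarrow> coeffs n (A' \<mu>)"
  using A by blast

lemma eventually_I: "eventually (\<lambda>\<mu>. \<mu> \<in> I) F"
  by (simp add: eventually_at_filter)

lemma eventually_near: "\<epsilon> > 0 \<Longrightarrow> eventually (\<lambda>\<mu>. \<mu> \<in> I \<inter> {\<mu>\<^sub>0 - \<epsilon><..<\<mu>\<^sub>0 + \<epsilon>}) F"
  unfolding eventually_at by (intro exI[of _ \<epsilon>]) (auto simp: dist_real_def)

lemma bvp_solution_sol:
  assumes "\<mu> \<in> I" "f \<in> Wv n"
  shows "bvp_solution n p a b r (A' \<mu>) (B \<mu>) f c y \<longleftrightarrow> sol n (A' \<mu>) f y \<and> B \<mu> y = c"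
  using bvp_solution_iff[OF coeffs[OF assms(1)] assms(2)] by (simp add: sol_def)

text \<open>The difference y - y0 is inserted into the estimate for the fixed operator at
  \<open>\<mu>\<^sub>0\<close>. Its residual there is the change of f minus the effect of the
  changed coefficients on y, and bounding y by y - y0 and y0 leaves a small multiple of the unknown
  norm to be absorbed.\<close>

lemma ivp_convergence:
  assumes sol: "eventually (\<lambda>\<mu>. sol n (A' \<mu>) (f \<mu>) (y \<mu>)) F" and f: "eventually (\<lambda>\<mu>. f \<mu> \<in> Wv n) F"
    and sol0: "sol n (A' \<mu>\<^sub>0) f0 y0" and f0: "f0 \<in> Wv n"
    and cf: "((\<lambda>\<mu>. nv n (\<lambda>t. f \<mu> t - f0 t)) \<longlongrightarrow> 0) F"
    and cj: "((\<lambda>\<mu>. jet (y \<mu>) a) \<longlongrightarrow> jet y0 a) F"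
    and cA: "((\<lambda>\<mu>. coeff_dist n (A' \<mu>) (A' \<mu>\<^sub>0)) \<longlongrightarrow> 0) F"
  shows "((\<lambda>\<mu>. nv N (\<lambda>t. y \<mu> t - y0 t)) \<longlongrightarrow> 0) F"
proof -
  note A0 = coeffs[OF mu0]
  have y0: "y0 \<in> Wv N" by (rule sol_sobolev[OF sol0])
  obtain K where K: "K \<ge> 0" "\<And>y. y \<in> Wv N \<Longrightarrow> nv N y \<le> K * (norm (jet y a) + nv n (residual (A' \<mu>\<^sub>0) y))"
    using ivp_estimate[OF A0] by blast
  obtain C where C: "C \<ge> 0" "\<And>A A' y. coeffs n A \<Longrightarrow> coeffs n A' \<Longrightarrow> y \<in> Wv N \<Longrightarrow>
     nv n (\<lambda>t. residual A y t - residual A' y t) \<le> C * coeff_dist n A A' * nv N y"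
    using residual_perturbation[of n] by blast
  define S where "S \<mu> = coeff_dist n (A' \<mu>) (A' \<mu>\<^sub>0)" for \<mu>
  define s where "s \<mu> = nv N (\<lambda>t. y \<mu> t - y0 t)" for \<mu>
  define \<rho> where "\<rho> \<mu> = K * (norm (jet (y \<mu>) a - jet y0 a) + nv n (\<lambda>t. f \<mu> t - f0 t) + C * S \<mu> * nv N y0)" for \<mu>
  have "(s \<longlongrightarrow> 0) F"
  proof (rule tendsto_zero_absorb)
    show "eventually (\<lambda>\<mu>. 0 \<le> s \<mu> \<and> s \<mu> \<le> \<rho> \<mu> + K * (C * S \<mu>) * s \<mu>) F"
      using sol f eventually_I
    proof eventually_elim
      fix \<mu> assume sl: "sol n (A' \<mu>) (f \<mu>) (y \<mu>)" and f: "f \<mu> \<in> Wv n" and \<mu>: "\<mu> \<in> I"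
      note Am = coeffs[OF \<mu>]
      have y: "y \<mu> \<in> Wv N" by (rule sol_sobolev[OF sl])
      let ?d = "\<lambda>t. y \<mu> t - y0 t"
      have d: "?d \<in> Wv N" by (rule sobolev_vec_diff[OF y y0])
      have S0: "0 \<le> S \<mu>" unfolding S_def by (rule coeff_dist_nonneg[OF Am A0])
      let ?R = "\<lambda>t. residual (A' \<mu>) (y \<mu>) t - residual (A' \<mu>\<^sub>0) (y \<mu>) t"
      have RW: "?R \<in> Wv n"
        by (intro sobolev_vec_diff residual_sobolev[OF Am y] residual_sobolev[OF A0 y])
      have fW: "(\<lambda>t. f \<mu> t - f0 t) \<in> Wv n" by (rule sobolev_vec_diff[OF f f0])
      have 1: "wveq n (residual (A' \<mu>\<^sub>0) ?d) (\<lambda>t. residual (A' \<mu>\<^sub>0) (y \<mu>) t - residual (A' \<mu>\<^sub>0) y0 t)"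
        using sol_diff[OF sol_residual[OF y] sol_residual[OF y0], of "A' \<mu>\<^sub>0"] by (simp add: sol_def)
      have 2: "wveq n (\<lambda>t. residual (A' \<mu>\<^sub>0) (y \<mu>) t - residual (A' \<mu>\<^sub>0) y0 t) (\<lambda>t. (f \<mu> t - f0 t) - ?R t)"
      proof -
        have "wveq n (\<lambda>t. (residual (A' \<mu>) (y \<mu>) t - residual (A' \<mu>\<^sub>0) y0 t) - ?R t) (\<lambda>t. (f \<mu> t - f0 t) - ?R t)"
          using sl sol0 by (intro wveq_diff wveq_refl) (auto simp: sol_def)
        then show ?thesis by simp
      qed
      have "nv n (residual (A' \<mu>\<^sub>0) ?d) = nv n (\<lambda>t. (f \<mu> t - f0 t) - ?R t)"
        by (rule wveq_nv[OF wveq_trans[OF 1 2] residual_sobolev[OF A0 d]])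
      also have "\<dots> \<le> nv n (\<lambda>t. f \<mu> t - f0 t) + nv n ?R" by (rule nv_diff[OF fW RW])
      also have "nv n ?R \<le> C * S \<mu> * nv N (y \<mu>)" unfolding S_def by (rule C(2)[OF Am A0 y])
      also have "\<dots> \<le> C * S \<mu> * (s \<mu> + nv N y0)"
        using nv_add[OF d y0] C(1) S0 by (intro mult_left_mono) (auto simp: s_def)
      finally have res: "nv n (residual (A' \<mu>\<^sub>0) ?d) \<le> nv n (\<lambda>t. f \<mu> t - f0 t) + C * S \<mu> * (s \<mu> + nv N y0)"
        by simp
      have "jet ?d a = jet (y \<mu>) a - jet y0 a" by (rule jet_diff[OF y y0]) (use ab in simp)
      then have "s \<mu> \<le> K * (norm (jet (y \<mu>) a - jet y0 a) + nv n (residual (A' \<mu>\<^sub>0) ?d))"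
        using K(2)[OF d] by (simp add: s_def)
      also have "\<dots> \<le> K * (norm (jet (y \<mu>) a - jet y0 a) + (nv n (\<lambda>t. f \<mu> t - f0 t) + C * S \<mu> * (s \<mu> + nv N y0)))"
        using res K(1) by (intro mult_left_mono add_left_mono)
      also have "\<dots> = \<rho> \<mu> + K * (C * S \<mu>) * s \<mu>" by (simp add: \<rho>_def algebra_simps)
      finally show "0 \<le> s \<mu> \<and> s \<mu> \<le> \<rho> \<mu> + K * (C * S \<mu>) * s \<mu>" using nv_nonneg[OF d] by (simp add: s_def)
    qed
    have cS: "(S \<longlongrightarrow> 0) F" using cA by (simp add: S_def[abs_def])
    have "((\<lambda>\<mu>. jet (y \<mu>) a - jet y0 a) \<longlongrightarrow> 0) F" using cj by (rule LIM_zero)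
    then have "(\<rho> \<longlongrightarrow> K * (0 + 0 + C * 0 * nv N y0)) F"
      unfolding \<rho>_def by (intro tendsto_intros tendsto_norm_zero cf cS)
    then show "(\<rho> \<longlongrightarrow> 0) F" by simp
    have "((\<lambda>\<mu>. K * (C * S \<mu>)) \<longlongrightarrow> K * (C * 0)) F" by (intro tendsto_intros cS)
    then show "((\<lambda>\<mu>. K * (C * S \<mu>)) \<longlongrightarrow> 0) F" by simp
  qed
  then show ?thesis by (simp add: s_def[abs_def])
qed

theorem continuous_dependence_sufficient:
  assumes hom: "\<And>y. sol n (A' \<mu>\<^sub>0) (\<lambda>t. 0) y \<Longrightarrow> B \<mu>\<^sub>0 y = 0 \<Longrightarrow> \<forall>t\<in>{a..b}. y t = 0"
    and cA: "((\<lambda>\<mu>. coeff_dist n (A' \<mu>) (A' \<mu>\<^sub>0)) \<longlongrightarrow> 0) F"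
    and cB: "\<And>y. y \<in> Wv N \<Longrightarrow> ((\<lambda>\<mu>. B \<mu> y) \<longlongrightarrow> B \<mu>\<^sub>0 y) F"
  shows "depends_continuously_at n p a b r I \<mu>\<^sub>0 A B"
proof -
  have aI: "a \<in> {a..b}" using ab by simp
  obtain C where C: "C \<ge> 0" "eventually (\<lambda>\<mu>. \<forall>y\<in>Wv N. norm (B \<mu> y) \<le> C * nv N y) F"
    using operators_uniformly_bounded[OF B cB] by blast
  \<comment> \<open>Operator and argument vary simultaneously; the uniform bound C handles the
    change of the argument, pointwise convergence that of the operator.\<close>
  have Bconv: "((\<lambda>\<mu>. B \<mu> (y \<mu>)) \<longlongrightarrow> B \<mu>\<^sub>0 y0) F"
    if y: "eventually (\<lambda>\<mu>. y \<mu> \<in> Wv N) F" and y0: "y0 \<in> Wv N"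
      and conv: "((\<lambda>\<mu>. nv N (\<lambda>t. y \<mu> t - y0 t)) \<longlongrightarrow> 0) F" for y y0
  proof -
    have "((\<lambda>\<mu>. C * nv N (\<lambda>t. y \<mu> t - y0 t)) \<longlongrightarrow> 0) F"
      using tendsto_mult_left[OF conv, of C] by simp
    moreover have "eventually (\<lambda>\<mu>. norm (B \<mu> (y \<mu>) - B \<mu> y0) \<le> C * nv N (\<lambda>t. y \<mu> t - y0 t)) F"
      using C(2) y eventually_I
    proof eventually_elim
      fix \<mu> assume 1: "\<forall>y\<in>Wv N. norm (B \<mu> y) \<le> C * nv N y" and 2: "y \<mu> \<in> Wv N" and 3: "\<mu> \<in> I"
      show "norm (B \<mu> (y \<mu>) - B \<mu> y0) \<le> C * nv N (\<lambda>t. y \<mu> t - y0 t)"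
        unfolding operator_diff[OF B[OF 3] 2 y0, symmetric] using 1 sobolev_vec_diff[OF 2 y0] by blast
    qed
    ultimately have "((\<lambda>\<mu>. B \<mu> (y \<mu>) - B \<mu> y0) \<longlongrightarrow> 0) F"
      by (rule Lim_null_comparison[rotated])
    from tendsto_add[OF this cB[OF y0]] show ?thesis by simp
  qed
  \<comment> \<open>A fundamental system whose Wronskian at a is the identity, so that q is the
    initial jet of \<open>comb \<mu> q\<close>.\<close>
  have "\<exists>y. sol n (A' \<mu>) (\<lambda>t. 0) y \<and> jet y a = axis c 1" if "\<mu> \<in> I" for \<mu> c
    using ivp_existence[OF coeffs[OF that] sobolev_vec_zero, of "axis c 1"] by (metis sol_def)
  then obtain \<Phi> where \<Phi>: "\<And>\<mu> c. \<mu> \<in> I \<Longrightarrow> sol n (A' \<mu>) (\<lambda>t. 0) (\<Phi> \<mu> c)"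
    "\<And>\<mu> c. \<mu> \<in> I \<Longrightarrow> jet (\<Phi> \<mu> c) a = axis c 1" by metis
  note \<Phi>W = sol_sobolev[OF \<Phi>(1)]
  define comb where "comb \<mu> q t = (\<Sum>c\<in>UNIV. q $ c *s \<Phi> \<mu> c t)" for \<mu> and q :: "complex^'d" and t
  have comb_sol: "sol n (A' \<mu>) (\<lambda>t. 0) (comb \<mu> q)" if "\<mu> \<in> I" for \<mu> q
    unfolding comb_def[abs_def] by (rule sol_sum) (rule \<Phi>(1)[OF that])
  note combW = sol_sobolev[OF comb_sol]
  have comb_jet: "jet (comb \<mu> q) a = q" if "\<mu> \<in> I" for \<mu> q
    unfolding comb_def[abs_def] using jet_sum[where J=UNIV and y="\<Phi> \<mu>" and q="\<lambda>c. q $ c", OF \<Phi>W[OF that] aI]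
    by (simp add: \<Phi>(2)[OF that] sum_axis_smult)
  \<comment> \<open>The characteristic matrix of the boundary-value problem in this basis.\<close>
  define M where "M \<mu> = (\<chi> i c. B \<mu> (\<Phi> \<mu> c) $ i)" for \<mu>
  have comb_B: "B \<mu> (comb \<mu> q) = M \<mu> *v q" if "\<mu> \<in> I" for \<mu> q
    unfolding comb_def[abs_def] using operator_sum[where J=UNIV and y="\<Phi> \<mu>" and q="\<lambda>c. q $ c", OF B[OF that] \<Phi>W[OF that]]
    by (simp add: vec_eq_iff M_def matrix_vector_mult_def mult.commute)
  have "M \<mu>\<^sub>0 *v q = 0 \<Longrightarrow> q = 0" for q
  proof -
    assume "M \<mu>\<^sub>0 *v q = 0"
    then have z: "comb \<mu>\<^sub>0 q t = 0" if "t \<in> {a..b}" for t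
      using hom[OF comb_sol[OF mu0]] comb_B[OF mu0] that by simp
    have "jet (comb \<mu>\<^sub>0 q) a = jet (\<lambda>t. 0) a"
      unfolding jet_def by (simp add: vec_eq_iff) (intro allI nth_deriv_cong aI, simp add: z)
    then show "q = 0" using comb_jet[OF mu0] jet_zero[OF aI] by simp
  qed
  then obtain Q where Q: "Q ** M \<mu>\<^sub>0 = mat 1"
    using matrix_left_invertible_ker[of "M \<mu>\<^sub>0"] by blast
  \<comment> \<open>A bound for the inverse of M at \<open>\<mu>\<^sub>0\<close>. A perturbation of
    M of size less than 1 / (2 \<kappa>) at most doubles it, which is the property P below.\<close>
  define \<kappa> where "\<kappa> = mat_size (\<lambda>_. Q) 0"
  have \<kappa>0: "0 \<le> \<kappa>" unfolding \<kappa>_def by (rule mat_size_nonneg)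
  have \<kappa>: "norm q \<le> \<kappa> * norm (M \<mu>\<^sub>0 *v q)" for q
    using norm_matrix_vector_le[of Q "M \<mu>\<^sub>0 *v q"] Q by (simp add: matrix_vector_mul_assoc \<kappa>_def)
  have cM: "((\<lambda>\<mu>. mat_size (\<lambda>_. M \<mu> - M \<mu>\<^sub>0) 0) \<longlongrightarrow> 0) F"
  proof -
    have "((\<lambda>\<mu>. B \<mu> (\<Phi> \<mu> c)) \<longlongrightarrow> B \<mu>\<^sub>0 (\<Phi> \<mu>\<^sub>0 c)) F" for c
    proof (rule Bconv)
      show "eventually (\<lambda>\<mu>. \<Phi> \<mu> c \<in> Wv N) F" using eventually_I by eventually_elim (rule \<Phi>W)
      show "((\<lambda>\<mu>. nv N (\<lambda>t. \<Phi> \<mu> c t - \<Phi> \<mu>\<^sub>0 c t)) \<longlongrightarrow> 0) F"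
      proof (rule ivp_convergence[OF _ _ \<Phi>(1)[OF mu0] sobolev_vec_zero _ _ cA])
        show "eventually (\<lambda>\<mu>. sol n (A' \<mu>) (\<lambda>t. 0) (\<Phi> \<mu> c)) F" using eventually_I by eventually_elim (rule \<Phi>(1))
        have "eventually (\<lambda>\<mu>. jet (\<Phi> \<mu> c) a = jet (\<Phi> \<mu>\<^sub>0 c) a) F"
          using eventually_I by eventually_elim (simp add: \<Phi>(2) mu0)
        then show "((\<lambda>\<mu>. jet (\<Phi> \<mu> c) a) \<longlongrightarrow> jet (\<Phi> \<mu>\<^sub>0 c) a) F" by (rule tendsto_eventually)
      qed (simp_all add: sobolev_vec_zero nv_zero)
    qed (rule \<Phi>W[OF mu0])
    from tendsto_vec_nth[OF LIM_zero[OF this]]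
    have "((\<lambda>\<mu>. (B \<mu> (\<Phi> \<mu> c) - B \<mu>\<^sub>0 (\<Phi> \<mu>\<^sub>0 c)) $ i) \<longlongrightarrow> 0) F" for c i
      by (simp only: zero_index)
    from tendsto_norm_zero[OF this]
    have "((\<lambda>\<mu>. norm ((B \<mu> (\<Phi> \<mu> c) - B \<mu>\<^sub>0 (\<Phi> \<mu>\<^sub>0 c)) $ i)) \<longlongrightarrow> 0) F" for c i .
    then have "((\<lambda>\<mu>. \<Sum>i\<in>UNIV. \<Sum>c\<in>UNIV. norm ((B \<mu> (\<Phi> \<mu> c) - B \<mu>\<^sub>0 (\<Phi> \<mu>\<^sub>0 c)) $ i)) \<longlongrightarrow> 0) F"
      by (intro tendsto_null_sum)
    then show ?thesis by (simp add: mat_size_def M_def)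
  qed
  define P where "P \<mu> \<longleftrightarrow> (\<forall>q. norm q \<le> 2 * \<kappa> * norm (M \<mu> *v q))" for \<mu>
  have "eventually P F"
  proof -
    have "((\<lambda>\<mu>. \<kappa> * mat_size (\<lambda>_. M \<mu> - M \<mu>\<^sub>0) 0) \<longlongrightarrow> 0) F"
      using tendsto_mult_left[OF cM, of \<kappa>] by simp
    then have "eventually (\<lambda>\<mu>. \<kappa> * mat_size (\<lambda>_. M \<mu> - M \<mu>\<^sub>0) 0 < 1 / 2) F" by (rule order_tendstoD) simp
    then show ?thesis
    proof eventually_elim
      fix \<mu> assume small: "\<kappa> * mat_size (\<lambda>_. M \<mu> - M \<mu>\<^sub>0) 0 < 1 / 2"
      show "P \<mu>" unfolding P_def
      proof
        fix q
        have "M \<mu>\<^sub>0 *v q = M \<mu> *v q - (M \<mu> - M \<mu>\<^sub>0) *v q" by (simp add: matrix_vector_mult_diff_rdistrib)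
        then have "norm (M \<mu>\<^sub>0 *v q) \<le> norm (M \<mu> *v q) + norm ((M \<mu> - M \<mu>\<^sub>0) *v q)"
          by (metis norm_triangle_ineq4)
        also have "norm ((M \<mu> - M \<mu>\<^sub>0) *v q) \<le> mat_size (\<lambda>_. M \<mu> - M \<mu>\<^sub>0) 0 * norm q" by (rule norm_matrix_vector_le)
        finally have "\<kappa> * norm (M \<mu>\<^sub>0 *v q) \<le> \<kappa> * (norm (M \<mu> *v q) + mat_size (\<lambda>_. M \<mu> - M \<mu>\<^sub>0) 0 * norm q)"
          using \<kappa>0 by (intro mult_left_mono) auto
        also have "\<dots> = \<kappa> * norm (M \<mu> *v q) + \<kappa> * mat_size (\<lambda>_. M \<mu> - M \<mu>\<^sub>0) 0 * norm q"
          by (simp add: algebra_simps)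
        also have "\<kappa> * mat_size (\<lambda>_. M \<mu> - M \<mu>\<^sub>0) 0 * norm q \<le> 1 / 2 * norm q"
          using small by (intro mult_right_mono) auto
        finally show "norm q \<le> 2 * \<kappa> * norm (M \<mu> *v q)" using \<kappa>[of q] by linarith
      qed
    qed
  qed
  then obtain \<epsilon> where \<epsilon>: "\<epsilon> > 0" "\<And>\<mu>. \<mu> \<in> I \<Longrightarrow> \<mu> \<noteq> \<mu>\<^sub>0 \<Longrightarrow> dist \<mu> \<mu>\<^sub>0 < \<epsilon> \<Longrightarrow> P \<mu>"
    unfolding eventually_at by blast
  \<comment> \<open>The filter at \<open>\<mu>\<^sub>0\<close> says nothing about the point
    itself.\<close>
  have P0: "P \<mu>\<^sub>0" unfolding P_def
  proof
    fix q
    have "\<kappa> * norm (M \<mu>\<^sub>0 *v q) \<le> 2 * \<kappa> * norm (M \<mu>\<^sub>0 *v q)" using \<kappa>0 by (intro mult_right_mono) auto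
    then show "norm q \<le> 2 * \<kappa> * norm (M \<mu>\<^sub>0 *v q)" using \<kappa>[of q] by linarith
  qed
  have P: "P \<mu>" if "\<mu> \<in> I \<inter> {\<mu>\<^sub>0 - \<epsilon><..<\<mu>\<^sub>0 + \<epsilon>}" for \<mu>
    using \<epsilon>(2)[of \<mu>] P0 that by (cases "\<mu> = \<mu>\<^sub>0") (auto simp: dist_real_def)
  \<comment> \<open>A solution with initial jet \<open>q\<close> is a particular solution plus the combination of the \<open>\<Phi>\<close> with
    coefficients \<open>q\<close>, so the boundary condition becomes a linear system for \<open>q\<close>.\<close>
  have decomp: "M \<mu> *v jet y a = B \<mu> y - B \<mu> z"
    if \<mu>: "\<mu> \<in> I" and y: "sol n (A' \<mu>) f y" and z: "sol n (A' \<mu>) f z" "jet z a = 0" for \<mu> f y z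
  proof -
    let ?u = "\<lambda>t. y t - z t" and ?q = "jet y a"
    have u: "sol n (A' \<mu>) (\<lambda>t. 0) ?u" using sol_diff[OF y z(1)] by simp
    have ju: "jet ?u a = ?q"
      using jet_diff[OF sol_sobolev[OF y] sol_sobolev[OF z(1)] aI] z(2) by simp
    have w: "sol n (A' \<mu>) (\<lambda>t. 0) (\<lambda>t. ?u t - comb \<mu> ?q t)" using sol_diff[OF u comb_sol[OF \<mu>]] by simp
    have "jet (\<lambda>t. ?u t - comb \<mu> ?q t) a = 0"
      using jet_diff[OF sol_sobolev[OF u] combW[OF \<mu>] aI] ju comb_jet[OF \<mu>] by simp
    then have "nv N (\<lambda>t. ?u t - comb \<mu> ?q t) = 0" by (rule sol_unique[OF coeffs[OF \<mu>] w])
    then have "B \<mu> (\<lambda>t. ?u t - comb \<mu> ?q t) = 0" by (rule operator_zero[OF B[OF \<mu>] sol_sobolev[OF w]])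
    then have "B \<mu> ?u = M \<mu> *v ?q"
      using operator_diff[OF B[OF \<mu>] sol_sobolev[OF u] combW[OF \<mu>]] comb_B[OF \<mu>] by simp
    then show ?thesis
      using operator_diff[OF B[OF \<mu>] sol_sobolev[OF y] sol_sobolev[OF z(1)]] by simp
  qed
  have particular: "\<exists>z. sol n (A' \<mu>) f z \<and> jet z a = 0" if "\<mu> \<in> I" "f \<in> Wv n" for \<mu> f
    using ivp_existence[OF coeffs[OF that(1)] that(2), of 0] by (metis sol_def)
  have solvable: "bvp_uniquely_solvable n p a b r (A' \<mu>) (B \<mu>) f c"
    if \<mu>: "\<mu> \<in> I \<inter> {\<mu>\<^sub>0 - \<epsilon><..<\<mu>\<^sub>0 + \<epsilon>}" and f: "f \<in> Wv n" for \<mu> f c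
  proof -
    have \<mu>I: "\<mu> \<in> I" using \<mu> by simp
    have inj: "M \<mu> *v q = 0 \<Longrightarrow> q = 0" for q
      using P[OF \<mu>] unfolding P_def by (metis mult_zero_right norm_le_zero_iff norm_zero)
    then obtain R where "R ** M \<mu> = mat 1" using matrix_left_invertible_ker[of "M \<mu>"] by blast
    then have R: "M \<mu> ** R = mat 1" by (simp add: matrix_left_right_inverse)
    obtain z where z: "sol n (A' \<mu>) f z" "jet z a = 0" using particular[OF \<mu>I f] by blast
    define q where "q = R *v (c - B \<mu> z)"
    have q: "M \<mu> *v q = c - B \<mu> z" by (simp add: q_def matrix_vector_mul_assoc R)
    define y where "y t = 1 *s comb \<mu> q t + z t" for t
    have y: "sol n (A' \<mu>) f y"
      using sol_linear[OF comb_sol[OF \<mu>I] z(1), of 1 q] by (simp add: y_def[abs_def])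
    have "B \<mu> y = c"
      using operator_linear[OF B[OF \<mu>I] combW[OF \<mu>I] sol_sobolev[OF z(1)], of 1 q] q comb_B[OF \<mu>I]
      by (simp add: y_def[abs_def])
    then have "bvp_solution n p a b r (A' \<mu>) (B \<mu>) f c y" using bvp_solution_sol[OF \<mu>I f] y by simp
    moreover have "\<forall>t\<in>{a..b}. x t = y t" if x: "bvp_solution n p a b r (A' \<mu>) (B \<mu>) f c x" for x
    proof
      fix t assume t: "t \<in> {a..b}"
      have x: "sol n (A' \<mu>) f x" "B \<mu> x = c" using x bvp_solution_sol[OF \<mu>I f] by auto
      have d: "sol n (A' \<mu>) (\<lambda>t. 0) (\<lambda>t. x t - y t)" using sol_diff[OF x(1) y] by simp
      have "M \<mu> *v jet x a = M \<mu> *v jet y a"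
        using decomp[OF \<mu>I x(1) z] decomp[OF \<mu>I y z] x(2) \<open>B \<mu> y = c\<close> by simp
      then have "M \<mu> *v (jet x a - jet y a) = 0" by (simp add: matrix_vector_mult_diff_distrib)
      from inj[OF this] have "jet (\<lambda>t. x t - y t) a = 0"
        using jet_diff[OF sol_sobolev[OF x(1)] sol_sobolev[OF y] aI] by simp
      from nv_zero_imp[OF sol_sobolev[OF d] sol_unique[OF coeffs[OF \<mu>I] d this] t] show "x t = y t" by simp
    qed
    ultimately show ?thesis unfolding bvp_uniquely_solvable_def by blast
  qed
  have convergence: "((\<lambda>\<mu>. nv N (\<lambda>t. y \<mu> t - y \<mu>\<^sub>0 t)) \<longlongrightarrow> 0) F"
    if f: "\<forall>\<mu>\<in>I. f \<mu> \<in> Wv n"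
      and y: "\<forall>\<mu>\<in>I \<inter> {\<mu>\<^sub>0 - \<epsilon><..<\<mu>\<^sub>0 + \<epsilon>}. bvp_solution n p a b r (A' \<mu>) (B \<mu>) (f \<mu>) (c \<mu>) (y \<mu>)"
      and cf: "((\<lambda>\<mu>. nv n (\<lambda>t. f \<mu> t - f \<mu>\<^sub>0 t)) \<longlongrightarrow> 0) F" and cc: "(c \<longlongrightarrow> c \<mu>\<^sub>0) F" for f c y
  proof -
    note near = eventually_near[OF \<epsilon>(1)]
    have near0: "\<mu>\<^sub>0 \<in> I \<inter> {\<mu>\<^sub>0 - \<epsilon><..<\<mu>\<^sub>0 + \<epsilon>}" using mu0 \<epsilon>(1) by simp
    have ys: "sol n (A' \<mu>) (f \<mu>) (y \<mu>)" "B \<mu> (y \<mu>) = c \<mu>" if "\<mu> \<in> I \<inter> {\<mu>\<^sub>0 - \<epsilon><..<\<mu>\<^sub>0 + \<epsilon>}" for \<mu>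
    proof -
      have "\<mu> \<in> I" "f \<mu> \<in> Wv n" using that f by auto
      then show "sol n (A' \<mu>) (f \<mu>) (y \<mu>)" "B \<mu> (y \<mu>) = c \<mu>"
        using y[rule_format, OF that] by (simp_all add: bvp_solution_sol)
    qed
    \<comment> \<open>All these start from the jet 0, so their convergence follows from that of f
      and of the coefficients alone.\<close>
    define z where "z \<mu> = (SOME z. sol n (A' \<mu>) (f \<mu>) z \<and> jet z a = 0)" for \<mu>
    have z: "sol n (A' \<mu>) (f \<mu>) (z \<mu>)" "jet (z \<mu>) a = 0" if "\<mu> \<in> I" for \<mu>
      using someI_ex[OF particular[OF that f[rule_format, OF that]]] unfolding z_def by blast+
    have f0: "f \<mu>\<^sub>0 \<in> Wv n" using f mu0 by blast
    have fe: "eventually (\<lambda>\<mu>. f \<mu> \<in> Wv n) F" using eventually_I by eventually_elim (use f in blast)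
    have cz: "((\<lambda>\<mu>. nv N (\<lambda>t. z \<mu> t - z \<mu>\<^sub>0 t)) \<longlongrightarrow> 0) F"
    proof (rule ivp_convergence[OF _ fe z(1)[OF mu0] f0 cf _ cA])
      show "eventually (\<lambda>\<mu>. sol n (A' \<mu>) (f \<mu>) (z \<mu>)) F" using eventually_I by eventually_elim (rule z(1))
      have "eventually (\<lambda>\<mu>. jet (z \<mu>) a = jet (z \<mu>\<^sub>0) a) F"
        using eventually_I by eventually_elim (simp add: z(2) mu0)
      then show "((\<lambda>\<mu>. jet (z \<mu>) a) \<longlongrightarrow> jet (z \<mu>\<^sub>0) a) F" by (rule tendsto_eventually)
    qed
    have cBz: "((\<lambda>\<mu>. B \<mu> (z \<mu>)) \<longlongrightarrow> B \<mu>\<^sub>0 (z \<mu>\<^sub>0)) F"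
    proof (rule Bconv[OF _ sol_sobolev[OF z(1)[OF mu0]] cz])
      show "eventually (\<lambda>\<mu>. z \<mu> \<in> Wv N) F" using eventually_I by eventually_elim (rule sol_sobolev[OF z(1)])
    qed
    define q where "q \<mu> = jet (y \<mu>) a" for \<mu>
    define g where "g \<mu> = c \<mu> - B \<mu> (z \<mu>)" for \<mu>
    have Mq: "M \<mu> *v q \<mu> = g \<mu>" if "\<mu> \<in> I \<inter> {\<mu>\<^sub>0 - \<epsilon><..<\<mu>\<^sub>0 + \<epsilon>}" for \<mu>
      using decomp[OF _ ys(1)[OF that] z(1) z(2)] ys(2)[OF that] that by (simp add: q_def g_def)
    have cq: "(q \<longlongrightarrow> q \<mu>\<^sub>0) F"
    proof -
      let ?h = "\<lambda>\<mu>. 2 * \<kappa> * (norm (g \<mu> - g \<mu>\<^sub>0) + mat_size (\<lambda>_. M \<mu> - M \<mu>\<^sub>0) 0 * norm (q \<mu>\<^sub>0))"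
      have "eventually (\<lambda>\<mu>. norm (q \<mu> - q \<mu>\<^sub>0) \<le> ?h \<mu>) F"
        using near
      proof eventually_elim
        fix \<mu> assume \<mu>: "\<mu> \<in> I \<inter> {\<mu>\<^sub>0 - \<epsilon><..<\<mu>\<^sub>0 + \<epsilon>}"
        \<comment> \<open>The linear systems at \<mu> and \<open>\<mu>\<^sub>0\<close> are
          subtracted so that \<open>M \<mu>\<close>, whose inverse is uniformly bounded by P, acts
          on the unknown difference.\<close>
        have "M \<mu> *v (q \<mu> - q \<mu>\<^sub>0) = (g \<mu> - g \<mu>\<^sub>0) - (M \<mu> - M \<mu>\<^sub>0) *v q \<mu>\<^sub>0"
          using Mq[OF \<mu>] Mq[OF near0] by (simp add: matrix_vector_mult_diff_distrib matrix_vector_mult_diff_rdistrib)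
        then have "norm (M \<mu> *v (q \<mu> - q \<mu>\<^sub>0)) \<le> norm (g \<mu> - g \<mu>\<^sub>0) + norm ((M \<mu> - M \<mu>\<^sub>0) *v q \<mu>\<^sub>0)"
          by (metis norm_triangle_ineq4)
        also have "\<dots> \<le> norm (g \<mu> - g \<mu>\<^sub>0) + mat_size (\<lambda>_. M \<mu> - M \<mu>\<^sub>0) 0 * norm (q \<mu>\<^sub>0)"
          by (intro add_left_mono norm_matrix_vector_le)
        finally have "2 * \<kappa> * norm (M \<mu> *v (q \<mu> - q \<mu>\<^sub>0)) \<le> ?h \<mu>" using \<kappa>0 by (intro mult_left_mono) auto
        then show "norm (q \<mu> - q \<mu>\<^sub>0) \<le> ?h \<mu>" using P[OF \<mu>] unfolding P_def by (meson order_trans)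
      qed
      moreover have "(?h \<longlongrightarrow> 0) F"
      proof -
        have "((\<lambda>\<mu>. g \<mu> - g \<mu>\<^sub>0) \<longlongrightarrow> 0) F"
          unfolding g_def by (rule LIM_zero) (intro tendsto_diff cc cBz)
        then have "(?h \<longlongrightarrow> 2 * \<kappa> * (0 + 0 * norm (q \<mu>\<^sub>0))) F"
          by (intro tendsto_intros tendsto_norm_zero cM)
        then show ?thesis by simp
      qed
      ultimately have "((\<lambda>\<mu>. q \<mu> - q \<mu>\<^sub>0) \<longlongrightarrow> 0) F" by (rule Lim_null_comparison)
      then show ?thesis by (rule LIM_zero_cancel)
    qed
    show ?thesis
    proof (rule ivp_convergence[OF _ fe ys(1)[OF near0] f0 cf _ cA])
      show "eventually (\<lambda>\<mu>. sol n (A' \<mu>) (f \<mu>) (y \<mu>)) F" using near by eventually_elim (rule ys(1))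
      show "((\<lambda>\<mu>. jet (y \<mu>) a) \<longlongrightarrow> jet (y \<mu>\<^sub>0) a) F" using cq by (simp add: q_def[abs_def])
    qed
  qed
  show ?thesis
    unfolding depends_continuously_at_def
    using \<epsilon>(1) solvable convergence by (intro exI[of _ \<epsilon>] conjI ballI allI impI) blast+
qed

theorem continuous_dependence_necessary:
  assumes dep: "depends_continuously_at n p a b r I \<mu>\<^sub>0 A B"
  shows "sol n (A' \<mu>\<^sub>0) (\<lambda>t. 0) y \<Longrightarrow> B \<mu>\<^sub>0 y = 0 \<Longrightarrow> \<forall>t\<in>{a..b}. y t = 0"
    and "((\<lambda>\<mu>. coeff_dist n (A' \<mu>) (A' \<mu>\<^sub>0)) \<longlongrightarrow> 0) F"
    and "y \<in> Wv N \<Longrightarrow> ((\<lambda>\<mu>. B \<mu> y) \<longlongrightarrow> B \<mu>\<^sub>0 y) F"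
proof -
  have aI: "a \<in> {a..b}" using ab by simp
  obtain \<epsilon> where \<epsilon>: "\<epsilon> > 0"
    and solv: "\<And>\<mu> f c. \<mu> \<in> I \<inter> {\<mu>\<^sub>0 - \<epsilon><..<\<mu>\<^sub>0 + \<epsilon>} \<Longrightarrow> f \<in> Wv n \<Longrightarrow> bvp_uniquely_solvable n p a b r (A' \<mu>) (B \<mu>) f c"
    and conv: "\<And>f c y. \<forall>\<mu>\<in>I. f \<mu> \<in> Wv n \<Longrightarrow>
        \<forall>\<mu>\<in>I \<inter> {\<mu>\<^sub>0 - \<epsilon><..<\<mu>\<^sub>0 + \<epsilon>}. bvp_solution n p a b r (A' \<mu>) (B \<mu>) (f \<mu>) (c \<mu>) (y \<mu>) \<Longrightarrow>
        ((\<lambda>\<mu>. nv n (\<lambda>t. f \<mu> t - f \<mu>\<^sub>0 t)) \<longlongrightarrow> 0) F \<Longrightarrow> (c \<longlongrightarrow> c \<mu>\<^sub>0) F \<Longrightarrow>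
        ((\<lambda>\<mu>. nv N (\<lambda>t. y \<mu> t - y \<mu>\<^sub>0 t)) \<longlongrightarrow> 0) F"
    using dep unfolding depends_continuously_at_def by blast
  define J where "J = I \<inter> {\<mu>\<^sub>0 - \<epsilon><..<\<mu>\<^sub>0 + \<epsilon>}"
  have J0: "\<mu>\<^sub>0 \<in> J" using mu0 \<epsilon> by (simp add: J_def)
  have JI: "\<mu> \<in> J \<Longrightarrow> \<mu> \<in> I" for \<mu> by (simp add: J_def)
  have evJ: "eventually (\<lambda>\<mu>. \<mu> \<in> J) F" unfolding J_def by (rule eventually_near[OF \<epsilon>])
  have unique: "\<forall>t\<in>{a..b}. x t = z t"
    if "\<mu> \<in> J" "f \<in> Wv n" "sol n (A' \<mu>) f x" "sol n (A' \<mu>) f z" "B \<mu> x = B \<mu> z" for \<mu> f x z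
    using solv[of \<mu> f "B \<mu> z"] that bvp_solution_sol[OF JI[OF that(1)] that(2)]
    unfolding bvp_uniquely_solvable_def J_def by metis
  have exist: "\<exists>x. sol n (A' \<mu>) f x \<and> B \<mu> x = c" if "\<mu> \<in> J" "f \<in> Wv n" for \<mu> f c
    using solv[of \<mu> f c] that bvp_solution_sol[OF JI[OF that(1)] that(2)]
    unfolding bvp_uniquely_solvable_def J_def by metis
  have hom: "\<forall>t\<in>{a..b}. y t = 0" if "sol n (A' \<mu>\<^sub>0) (\<lambda>t. 0) y" "B \<mu>\<^sub>0 y = 0" for y
    using unique[OF J0 sobolev_vec_zero that(1) sol_zero] that(2) operator_zero[OF B[OF mu0] sobolev_vec_zero nv_zero] by simp
  then show "sol n (A' \<mu>\<^sub>0) (\<lambda>t. 0) y \<Longrightarrow> B \<mu>\<^sub>0 y = 0 \<Longrightarrow> \<forall>t\<in>{a..b}. y t = 0" .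
  \<comment> \<open>A basis normalised by boundary values, so that \<open>comb \<mu> q\<close> has
    boundary value q. Outside J the choice is arbitrary; \<open>conv\<close> asks for solutions on J
    only.\<close>
  define Y where "Y c \<mu> = (SOME x. sol n (A' \<mu>) (\<lambda>t. 0) x \<and> B \<mu> x = axis c 1)" for c \<mu>
  have Y: "sol n (A' \<mu>) (\<lambda>t. 0) (Y c \<mu>)" "B \<mu> (Y c \<mu>) = axis c 1" if "\<mu> \<in> J" for c \<mu>
    using someI_ex[OF exist[OF that sobolev_vec_zero, of "axis c 1"]] unfolding Y_def by blast+
  note YW = sol_sobolev[OF Y(1)]
  have cY: "((\<lambda>\<mu>. nv N (\<lambda>t. Y c \<mu> t - Y c \<mu>\<^sub>0 t)) \<longlongrightarrow> 0) F" for c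
  proof (rule conv[of "\<lambda>_ _. 0" "\<lambda>_. axis c 1" "Y c"])
    show "\<forall>\<mu>\<in>I \<inter> {\<mu>\<^sub>0 - \<epsilon><..<\<mu>\<^sub>0 + \<epsilon>}. bvp_solution n p a b r (A' \<mu>) (B \<mu>) (\<lambda>t. 0) (axis c 1) (Y c \<mu>)"
      using Y bvp_solution_sol[OF _ sobolev_vec_zero] unfolding J_def by blast
  qed (simp_all add: sobolev_vec_zero nv_zero)
  define \<eta> where "\<eta> \<mu> = (\<Sum>c\<in>UNIV. nv N (\<lambda>t. Y c \<mu> t - Y c \<mu>\<^sub>0 t))" for \<mu>
  have c\<eta>: "(\<eta> \<longlongrightarrow> 0) F" unfolding \<eta>_def[abs_def] by (intro tendsto_null_sum cY)
  have \<eta>_ge: "nv N (\<lambda>t. Y c \<mu> t - Y c \<mu>\<^sub>0 t) \<le> \<eta> \<mu>" if "\<mu> \<in> J" for c \<mu>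
    unfolding \<eta>_def by (rule member_le_sum[of c UNIV "\<lambda>c. nv N (\<lambda>t. Y c \<mu> t - Y c \<mu>\<^sub>0 t)"])
      (auto intro!: nv_nonneg sobolev_vec_diff YW that J0)
  define comb where "comb \<mu> q t = (\<Sum>c\<in>UNIV. q $ c *s Y c \<mu> t)" for \<mu> and q :: "complex^'d" and t
  have comb_sol: "sol n (A' \<mu>) (\<lambda>t. 0) (comb \<mu> q)" if "\<mu> \<in> J" for \<mu> q
    unfolding comb_def[abs_def] by (rule sol_sum) (rule Y(1)[OF that])
  have comb_B: "B \<mu> (comb \<mu> q) = q" if "\<mu> \<in> J" for \<mu> q
    unfolding comb_def[abs_def] using operator_sum[where J=UNIV and y="\<lambda>c. Y c \<mu>" and q="\<lambda>c. q $ c", OF B[OF JI[OF that]] YW[OF that]]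
    by (simp add: Y(2)[OF that] sum_axis_smult)
  \<comment> \<open>The Wronskian at a. If it annihilates q at \<open>\<mu>\<^sub>0\<close>, the
    combination with coefficients q has zero initial jet, hence vanishes, and so does its boundary
    value q.\<close>
  define U where "U \<mu> = (\<chi> d c. jet (Y c \<mu>) a $ d)" for \<mu>
  have comb_jet: "jet (comb \<mu> q) a = U \<mu> *v q" if "\<mu> \<in> J" for \<mu> q
    unfolding comb_def[abs_def] using jet_sum[where J=UNIV and y="\<lambda>c. Y c \<mu>" and q="\<lambda>c. q $ c", OF YW[OF that] aI]
    by (simp add: vec_eq_iff U_def matrix_vector_mult_def mult.commute)
  have "U \<mu>\<^sub>0 *v q = 0 \<Longrightarrow> q = 0" for q
  proof -
    assume "U \<mu>\<^sub>0 *v q = 0"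
    then have "nv N (comb \<mu>\<^sub>0 q) = 0"
      by (intro sol_unique[OF coeffs[OF mu0] comb_sol[OF J0]]) (simp add: comb_jet[OF J0])
    then show "q = 0" using operator_zero[OF B[OF mu0] sol_sobolev[OF comb_sol[OF J0]]] comb_B[OF J0] by metis
  qed
  then obtain Q where Q: "Q ** U \<mu>\<^sub>0 = mat 1"
    using matrix_left_invertible_ker[of "U \<mu>\<^sub>0"] by blast
  define S where "S \<mu> = coeff_dist n (A' \<mu>) (A' \<mu>\<^sub>0)" for \<mu>
  obtain C where C: "C \<ge> 0" "\<And>A y. coeffs n A \<Longrightarrow> (\<And>c. sol n A (\<lambda>t. 0) (y c)) \<Longrightarrow>
     coeff_dist n A (A' \<mu>\<^sub>0) \<le> C * (\<Sum>c\<in>UNIV. nv N (\<lambda>t. y c t - Y c \<mu>\<^sub>0 t)) * (1 + coeff_dist n A (A' \<mu>\<^sub>0))"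
    using coefficient_recovery[OF coeffs[OF mu0] Y(1)[OF J0] Q[unfolded U_def]] by blast
  have S: "(S \<longlongrightarrow> 0) F"
  proof (rule tendsto_zero_absorb)
    show "eventually (\<lambda>\<mu>. 0 \<le> S \<mu> \<and> S \<mu> \<le> C * \<eta> \<mu> + C * \<eta> \<mu> * S \<mu>) F"
      using evJ
    proof eventually_elim
      fix \<mu> assume \<mu>: "\<mu> \<in> J"
      have "S \<mu> \<le> C * \<eta> \<mu> * (1 + S \<mu>)"
        unfolding S_def \<eta>_def by (rule C(2)[OF coeffs[OF JI[OF \<mu>]] Y(1)[OF \<mu>]])
      moreover have "0 \<le> S \<mu>" unfolding S_def by (rule coeff_dist_nonneg[OF coeffs[OF JI[OF \<mu>]] coeffs[OF mu0]])
      ultimately show "0 \<le> S \<mu> \<and> S \<mu> \<le> C * \<eta> \<mu> + C * \<eta> \<mu> * S \<mu>" by (simp add: algebra_simps)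
    qed
    show "((\<lambda>\<mu>. C * \<eta> \<mu>) \<longlongrightarrow> 0) F" "((\<lambda>\<mu>. C * \<eta> \<mu>) \<longlongrightarrow> 0) F"
      using tendsto_mult_left[OF c\<eta>, of C] by simp_all
  qed
  then show "((\<lambda>\<mu>. coeff_dist n (A' \<mu>) (A' \<mu>\<^sub>0)) \<longlongrightarrow> 0) F" by (simp add: S_def[abs_def])
  show "((\<lambda>\<mu>. B \<mu> y) \<longlongrightarrow> B \<mu>\<^sub>0 y) F" if y: "y \<in> Wv N"
  proof -
    \<comment> \<open>With this right-hand side y solves the equation for every \<mu>; only the
      behaviour of its boundary value is unknown.\<close>
    define f where "f \<mu> = residual (A' \<mu>) y" for \<mu>
    have f: "f \<mu> \<in> Wv n" if "\<mu> \<in> I" for \<mu> unfolding f_def by (rule residual_sobolev[OF coeffs[OF that] y])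
    define z where "z \<mu> = (SOME x. sol n (A' \<mu>) (f \<mu>) x \<and> B \<mu> x = B \<mu>\<^sub>0 y)" for \<mu>
    have z: "sol n (A' \<mu>) (f \<mu>) (z \<mu>)" "B \<mu> (z \<mu>) = B \<mu>\<^sub>0 y" if "\<mu> \<in> J" for \<mu>
      using someI_ex[OF exist[OF that f[OF JI[OF that]], of "B \<mu>\<^sub>0 y"]] unfolding z_def by blast+
    note zW = sol_sobolev[OF z(1)]
    obtain C' where C': "C' \<ge> 0" "\<And>A A' y. coeffs n A \<Longrightarrow> coeffs n A' \<Longrightarrow> y \<in> Wv N \<Longrightarrow>
       nv n (\<lambda>t. residual A y t - residual A' y t) \<le> C' * coeff_dist n A A' * nv N y"
      using residual_perturbation[of n] by blast
    have cz: "((\<lambda>\<mu>. nv N (\<lambda>t. z \<mu> t - z \<mu>\<^sub>0 t)) \<longlongrightarrow> 0) F"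
    proof (rule conv[of f "\<lambda>_. B \<mu>\<^sub>0 y" z])
      show "\<forall>\<mu>\<in>I. f \<mu> \<in> Wv n" using f by blast
      show "\<forall>\<mu>\<in>I \<inter> {\<mu>\<^sub>0 - \<epsilon><..<\<mu>\<^sub>0 + \<epsilon>}. bvp_solution n p a b r (A' \<mu>) (B \<mu>) (f \<mu>) (B \<mu>\<^sub>0 y) (z \<mu>)"
        using z bvp_solution_sol[OF _ f] unfolding J_def by blast
      show "((\<lambda>\<mu>. nv n (\<lambda>t. f \<mu> t - f \<mu>\<^sub>0 t)) \<longlongrightarrow> 0) F"
      proof (rule tendsto_sandwich[of "\<lambda>_. 0" _ F "\<lambda>\<mu>. C' * S \<mu> * nv N y"])
        show "eventually (\<lambda>\<mu>. 0 \<le> nv n (\<lambda>t. f \<mu> t - f \<mu>\<^sub>0 t)) F"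
          using eventually_I by eventually_elim (intro nv_nonneg sobolev_vec_diff f mu0)
        show "eventually (\<lambda>\<mu>. nv n (\<lambda>t. f \<mu> t - f \<mu>\<^sub>0 t) \<le> C' * S \<mu> * nv N y) F"
          using eventually_I unfolding f_def S_def
          by eventually_elim (rule C'(2)[OF coeffs coeffs[OF mu0] y])
        have "((\<lambda>\<mu>. C' * S \<mu> * nv N y) \<longlongrightarrow> C' * 0 * nv N y) F" by (intro tendsto_intros S)
        then show "((\<lambda>\<mu>. C' * S \<mu> * nv N y) \<longlongrightarrow> 0) F" by simp
      qed simp
    qed simp
    \<comment> \<open>At \<open>\<mu>\<^sub>0\<close> the function y itself has the prescribed
      boundary value, so uniqueness identifies it with z there.\<close>
    have z0: "nv N (\<lambda>t. y t - z \<mu>\<^sub>0 t) = 0"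
    proof -
      have "\<forall>t\<in>{a..b}. y t = z \<mu>\<^sub>0 t"
        by (rule unique[OF J0 f[OF mu0] _ z(1)[OF J0]]) (auto simp: f_def sol_residual[OF y] z(2)[OF J0])
      then have "wveq N (\<lambda>t. y t - z \<mu>\<^sub>0 t) (\<lambda>t. 0)" by (intro wveqI) simp
      from wveq_nv[OF this sobolev_vec_diff[OF y zW[OF J0]]] show ?thesis by (simp add: nv_zero)
    qed
    define q where "q \<mu> = B \<mu> y - B \<mu>\<^sub>0 y" for \<mu>
    define \<kappa> where "\<kappa> = mat_size (\<lambda>_. Q) 0"
    have \<kappa>0: "0 \<le> \<kappa>" unfolding \<kappa>_def by (rule mat_size_nonneg)
    let ?k = "\<kappa> * sup_const * real r"
    have le: "norm (q \<mu>) \<le> ?k * nv N (\<lambda>t. z \<mu> t - z \<mu>\<^sub>0 t) + (?k * real (CARD('d)) * \<eta> \<mu>) * norm (q \<mu>)"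
      if \<mu>: "\<mu> \<in> J" for \<mu>
    proof -
      have jb: "norm (jet x a) \<le> sup_const * (real r * nv N x)" if "x \<in> Wv N" for x
        using nv_sup_bound[OF jet_sobolev[OF that] aI] mult_left_mono[OF jet_le_nv[OF that] less_imp_le[OF sup_const_pos]]
        by linarith
      let ?u = "\<lambda>t. y t - z \<mu> t"
      have uW: "?u \<in> Wv N" by (rule sobolev_vec_diff[OF y zW[OF \<mu>]])
      have "sol n (A' \<mu>) (f \<mu>) y" unfolding f_def by (rule sol_residual[OF y])
      from sol_diff[OF this z(1)[OF \<mu>]] have u: "sol n (A' \<mu>) (\<lambda>t. 0) ?u" by simp
      have "B \<mu> ?u = q \<mu>" using operator_diff[OF B[OF JI[OF \<mu>]] y zW[OF \<mu>]] z(2)[OF \<mu>] by (simp add: q_def)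
      then have "\<forall>t\<in>{a..b}. ?u t = comb \<mu> (q \<mu>) t"
        using unique[OF \<mu> sobolev_vec_zero u comb_sol[OF \<mu>]] comb_B[OF \<mu>] by metis
      then have "jet ?u a = jet (comb \<mu> (q \<mu>)) a"
        unfolding jet_def vec_eq_iff vec_lambda_beta by (intro allI nth_deriv_cong aI) simp
      then have ju: "jet ?u a = U \<mu> *v q \<mu>" by (simp add: comb_jet[OF \<mu>])
      have "nv N ?u \<le> nv N (\<lambda>t. y t - z \<mu>\<^sub>0 t) + nv N (\<lambda>t. z \<mu> t - z \<mu>\<^sub>0 t)"
        using nv_diff[OF sobolev_vec_diff[OF y zW[OF J0]] sobolev_vec_diff[OF zW[OF \<mu>] zW[OF J0]]] by simp
      then have nu: "nv N ?u \<le> nv N (\<lambda>t. z \<mu> t - z \<mu>\<^sub>0 t)" using z0 by simp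
      \<comment> \<open>Q inverts the Wronskian at \<open>\<mu>\<^sub>0\<close>, whereas the jet of
        ?u is formed with the one at \<mu>. ?w compares the combinations with the same coefficients
        at both parameters; its norm is at most a multiple of \<eta> |q|, a term to be
        absorbed.\<close>
      let ?w = "\<lambda>t. comb \<mu> (q \<mu>) t - comb \<mu>\<^sub>0 (q \<mu>) t"
      have w_eq: "?w = (\<lambda>t. \<Sum>c\<in>UNIV. q \<mu> $ c *s (Y c \<mu> t - Y c \<mu>\<^sub>0 t))"
        by (simp add: comb_def fun_eq_iff vector_sub_rdistrib vector_ssub_ldistrib sum_subtractf)
      have wW: "?w \<in> Wv N" by (intro sobolev_vec_diff sol_sobolev[OF comb_sol] \<mu> J0)
      have "nv N ?w \<le> (\<Sum>c\<in>UNIV. norm (q \<mu> $ c) * nv N (\<lambda>t. Y c \<mu> t - Y c \<mu>\<^sub>0 t))"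
        unfolding w_eq
        by (rule order_trans[OF nv_sum])
           (rule sobolev_vec_scale sobolev_vec_diff YW[OF \<mu>] YW[OF J0] sum_mono nv_scale)+
      also have "\<dots> \<le> (\<Sum>c\<in>(UNIV::'d set). norm (q \<mu>) * \<eta> \<mu>)"
        by (intro sum_mono mult_mono Finite_Cartesian_Product.norm_nth_le \<eta>_ge[OF \<mu>] nv_nonneg sobolev_vec_diff YW \<mu> J0) auto
      finally have nw: "nv N ?w \<le> real CARD('d) * (norm (q \<mu>) * \<eta> \<mu>)" by simp
      have jw: "jet ?w a = (U \<mu> *v q \<mu>) - (U \<mu>\<^sub>0 *v q \<mu>)"
        using jet_diff[OF sol_sobolev[OF comb_sol[OF \<mu>]] sol_sobolev[OF comb_sol[OF J0]] aI] comb_jet[OF \<mu>] comb_jet[OF J0] by simp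
      have "norm (q \<mu>) = norm (Q *v (U \<mu>\<^sub>0 *v q \<mu>))" by (simp add: matrix_vector_mul_assoc Q)
      also have "\<dots> \<le> \<kappa> * norm (U \<mu>\<^sub>0 *v q \<mu>)" unfolding \<kappa>_def by (rule norm_matrix_vector_le)
      also have "U \<mu>\<^sub>0 *v q \<mu> = jet ?u a - jet ?w a" using ju jw by simp
      also have "\<kappa> * norm (jet ?u a - jet ?w a) \<le> \<kappa> * (norm (jet ?u a) + norm (jet ?w a))"
        by (intro mult_left_mono norm_triangle_ineq4 \<kappa>0)
      also have "\<dots> \<le> \<kappa> * (sup_const * (real r * nv N (\<lambda>t. z \<mu> t - z \<mu>\<^sub>0 t)) + sup_const * (real r * (real CARD('d) * (norm (q \<mu>) * \<eta> \<mu>))))"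
        using sup_const_pos
        by (intro mult_left_mono \<kappa>0 add_mono order_trans[OF jb[OF uW]] order_trans[OF jb[OF wW]] nu nw) auto
      finally show ?thesis by (simp add: algebra_simps)
    qed
    have "((\<lambda>\<mu>. norm (q \<mu>)) \<longlongrightarrow> 0) F"
    proof (rule tendsto_zero_absorb)
      show "eventually (\<lambda>\<mu>. 0 \<le> norm (q \<mu>) \<and> norm (q \<mu>) \<le> ?k * nv N (\<lambda>t. z \<mu> t - z \<mu>\<^sub>0 t) + (?k * real (CARD('d)) * \<eta> \<mu>) * norm (q \<mu>)) F"
        using evJ by eventually_elim (use le in simp)
      show "((\<lambda>\<mu>. ?k * nv N (\<lambda>t. z \<mu> t - z \<mu>\<^sub>0 t)) \<longlongrightarrow> 0) F" using tendsto_mult_left[OF cz, of ?k] by simp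
      show "((\<lambda>\<mu>. ?k * real (CARD('d)) * \<eta> \<mu>) \<longlongrightarrow> 0) F" using tendsto_mult_left[OF c\<eta>, of "?k * real CARD('d)"] by simp
    qed
    then have "(q \<longlongrightarrow> 0) F" by (rule tendsto_norm_zero_cancel)
    then show ?thesis unfolding q_def by (rule LIM_zero_cancel)
  qed
qed

lemma coeff_dist_tendsto_iff:
  "((\<lambda>\<mu>. coeff_dist n (A' \<mu>) (A' \<mu>\<^sub>0)) \<longlongrightarrow> 0) F \<longleftrightarrow>
   (\<forall>l<r. ((\<lambda>\<mu>. nm n (\<lambda>t. A l \<mu> t - A l \<mu>\<^sub>0 t)) \<longlongrightarrow> 0) F)"
proof (intro iffI allI impI)
  fix l assume c: "((\<lambda>\<mu>. coeff_dist n (A' \<mu>) (A' \<mu>\<^sub>0)) \<longlongrightarrow> 0) F" and l: "l < r"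
  show "((\<lambda>\<mu>. nm n (\<lambda>t. A l \<mu> t - A l \<mu>\<^sub>0 t)) \<longlongrightarrow> 0) F"
  proof (rule tendsto_sandwich[OF _ _ tendsto_const c])
    show "eventually (\<lambda>\<mu>. 0 \<le> nm n (\<lambda>t. A l \<mu> t - A l \<mu>\<^sub>0 t)) F"
      using eventually_I by eventually_elim (rule nm_nonneg[OF coeff_diff_sobolev[OF coeffs coeffs[OF mu0] l]])
    show "eventually (\<lambda>\<mu>. nm n (\<lambda>t. A l \<mu> t - A l \<mu>\<^sub>0 t) \<le> coeff_dist n (A' \<mu>) (A' \<mu>\<^sub>0)) F"
      using eventually_I by eventually_elim (rule nm_le_coeff_dist[OF coeffs coeffs[OF mu0] l])
  qed
next
  assume "\<forall>l<r. ((\<lambda>\<mu>. nm n (\<lambda>t. A l \<mu> t - A l \<mu>\<^sub>0 t)) \<longlongrightarrow> 0) F"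
  then show "((\<lambda>\<mu>. coeff_dist n (A' \<mu>) (A' \<mu>\<^sub>0)) \<longlongrightarrow> 0) F"
    unfolding coeff_dist_def by (intro tendsto_null_sum) auto
qed

end

theorem theorem3p2:
  fixes a b :: real and n r :: nat and p :: ennreal and I :: "real set" and \<mu>\<^sub>0 :: real
    and A :: "nat \<Rightarrow> real \<Rightarrow> real \<Rightarrow> complex^'m^'m"
    and B :: "real \<Rightarrow> (real \<Rightarrow> complex^'m) \<Rightarrow> complex^'d"
  assumes "a < b" and "1 \<le> r" and "1 \<le> p"
    and "CARD('d) = r * CARD('m)"
    and "is_interval I" and "closed I" and "\<mu>\<^sub>0 \<in> I"
    and "\<And>j \<mu>. j < r \<Longrightarrow> \<mu> \<in> I \<Longrightarrow> A j \<mu> \<in> sobolev_mat n p a b"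
    and "\<And>\<mu>. \<mu> \<in> I \<Longrightarrow> continuous_linear_operator (n + r) p a b (B \<mu>)"
  shows "depends_continuously_at n p a b r I \<mu>\<^sub>0 A B \<longleftrightarrow>
     (\<forall>y. bvp_solution n p a b r (\<lambda>j. A j \<mu>\<^sub>0) (B \<mu>\<^sub>0) (\<lambda>t. 0) 0 y \<longrightarrow> (\<forall>t\<in>{a..b}. y t = 0)) \<and>
     (\<forall>j\<in>{1..r}. ((\<lambda>\<mu>. sobolev_mat_norm n p a b (\<lambda>t. A (r - j) \<mu> t - A (r - j) \<mu>\<^sub>0 t)) \<longlongrightarrow> 0)
        (at \<mu>\<^sub>0 within I)) \<and>
     (\<forall>y\<in>sobolev_vec (n + r) p a b. ((\<lambda>\<mu>. B \<mu> y) \<longlongrightarrow> B \<mu>\<^sub>0 y) (at \<mu>\<^sub>0 within I))"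
proof -
  \<comment> \<open>The cardinality condition provides the enumeration e of pairs on which the
    locale \<open>companion\<close> is based.\<close>
  have "card (UNIV :: 'd set) = card ({..<r} \<times> (UNIV :: 'm set))"
    using assms(4) by (simp add: card_cartesian_product)
  then obtain e :: "'d \<Rightarrow> nat \<times> 'm" where e: "bij_betw e UNIV ({..<r} \<times> UNIV)"
    by (metis bij_betw_iff_card finite finite_SigmaI finite_lessThan)
  interpret bvp_family a b p r e n I \<mu>\<^sub>0 A B
    by unfold_locales (use assms e in auto)
  have reindex: "(\<forall>j\<in>{1..r}. P (r - j)) \<longleftrightarrow> (\<forall>l<r. P l)" for P
  proof
    assume H: "\<forall>j\<in>{1..r}. P (r - j)"
    show "\<forall>l<r. P l"
    proof (intro allI impI)
      fix l assume "l < r"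
      then show "P l" using H[rule_format, of "r - l"] by simp
    qed
  qed auto
  have "depends_continuously_at n p a b r I \<mu>\<^sub>0 A B \<longleftrightarrow>
     (\<forall>y. sol n (A' \<mu>\<^sub>0) (\<lambda>t. 0) y \<and> B \<mu>\<^sub>0 y = 0 \<longrightarrow> (\<forall>t\<in>{a..b}. y t = 0)) \<and>
     ((\<lambda>\<mu>. coeff_dist n (A' \<mu>) (A' \<mu>\<^sub>0)) \<longlongrightarrow> 0) F \<and>
     (\<forall>y\<in>Wv N. ((\<lambda>\<mu>. B \<mu> y) \<longlongrightarrow> B \<mu>\<^sub>0 y) F)"
    using continuous_dependence_sufficient continuous_dependence_necessary by blast
  then show ?thesis
    unfolding coeff_dist_tendsto_iff reindex[of "\<lambda>l. ((\<lambda>\<mu>. nm n (\<lambda>t. A l \<mu> t - A l \<mu>\<^sub>0 t)) \<longlongrightarrow> 0) F"]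
      bvp_solution_sol[OF mu0 sobolev_vec_zero] .
qed

end
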